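(* There exists a constant $C$, depending only on $d,\vartheta_{\mathcal{T}},p$ and $\Omega$, such that all vector fields $\mathbf{v}\in\mathbf{V}_{\mathcal{T}}$ satisfy $$\left|\left(\int_\Omega|\nabla\mathbf{v}|^2\right)^{1/2}-\left(\int_\Omega\left[|\nabla\cdot\mathbf{v}|^2+|\nabla\times\mathbf{v}|^2\right]\right)^{1/2}\right|\le C\,|\mathbf{v}|_{\mathbf{J},\mathcal{T}}.$$
   Context: Let $d\in\{2,3\}$ and let $\Omega\subset\mathbb{R}^d$ be a bounded convex polytopal open set. $\mathcal{T}$ is a finite conforming partition of $\Omega$ into closed simplices, with shape-regularity parameter $\vartheta_{\mathcal{T}}=\max_{K\in\mathcal{T}}\mathrm{diam}(K)/\rho_K$, $\rho_K$ the diameter of the largest ball inscribed in $K$. $\mathcal{F}^I$ and $\mathcal{F}^B$ are the sets of closed $(d-1)$-dimensional interior and boundary faces. The mesh-size function $h_{\mathcal{T}}$ equals $(\mathcal{H}^{d-1}(F))^{1/(d-1)}$ on each face $F$. For an interior face shared by $K,K'$, the jump is $[\![\mathbf{v}]\!]=\mathbf{v}|_K-\mathbf{v}|_{K'}$ (traces; sign fixed by a chosen normal). $\int_{\mathcal{G}}=\sum_{F\in\mathcal{G}}\int_F$ for a set of faces $\mathcal{G}$. $(\mathbf{v})_T$ is the tangential component of the trace of $\mathbf{v}$ on a boundary face. Fix $p\ge2$; $\mathbf{V}_{\mathcal{T}}=\{\mathbf{v}\in L^2(\Omega;\mathbb{R}^d):\mathbf{v}|_K\in\mathbb{P}_{p-1}^d\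 \forall K\in\mathcal{T}\}$, where $\mathbb{P}_{p-1}^d$ is the space of $\mathbb{R}^d$-valued polynomials of total degree at most $p-1$. $\nabla\mathbf{v}$, $\nabla\cdot\mathbf{v}$, $\nabla\times\mathbf{v}$ are the piecewise gradient, divergence and curl; for $d=2$ the curl is the scalar $\nabla\times\mathbf{v}=\partial_{x_1}\mathbf{v}_2-\partial_{x_2}\mathbf{v}_1$. $|\nabla\mathbf{v}|$ is the Frobenius norm. $|\mathbf{v}|_{\mathbf{J},\mathcal{T}}^2=\int_{\mathcal{F}^I}h_{\mathcal{T}}^{-1}|[\![\mathbf{v}]\!]|^2+\int_{\mathcal{F}^B}h_{\mathcal{T}}^{-1}|(\mathbf{v})_T|^2$. *)

theory Defs
  imports "HOL-Analysis.Analysis"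
begin

section \<open>Hausdorff measure\<close>

text \<open>
  The normalisation by the volume of the Euclidean unit ball makes the \<open>m\<close>-dimensional Hausdorff
  measure agree with the Lebesgue measure on \<open>m\<close>-dimensional planes. Only \<open>m \<ge> 1\<close> is meant: for
  \<open>m = 0\<close> the empty members of a cover would be counted with weight one. Boundedness is demanded
  explicitly because \<^const>\<open>diameter\<close> is unspecified on unbounded sets. By Caratheodory's criterion the outer measure
  is countably additive on the Borel sets, so \<^const>\<open>measure_of\<close> does not degenerate.
\<close>

definition hausdorff_content :: "nat \<Rightarrow> real \<Rightarrow> 'a::metric_space set \<Rightarrow> ennreal" where
  "hausdorff_content m \<delta> A =
     (INF C \<in> {C :: nat \<Rightarrow> 'a set. A \<subseteq> (\<Union>i. C i) \<and> (\<forall>i. bounded (C i) \<and> diameter (C i) \<le> \<delta>)}.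
        \<Sum>i. ennreal (unit_ball_vol (real m) * (diameter (C i) / 2) ^ m))"

definition hausdorff_outer :: "nat \<Rightarrow> 'a::metric_space set \<Rightarrow> ennreal" where
  "hausdorff_outer m A = (SUP \<delta> \<in> {0<..}. hausdorff_content m \<delta> A)"

definition hausdorff_measure :: "nat \<Rightarrow> 'a::metric_space measure" where
  "hausdorff_measure m = measure_of UNIV (sets borel) (hausdorff_outer m)"


section \<open>Domains, simplicial meshes and their faces\<close>

definition convex_polytopal_domain :: "'a::euclidean_space set \<Rightarrow> bool" where
  "convex_polytopal_domain \<Omega> \<longleftrightarrow>
     open \<Omega> \<and> bounded \<Omega> \<and> convex \<Omega> \<and> polytope (closure \<Omega>)"

text \<open>
  \<^const>\<open>triangulation\<close> comprises finiteness and conformity: the intersection of any two elements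
  is a (possibly empty) common face. The elements are nondegenerate simplices of full dimension.
\<close>

definition conforming_mesh :: "'a::euclidean_space set \<Rightarrow> 'a set set \<Rightarrow> bool" where
  "conforming_mesh \<Omega> \<T> \<longleftrightarrow>
     triangulation \<T> \<and> (\<forall>K\<in>\<T>. int DIM('a) simplex K) \<and> \<Union>\<T> = closure \<Omega>"

definition inball_diameter :: "'a::euclidean_space set \<Rightarrow> real" where
  "inball_diameter K = Sup {2 * r | r. 0 \<le> r \<and> (\<exists>x. cball x r \<subseteq> K)}"

definition shape_regularity :: "'a::euclidean_space set set \<Rightarrow> real" where
  "shape_regularity \<T> = Max ((\<lambda>K. diameter K / inball_diameter K) ` \<T>)"

definition interior_faces :: "'a::euclidean_space set set \<Rightarrow> 'a set set" where
  "interior_faces \<T> = {F. \<exists>K\<in>\<T>. \<exists>K'\<in>\<T>. K \<noteq> K' \<and> F facet_of K \<and> F facet_of K'}"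

definition boundary_faces :: "'a::euclidean_space set \<Rightarrow> 'a set set \<Rightarrow> 'a set set" where
  "boundary_faces \<Omega> \<T> = {F. F \<subseteq> frontier \<Omega> \<and> (\<exists>K\<in>\<T>. F facet_of K)}"

abbreviation surface_measure :: "'a::euclidean_space measure" where
  "surface_measure \<equiv> hausdorff_measure (DIM('a) - 1)"

definition face_size :: "'a::euclidean_space set \<Rightarrow> real" where
  "face_size F = measure surface_measure F powr (1 / (real DIM('a) - 1))"


section \<open>Piecewise polynomial vector fields\<close>

text \<open>Real polynomials in \<open>CARD('n)\<close> variables of total degree at most \<open>k\<close>; \<open>\<alpha>\<close> is a multi-index.\<close>

definition polynomial_of_degree_le :: "nat \<Rightarrow> (real^'n \<Rightarrow> real) \<Rightarrow> bool" where
  "polynomial_of_degree_le k f \<longleftrightarrow>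
     (\<exists>c. \<forall>x. f x = (\<Sum>\<alpha> | (\<Sum>i\<in>UNIV. \<alpha> i) \<le> k. c \<alpha> * (\<Prod>i\<in>UNIV. (x $ i) ^ \<alpha> i)))"

text \<open>
  Every class of square-integrable fields that are polynomial on each element has a representative
  that is polynomial everywhere in the interior of each element, and this is the one used. Its
  values on the mesh skeleton and outside the domain are arbitrary and enter nowhere: traces are
  limits from the interior of an element, and the skeleton is a Lebesgue null set.
\<close>

definition broken_polynomials :: "(real^'n) set set \<Rightarrow> nat \<Rightarrow> (real^'n \<Rightarrow> real^'n) set" where
  "broken_polynomials \<T> k =
     {v. \<forall>K\<in>\<T>. \<exists>q. (\<forall>i. polynomial_of_degree_le k (\<lambda>x. q x $ i)) \<and> (\<forall>x\<in>interior K. v x = q x)}"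

text \<open>
  At interior points of an element, \<^term>\<open>jacobian v (at x) $ i $ j\<close> is the partial derivative
  of the \<open>i\<close>-th component in the \<open>j\<close>-th direction. The norm of a matrix of type
  \<^typ>\<open>real^'n^'n\<close> is its Frobenius norm.
\<close>

definition grad :: "(real^'n \<Rightarrow> real^'n) \<Rightarrow> real^'n \<Rightarrow> real^'n^'n" where
  "grad v x = jacobian v (at x)"

definition dvg :: "(real^'n \<Rightarrow> real^'n) \<Rightarrow> real^'n \<Rightarrow> real" where
  "dvg v x = (\<Sum>i\<in>UNIV. grad v x $ i $ i)"

definition curl2 :: "(real^2 \<Rightarrow> real^2) \<Rightarrow> real^2 \<Rightarrow> real" where
  "curl2 v x = grad v x $ 2 $ 1 - grad v x $ 1 $ 2"

definition curl3 :: "(real^3 \<Rightarrow> real^3) \<Rightarrow> real^3 \<Rightarrow> real^3" where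
  "curl3 v x = vector [grad v x $ 3 $ 2 - grad v x $ 2 $ 3,
                       grad v x $ 1 $ 3 - grad v x $ 3 $ 1,
                       grad v x $ 2 $ 1 - grad v x $ 1 $ 2]"


section \<open>Traces, jumps and the jump seminorm\<close>

definition elem_trace :: "('a::euclidean_space \<Rightarrow> 'b::t2_space) \<Rightarrow> 'a set \<Rightarrow> 'a \<Rightarrow> 'b" where
  "elem_trace v K x = Lim (at x within interior K) v"

text \<open>
  The choice of the ordered pair of elements sharing a face stands for the choice of a normal;
  it determines the sign of the jump.
\<close>

definition face_elements :: "'a::euclidean_space set set \<Rightarrow> 'a set \<Rightarrow> 'a set \<times> 'a set" where
  "face_elements \<T> F =
     (SOME (K, K'). K \<in> \<T> \<and> K' \<in> \<T> \<and> K \<noteq> K' \<and> F facet_of K \<and> F facet_of K')"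

definition jump ::
  "'a::euclidean_space set set \<Rightarrow> ('a \<Rightarrow> 'a) \<Rightarrow> 'a set \<Rightarrow> 'a \<Rightarrow> 'a" where
  "jump \<T> v F x = (case face_elements \<T> F of (K, K') \<Rightarrow> elem_trace v K x - elem_trace v K' x)"

definition face_normal :: "'a::euclidean_space set \<Rightarrow> 'a" where
  "face_normal F = (SOME n. norm n = 1 \<and> (\<forall>x\<in>F. \<forall>y\<in>F. n \<bullet> (x - y) = 0))"

definition tangential_trace ::
  "'a::euclidean_space set set \<Rightarrow> ('a \<Rightarrow> 'a) \<Rightarrow> 'a set \<Rightarrow> 'a \<Rightarrow> 'a" where
  "tangential_trace \<T> v F x =
     (let w = elem_trace v (THE K. K \<in> \<T> \<and> F facet_of K) x; n = face_normal F
      in w - (w \<bullet> n) *\<^sub>R n)"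

definition jump_seminorm ::
  "'a::euclidean_space set \<Rightarrow> 'a set set \<Rightarrow> ('a \<Rightarrow> 'a) \<Rightarrow> real" where
  "jump_seminorm \<Omega> \<T> v = sqrt (
     (\<Sum>F\<in>interior_faces \<T>.
        LINT x:F|surface_measure. inverse (face_size F) * (norm (jump \<T> v F x))\<^sup>2) +
     (\<Sum>F\<in>boundary_faces \<Omega> \<T>.
        LINT x:F|surface_measure. inverse (face_size F) * (norm (tangential_trace \<T> v F x))\<^sup>2))"

end

theory Submission
  imports Defs
begin

text \<open>
  For a piecewise polynomial field \<open>w\<close> that is continuous across interior faces and normal on boundary
  faces, \<open>|\<nabla>w|\<^sup>2 - |div w|\<^sup>2 - |curl w|\<^sup>2\<close> is the divergence of a quantity whose normal component on a face
  only involves \<open>w\<close> and tangential derivatives; the contributions of the two sides of an interior face cancel,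
  those of the flat boundary faces vanish, and both energies of \<open>w\<close> agree. The divergence theorem is applied to the
  product with a Lipschitz cut-off in barycentric coordinates, so only volume integrals over thin slabs occur.

  A general \<open>v\<close> is compared with the field \<open>w\<close> that has, at each Lagrange node, a value taken from one of
  the elements at the node; at a boundary node its tangential part is removed, and it is set to zero if boundary faces
  with different normals meet there. Two elements at a node are linked by a chain of elements sharing faces through the
  node, whose length is bounded by shape regularity, so the nodal defects are bounded by the jumps, and by
  an inverse estimate so is the gradient of \<open>v - w\<close>. The triangle inequality for the two energy
  seminorms gives the theorem.
\<close>

section \<open>The Hausdorff measure as a Borel measure\<close>

text \<open>Face integrals only ever have to dominate nodal defects, so little is asked of the
  Hausdorff measure: finiteness on facets, scaling under homotheties, and a lower bound
  \<open>c * h ^ (d - 1)\<close> for a facet of an element of diameter \<open>h\<close>. Its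
  identification with Lebesgue measure on hyperplanes is avoided, and the exact Green identity never
  touches it, because slabs replace the faces there.

  The weight \<open>inverse (face_size F)\<close> is matched to this: a weighted face integral
  controls \<open>h ^ (d - 2)\<close> times a squared nodal value, while the squared gradient of a
  Lagrange basis function, of order \<open>h\<close> to the power -2, integrated over an element of
  volume at most of order \<open>h ^ d\<close>, costs the same power. All mesh sizes cancel once the
  diameters of the elements at one node are comparable.

  The domain enters the constant only through the angles between its facets. Where two non-parallel
  boundary faces meet, zero is the only vector normal to both, so the full trace must be recovered
  from its two tangential parts, and the cost grows as the normals become parallel. A convex
  polytope has finitely many facets, which bounds this cost independently of the mesh.\<close>

lemma hausdorff_content_le:
  assumes "A \<subseteq> (\<Union>i. C i)" "\<And>i. bounded (C i)" "\<And>i. diameter (C i) \<le> \<delta>"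
  shows "hausdorff_content m \<delta> A \<le> (\<Sum>i. ennreal (unit_ball_vol (real m) * (diameter (C i) / 2) ^ m))"
  unfolding hausdorff_content_def using assms by (intro INF_lower) auto

lemma hausdorff_content_close:
  assumes "hausdorff_content m \<delta> A < e"
  obtains C :: "nat \<Rightarrow> 'a::metric_space set"
  where "A \<subseteq> (\<Union>i. C i)" "\<And>i. bounded (C i)" "\<And>i. diameter (C i) \<le> \<delta>"
    "(\<Sum>i. ennreal (unit_ball_vol (real m) * (diameter (C i) / 2) ^ m)) < e"
  using assms unfolding hausdorff_content_def INF_less_iff by auto

lemma hausdorff_content_mono: "A \<subseteq> B \<Longrightarrow> hausdorff_content m \<delta> A \<le> hausdorff_content m \<delta> B"
  unfolding hausdorff_content_def by (intro INF_superset_mono) auto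

lemma hausdorff_content_antimono: "\<delta> \<le> \<delta>' \<Longrightarrow> hausdorff_content m \<delta>' A \<le> hausdorff_content m \<delta> A"
  unfolding hausdorff_content_def by (intro INF_superset_mono) (auto intro: order_trans)

lemma hausdorff_content_le_outer: "\<delta> > 0 \<Longrightarrow> hausdorff_content m \<delta> A \<le> hausdorff_outer m A"
  unfolding hausdorff_outer_def by (intro SUP_upper) auto

lemma hausdorff_outer_mono: "A \<subseteq> B \<Longrightarrow> hausdorff_outer m A \<le> hausdorff_outer m B"
  unfolding hausdorff_outer_def by (intro SUP_mono') (simp add: hausdorff_content_mono)

lemma hausdorff_outer_empty: assumes "m \<ge> 1" shows "hausdorff_outer m {} = 0"
proof -
  have "hausdorff_content m \<delta> ({} :: 'a set) = 0" if "\<delta> > 0" for \<delta>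
  proof -
    have "hausdorff_content m \<delta> ({} :: 'a set)
      \<le> (\<Sum>i::nat. ennreal (unit_ball_vol (real m) * (diameter ({} :: 'a set) / 2) ^ m))"
      using that by (intro hausdorff_content_le) auto
    also have "\<dots> = 0" using assms by (simp add: zero_power)
    finally show ?thesis by simp
  qed
  then show ?thesis unfolding hausdorff_outer_def by (simp add: image_constant_conv)
qed

text \<open>The usual splitting of an error \<open>e\<close> into the parts
  \<open>e * (1/2) ^ Suc n\<close>: nearly optimal covers of the members are merged by
  \<open>prod_decode\<close> into a single sequence, since a cover has to be indexed by the
  naturals.\<close>

lemma hausdorff_content_UN_le:
  fixes A :: "nat \<Rightarrow> 'a::metric_space set"
  shows "hausdorff_content m \<delta> (\<Union>i. A i) \<le> (\<Sum>i. hausdorff_content m \<delta> (A i))"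
proof (rule ennreal_le_epsilon)
  let ?f = "\<lambda>C :: 'a set. ennreal (unit_ball_vol (real m) * (diameter C / 2) ^ m)"
  fix e :: real assume e: "0 < e" and fin: "(\<Sum>n. hausdorff_content m \<delta> (A n)) < top"
  then have *: "hausdorff_content m \<delta> (A n) < hausdorff_content m \<delta> (A n) + e * (1/2)^Suc n" for n
    by (auto simp add: less_top dest!: ennreal_suminf_lessD)
  have "\<exists>C. A n \<subseteq> (\<Union>i. C i) \<and> (\<forall>i::nat. bounded (C i)) \<and> (\<forall>i. diameter (C i) \<le> \<delta>) \<and>
     (\<Sum>i. ?f (C i)) \<le> hausdorff_content m \<delta> (A n) + e * (1/2)^(Suc n)" for n
    by (rule hausdorff_content_close[OF *[of n]]) (metis order.strict_implies_order)
  then obtain B where sb: "\<And>n. A n \<subseteq> (\<Union>i. B n i)" and bd: "\<And>n i::nat. bounded (B n i)"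
    and dm: "\<And>n i. diameter (B n i) \<le> \<delta>"
    and le: "\<And>n. (\<Sum>i. ?f (B n i)) \<le> hausdorff_content m \<delta> (A n) + e * (1/2)^(Suc n)"
    by metis
  define C where "C = case_prod B o prod_decode"
  have A_C: "(\<Union>i. A i) \<subseteq> (\<Union>i. C i)"
    using sb by (auto simp add: C_def subset_eq) (metis prod.case prod_encode_inverse)
  have "hausdorff_content m \<delta> (\<Union>i. A i) \<le> (\<Sum>i. ?f (C i))"
    using A_C bd dm by (intro hausdorff_content_le) (auto simp: C_def split: prod.split)
  also have "\<dots> = (\<Sum>n. \<Sum>i. ?f (B n i))"
    unfolding C_def comp_def
    by (intro suminf_ennreal_2dimen[where f="\<lambda>x. ?f (case_prod B x)", simplified case_prod_conv]) simp
  also have "\<dots> \<le> (\<Sum>n. hausdorff_content m \<delta> (A n) + e * (1/2) ^ Suc n)"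
    by (intro suminf_le le allI) auto
  also have "\<dots> = (\<Sum>n. hausdorff_content m \<delta> (A n)) + (\<Sum>n. ennreal e * ennreal ((1/2) ^ Suc n))"
    using e by (subst suminf_add[symmetric])
      (auto simp del: ennreal_suminf_cmult simp add: ennreal_mult[symmetric])
  also have "\<dots> = (\<Sum>n. hausdorff_content m \<delta> (A n)) + e"
    unfolding ennreal_suminf_cmult
    by (subst suminf_ennreal_eq[OF zero_le_power power_half_series]) auto
  finally show "hausdorff_content m \<delta> (\<Union>i. A i) \<le> (\<Sum>n. hausdorff_content m \<delta> (A n)) + e" .
qed

lemma hausdorff_outer_UN_le:
  fixes A :: "nat \<Rightarrow> 'a::metric_space set"
  shows "hausdorff_outer m (\<Union>i. A i) \<le> (\<Sum>i. hausdorff_outer m (A i))"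
  unfolding hausdorff_outer_def[of m "\<Union>i. A i"]
proof (rule SUP_least)
  fix \<delta> :: real assume "\<delta> \<in> {0<..}"
  then have "(\<Sum>i. hausdorff_content m \<delta> (A i)) \<le> (\<Sum>i. hausdorff_outer m (A i))"
    by (intro suminf_le hausdorff_content_le_outer) auto
  then show "hausdorff_content m \<delta> (\<Union>i. A i) \<le> (\<Sum>i. hausdorff_outer m (A i))"
    using hausdorff_content_UN_le order_trans by blast
qed

lemma outer_measure_space_hausdorff:
  assumes "m \<ge> 1" shows "outer_measure_space UNIV (hausdorff_outer m :: 'a::metric_space set \<Rightarrow> ennreal)"
  unfolding outer_measure_space_def positive_def increasing_def countably_subadditive_def
  using assms by (auto simp: hausdorff_outer_empty hausdorff_outer_mono hausdorff_outer_UN_le)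

lemma hausdorff_outer_Un_le:
  assumes "m \<ge> 1" shows "hausdorff_outer m (A \<union> B) \<le> hausdorff_outer m A + hausdorff_outer m B"
proof -
  interpret sigma_algebra UNIV "UNIV :: 'a set set" using sigma_algebra_Pow[of "UNIV::'a set"] by simp
  have "subadditive UNIV (hausdorff_outer m :: 'a set \<Rightarrow> ennreal)"
    by (rule countably_subadditive_subadditive)
      (use outer_measure_space_hausdorff[OF assms, where 'a='a] in \<open>auto simp: outer_measure_space_def\<close>)
  have "hausdorff_outer m (A \<union> (B - A)) \<le> hausdorff_outer m A + hausdorff_outer m (B - A)"
    using \<open>subadditive UNIV _\<close> by (intro subadditiveD) auto
  also have "\<dots> \<le> hausdorff_outer m A + hausdorff_outer m B"
    by (intro add_left_mono hausdorff_outer_mono) auto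
  finally show ?thesis by (simp add: Un_Diff_cancel)
qed

text \<open>A set of diameter below \<open>d\<close> cannot meet both sides, so every fine cover of
  the union splits into covers of the two parts; members dropped from one side become empty and
  weigh nothing because \<open>m \<ge> 1\<close>. The supremum over \<delta> is taken along
  \<open>d / (2 + n)\<close>, which stays below \<open>d\<close>: a supremum of sums separates only
  along a monotone sequence.\<close>

lemma hausdorff_outer_separated:
  fixes A B :: "'a::metric_space set"
  assumes m: "m \<ge> 1" and d: "d > 0" and sep: "\<And>x y. x \<in> A \<Longrightarrow> y \<in> B \<Longrightarrow> d \<le> dist x y"
  shows "hausdorff_outer m A + hausdorff_outer m B = hausdorff_outer m (A \<union> B)"
proof (rule antisym)
  let ?f = "\<lambda>C :: 'a set. ennreal (unit_ball_vol (real m) * (diameter C / 2) ^ m)"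
  have main: "hausdorff_content m \<delta> A + hausdorff_content m \<delta> B \<le> hausdorff_outer m (A \<union> B)"
    if \<delta>: "0 < \<delta>" "\<delta> < d" for \<delta>
  proof -
    have "hausdorff_content m \<delta> A + hausdorff_content m \<delta> B \<le> hausdorff_content m \<delta> (A \<union> B)"
      unfolding hausdorff_content_def[of m \<delta> "A \<union> B"]
    proof (rule INF_greatest)
      fix C :: "nat \<Rightarrow> 'a set"
      assume "C \<in> {C. A \<union> B \<subseteq> (\<Union>i. C i) \<and> (\<forall>i. bounded (C i) \<and> diameter (C i) \<le> \<delta>)}"
      then have C: "A \<union> B \<subseteq> (\<Union>i. C i)" "\<And>i. bounded (C i)" "\<And>i. diameter (C i) \<le> \<delta>" by auto
      define P where "P i = (if C i \<inter> A = {} then {} else C i)" for i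
      define Q where "Q i = (if C i \<inter> B = {} then {} else C i)" for i
      have "hausdorff_content m \<delta> A \<le> (\<Sum>i. ?f (P i))"
        using C \<delta> by (intro hausdorff_content_le) (fastforce simp: P_def)+
      moreover have "hausdorff_content m \<delta> B \<le> (\<Sum>i. ?f (Q i))"
        using C \<delta> by (intro hausdorff_content_le) (fastforce simp: Q_def)+
      moreover have "?f (P i) + ?f (Q i) \<le> ?f (C i)" for i
      proof (cases "C i \<inter> A = {} \<or> C i \<inter> B = {}")
        case True then show ?thesis using m by (auto simp: P_def Q_def zero_power)
      next
        case False
        then obtain x y where "x \<in> C i" "y \<in> C i" "x \<in> A" "y \<in> B" by auto
        then have "d \<le> diameter (C i)"
          using sep diameter_bounded_bound[OF C(2)] by (meson order_trans)
        then show ?thesis using C(3)[of i] \<delta> by simp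
      qed
      then have "(\<Sum>i. ?f (P i)) + (\<Sum>i. ?f (Q i)) \<le> (\<Sum>i. ?f (C i))"
        by (subst suminf_add) (auto intro!: suminf_le)
      ultimately show "hausdorff_content m \<delta> A + hausdorff_content m \<delta> B \<le> (\<Sum>i. ?f (C i))"
        by (meson add_mono order_trans)
    qed
    also have "\<dots> \<le> hausdorff_outer m (A \<union> B)" using \<delta> by (intro hausdorff_content_le_outer)
    finally show ?thesis .
  qed
  have SUP_eq: "hausdorff_outer m X = (SUP n. hausdorff_content m (d / (2 + real n)) X)" for X :: "'a set"
    unfolding hausdorff_outer_def
  proof (rule antisym[OF SUP_least SUP_least])
    fix \<delta> :: real assume "\<delta> \<in> {0<..}"
    then obtain n where n: "d / \<delta> \<le> real n" using real_arch_simple by blast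
    have "d \<le> \<delta> * real n" using n \<open>\<delta> \<in> _\<close> by (simp add: field_simps)
    also have "\<dots> \<le> \<delta> * (2 + real n)" using \<open>\<delta> \<in> _\<close> by simp
    finally have "d / (2 + real n) \<le> \<delta>" by (simp add: field_simps)
    then show "hausdorff_content m \<delta> X \<le> (SUP n. hausdorff_content m (d / (2 + real n)) X)"
      by (intro SUP_upper2[of n]) (auto intro: hausdorff_content_antimono)
  next
    fix n show "hausdorff_content m (d / (2 + real n)) X \<le> (SUP \<delta>\<in>{0<..}. hausdorff_content m \<delta> X)"
      using d by (intro SUP_upper) auto
  qed
  have inc: "incseq (\<lambda>n. hausdorff_content m (d / (2 + real n)) X)" for X :: "'a set"
    using d by (intro incseq_SucI hausdorff_content_antimono) (auto simp: field_simps)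
  have "hausdorff_outer m A + hausdorff_outer m B =
     (SUP n. hausdorff_content m (d / (2 + real n)) A + hausdorff_content m (d / (2 + real n)) B)"
    unfolding SUP_eq[of A] SUP_eq[of B] by (rule ennreal_SUP_add[symmetric]) (rule inc)+
  also have "\<dots> \<le> hausdorff_outer m (A \<union> B)"
    using d by (intro SUP_least main) (auto simp: field_simps add_pos_nonneg)
  finally show "hausdorff_outer m A + hausdorff_outer m B \<le> hausdorff_outer m (A \<union> B)" .
qed (rule hausdorff_outer_Un_le[OF m])

text \<open>Caratheodory's criterion. The layers at distance between \<open>1/(n+2)\<close> and \<open>1/(n+1)\<close> from the
  closed set are separated from one another if every other layer is skipped, so their outer measures are summable.\<close>

lemma hausdorff_outer_closed_split:
  fixes E X :: "'a::metric_space set"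
  assumes m: "m \<ge> 1" and E: "closed E"
  shows "hausdorff_outer m (X \<inter> E) + hausdorff_outer m (X - E) \<le> hausdorff_outer m X"
proof (cases "E = {} \<or> hausdorff_outer m X = \<infinity>")
  case True then show ?thesis using m by (auto simp: hausdorff_outer_empty)
next
  case False
  then have ne: "E \<noteq> {}" and fin: "hausdorff_outer m X < top" by (auto simp: less_top)
  let ?h = "hausdorff_outer m :: 'a set \<Rightarrow> ennreal"
  define A where "A n = {x \<in> X. 1 / (1 + real n) \<le> infdist x E}" for n
  define B where "B n = A (Suc n) - A n" for n
  have lip: "infdist x E \<le> infdist y E + dist x y" for x y using infdist_triangle by blast
  have sepA: "?h (X \<inter> E) + ?h (A n) \<le> ?h X" for n
  proof -
    have "?h (X \<inter> E) + ?h (A n) = ?h ((X \<inter> E) \<union> A n)"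
    proof (rule hausdorff_outer_separated[OF m, of "1 / (1 + real n)"])
      fix x y assume "x \<in> X \<inter> E" "y \<in> A n"
      then have "infdist x E = 0" "1 / (1 + real n) \<le> infdist y E" by (auto simp: A_def)
      then show "1 / (1 + real n) \<le> dist x y" using lip[of y x] by (simp add: dist_commute)
    qed simp
    also have "\<dots> \<le> ?h X" by (rule hausdorff_outer_mono) (auto simp: A_def)
    finally show ?thesis .
  qed
  have Amono: "A i \<subseteq> A j" if "i \<le> j" for i j
  proof -
    have "1 / (1 + real j) \<le> 1 / (1 + real i)" using that by (simp add: field_simps)
    then show ?thesis by (auto simp: A_def)
  qed
  have sepB: "?h (Y \<union> B (Suc n)) = ?h Y + ?h (B (Suc n))" if "Y \<subseteq> A n" for n Y
  proof (rule hausdorff_outer_separated[OF m, symmetric, of "1 / (1 + real n) - 1 / (1 + real (Suc n))"])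
    fix x y assume "x \<in> Y" "y \<in> B (Suc n)"
    then have "1 / (1 + real n) \<le> infdist x E" "infdist y E < 1 / (1 + real (Suc n))"
      using that by (auto simp: A_def B_def)
    then show "1 / (1 + real n) - 1 / (1 + real (Suc n)) \<le> dist x y" using lip[of x y] by simp
  qed (simp add: frac_less2)
  have par: "(\<Sum>j<N. ?h (B (2*j + r))) \<le> ?h X" for N r
  proof -
    have "(\<Sum>j<N. ?h (B (2*j + r))) = ?h (\<Union>j<N. B (2*j+r))"
    proof (induction N)
      case 0 then show ?case using m by (simp add: hausdorff_outer_empty)
    next
      case (Suc N)
      show ?case
      proof (cases "2 * N + r")
        case 0 then show ?thesis using m by (simp add: hausdorff_outer_empty lessThan_Suc)
      next
        case (Suc k)
        have "(\<Union>j<N. B (2*j+r)) \<subseteq> A k"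
        proof safe
          fix j x assume "j < N" "x \<in> B (2 * j + r)"
          then have "x \<in> A (Suc (2*j+r))" by (simp add: B_def)
          moreover have "Suc (2*j+r) \<le> k" using \<open>j < N\<close> Suc by linarith
          ultimately show "x \<in> A k" using Amono by blast
        qed
        from sepB[OF this] show ?thesis using Suc.IH Suc
          by (simp add: lessThan_Suc Un_commute add.commute)
      qed
    qed
    also have "\<dots> \<le> ?h X" by (rule hausdorff_outer_mono) (auto simp: A_def B_def)
    finally show ?thesis .
  qed
  have "(\<Sum>j. ?h (B j)) \<le> 2 * ?h X"
  proof (rule suminf_le_const[OF summableI])
    fix N
    have "(\<Sum>j<N. ?h (B j)) \<le> (\<Sum>j<2*N. ?h (B j))" by (rule sum_mono2) auto
    also have "\<dots> = (\<Sum>j<N. ?h (B (2*j+0))) + (\<Sum>j<N. ?h (B (2*j+1)))"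
      by (induction N) (auto simp: algebra_simps)
    also have "\<dots> \<le> ?h X + ?h X" by (intro add_mono par)
    also have "\<dots> = 2 * ?h X" by (simp add: mult_2)
    finally show "(\<Sum>j<N. ?h (B j)) \<le> 2 * ?h X" .
  qed
  then have S: "(\<Sum>j. ?h (B j)) < top" using fin by (metis ennreal_mult_less_top ennreal_numeral_less_top order_le_less_trans)
  have "X - E \<subseteq> A n \<union> (\<Union>j. B (j + n))" for n
  proof
    fix x assume x: "x \<in> X - E"
    then have "infdist x E > 0" using E ne in_closed_iff_infdist_zero infdist_nonneg
      by (metis DiffD2 less_eq_real_def)
    then obtain k where "inverse (real (Suc k)) < infdist x E" using reals_Archimedean by blast
    then have k: "x \<in> A k" using x by (auto simp: A_def inverse_eq_divide add.commute)
    show "x \<in> A n \<union> (\<Union>j. B (j + n))"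
    proof (cases "x \<in> A n")
      case False
      define l where "l = (LEAST l. x \<in> A l)"
      have l: "x \<in> A l" unfolding l_def using k by (rule LeastI)
      then have "n < l" using False Amono[of l n] by (meson not_le subsetD)
      moreover have "x \<notin> A (l - 1)" unfolding l_def
        by (metis (no_types, lifting) False Suc_pred' \<open>n < l\<close> diff_less gr_zeroI l_def less_zeroE not_less_Least zero_less_one)
      ultimately have "x \<in> B ((l - 1 - n) + n)" using l by (simp add: B_def)
      then show ?thesis by blast
    qed simp
  qed
  note sub = this
  have rem: "?h (X - E) \<le> ?h (A n) + (\<Sum>j. ?h (B (j + n)))" for n
  proof -
    have "?h (X - E) \<le> ?h (A n \<union> (\<Union>j. B (j + n)))" by (rule hausdorff_outer_mono[OF sub])
    also have "\<dots> \<le> ?h (A n) + ?h (\<Union>j. B (j + n))" by (rule hausdorff_outer_Un_le[OF m])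
    also have "\<dots> \<le> ?h (A n) + (\<Sum>j. ?h (B (j + n)))"
      by (intro add_left_mono hausdorff_outer_UN_le)
    finally show ?thesis .
  qed
  \<comment> \<open>Partial sums of the layers are added on both sides instead of subtracting tails,
    since subtraction in \<open>ennreal\<close> is truncated. In the limit the whole layer sum
    stands on both sides and cancels, being finite by \<open>S\<close>.\<close>
  have "?h (X \<inter> E) + ?h (X - E) + (\<Sum>j<n. ?h (B j)) \<le> ?h X + (\<Sum>j. ?h (B j))" for n
  proof -
    have "?h (X \<inter> E) + ?h (X - E) + (\<Sum>j<n. ?h (B j))
      \<le> ?h (X \<inter> E) + (?h (A n) + (\<Sum>j. ?h (B (j + n)))) + (\<Sum>j<n. ?h (B j))"
      by (intro add_mono rem) auto
    also have "\<dots> = (?h (X \<inter> E) + ?h (A n)) + ((\<Sum>j. ?h (B (j + n))) + (\<Sum>j<n. ?h (B j)))"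
      by (simp add: ac_simps)
    also have "\<dots> \<le> ?h X + (\<Sum>j. ?h (B j))"
      by (intro add_mono sepA) (simp add: suminf_offset[of "\<lambda>j. ?h (B j)" n] add.commute)
    finally show ?thesis .
  qed
  then have "(SUP n. ?h (X \<inter> E) + ?h (X - E) + (\<Sum>j<n. ?h (B j))) \<le> ?h X + (\<Sum>j. ?h (B j))"
    by (intro SUP_least)
  then have "?h (X \<inter> E) + ?h (X - E) + (\<Sum>j. ?h (B j)) \<le> ?h X + (\<Sum>j. ?h (B j))"
    by (simp add: ennreal_SUP_add_right suminf_eq_SUP)
  then have "(\<Sum>j. ?h (B j)) + (?h (X \<inter> E) + ?h (X - E)) \<le> (\<Sum>j. ?h (B j)) + ?h X"
    by (simp only: add.commute)
  then show ?thesis using S by (auto simp: ennreal_add_left_cancel_le)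
qed

text \<open>Caratheodory's lemma yields a measure on the sets that split every set additively.
  Closed sets are among them by \<open>hausdorff_outer_closed_split\<close>, hence so is the
  sigma-algebra that they generate.\<close>

lemma measure_space_hausdorff:
  assumes m: "m \<ge> 1"
  shows "measure_space UNIV (sets borel) (hausdorff_outer m :: 'a::metric_space set \<Rightarrow> ennreal)"
proof -
  interpret sigma_algebra UNIV "UNIV :: 'a set set" using sigma_algebra_Pow[of "UNIV::'a set"] by simp
  let ?L = "lambda_system UNIV UNIV (hausdorff_outer m :: 'a set \<Rightarrow> ennreal)"
  have ms: "measure_space UNIV ?L (hausdorff_outer m)"
    by (rule caratheodory_lemma[OF outer_measure_space_hausdorff[OF m]])
  then have sa: "sigma_algebra UNIV ?L" by (simp add: measure_space_def)
  have "Collect closed \<subseteq> ?L"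
  proof safe
    fix E :: "'a set" assume E: "closed E"
    have "hausdorff_outer m (E \<inter> X) + hausdorff_outer m ((UNIV - E) \<inter> X) = hausdorff_outer m X" for X
    proof (rule antisym)
      show "hausdorff_outer m (E \<inter> X) + hausdorff_outer m ((UNIV - E) \<inter> X) \<le> hausdorff_outer m X"
        using hausdorff_outer_closed_split[OF m E, of X]
        by (simp add: Int_commute Diff_eq)
      have "X = (E \<inter> X) \<union> ((UNIV - E) \<inter> X)" by auto
      then show "hausdorff_outer m X \<le> hausdorff_outer m (E \<inter> X) + hausdorff_outer m ((UNIV - E) \<inter> X)"
        using hausdorff_outer_Un_le[OF m, of "E \<inter> X" "(UNIV - E) \<inter> X"] by simp
    qed
    then show "E \<in> ?L" by (simp add: lambda_system_def)
  qed
  then have "sets borel \<subseteq> ?L"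
    unfolding borel_eq_closed using sigma_algebra.sigma_sets_subset[OF sa] by simp
  then show ?thesis
    by (intro measure_down[OF ms]) (auto simp: sets.sigma_algebra_axioms[of borel, simplified])
qed

lemma sets_hausdorff_measure [simp, measurable_cong]: "sets (hausdorff_measure m) = sets borel"
  unfolding hausdorff_measure_def by (simp add: sets.sigma_sets_eq[of borel, simplified])

lemma space_hausdorff_measure [simp]: "space (hausdorff_measure m) = UNIV"
  unfolding hausdorff_measure_def by simp

lemma emeasure_hausdorff_measure:
  fixes A :: "'a::metric_space set"
  assumes "m \<ge> 1" "A \<in> sets borel"
  shows "emeasure (hausdorff_measure m) A = hausdorff_outer m A"
proof -
  have *: "positive (sets borel) (hausdorff_outer m :: 'a set \<Rightarrow> ennreal)"
    "countably_additive (sets borel) (hausdorff_outer m :: 'a set \<Rightarrow> ennreal)"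
    using measure_space_hausdorff[OF assms(1), where 'a='a] by (auto simp: measure_space_def)
  show ?thesis
    by (rule emeasure_measure_of[OF hausdorff_measure_def]) (use assms * in auto)
qed

section \<open>Hausdorff measures of Lipschitz images and cones\<close>

lemma ennreal_le_mult_INF:
  fixes a :: ennreal and c :: real
  assumes "0 < c" "\<And>i. i \<in> I \<Longrightarrow> a \<le> ennreal c * f i"
  shows "a \<le> ennreal c * (INF i\<in>I. f i)"
proof -
  have "a / ennreal c \<le> (INF i\<in>I. f i)"
    using assms by (intro INF_greatest divide_le_posI_ennreal) (auto simp: mult.commute)
  then have "ennreal c * (a / ennreal c) \<le> ennreal c * (INF i\<in>I. f i)" by (rule mult_left_mono) simp
  moreover have "ennreal c * (a / ennreal c) = a"
    using assms(1) by (simp add: ennreal_times_divide mult_divide_eq_ennreal mult.commute)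
  ultimately show ?thesis by simp
qed

text \<open>A cover of \<open>A\<close> is mapped forward, after intersection with \<open>A\<close>
  because \<open>f\<close> is Lipschitz only there. The scale \<delta> turns into
  \<open>L * \<delta>\<close>, which the supremum over all scales absorbs.\<close>

lemma hausdorff_outer_lipschitz_image_le:
  fixes f :: "'a::metric_space \<Rightarrow> 'b::metric_space"
  assumes L: "L > 0" and m: "m \<ge> 1" and lip: "\<And>x y. x \<in> A \<Longrightarrow> y \<in> A \<Longrightarrow> dist (f x) (f y) \<le> L * dist x y"
  shows "hausdorff_outer m (f ` A) \<le> ennreal (L ^ m) * hausdorff_outer m A"
proof -
  have "hausdorff_content m (L * \<delta>) (f ` A) \<le> ennreal (L ^ m) * hausdorff_content m \<delta> A" if "\<delta> > 0" for \<delta>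
    unfolding hausdorff_content_def[of m \<delta> A]
  proof (rule ennreal_le_mult_INF)
    fix C :: "nat \<Rightarrow> 'a set"
    assume "C \<in> {C. A \<subseteq> (\<Union>i. C i) \<and> (\<forall>i. bounded (C i) \<and> diameter (C i) \<le> \<delta>)}"
    then have C: "A \<subseteq> (\<Union>i. C i)" "\<And>i. bounded (C i)" "\<And>i. diameter (C i) \<le> \<delta>" by auto
    have d: "dist x y \<le> L * diameter (C i)" if xy: "x \<in> f ` (C i \<inter> A)" "y \<in> f ` (C i \<inter> A)" for x y i
    proof -
      obtain x' y' where *: "x = f x'" "y = f y'" "x' \<in> C i \<inter> A" "y' \<in> C i \<inter> A" using xy by auto
      then have "dist x y \<le> L * dist x' y'" using lip by auto
      also have "\<dots> \<le> L * diameter (C i)"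
        using * L by (intro mult_left_mono diameter_bounded_bound C) auto
      finally show ?thesis .
    qed
    have bd: "bounded (f ` (C i \<inter> A))" for i
      using d[of _ i] unfolding bounded_def by (cases "C i \<inter> A = {}") (blast, blast)
    have dm: "diameter (f ` (C i \<inter> A)) \<le> L * diameter (C i)" for i
    proof (cases "C i \<inter> A = {}")
      case True then show ?thesis using L diameter_ge_0[OF C(2), of i] by simp
    next
      case False then show ?thesis
        using d[of _ i] unfolding diameter_def[of "f ` (C i \<inter> A)"] by (auto intro!: cSUP_least)
    qed
    have "hausdorff_content m (L * \<delta>) (f ` A)
      \<le> (\<Sum>i. ennreal (unit_ball_vol (real m) * (diameter (f ` (C i \<inter> A)) / 2) ^ m))"
    proof (rule hausdorff_content_le)
      show "diameter (f ` (C i \<inter> A)) \<le> L * \<delta>" for i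
        using dm[of i] C(3)[of i] L by (meson mult_left_mono less_imp_le order_trans)
      show "f ` A \<subseteq> (\<Union>i. f ` (C i \<inter> A))" using C(1) by blast
    qed (use bd in auto)
    also have "\<dots> \<le> (\<Sum>i. ennreal (L ^ m) * ennreal (unit_ball_vol (real m) * (diameter (C i) / 2) ^ m))"
    proof (intro suminf_le)
      fix i
      have "(diameter (f ` (C i \<inter> A)) / 2) ^ m \<le> (L * (diameter (C i) / 2)) ^ m"
        using dm[of i] diameter_ge_0[OF bd] by (intro power_mono) auto
      then have "unit_ball_vol (real m) * (diameter (f ` (C i \<inter> A)) / 2) ^ m
         \<le> L ^ m * (unit_ball_vol (real m) * (diameter (C i) / 2) ^ m)"
        by (subst mult.left_commute, intro mult_left_mono) (simp_all add: power_mult_distrib[symmetric])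
      then show "ennreal (unit_ball_vol (real m) * (diameter (f ` (C i \<inter> A)) / 2) ^ m)
         \<le> ennreal (L ^ m) * ennreal (unit_ball_vol (real m) * (diameter (C i) / 2) ^ m)"
        using L diameter_ge_0[OF C(2)] by (subst ennreal_mult[symmetric]) (auto intro!: ennreal_leI)
    qed auto
    finally show "hausdorff_content m (L * \<delta>) (f ` A)
       \<le> ennreal (L ^ m) * (\<Sum>i. ennreal (unit_ball_vol (real m) * (diameter (C i) / 2) ^ m))"
      by simp
  qed (use L in simp)
  note main = this
  show ?thesis unfolding hausdorff_outer_def[of m "f ` A"]
  proof (rule SUP_least)
    fix \<delta> :: real assume "\<delta> \<in> {0<..}"
    then have "hausdorff_content m \<delta> (f ` A) \<le> ennreal (L ^ m) * hausdorff_content m (\<delta> / L) A"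
      using main[of "\<delta> / L"] L by simp
    also have "\<dots> \<le> ennreal (L ^ m) * hausdorff_outer m A"
      using L \<open>\<delta> \<in> _\<close> by (intro mult_left_mono hausdorff_content_le_outer) auto
    finally show "hausdorff_content m \<delta> (f ` A) \<le> ennreal (L ^ m) * hausdorff_outer m A" .
  qed
qed

text \<open>The finite cover is padded to a sequence by empty sets, which have weight zero because
  \<open>m \<ge> 1\<close>.\<close>

lemma hausdorff_content_finite_cover_le:
  assumes I: "finite I" and sub: "A \<subseteq> (\<Union>i\<in>I. D i)" and bd: "\<And>i. i \<in> I \<Longrightarrow> bounded (D i)"
    and dm: "\<And>i. i \<in> I \<Longrightarrow> diameter (D i) \<le> r" and r: "0 \<le> r" "r \<le> \<delta>" and m: "m \<ge> 1"
  shows "hausdorff_content m \<delta> A \<le> ennreal (real (card I) * (unit_ball_vol (real m) * (r / 2) ^ m))"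
proof -
  obtain h where h: "bij_betw h {0..<card I} I" using ex_bij_betw_nat_finite[OF I] by blast
  define C where "C n = (if n < card I then D (h n) else {})" for n
  have hI: "h n \<in> I" if "n < card I" for n using h that by (auto simp: bij_betw_def)
  have "A \<subseteq> (\<Union>i. C i)"
  proof
    fix x assume "x \<in> A"
    then obtain i where "i \<in> I" "x \<in> D i" using sub by auto
    moreover then obtain n where "n < card I" "h n = i" using h by (auto simp: bij_betw_def image_iff) (metis atLeastLessThan_iff imageE)
    ultimately show "x \<in> (\<Union>i. C i)" by (auto simp: C_def intro!: exI[of _ n])
  qed
  then have "hausdorff_content m \<delta> A \<le> (\<Sum>i. ennreal (unit_ball_vol (real m) * (diameter (C i) / 2) ^ m))"
    using bd dm[THEN order_trans[OF _ r(2)]] hI r by (intro hausdorff_content_le) (auto simp: C_def)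
  also have "\<dots> = (\<Sum>i<card I. ennreal (unit_ball_vol (real m) * (diameter (C i) / 2) ^ m))"
    using m by (intro suminf_finite) (auto simp: C_def zero_power)
  also have "\<dots> \<le> (\<Sum>i<card I. ennreal (unit_ball_vol (real m) * (r / 2) ^ m))"
    using bd dm hI
    by (intro sum_mono ennreal_leI mult_left_mono power_mono) (auto simp: C_def diameter_ge_0)
  also have "\<dots> = ennreal (real (card I) * (unit_ball_vol (real m) * (r / 2) ^ m))"
    using r by (simp add: ennreal_mult ennreal_of_nat_eq_real_of_nat)
  finally show ?thesis .
qed

text \<open>With one vertex as origin the hull is parametrised by \<open>m\<close> coordinates in
  the unit interval. A grid of mesh \<open>1 / N\<close> has at most \<open>(N + 1) ^ m\<close>
  cells, with images of diameter at most \<open>R / N\<close>, so the total weight is bounded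
  independently of \<open>N\<close>.\<close>

lemma hausdorff_outer_convex_hull_finite:
  fixes T :: "'a::euclidean_space set"
  assumes T: "finite T" "card T = Suc m" and m: "m \<ge> 1"
  shows "hausdorff_outer m (convex hull T) < top"
proof -
  obtain z where z: "z \<in> T" using T by fastforce
  define T' where "T' = T - {z}"
  have T': "finite T'" "card T' = m" "z \<notin> T'" "T = insert z T'" using T z by (auto simp: T'_def)
  define R where "R = (\<Sum>t\<in>T'. norm (t - z))"
  have R: "R \<ge> 0" unfolding R_def by (intro sum_nonneg) auto
  let ?B = "ennreal (unit_ball_vol (real m) * R ^ m)"
  have "hausdorff_content m \<delta> (convex hull T) \<le> ?B" if \<delta>: "\<delta> > 0" for \<delta>
  proof -
    obtain N where N: "R / \<delta> < real N" "N > 0"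
      by (metis reals_Archimedean2 gr0I less_trans of_nat_0 of_nat_0_less_iff not_less of_nat_less_iff less_one divide_nonneg_pos R \<delta> not_less_iff_gr_or_eq)
    then have N': "R / real N \<le> \<delta>" using \<delta> by (simp add: field_simps)
    \<comment> \<open>The cell numbers run up to \<open>N\<close> inclusive because the coordinate 1
      falls into cell \<open>N\<close>. The surplus is paid by \<open>N + 1 \<le> 2 * N\<close>,
      against the factor 1/2 that turns diameters into radii.\<close>
    define I where "I = PiE T' (\<lambda>_. {0..N})"
    define D where "D a = {z + (\<Sum>t\<in>T'. u t *\<^sub>R (t - z)) | u. \<forall>t\<in>T'. real (a t) / N \<le> u t \<and> u t \<le> (real (a t) + 1) / N}" for a :: "'a \<Rightarrow> nat"
    have dist_D: "norm (x - y) \<le> R / N" if "x \<in> D a" "y \<in> D a" for x y a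
    proof -
      obtain u v where x: "x = z + (\<Sum>t\<in>T'. u t *\<^sub>R (t - z))" and y: "y = z + (\<Sum>t\<in>T'. v t *\<^sub>R (t - z))"
        and u: "\<And>t. t\<in>T' \<Longrightarrow> real (a t) / N \<le> u t \<and> u t \<le> (real (a t) + 1) / N"
        and v: "\<And>t. t\<in>T' \<Longrightarrow> real (a t) / N \<le> v t \<and> v t \<le> (real (a t) + 1) / N"
        using \<open>x \<in> D a\<close> \<open>y \<in> D a\<close> unfolding D_def by blast
      have "norm (x - y) = norm (\<Sum>t\<in>T'. (u t - v t) *\<^sub>R (t - z))"
        by (simp add: x y sum_subtractf[symmetric] scaleR_left_diff_distrib)
      also have "\<dots> \<le> (\<Sum>t\<in>T'. norm (t - z) / N)"
      proof (rule sum_norm_le)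
        fix t assume t: "t \<in> T'"
        have "\<bar>u t - v t\<bar> \<le> 1 / N" using u[OF t] v[OF t] by (auto simp: add_divide_distrib)
        then show "norm ((u t - v t) *\<^sub>R (t - z)) \<le> norm (t - z) / N"
          using mult_right_mono[of "\<bar>u t - v t\<bar>" "1/N" "norm (t - z)"] by simp
      qed
      also have "\<dots> = R / N" by (simp add: R_def sum_divide_distrib)
      finally show ?thesis .
    qed
    have "hausdorff_content m \<delta> (convex hull T) \<le> ennreal (real (card I) * (unit_ball_vol (real m) * (R / N / 2) ^ m))"
    proof (rule hausdorff_content_finite_cover_le[OF _ _ _ _ _ N' m])
      show "finite I" unfolding I_def using T' by (intro finite_PiE) auto
      show "bounded (D i)" for i
        using dist_D[of _ i] unfolding bounded_def dist_norm by (cases "D i = {}") (blast, blast)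
      show "diameter (D i) \<le> R / N" for i
        using dist_D[of _ i] R by (intro diameter_le) auto
      show "0 \<le> R / N" using R by simp
      show "convex hull T \<subseteq> (\<Union>i\<in>I. D i)"
      proof
        fix x assume "x \<in> convex hull T"
        then obtain u where u: "\<And>t. t \<in> T \<Longrightarrow> 0 \<le> u t" "sum u T = 1" "(\<Sum>t\<in>T. u t *\<^sub>R t) = x"
          unfolding convex_hull_finite[OF T(1)] by auto
        have uz: "u z = 1 - sum u T'" using u(2) T' by simp
        have "x = u z *\<^sub>R z + (\<Sum>t\<in>T'. u t *\<^sub>R t)" using u(3) T' by simp
        also have "\<dots> = z + (\<Sum>t\<in>T'. u t *\<^sub>R (t - z))"
          by (simp add: uz scaleR_left_diff_distrib scaleR_right_diff_distrib sum_subtractf scaleR_sum_left)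
        finally have x: "x = z + (\<Sum>t\<in>T'. u t *\<^sub>R (t - z))" .
        define a where "a = (\<lambda>t\<in>T'. nat \<lfloor>real N * u t\<rfloor>)"
        have le1: "u t \<le> 1" if "t \<in> T'" for t
        proof -
          have "u t \<le> sum u T" using that T' u(1) T(1) by (intro member_le_sum) auto
          then show ?thesis using u(2) by simp
        qed
        have "a \<in> I" unfolding I_def a_def
        proof (rule restrict_PiE_iff[THEN iffD2], safe)
          fix t assume "t \<in> T'"
          then have "real N * u t \<le> N" using le1[of t] N by (simp add: mult_left_le)
          then show "nat \<lfloor>real N * u t\<rfloor> \<in> {0..N}" by (auto simp: nat_le_iff floor_le_iff)
        qed
        moreover have "x \<in> D a" unfolding D_def
        proof (intro CollectI exI conjI ballI)
          show "x = z + (\<Sum>t\<in>T'. u t *\<^sub>R (t - z))" by fact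
          fix t assume t: "t \<in> T'"
          then have "real (a t) = of_int \<lfloor>real N * u t\<rfloor>" using u(1)[of t] T' by (simp add: a_def)
          then have "real (a t) \<le> real N * u t" "real N * u t \<le> real (a t) + 1" by linarith+
          then show "real (a t) / N \<le> u t" "u t \<le> (real (a t) + 1) / N"
            using N by (auto simp: field_simps)
        qed
        ultimately show "x \<in> (\<Union>i\<in>I. D i)" by blast
      qed
    qed
    also have "card I = (N + 1) ^ m" unfolding I_def using T' by (simp add: card_PiE)
    also have "real ((N + 1) ^ m) * (unit_ball_vol (real m) * (R / N / 2) ^ m) = unit_ball_vol (real m) * (real (N+1) * (R / N / 2)) ^ m"
      by (simp only: power_mult_distrib of_nat_power mult.left_commute)
    also have "ennreal \<dots> \<le> ?B"
    proof (intro ennreal_leI mult_left_mono power_mono)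
      have "real (N+1) * R \<le> 2 * real N * R" using N R by (intro mult_right_mono) auto
      then show "real (N+1) * (R / N / 2) \<le> R" using N by (simp add: field_simps)
    qed (use R in auto)
    finally show ?thesis .
  qed
  then have "hausdorff_outer m (convex hull T) \<le> ?B"
    unfolding hausdorff_outer_def by (intro SUP_least) auto
  then show ?thesis using le_less_trans ennreal_less_top by blast
qed

text \<open>The cone over a set of small diameter \<open>\<delta>\<close> is covered by about \<open>D/\<delta>\<close> balls of radius \<open>2\<delta>\<close>
  centred on one generating segment.\<close>

lemma cone_cover:
  fixes z :: "'a::euclidean_space"
  assumes d2: "DIM('a) = Suc m" "m \<ge> 1" and C: "bounded C" "diameter C \<le> D" and D: "D > 0"
    and near: "\<And>y. y \<in> C \<Longrightarrow> dist y z \<le> D"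
  shows "\<exists>M \<in> sets lborel. (\<Union>y\<in>C. closed_segment y z) \<subseteq> M \<and>
    emeasure lborel M \<le> ennreal (3 * unit_ball_vol DIM('a) * 4 ^ DIM('a) / unit_ball_vol (real m) * D)
       * ennreal (unit_ball_vol (real m) * (diameter C / 2) ^ m)"
proof (cases "C = {}")
  case True then show ?thesis by (intro bexI[of _ "{}"]) auto
next
  case False
  then obtain y0 where y0: "y0 \<in> C" by auto
  show ?thesis
  proof (cases "diameter C = 0")
    case True
    \<comment> \<open>For a single point the right-hand side is zero. The cone is then a segment, a
      null set in dimension at least two.\<close>
    have "y = y0" if "y \<in> C" for y
      using diameter_bounded_bound[OF C(1) that y0] True by simp
    then have "C = {y0}" using y0 by blast
    then have "(\<Union>y\<in>C. closed_segment y z) = closed_segment y0 z" by simp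
    moreover have "interior (closed_segment y0 z) = {}"
      using d2 by (simp add: interior_closed_segment_ge2)
    then have "negligible (closed_segment y0 z)" by (simp add: negligible_convex_interior)
    then have "emeasure lborel (closed_segment y0 z) = 0"
      by (simp add: negligible_iff_emeasure0)
    ultimately show ?thesis by (intro bexI[of _ "closed_segment y0 z"]) (auto simp: borel_closed)
  next
    case False
    define \<delta> where "\<delta> = diameter C"
    have \<delta>: "\<delta> > 0" "\<delta> \<le> D" using False diameter_ge_0[OF C(1)] C(2) by (auto simp: \<delta>_def)
    define n where "n = nat \<lceil>D / \<delta>\<rceil>"
    have "1 \<le> D / \<delta>" using \<delta> by simp
    moreover have "real n = of_int \<lceil>D / \<delta>\<rceil>"
      unfolding n_def using \<open>1 \<le> D / \<delta>\<close> by (intro of_nat_nat) linarith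
    moreover have "D / \<delta> \<le> of_int \<lceil>D / \<delta>\<rceil>" "of_int \<lceil>D / \<delta>\<rceil> \<le> D / \<delta> + 1"
      using ceiling_correct[of "D / \<delta>"] by auto
    ultimately have n: "D / \<delta> \<le> real n" "real n \<le> D / \<delta> + 1" "1 \<le> real n" by auto
    define p where "p j = (1 - real j / n) *\<^sub>R y0 + (real j / n) *\<^sub>R z" for j
    \<comment> \<open>The radius is the sum of \<delta>, for moving from the segment of
      \<open>y\<close> to that of \<open>y0\<close>, and of \<open>D / n \<le> \<delta>\<close>, for
      rounding the parameter down to a multiple of \<open>1 / n\<close>. Since \<delta> is at most
      \<open>D\<close>, the number \<open>n + 1\<close> of balls is at most
      \<open>3 * D / \<delta>\<close>.\<close>
    define M where "M = (\<Union>j\<in>{0..n}. cball (p j) (2 * \<delta>))"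
    have "M \<in> sets lborel" unfolding M_def by simp
    moreover have "(\<Union>y\<in>C. closed_segment y z) \<subseteq> M"
    proof safe
      fix y x assume y: "y \<in> C" and "x \<in> closed_segment y z"
      then obtain t where t: "0 \<le> t" "t \<le> 1" and x: "x = (1 - t) *\<^sub>R y + t *\<^sub>R z"
        unfolding closed_segment_def by auto
      define j where "j = nat \<lfloor>t * n\<rfloor>"
      have "real j = of_int \<lfloor>t * n\<rfloor>" using t by (simp add: j_def)
      then have j: "real j \<le> t * n" "t * n \<le> real j + 1" by linarith+
      then have "real j \<le> n" using t n by (metis mult_left_le_one_le of_nat_0_le_iff order_trans)
      have tj: "0 \<le> t - real j / n" "t - real j / n \<le> 1 / n"
        using j n pos_le_divide_eq[of "real n" t "real j + 1"] pos_divide_le_eq[of "real n" "real j" t]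
        by (auto simp: add_divide_distrib)
      have "x - p j = (1 - t) *\<^sub>R (y - y0) + (t - real j / n) *\<^sub>R (z - y0)"
        by (simp add: x p_def algebra_simps)
      then have "norm (x - p j) \<le> (1 - t) * norm (y - y0) + (t - real j / n) * norm (z - y0)"
        using t tj by (metis norm_triangle_ineq norm_scaleR abs_of_nonneg diff_ge_0_iff_ge)
      also have "\<dots> \<le> 1 * \<delta> + (1 / n) * D"
        using t tj diameter_bounded_bound[OF C(1) y y0] near[OF y0] D
        by (intro add_mono mult_mono) (auto simp: \<delta>_def dist_norm norm_minus_commute)
      also have "\<dots> \<le> 2 * \<delta>" using n \<delta> by (simp add: field_simps)
      finally have "x \<in> cball (p j) (2 * \<delta>)" by (simp add: dist_norm norm_minus_commute)
      then show "x \<in> M" using \<open>real j \<le> n\<close> by (auto simp: M_def)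
    qed
    moreover have "emeasure lborel M \<le> ennreal (3 * unit_ball_vol DIM('a) * 4 ^ DIM('a) / unit_ball_vol (real m) * D)
       * ennreal (unit_ball_vol (real m) * (diameter C / 2) ^ m)"
    proof -
      have "emeasure lborel M \<le> (\<Sum>j\<in>{0..n}. emeasure lborel (cball (p j) (2 * \<delta>)))"
        unfolding M_def by (rule emeasure_subadditive_finite) auto
      also have "\<dots> = (\<Sum>j\<in>{0..n}. ennreal (unit_ball_vol DIM('a) * (2 * \<delta>) ^ DIM('a)))"
        using \<delta> by (simp add: emeasure_cball)
      also have "\<dots> = ennreal ((real n + 1) * (unit_ball_vol DIM('a) * (2 * \<delta>) ^ DIM('a)))"
        using \<delta> by (simp add: ennreal_mult ennreal_of_nat_eq_real_of_nat add.commute)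
      also have "\<dots> \<le> ennreal ((3 * D / \<delta>) * (unit_ball_vol DIM('a) * (2 * \<delta>) ^ DIM('a)))"
      proof (intro ennreal_leI mult_right_mono)
        have "1 \<le> D / \<delta>" using \<delta> by simp
        then show "real n + 1 \<le> 3 * D / \<delta>" using n(2) by simp
      qed (use \<delta> in auto)
      also have "(3 * D / \<delta>) * (unit_ball_vol DIM('a) * (2 * \<delta>) ^ DIM('a))
         = (3 * unit_ball_vol DIM('a) * 4 ^ DIM('a) / unit_ball_vol (real m) * D) * (unit_ball_vol (real m) * (\<delta> / 2) ^ m) / 2"
      proof -
        have U: "unit_ball_vol (real m) \<noteq> 0"
          by (rule less_imp_neq[THEN not_sym, OF unit_ball_vol_pos]) simp
        have p: "(2 * \<delta>) ^ m = 4 ^ m * (\<delta>/2) ^ m" unfolding power_mult_distrib[symmetric] by simp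
        have *: "(3 * D / \<delta>) * (V * (2 * \<delta> * (P * X))) = (3 * V * (4 * P) / U * D) * (U * X) / 2"
          if "U \<noteq> 0" for V P X U :: real using that \<delta> by (simp add: field_simps)
        show ?thesis unfolding d2 power_Suc p by (rule *[OF U])
      qed
      also have "ennreal \<dots> \<le> ennreal ((3 * unit_ball_vol DIM('a) * 4 ^ DIM('a) / unit_ball_vol (real m) * D)
          * (unit_ball_vol (real m) * (\<delta> / 2) ^ m))"
        using D \<delta> by (intro ennreal_leI) (auto intro!: mult_nonneg_nonneg divide_nonneg_nonneg)
      finally show ?thesis using D \<delta> by (subst ennreal_mult[symmetric]) (auto simp: \<delta>_def mult.assoc)
    qed
    ultimately show ?thesis by blast
  qed
qed

text \<open>The cones over the members of a cover of \<open>F\<close> cover \<open>K\<close>, and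
  \<open>cone_cover\<close> pays for each by the weight of the member. Covers at the single scale
  \<open>D\<close> suffice. Read backwards, this bounds the Hausdorff measure of the base from below
  by a volume.\<close>

lemma emeasure_cone_le_hausdorff:
  fixes z :: "'a::euclidean_space"
  assumes d2: "DIM('a) = Suc m" "m \<ge> 1" and D: "D > 0"
    and near: "\<And>y. y \<in> F \<Longrightarrow> dist y z \<le> D" and K: "K \<in> sets lborel" "K \<subseteq> (\<Union>y\<in>F. closed_segment y z)"
  shows "emeasure lborel K \<le> ennreal (3 * unit_ball_vol DIM('a) * 4 ^ DIM('a) / unit_ball_vol (real m) * D) * hausdorff_outer m F"
proof -
  let ?c = "3 * unit_ball_vol DIM('a) * 4 ^ DIM('a) / unit_ball_vol (real m) * D"
  have "emeasure lborel K \<le> ennreal ?c * hausdorff_content m D F"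
    unfolding hausdorff_content_def
  proof (rule ennreal_le_mult_INF)
    fix C :: "nat \<Rightarrow> 'a set"
    assume "C \<in> {C. F \<subseteq> (\<Union>i. C i) \<and> (\<forall>i. bounded (C i) \<and> diameter (C i) \<le> D)}"
    then have C: "F \<subseteq> (\<Union>i. C i)" "\<And>i. bounded (C i)" "\<And>i. diameter (C i) \<le> D" by auto
    have "\<exists>M \<in> sets lborel. (\<Union>y\<in>C i \<inter> F. closed_segment y z) \<subseteq> M \<and>
      emeasure lborel M \<le> ennreal ?c * ennreal (unit_ball_vol (real m) * (diameter (C i \<inter> F) / 2) ^ m)" for i
      using C by (intro cone_cover[OF d2 _ _ D near])
        (auto intro: bounded_subset order_trans[OF diameter_subset])
    then obtain M where M: "\<And>i. M i \<in> sets lborel" "\<And>i. (\<Union>y\<in>C i \<inter> F. closed_segment y z) \<subseteq> M i"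
      "\<And>i. emeasure lborel (M i) \<le> ennreal ?c * ennreal (unit_ball_vol (real m) * (diameter (C i \<inter> F) / 2) ^ m)"
      by metis
    have "K \<subseteq> (\<Union>i. M i)" using K(2) C(1) M(2) by (blast 8)
    then have "emeasure lborel K \<le> emeasure lborel (\<Union>i. M i)" using M(1) by (intro emeasure_mono) auto
    also have "\<dots> \<le> (\<Sum>i. emeasure lborel (M i))" using M(1) by (intro emeasure_subadditive_countably) auto
    also have "\<dots> \<le> (\<Sum>i. ennreal ?c * ennreal (unit_ball_vol (real m) * (diameter (C i) / 2) ^ m))"
    proof (intro suminf_le order_trans[OF M(3)] mult_left_mono ennreal_leI power_mono divide_right_mono)
      show "diameter (C i \<inter> F) \<le> diameter (C i)" for i using C by (intro diameter_subset) auto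
      show "0 \<le> diameter (C i \<inter> F) / 2" for i
        using C by (simp add: diameter_ge_0 bounded_subset[OF _ Int_lower1])
    qed auto
    finally show "emeasure lborel K \<le> ennreal ?c * (\<Sum>i. ennreal (unit_ball_vol (real m) * (diameter (C i) / 2) ^ m))"
      by simp
  qed (use D in auto)
  also have "\<dots> \<le> ennreal ?c * hausdorff_outer m F"
    using D by (intro mult_left_mono hausdorff_content_le_outer) auto
  finally show ?thesis .
qed

section \<open>Barycentric coordinates\<close>

text \<open>For \<open>d + 1\<close> affinely independent points the choice exists and is unique at
  every point of the space, so the coordinate is a global affine function, negative beyond the
  opposite facet.\<close>

definition bary :: "'a::euclidean_space set \<Rightarrow> 'a \<Rightarrow> 'a \<Rightarrow> real" where
  "bary S z x = (SOME u. sum u S = 1 \<and> (\<Sum>v\<in>S. u v *\<^sub>R v) = x) z"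

definition bary_grad :: "'a::euclidean_space set \<Rightarrow> 'a \<Rightarrow> 'a" where
  "bary_grad S z = (\<Sum>b\<in>Basis. (bary S z b - bary S z 0) *\<^sub>R b)"

locale full_simplex =
  fixes S :: "'a::euclidean_space set"
  assumes indep: "\<not> affine_dependent S" and card_S: "card S = Suc DIM('a)"
begin

lemma finite_S [simp, intro]: "finite S"
  using indep aff_independent_finite by blast

lemma S_nonempty: "S \<noteq> {}" using card_S by auto

lemma bary_aux: "sum (\<lambda>z. bary S z x) S = 1" "(\<Sum>z\<in>S. bary S z x *\<^sub>R z) = x"
proof -
  have "affine hull S = UNIV"
    using indep card_S by (intro affine_independent_span_gt) auto
  then have "\<exists>u. sum u S = 1 \<and> (\<Sum>v\<in>S. u v *\<^sub>R v) = x"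
    using affine_hull_finite[of S] by auto
  from someI_ex[OF this] show "sum (\<lambda>z. bary S z x) S = 1" "(\<Sum>z\<in>S. bary S z x *\<^sub>R z) = x"
    by (auto simp: bary_def)
qed

lemmas bary_sum = bary_aux(1) and bary_comb = bary_aux(2)

lemma bary_unique:
  assumes "sum u S = 1" "(\<Sum>v\<in>S. u v *\<^sub>R v) = x" "z \<in> S"
  shows "bary S z x = u z"
proof (rule ccontr)
  assume ne: "bary S z x \<noteq> u z"
  let ?U = "\<lambda>v. bary S v x - u v"
  have "sum ?U S = 0" using assms bary_sum by (simp add: sum_subtractf)
  moreover have "(\<Sum>v\<in>S. ?U v *\<^sub>R v) = 0"
    using assms bary_comb[of x] by (simp add: scaleR_left_diff_distrib sum_subtractf)
  ultimately have "affine_dependent S"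
    using ne assms(3) by (subst affine_dependent_explicit_finite) (auto intro!: exI[of _ ?U])
  then show False using indep by simp
qed

lemma bary_affine_comb:
  assumes z: "z \<in> S" and u: "finite I" "sum u I = 1"
  shows "bary S z (\<Sum>i\<in>I. u i *\<^sub>R y i) = (\<Sum>i\<in>I. u i * bary S z (y i))"
proof (rule bary_unique[OF _ _ z])
  show "(\<Sum>v\<in>S. \<Sum>i\<in>I. u i * bary S v (y i)) = 1"
    by (subst sum.swap) (simp add: sum_distrib_left[symmetric] bary_sum u)
  have "(\<Sum>v\<in>S. (\<Sum>i\<in>I. u i * bary S v (y i)) *\<^sub>R v) = (\<Sum>i\<in>I. u i *\<^sub>R (\<Sum>v\<in>S. bary S v (y i) *\<^sub>R v))"
    by (simp add: scaleR_sum_left scaleR_sum_right) (rule sum.swap)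
  then show "(\<Sum>v\<in>S. (\<Sum>i\<in>I. u i * bary S v (y i)) *\<^sub>R v) = (\<Sum>i\<in>I. u i *\<^sub>R y i)"
    by (simp add: bary_comb)
qed

lemma bary_segment:
  assumes "z \<in> S"
  shows "bary S z ((1 - t) *\<^sub>R x + t *\<^sub>R y) = (1 - t) * bary S z x + t * bary S z y"
  using bary_affine_comb[OF assms, of "{0::nat,1}" "\<lambda>i. if i = 0 then 1 - t else t" "\<lambda>i. if i = 0 then x else y"]
  by simp

lemma bary_linear:
  assumes z: "z \<in> S" shows "linear (\<lambda>x. bary S z x - bary S z 0)"
proof (rule linearI)
  have sc: "bary S z (c *\<^sub>R x) = (1 - c) * bary S z 0 + c * bary S z x" for c x
    using bary_segment[OF z, of c 0 x] by simp
  show "bary S z (c *\<^sub>R x) - bary S z 0 = c *\<^sub>R (bary S z x - bary S z 0)" for c x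
    by (simp add: sc algebra_simps)
  show "bary S z (x + y) - bary S z 0 = bary S z x - bary S z 0 + (bary S z y - bary S z 0)" for x y
    using bary_segment[OF z, of "1/2" "2 *\<^sub>R x" "2 *\<^sub>R y"] sc[of 2 x] sc[of 2 y]
    by (simp add: algebra_simps)
qed

lemma bary_eq: assumes "z \<in> S" shows "bary S z x = bary S z 0 + bary_grad S z \<bullet> x"
proof -
  interpret linear "\<lambda>x. bary S z x - bary S z 0" by (rule bary_linear[OF assms])
  have "bary S z x - bary S z 0 = bary S z (\<Sum>b\<in>Basis. (x \<bullet> b) *\<^sub>R b) - bary S z 0"
    by (simp add: euclidean_representation)
  also have "\<dots> = (\<Sum>b\<in>Basis. (x \<bullet> b) * (bary S z b - bary S z 0))"
    by (subst sum) (simp add: scale)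
  also have "\<dots> = bary_grad S z \<bullet> x"
    by (simp add: bary_grad_def inner_sum_left mult.commute inner_commute[of x])
  finally show ?thesis by simp
qed

lemma bary_diff: "z \<in> S \<Longrightarrow> bary S z x - bary S z y = bary_grad S z \<bullet> (x - y)"
  using bary_eq[of z x] bary_eq[of z y] by (simp add: inner_diff_right)

lemma bary_vertex: "z \<in> S \<Longrightarrow> v \<in> S \<Longrightarrow> bary S z v = (if v = z then 1 else 0)"
  by (subst bary_unique[of "\<lambda>w. if w = v then 1 else 0"]) (auto simp: if_distrib[of "\<lambda>c. c *\<^sub>R _"] cong: if_cong)

lemma continuous_on_bary: "z \<in> S \<Longrightarrow> continuous_on A (bary S z)"
  by (subst continuous_on_cong[OF refl bary_eq]) (auto intro!: continuous_intros)

lemma bary_has_derivative: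
  "z \<in> S \<Longrightarrow> (bary S z has_derivative (\<lambda>h. bary_grad S z \<bullet> h)) (at x within A)"
proof -
  assume "z \<in> S"
  then have "(\<lambda>x. bary S z 0 + bary_grad S z \<bullet> x) = bary S z" using bary_eq by (metis ext)
  moreover have "((\<lambda>x. bary S z 0 + bary_grad S z \<bullet> x) has_derivative (\<lambda>h. bary_grad S z \<bullet> h)) (at x within A)"
    by (auto intro!: derivative_eq_intros)
  ultimately show ?thesis by simp
qed

lemma face_iff: assumes "T \<subseteq> S"
  shows "x \<in> convex hull T \<longleftrightarrow> (\<forall>z\<in>S. 0 \<le> bary S z x) \<and> (\<forall>z\<in>S-T. bary S z x = 0)"
proof
  have fT: "finite T" using assms finite_subset by blast
  assume "x \<in> convex hull T"
  then obtain u where u: "\<And>z. z\<in>T \<Longrightarrow> 0 \<le> u z" "sum u T = 1" "(\<Sum>v\<in>T. u v *\<^sub>R v) = x"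
    unfolding convex_hull_finite[OF fT] by auto
  define u' where "u' v = (if v \<in> T then u v else 0)" for v
  have "sum u' S = 1" "(\<Sum>v\<in>S. u' v *\<^sub>R v) = x"
    using u assms unfolding u'_def
    by (auto simp: if_distrib[of "\<lambda>c. c *\<^sub>R _"] sum.If_cases Int_absorb1 cong: if_cong)
  then have "bary S z x = u' z" if "z \<in> S" for z using bary_unique that by blast
  then show "(\<forall>z\<in>S. 0 \<le> bary S z x) \<and> (\<forall>z\<in>S-T. bary S z x = 0)"
    using u(1) by (auto simp: u'_def)
next
  have fT: "finite T" using assms finite_subset by blast
  assume r: "(\<forall>z\<in>S. 0 \<le> bary S z x) \<and> (\<forall>z\<in>S-T. bary S z x = 0)"
  have "(\<Sum>z\<in>T. bary S z x) = 1" "(\<Sum>z\<in>T. bary S z x *\<^sub>R z) = x"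
    using r bary_sum[of x] bary_comb[of x] sum.mono_neutral_left[OF finite_S assms, of "\<lambda>z. bary S z x"]
      sum.mono_neutral_left[OF finite_S assms, of "\<lambda>z. bary S z x *\<^sub>R z"] by auto
  then show "x \<in> convex hull T"
    unfolding convex_hull_finite[OF fT] using r assms by (auto intro!: exI[of _ "\<lambda>z. bary S z x"])
qed

lemma hull_iff: "x \<in> convex hull S \<longleftrightarrow> (\<forall>z\<in>S. 0 \<le> bary S z x)"
  using face_iff[of S] by simp

lemma facet_iff: "z \<in> S \<Longrightarrow> x \<in> convex hull (S - {z}) \<longleftrightarrow> x \<in> convex hull S \<and> bary S z x = 0"
  using face_iff[of "S - {z}" x] hull_iff[of x] by auto

lemma interior_iff: "x \<in> interior (convex hull S) \<longleftrightarrow> (\<forall>z\<in>S. 0 < bary S z x)"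
proof -
  have "x \<in> interior (convex hull S) \<longleftrightarrow> (\<exists>u. (\<forall>x\<in>S. 0 < u x) \<and> sum u S = 1 \<and> (\<Sum>x\<in>S. u x *\<^sub>R x) = x)"
    unfolding interior_convex_hull_explicit_minimal[OF indep] using card_S by auto
  also have "\<dots> \<longleftrightarrow> (\<forall>z\<in>S. 0 < bary S z x)"
  proof
    assume "\<exists>u. (\<forall>x\<in>S. 0 < u x) \<and> sum u S = 1 \<and> (\<Sum>x\<in>S. u x *\<^sub>R x) = x"
    then obtain u where "\<forall>x\<in>S. 0 < u x" "sum u S = 1" "(\<Sum>x\<in>S. u x *\<^sub>R x) = x" by blast
    then show "\<forall>z\<in>S. 0 < bary S z x" using bary_unique[of u x] by simp
  next
    assume "\<forall>z\<in>S. 0 < bary S z x"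
    then show "\<exists>u. (\<forall>x\<in>S. 0 < u x) \<and> sum u S = 1 \<and> (\<Sum>x\<in>S. u x *\<^sub>R x) = x"
      using bary_sum[of x] bary_comb[of x] by (intro exI[of _ "\<lambda>z. bary S z x"]) simp
  qed
  finally show ?thesis .
qed

lemma bary_bounds: "x \<in> convex hull S \<Longrightarrow> z \<in> S \<Longrightarrow> 0 \<le> bary S z x \<and> bary S z x \<le> 1"
  using member_le_sum[of z S "\<lambda>z. bary S z x"] bary_sum[of x] hull_iff[of x] by auto

lemma sum_bary_grad: "(\<Sum>z\<in>S. bary_grad S z) = 0"
proof -
  have "(\<Sum>z\<in>S. bary_grad S z) \<bullet> h = 0" for h
  proof -
    have "(\<Sum>z\<in>S. bary_grad S z) \<bullet> h = (\<Sum>z\<in>S. bary S z h - bary S z 0)"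
      by (simp add: inner_sum_left bary_diff)
    then show ?thesis by (simp add: sum_subtractf bary_sum)
  qed
  then show ?thesis using inner_eq_zero_iff by blast
qed

lemma bary_grad_comb: "(\<Sum>z\<in>S. (bary_grad S z \<bullet> h) *\<^sub>R z) = h"
proof -
  have "(\<Sum>z\<in>S. (bary_grad S z \<bullet> h) *\<^sub>R z) = (\<Sum>z\<in>S. bary S z h *\<^sub>R z - bary S z 0 *\<^sub>R z)"
    by (intro sum.cong refl) (metis bary_diff diff_zero scaleR_left_diff_distrib)
  then show ?thesis by (simp add: sum_subtractf bary_comb)
qed

lemma card_ge_2: "2 \<le> card S" using card_S DIM_positive[where 'a='a] by simp

lemma other_vertex: obtains v where "v \<in> S" "v \<noteq> z"
proof -
  have "\<not> S \<subseteq> {z}" using card_ge_2 card_mono[of "{z}" S] by auto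
  then show thesis using that by blast
qed

lemma bary_grad_nonzero: assumes "z \<in> S" shows "bary_grad S z \<noteq> 0"
proof -
  obtain v where v: "v \<in> S" "v \<noteq> z" by (rule other_vertex)
  then have "bary S z z - bary S z v = 1" using assms by (simp add: bary_vertex)
  then show ?thesis using bary_diff[OF assms, of z v] by auto
qed

lemma interior_nonempty: "interior (convex hull S) \<noteq> {}"
proof -
  let ?x = "\<Sum>z\<in>S. (1 / real (card S)) *\<^sub>R z"
  have s: "(\<Sum>z\<in>S. 1 / real (card S)) = 1" using S_nonempty by simp
  have "bary S z ?x = 1 / real (card S)" if "z \<in> S" for z
    using bary_unique[OF s refl that] by simp
  then have "?x \<in> interior (convex hull S)"
    unfolding interior_iff using card_ge_2 by auto
  then show ?thesis by blast
qed

lemma closure_interior_hull: "closure (interior (convex hull S)) = convex hull S"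
  using interior_nonempty by (simp add: convex_closure_interior closure_closed finite_imp_compact_convex_hull compact_imp_closed)

lemma compact_hull [simp, intro]: "compact (convex hull S)"
  by (simp add: finite_imp_compact_convex_hull)

text \<open>Along the diameter of the ball parallel to its gradient the coordinate changes by
  \<open>2 * r * norm (bary_grad S z)\<close>, yet it stays between 0 and 1.\<close>

lemma cball_norm_grad: assumes "cball x r \<subseteq> convex hull S" "0 \<le> r" "z \<in> S"
  shows "2 * r * norm (bary_grad S z) \<le> 1"
proof -
  let ?n = "(r / norm (bary_grad S z)) *\<^sub>R bary_grad S z"
  have n: "norm ?n = r" using assms bary_grad_nonzero by simp
  then have "x + ?n \<in> convex hull S" "x - ?n \<in> convex hull S"
    using assms by (auto simp: subset_eq dist_norm)
  then have "bary S z (x + ?n) - bary S z (x - ?n) \<le> 1"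
    using bary_bounds[OF _ assms(3)] by (meson diff_mono diff_zero order_trans le_diff_eq add_increasing2 order_refl)
  moreover have "bary S z (x + ?n) - bary S z (x - ?n) = bary_grad S z \<bullet> (2 *\<^sub>R ?n)"
    using bary_diff[OF assms(3), of "x + ?n" "x - ?n"] by (simp add: scaleR_2[symmetric] del: scaleR_scaleR)
  moreover have "bary_grad S z \<bullet> (2 *\<^sub>R ?n) = 2 * r * norm (bary_grad S z)"
    using bary_grad_nonzero[OF assms(3)] by (simp add: dot_square_norm power2_eq_square)
  ultimately show ?thesis by simp
qed

lemma inball_set: "{2 * r | r. 0 \<le> r \<and> (\<exists>x. cball x r \<subseteq> convex hull S)} \<noteq> {}"
    "bdd_above {2 * r | r. 0 \<le> r \<and> (\<exists>x. cball x r \<subseteq> convex hull S)}"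
proof -
  obtain v where v: "v \<in> S" using S_nonempty by auto
  then have "cball v 0 \<subseteq> convex hull S" by (simp add: hull_inc)
  then show "{2 * r | r. 0 \<le> r \<and> (\<exists>x. cball x r \<subseteq> convex hull S)} \<noteq> {}" by blast
  have "2 * r \<le> 1 / norm (bary_grad S v)" if "0 \<le> r" "cball x r \<subseteq> convex hull S" for x r
    using cball_norm_grad[OF that(2,1) v] bary_grad_nonzero[OF v] by (simp add: field_simps)
  then show "bdd_above {2 * r | r. 0 \<le> r \<and> (\<exists>x. cball x r \<subseteq> convex hull S)}"
    by (intro bdd_aboveI) auto
qed

lemma inball_diameter_pos: "inball_diameter (convex hull S) > 0"
proof -
  obtain x where "x \<in> interior (convex hull S)" using interior_nonempty by auto
  then obtain r where "r > 0" "cball x r \<subseteq> convex hull S" unfolding mem_interior_cball by auto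
  then have "2 * r \<le> inball_diameter (convex hull S)"
    unfolding inball_diameter_def by (intro cSup_upper inball_set(2)) auto
  then show ?thesis using \<open>r > 0\<close> by simp
qed

lemma inball_diameter_norm_grad: assumes z: "z \<in> S"
  shows "inball_diameter (convex hull S) * norm (bary_grad S z) \<le> 1"
proof -
  have "inball_diameter (convex hull S) \<le> 1 / norm (bary_grad S z)"
    unfolding inball_diameter_def
  proof (rule cSup_least[OF inball_set(1)])
    fix s assume "s \<in> {2 * r | r. 0 \<le> r \<and> (\<exists>x. cball x r \<subseteq> convex hull S)}"
    then obtain r x where "s = 2 * r" "0 \<le> r" "cball x r \<subseteq> convex hull S" by auto
    then show "s \<le> 1 / norm (bary_grad S z)"
      using cball_norm_grad[of x r z] z bary_grad_nonzero[OF z] by (simp add: field_simps)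
  qed
  then show ?thesis using bary_grad_nonzero[OF z] by (simp add: field_simps)
qed

lemma inball_exists: assumes "e < inball_diameter (convex hull S)"
  obtains x r where "0 \<le> r" "e < 2 * r" "cball x r \<subseteq> convex hull S"
  using less_cSupD[OF inball_set(1) assms[unfolded inball_diameter_def]] by auto

text \<open>The coordinate of \<open>v\<close> drops from 1 to 0 along the edge, so the edge is at
  least as long as the height \<open>1 / norm (bary_grad S v)\<close>, which is no smaller than the
  inball diameter.\<close>

lemma edge_length: assumes "v \<in> S" "w \<in> S" "v \<noteq> w"
  shows "inball_diameter (convex hull S) \<le> dist v w"
proof -
  have "1 = bary S v v - bary S v w" using assms by (simp add: bary_vertex)
  also have "\<dots> = bary_grad S v \<bullet> (v - w)" using bary_diff assms by blast
  also have "\<dots> \<le> norm (bary_grad S v) * dist v w" by (simp add: dist_norm norm_cauchy_schwarz)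
  finally have "inball_diameter (convex hull S) * 1 \<le> inball_diameter (convex hull S) * (norm (bary_grad S v) * dist v w)"
    using inball_diameter_pos by (intro mult_left_mono) auto
  also have "\<dots> \<le> 1 * dist v w"
    unfolding mult.assoc[symmetric] using inball_diameter_norm_grad[OF assms(1)] by (intro mult_right_mono) auto
  finally show ?thesis by simp
qed

lemma diameter_pos: "diameter (convex hull S) > 0"
proof -
  obtain v where v: "v \<in> S" using S_nonempty by auto
  obtain w where w: "w \<in> S" "w \<noteq> v" by (rule other_vertex)
  have "inball_diameter (convex hull S) \<le> dist v w" using edge_length v w by auto
  also have "\<dots> \<le> diameter (convex hull S)"
    using v w by (intro diameter_bounded_bound) (auto simp: hull_inc compact_imp_bounded)
  finally show ?thesis using inball_diameter_pos by simp
qed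

end

text \<open>Two simplices sharing the facet opposite to \<open>z\<close> and \<open>z'\<close>: the affine map fixing that facet and
  sending \<open>z\<close> to \<open>z'\<close> transports barycentric coordinates.\<close>

locale facet_pair = S: full_simplex S + S': full_simplex S'
  for S S' :: "'a::euclidean_space set" +
  fixes z z' assumes z: "z \<in> S" and z': "z' \<in> S'" and common: "S - {z} = S' - {z'}"
begin

text \<open>Both sides are affine, vanish at the common vertices and agree at \<open>z'\<close>. The
  factor \<open>bary S z z'\<close> is the signed ratio of the two heights over the common facet: it
  is negative exactly when \<open>z\<close> and \<open>z'\<close> lie on different sides.\<close>

lemma bary_scale: "bary S z x = bary S z z' * bary S' z' x"
proof -
  have "bary S z (\<Sum>v\<in>S'. bary S' v x *\<^sub>R v) = (\<Sum>v\<in>S'. bary S' v x * bary S z v)"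
    by (rule S.bary_affine_comb[OF z]) (auto simp: S'.bary_sum)
  also have "\<dots> = bary S' z' x * bary S z z' + (\<Sum>v\<in>S'-{z'}. bary S' v x * bary S z v)"
    using z' by (simp add: sum.remove)
  also have "(\<Sum>v\<in>S'-{z'}. bary S' v x * bary S z v) = 0"
    using S.bary_vertex[OF z] by (intro sum.neutral) (auto simp: common[symmetric])
  finally show ?thesis by (simp add: S'.bary_comb)
qed

lemma bary_z'_nonzero: "bary S z z' \<noteq> 0"
  using bary_scale[of z] S.bary_vertex[OF z z] by auto

definition flip :: "'a \<Rightarrow> 'a" where "flip x = x + bary S z x *\<^sub>R (z' - z)"

lemma bary_flip:
  shows "bary S' z' (flip x) = bary S z x" "t \<in> S - {z} \<Longrightarrow> bary S' t (flip x) = bary S t x"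
proof -
  let ?u = "\<lambda>v. if v = z' then bary S z x else bary S v x"
  have n: "v \<noteq> z'" if "v \<in> S - {z}" for v using that common by auto
  have "sum ?u S' = bary S z x + sum ?u (S - {z})"
    using z' by (simp add: sum.remove common)
  also have "sum ?u (S - {z}) = (\<Sum>v\<in>S-{z}. bary S v x)" using n by (intro sum.cong) auto
  finally have 1: "sum ?u S' = 1" using S.bary_sum[of x] z by (simp add: sum.remove)
  have "(\<Sum>v\<in>S'. ?u v *\<^sub>R v) = bary S z x *\<^sub>R z' + (\<Sum>v\<in>S-{z}. ?u v *\<^sub>R v)"
    using z' by (simp add: sum.remove common)
  also have "(\<Sum>v\<in>S-{z}. ?u v *\<^sub>R v) = (\<Sum>v\<in>S-{z}. bary S v x *\<^sub>R v)" using n by (intro sum.cong) auto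
  also have "bary S z x *\<^sub>R z' + \<dots> = flip x"
    using S.bary_comb[of x] z by (simp add: sum.remove flip_def algebra_simps)
  finally have 2: "(\<Sum>v\<in>S'. ?u v *\<^sub>R v) = flip x" .
  show "bary S' z' (flip x) = bary S z x" using S'.bary_unique[OF 1 2 z'] by simp
  show "bary S' t (flip x) = bary S t x" if "t \<in> S - {z}"
    using S'.bary_unique[OF 1 2, of t] n[OF that] that common by auto
qed

lemma bary_grad_scale: "bary_grad S z = bary S z z' *\<^sub>R bary_grad S' z'"
proof -
  have "bary S z b - bary S z 0 = bary S z z' * (bary S' z' b - bary S' z' 0)" for b
    using bary_scale[of b] bary_scale[of 0] by (simp add: algebra_simps)
  then show ?thesis unfolding bary_grad_def by (simp add: scaleR_sum_right)
qed

end

section \<open>Stars in a simplicial mesh\<close>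

context full_simplex begin

lemma facet_of_hull_iff: "F facet_of convex hull S \<longleftrightarrow> (\<exists>z\<in>S. F = convex hull (S - {z}))"
  unfolding facet_of_convex_hull_affine_independent_alt[OF indep] using card_ge_2 by auto

lemma subset_if_hull_subset: assumes "c \<subseteq> S" "c' \<subseteq> S" "convex hull c \<subseteq> convex hull c'" shows "c \<subseteq> c'"
proof
  fix v assume v: "v \<in> c"
  then have "v \<in> convex hull c'" by (meson assms(3) hull_inc subsetD)
  then have "\<forall>z\<in>S - c'. bary S z v = 0" using face_iff[OF assms(2), of v] by blast
  moreover have "bary S v v = 1" using bary_vertex[of v v] v assms(1) by auto
  ultimately have "v \<notin> S - c'" by (metis zero_neq_one)
  then show "v \<in> c'" using v assms(1) by auto
qed

lemma opposite_vertex_unique: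
  assumes "z \<in> S" "w \<in> S" "convex hull (S - {z}) = convex hull (S - {w})" shows "z = w"
proof -
  have "S - {z} \<subseteq> S - {w}" by (rule subset_if_hull_subset[OF Diff_subset Diff_subset equalityD1[OF assms(3)]])
  then show ?thesis using assms(1,2) by auto
qed

lemma bary_center:
  assumes "T \<subseteq> S" "T \<noteq> {}" "z \<in> S"
  shows "bary S z (\<Sum>v\<in>T. (1 / real (card T)) *\<^sub>R v) = (if z \<in> T then 1 / real (card T) else 0)"
proof -
  have "finite T" using finite_subset[OF assms(1) finite_S] .
  then have T: "finite T" "card T \<noteq> 0" using assms(2) by (simp_all add: card_eq_0_iff)
  have "bary S z (\<Sum>v\<in>T. (1 / real (card T)) *\<^sub>R v) = (\<Sum>v\<in>T. 1 / real (card T) * bary S z v)"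
    using T assms by (intro bary_affine_comb) auto
  also have "\<dots> = (\<Sum>v\<in>T. if v = z then 1 / real (card T) else 0)"
    using assms by (intro sum.cong) (auto simp: bary_vertex)
  also have "\<dots> = (if z \<in> T then 1 / real (card T) else 0)" using T by simp
  finally show ?thesis .
qed

lemma aff_dim_face: "c \<subseteq> S \<Longrightarrow> aff_dim (convex hull c) = int (card c) - 1"
  using affine_independent_subset[OF indep, of c] aff_dim_affine_independent[of c]
  by (simp add: aff_dim_convex_hull)

end

context facet_pair begin

lemma finite_common: "finite (S - {z})" "S - {z} \<noteq> {}" "card (S - {z}) = DIM('a)"
proof -
  show c: "card (S - {z}) = DIM('a)" using S.card_S z by (simp add: card_Diff_singleton)
  show "S - {z} \<noteq> {}" using c DIM_positive[where 'a='a] by (metis card.empty less_irrefl)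
qed simp

lemma center_bary:
  assumes "v \<in> S - {z}"
  shows "bary S v (\<Sum>v\<in>S-{z}. (1 / real (card (S-{z}))) *\<^sub>R v) = 1 / real DIM('a)"
    "bary S' v (\<Sum>v\<in>S-{z}. (1 / real (card (S-{z}))) *\<^sub>R v) = 1 / real DIM('a)"
proof -
  have "v \<in> S' - {z'}" "S - {z} \<subseteq> S'" using assms common by auto
  then show "bary S v (\<Sum>v\<in>S-{z}. (1 / real (card (S-{z}))) *\<^sub>R v) = 1 / real DIM('a)"
    "bary S' v (\<Sum>v\<in>S-{z}. (1 / real (card (S-{z}))) *\<^sub>R v) = 1 / real DIM('a)"
    using S.bary_center[OF Diff_subset finite_common(2), of v]
      S'.bary_center[OF _ finite_common(2), of v] finite_common(3) assms by auto
qed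

text \<open>A short step from the barycentre of the common facet towards \<open>z\<close> enters
  both interiors: the coordinates of the common vertices stay positive by continuity, and the two
  remaining coordinates have equal sign by \<open>bary_scale\<close>.\<close>

lemma positive_side_imp_interior_meet:
  assumes "bary S z z' > 0"
  shows "interior (convex hull S) \<inter> interior (convex hull S') \<noteq> {}"
proof -
  let ?S0 = "S - {z}"
  define p where "p = (\<Sum>v\<in>?S0. (1 / real (card ?S0)) *\<^sub>R v)"
  define q where "q t = (1 - t) *\<^sub>R p + t *\<^sub>R z" for t :: real
  have c: "1 / real DIM('a) > 0" by simp
  have p: "bary S v p = 1 / real DIM('a)" "bary S' v p = 1 / real DIM('a)" if "v \<in> ?S0" for v
    using center_bary[OF that] unfolding p_def by auto
  have pz: "bary S z p = 0" using S.bary_center[of ?S0 z] finite_common z unfolding p_def by auto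
  have "\<forall>v\<in>?S0. \<forall>\<^sub>F t in at_right 0. bary S' v (q t) > 0"
  proof
    fix v assume v: "v \<in> ?S0"
    have "((\<lambda>t. (1 - t) * bary S' v p + t * bary S' v z) \<longlongrightarrow> (1 - 0) * bary S' v p + 0 * bary S' v z) (at_right (0::real))"
      by (intro tendsto_intros)
    then show "\<forall>\<^sub>F t in at_right 0. bary S' v (q t) > 0"
      using order_tendstoD(1)[of _ "bary S' v p" "at_right 0" 0] p(2)[OF v] c v common
      unfolding q_def by (subst S'.bary_segment) auto
  qed
  then have "\<forall>\<^sub>F t in at_right 0. \<forall>v\<in>?S0. bary S' v (q t) > 0"
    using finite_common by (simp add: eventually_ball_finite)
  moreover have "\<forall>\<^sub>F t in at_right 0. t \<in> {0<..<(1::real)}" by (rule eventually_at_right_real) simp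
  ultimately have "\<forall>\<^sub>F t in at_right (0::real). (\<forall>v\<in>?S0. bary S' v (q t) > 0) \<and> t \<in> {0<..<1}"
    by (rule eventually_conj)
  then obtain t :: real where t: "\<forall>v\<in>?S0. bary S' v (q t) > 0" "0 < t" "t < 1"
    using eventually_happens[of _ "at_right (0::real)"] by force
  have qz: "bary S z (q t) = t" unfolding q_def using S.bary_segment[OF z] pz S.bary_vertex[OF z z] by simp
  have "bary S v (q t) > 0" if "v \<in> S" for v
  proof (cases "v = z")
    case False
    then show ?thesis using that p(1)[of v] c t z unfolding q_def
      by (subst S.bary_segment) (auto simp: S.bary_vertex)
  qed (use qz t in simp)
  moreover have "bary S' v (q t) > 0" if "v \<in> S'" for v
  proof (cases "v = z'")
    case True
    have "bary S z z' * bary S' z' (q t) > 0" using bary_scale[of "q t"] qz t by simp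
    then show ?thesis using assms True by (simp add: zero_less_mult_iff)
  qed (use t that common in auto)
  ultimately show ?thesis using S.interior_iff S'.interior_iff by blast
qed

text \<open>Near the barycentre of the facet all coordinates of the common vertices are positive in
  both simplices. Membership then depends only on the sign of \<open>bary S z\<close>, and the
  negative ratio makes the two simplices accept complementary signs.\<close>

lemma opposite_sides_center_interior:
  assumes "bary S z z' < 0"
  shows "(\<Sum>v\<in>S-{z}. (1 / real (card (S-{z}))) *\<^sub>R v) \<in> interior (convex hull S \<union> convex hull S')"
proof -
  let ?S0 = "S - {z}"
  define p where "p = (\<Sum>v\<in>?S0. (1 / real (card ?S0)) *\<^sub>R v)"
  define U where "U = (\<Inter>v\<in>?S0. {y. 0 < bary S v y} \<inter> {y. 0 < bary S' v y})"
  have "open U" unfolding U_def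
    using finite_common common
    by (intro open_INT ballI open_Int open_Collect_less S.continuous_on_bary S'.continuous_on_bary continuous_on_const) auto
  moreover have "p \<in> U" unfolding U_def p_def using center_bary by simp
  moreover have "U \<subseteq> convex hull S \<union> convex hull S'"
  proof
    fix y assume y: "y \<in> U"
    show "y \<in> convex hull S \<union> convex hull S'"
    proof (cases "0 \<le> bary S z y")
      case True
      then have "0 \<le> bary S v y" if "v \<in> S" for v
        using y that by (cases "v = z") (auto simp: U_def intro: less_imp_le)
      then show ?thesis by (simp add: S.hull_iff)
    next
      case False
      then have "bary S z z' * bary S' z' y < 0" using bary_scale[of y] by simp
      then have "0 < bary S' z' y" using assms by (simp add: mult_less_0_iff)
      then have "0 \<le> bary S' v y" if "v \<in> S'" for v
        using y that common by (cases "v = z'") (auto simp: U_def intro: less_imp_le)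
      then show ?thesis by (simp add: S'.hull_iff)
    qed
  qed
  ultimately show ?thesis unfolding p_def by (meson interiorI)
qed

end

section \<open>Facets, boundary faces and stars of a conforming mesh\<close>

definition verts :: "'a::euclidean_space set \<Rightarrow> 'a set" where
  "verts K = {x. x extreme_point_of K}"

locale mesh =
  fixes \<Omega> :: "'a::euclidean_space set" and \<T> :: "'a set set"
  assumes dom: "convex_polytopal_domain \<Omega>" and conf: "conforming_mesh \<Omega> \<T>" and dim2: "2 \<le> DIM('a)"
begin

lemma finite_mesh [simp, intro]: "finite \<T>" and Union_mesh: "\<Union>\<T> = closure \<Omega>"
  and inter_face: "\<And>K K'. K \<in> \<T> \<Longrightarrow> K' \<in> \<T> \<Longrightarrow> K \<inter> K' face_of K"
  using conf unfolding conforming_mesh_def triangulation_def by auto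

lemma open_dom: "open \<Omega>" and convex_dom: "convex \<Omega>"
  and polytope_dom: "polytope (closure \<Omega>)"
  using dom unfolding convex_polytopal_domain_def by auto

lemma interior_closure_dom: "interior (closure \<Omega>) = \<Omega>"
  using convex_interior_closure[OF convex_dom] interior_open[OF open_dom] by simp

lemma verts_hull: assumes "\<not> affine_dependent C" shows "verts (convex hull C) = C"
  using extreme_point_of_convex_hull_affine_independent[OF assms] by (auto simp: verts_def)

lemma elem: assumes "K \<in> \<T>" shows "full_simplex (verts K)" "convex hull (verts K) = K"
proof -
  have "int DIM('a) simplex K" using assms conf unfolding conforming_mesh_def by auto
  then obtain C where C: "\<not> affine_dependent C" "int (card C) = int DIM('a) + 1" "K = convex hull C"
    unfolding simplex_def by auto
  then have "verts K = C" using verts_hull by simp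
  then show "full_simplex (verts K)" "convex hull (verts K) = K" using C by (auto simp: full_simplex_def)
qed

lemma elem_subset: "K \<in> \<T> \<Longrightarrow> K \<subseteq> closure \<Omega>" using Union_mesh by auto

lemma elem_compact: assumes "K \<in> \<T>" shows "compact K" "convex K" "closed K" "bounded K"
proof -
  interpret full_simplex "verts K" using elem assms by auto
  show "compact K" using compact_hull elem(2)[OF assms] by simp
  then show "closed K" "bounded K" by (auto simp: compact_imp_closed compact_imp_bounded)
  show "convex K" by (metis elem(2)[OF assms] convex_convex_hull)
qed

lemma elem_interior: assumes "K \<in> \<T>" shows "interior K \<noteq> {}" "closure (interior K) = K" "interior K \<subseteq> \<Omega>"
proof -
  interpret full_simplex "verts K" using elem assms by auto
  show "interior K \<noteq> {}" "closure (interior K) = K"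
    using interior_nonempty closure_interior_hull elem(2)[OF assms] by auto
  show "interior K \<subseteq> \<Omega>" using interior_mono[OF elem_subset[OF assms]] interior_closure_dom by simp
qed

text \<open>An element that is a proper face of another one misses the interior of the latter,
  whereas its own nonempty interior would lie there.\<close>

lemma inter_proper: assumes "K \<in> \<T>" "K' \<in> \<T>" "K \<noteq> K'" shows "K \<inter> K' \<noteq> K"
proof
  assume "K \<inter> K' = K"
  then have "K face_of K'" using inter_face[OF assms(2,1)] by (simp add: Int_commute)
  then have "K \<inter> interior K' = {}" using face_of_disjoint_interior assms(3) by blast
  moreover have "interior K \<subseteq> K \<inter> interior K'" using \<open>K \<inter> K' = K\<close> interior_mono[of K K'] interior_subset by blast
  ultimately show False using elem_interior(1)[OF assms(1)] by auto
qed

lemma inter_interior: assumes "K \<in> \<T>" "K' \<in> \<T>" "K \<noteq> K'" shows "K' \<inter> interior K = {}"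
  using face_of_disjoint_interior[OF inter_face[OF assms(1,2)] inter_proper[OF assms]] interior_subset by blast

text \<open>A face of a simplex is spanned by some of its vertices. These are the extreme points of
  the face, so both elements supply the same set.\<close>

lemma inter_hull: assumes "K \<in> \<T>" "K' \<in> \<T>"
  obtains c where "c \<subseteq> verts K" "c \<subseteq> verts K'" "K \<inter> K' = convex hull c"
proof -
  interpret S: full_simplex "verts K" using elem assms by auto
  interpret S': full_simplex "verts K'" using elem assms by auto
  obtain c where c: "c \<subseteq> verts K" "K \<inter> K' = convex hull c"
    using inter_face[OF assms] elem(2)[OF assms(1)] face_of_convex_hull_affine_independent[OF S.indep] by metis
  obtain c' where c': "c' \<subseteq> verts K'" "K' \<inter> K = convex hull c'"
    using inter_face[OF assms(2,1)] elem(2)[OF assms(2)] face_of_convex_hull_affine_independent[OF S'.indep] by metis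
  have "c = verts (K \<inter> K')" unfolding c(2)
    by (rule verts_hull[OF affine_independent_subset[OF S.indep c(1)], symmetric])
  also have "\<dots> = verts (convex hull c')" using c'(2) by (simp add: Int_commute)
  also have "\<dots> = c'" by (rule verts_hull[OF affine_independent_subset[OF S'.indep c'(1)]])
  finally show thesis using that c c' by auto
qed

text \<open>The extreme points of \<open>F\<close> are all but one vertex on either side. A larger
  intersection would have to contain every vertex of \<open>K\<close>. The ratio
  \<open>bary (verts K) z z'\<close> is nonzero, and it is not positive because the interiors of
  distinct elements are disjoint.\<close>

lemma facet_shared:
  assumes K: "K \<in> \<T>" "K' \<in> \<T>" "K \<noteq> K'" and F: "F facet_of K" "F facet_of K'"
  obtains z z' where "facet_pair (verts K) (verts K') z z'" "F = convex hull (verts K - {z})"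
    "K \<inter> K' = F" "bary (verts K) z z' < 0"
proof -
  interpret S: full_simplex "verts K" using elem K by auto
  interpret S': full_simplex "verts K'" using elem K by auto
  obtain z where z: "z \<in> verts K" "F = convex hull (verts K - {z})"
    using F(1) S.facet_of_hull_iff elem(2) K by metis
  obtain z' where z': "z' \<in> verts K'" "F = convex hull (verts K' - {z'})"
    using F(2) S'.facet_of_hull_iff elem(2) K by metis
  have eq: "verts K - {z} = verts K' - {z'}"
  proof -
    have "verts K - {z} = verts F"
      using verts_hull affine_independent_subset[OF S.indep] z by (metis Diff_subset)
    also have "\<dots> = verts K' - {z'}"
      using verts_hull affine_independent_subset[OF S'.indep] z' by (metis Diff_subset)
    finally show ?thesis .
  qed
  interpret facet_pair "verts K" "verts K'" z z' by unfold_locales (use z z' eq in auto)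
  obtain c where c: "c \<subseteq> verts K" "c \<subseteq> verts K'" "K \<inter> K' = convex hull c" using inter_hull K by metis
  have "F \<subseteq> convex hull c" using F facet_of_imp_subset c(3) by blast
  then have "verts K - {z} \<subseteq> c" using S.subset_if_hull_subset[OF Diff_subset c(1)] \<open>F = convex hull (verts K - {z})\<close> by blast
  moreover have "c \<noteq> verts K" using inter_proper[OF K] c elem K by auto
  ultimately have "c = verts K - {z}" using c(1) by auto
  then have FF: "K \<inter> K' = F" using c \<open>F = convex hull (verts K - {z})\<close> by simp
  have "\<not> bary (verts K) z z' > 0"
  proof
    assume "0 < bary (verts K) z z'"
    from positive_side_imp_interior_meet[OF this] have "interior K \<inter> interior K' \<noteq> {}"
      using elem(2) K by simp
    then show False using inter_interior[OF K] interior_subset[of K'] by auto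
  qed
  then have "bary (verts K) z z' < 0" using bary_z'_nonzero by linarith
  then show thesis by (rule that[OF facet_pair_axioms \<open>F = convex hull (verts K - {z})\<close> FF])
qed

text \<open>Three opposite vertices would lie pairwise on different sides of one hyperplane. In
  terms of height ratios, the third ratio is a product of two negative ones and yet negative
  itself.\<close>

lemma facet_shared_by_two:
  assumes K: "K1 \<in> \<T>" "K2 \<in> \<T>" "K3 \<in> \<T>" and F: "F facet_of K1" "F facet_of K2" "F facet_of K3"
  shows "K1 = K2 \<or> K1 = K3 \<or> K2 = K3"
proof (rule ccontr)
  assume n: "\<not> ?thesis"
  interpret S1: full_simplex "verts K1" using elem K by auto
  interpret S2: full_simplex "verts K2" using elem K by auto
  interpret S3: full_simplex "verts K3" using elem K by auto
  obtain z1 z2 where 12: "facet_pair (verts K1) (verts K2) z1 z2" "F = convex hull (verts K1 - {z1})"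
    "bary (verts K1) z1 z2 < 0" using facet_shared[of K1 K2 F] n K F by metis
  obtain w1 z3 where 13: "facet_pair (verts K1) (verts K3) w1 z3" "F = convex hull (verts K1 - {w1})"
    "bary (verts K1) w1 z3 < 0" using facet_shared[of K1 K3 F] n K F by metis
  obtain w2 w3 where 23: "facet_pair (verts K2) (verts K3) w2 w3" "F = convex hull (verts K2 - {w2})"
    "bary (verts K2) w2 w3 < 0" using facet_shared[of K2 K3 F] n K F by metis
  interpret A: facet_pair "verts K1" "verts K2" z1 z2 by fact
  interpret B: facet_pair "verts K1" "verts K3" w1 z3 by fact
  interpret C: facet_pair "verts K2" "verts K3" w2 w3 by fact
  have w1: "w1 = z1" using S1.opposite_vertex_unique[OF B.z A.z] 12(2) 13(2) by simp
  have w2: "w2 = z2" using S2.opposite_vertex_unique[OF C.z A.z'] 12(2) 23(2) A.common by simp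
  have w3: "w3 = z3"
    using S3.opposite_vertex_unique[OF C.z' B.z'] 13(2) 23(2) B.common C.common by simp
  have "bary (verts K1) z1 z3 = bary (verts K1) z1 z2 * bary (verts K2) z2 z3"
    by (rule A.bary_scale)
  moreover have "0 < bary (verts K1) z1 z2 * bary (verts K2) z2 z3"
    using 12(3) 23(3) w2 w3 by (intro mult_neg_neg) auto
  ultimately show False using 13(3) w1 by simp
qed

lemma facet_center_in:
  assumes "K \<in> \<T>" "F = convex hull (verts K - {z})" "z \<in> verts K"
  shows "(\<Sum>v\<in>verts K - {z}. (1 / real (card (verts K - {z}))) *\<^sub>R v) \<in> F"
proof -
  interpret full_simplex "verts K" using elem assms by auto
  have "card (verts K - {z}) = DIM('a)" using card_S assms(3) by (simp add: card_Diff_singleton)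
  moreover from this have "verts K - {z} \<noteq> {}" using DIM_positive[where 'a='a] by (metis card.empty less_irrefl)
  ultimately show ?thesis unfolding assms(2) face_iff[OF Diff_subset]
    using bary_center[of "verts K - {z}"] by auto
qed

text \<open>The barycentre of the shared facet is interior to the union of the two elements, hence
  to the closure of the domain, and a convex open set is the interior of its closure.\<close>

lemma shared_not_boundary:
  assumes K: "K \<in> \<T>" "K' \<in> \<T>" "K \<noteq> K'" and F: "F facet_of K" "F facet_of K'"
  shows "\<not> F \<subseteq> frontier \<Omega>"
proof -
  obtain z z' where fp: "facet_pair (verts K) (verts K') z z'" "F = convex hull (verts K - {z})"
    "bary (verts K) z z' < 0" using facet_shared[OF K F] by metis
  interpret facet_pair "verts K" "verts K'" z z' by fact
  let ?p = "\<Sum>v\<in>verts K - {z}. (1 / real (card (verts K - {z}))) *\<^sub>R v"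
  have "?p \<in> interior (K \<union> K')" using opposite_sides_center_interior[OF fp(3)] elem K by simp
  moreover have "interior (K \<union> K') \<subseteq> interior (closure \<Omega>)"
    using elem_subset K by (intro interior_mono) auto
  ultimately have "?p \<in> \<Omega>" using interior_closure_dom by auto
  moreover have "?p \<in> F" by (rule facet_center_in[OF K(1) fp(2) z])
  ultimately show ?thesis using open_dom by (auto simp: frontier_def interior_open)
qed

text \<open>If some point of \<open>F\<close> lay in the open domain, so would a nearby point
  \<open>q\<close> of \<open>F\<close> with positive coordinates at all vertices of
  \<open>F\<close>. Points just beyond \<open>q\<close> leave \<open>K\<close> and belong to other
  elements; these are finitely many closed sets, so one of them contains \<open>q\<close>. Its
  common face with \<open>K\<close> contains \<open>q\<close>, hence all vertices of
  \<open>F\<close>, and \<open>F\<close> is shared after all.\<close>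

lemma unshared_boundary:
  assumes K: "K \<in> \<T>" and F: "F facet_of K" and un: "\<And>K'. K' \<in> \<T> \<Longrightarrow> F facet_of K' \<Longrightarrow> K' = K"
  shows "F \<subseteq> frontier \<Omega>"
proof
  interpret full_simplex "verts K" using elem K by auto
  obtain z where z: "z \<in> verts K" "F = convex hull (verts K - {z})"
    using F facet_of_hull_iff elem(2) K by metis
  let ?S0 = "verts K - {z}"
  have c0: "card ?S0 = DIM('a)" using card_S z by (simp add: card_Diff_singleton)
  have "?S0 \<noteq> {}" using c0 DIM_positive[where 'a='a] by (metis card.empty less_irrefl)
  note S0 = c0 this
  define p where "p = (\<Sum>v\<in>?S0. (1 / real (card ?S0)) *\<^sub>R v)"
  fix x assume x: "x \<in> F"
  show "x \<in> frontier \<Omega>"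
  proof (rule ccontr)
    assume "x \<notin> frontier \<Omega>"
    moreover have "x \<in> closure \<Omega>" using x F K elem_subset facet_of_imp_subset by blast
    ultimately have xO: "x \<in> \<Omega>" using open_dom by (auto simp: frontier_def interior_open)
    have "((\<lambda>s. (1 - s) *\<^sub>R x + s *\<^sub>R p) \<longlongrightarrow> (1 - 0) *\<^sub>R x + 0 *\<^sub>R p) (at_right (0::real))"
      by (intro tendsto_intros)
    then have "((\<lambda>s. (1 - s) *\<^sub>R x + s *\<^sub>R p) \<longlongrightarrow> x) (at_right (0::real))" by simp
    from topological_tendstoD[OF this open_dom xO]
    have "\<forall>\<^sub>F s in at_right 0. (1 - s) *\<^sub>R x + s *\<^sub>R p \<in> \<Omega>" .
    moreover have "\<forall>\<^sub>F t in at_right 0. t \<in> {0<..<(1::real)}" by (rule eventually_at_right_real) simp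
    ultimately have "\<forall>\<^sub>F s in at_right (0::real). (1 - s) *\<^sub>R x + s *\<^sub>R p \<in> \<Omega> \<and> s \<in> {0<..<1}"
      by (rule eventually_conj)
    then obtain s :: real where s: "(1 - s) *\<^sub>R x + s *\<^sub>R p \<in> \<Omega>" "0 < s" "s < 1"
      using eventually_happens[of _ "at_right (0::real)"] by force
    define q where "q = (1 - s) *\<^sub>R x + s *\<^sub>R p"
    have qO: "q \<in> \<Omega>" using s q_def by simp
    have qb: "bary (verts K) v q > 0" if "v \<in> ?S0" for v
    proof -
      have "0 \<le> bary (verts K) v x" using x that z face_iff[of ?S0] by auto
      then show ?thesis using that s bary_center[of ?S0 v] S0 DIM_positive[where 'a='a] unfolding q_def p_def
        by (subst bary_segment) (auto intro!: add_nonneg_pos)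
    qed
    have qz: "bary (verts K) z q = 0"
      using x z S0 face_iff[of ?S0 x] bary_center[of ?S0 z] unfolding q_def p_def by (subst bary_segment) auto
    \<comment> \<open>A negative parameter: these points continue the line from \<open>z\<close>
      through \<open>q\<close> beyond the facet.\<close>
    define y where "y n = (1 - (- 1 / real (Suc n))) *\<^sub>R q + (- 1 / real (Suc n)) *\<^sub>R z" for n
    have lim0: "(\<lambda>n. - 1 / real (Suc n)) \<longlonglongrightarrow> 0" using LIMSEQ_inverse_real_of_nat_add_minus[of 0]
      by (simp add: inverse_eq_divide)
    then have "y \<longlonglongrightarrow> (1 - 0) *\<^sub>R q + 0 *\<^sub>R z" unfolding y_def by (intro tendsto_intros)
    then have ylim: "y \<longlonglongrightarrow> q" by simp
    have "\<forall>\<^sub>F n in sequentially. y n \<in> \<Omega>" using topological_tendstoD[OF ylim open_dom qO] .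
    then have "\<forall>\<^sub>F n in sequentially. y n \<in> \<Union>(\<T> - {K})"
    proof eventually_elim
      case (elim n)
      have "bary (verts K) z (y n) < 0"
        unfolding y_def bary_segment[OF z(1)] qz using bary_vertex[OF z(1) z(1)] by (simp del: of_nat_Suc)
      then have "y n \<notin> K" using hull_iff[of "y n"] z(1) elem(2)[OF K] by force
      then show ?case using elim Union_mesh closure_subset[of \<Omega>] by blast
    qed
    moreover have "closed (\<Union>(\<T> - {K}))" using elem_compact by (intro closed_Union) auto
    ultimately have "q \<in> \<Union>(\<T> - {K})"
      using Lim_in_closed_set[OF _ _ _ ylim] by (meson trivial_limit_sequentially)
    then obtain K2 where K2: "K2 \<in> \<T>" "K2 \<noteq> K" "q \<in> K2" by auto
    obtain c where c: "c \<subseteq> verts K" "c \<subseteq> verts K2" "K \<inter> K2 = convex hull c" using inter_hull K K2 by metis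
    have "0 \<le> bary (verts K) v q" if "v \<in> verts K" for v
      using qb[of v] qz that by (cases "v = z") (auto intro: less_imp_le)
    then have "q \<in> K" using hull_iff[of q] elem(2)[OF K] by simp
    then have "q \<in> convex hull c" using K2 c by auto
    then have "?S0 \<subseteq> c" using qb face_iff[OF c(1), of q] by force
    moreover have "c \<noteq> verts K" using inter_proper[OF K K2(1)] K2 c elem K by auto
    ultimately have "c = ?S0" using c(1) by auto
    then have "F face_of K2" using c(3) z inter_face[OF K2(1) K] by (simp add: Int_commute)
    moreover have "aff_dim K2 = DIM('a)" "aff_dim K = DIM('a)"
      using elem_interior(1) K K2 aff_dim_nonempty_interior by blast+
    ultimately have "F facet_of K2" using F unfolding facet_of_def by auto
    then show False using un K2 by auto
  qed
qed

definition star :: "'a \<Rightarrow> 'a set set" where "star x = {K \<in> \<T>. x \<in> K}"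

definition star_adj :: "'a \<Rightarrow> ('a set \<times> 'a set) set" where
  "star_adj x = {(K, K'). K \<in> star x \<and> K' \<in> star x \<and> K \<noteq> K' \<and> (\<exists>F. F facet_of K \<and> F facet_of K' \<and> x \<in> F)}"

text \<open>A generic segment near \<open>x\<close> between the interiors of two elements misses all intersections of
  codimension two, so it can only pass from element to element through facets, and these contain \<open>x\<close>.\<close>

lemma star_connected:
  assumes K: "K \<in> star x" "K' \<in> star x" shows "(K, K') \<in> (star_adj x)\<^sup>*"
proof (rule ccontr)
  assume nr: "(K, K') \<notin> (star_adj x)\<^sup>*"
  have KT: "K \<in> \<T>" "K' \<in> \<T>" "x \<in> K" "x \<in> K'" using K by (auto simp: star_def)
  have "closed (\<Union>(\<T> - star x))" using elem_compact by (intro closed_Union) auto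
  then have "open (- \<Union>(\<T> - star x))" by (simp add: open_Compl)
  moreover have "x \<in> - \<Union>(\<T> - star x)" by (auto simp: star_def)
  ultimately obtain r where r: "r > 0" "ball x r \<subseteq> - \<Union>(\<T> - star x)" unfolding open_contains_ball by blast
  have meet: "interior L \<inter> ball x r \<noteq> {}" if "L \<in> \<T>" "x \<in> L" for L
  proof -
    have "x \<in> closure (interior L)" using elem_interior(2) that by simp
    then obtain y where "y \<in> interior L" "dist y x < r" using r(1) unfolding closure_approachable by blast
    then show ?thesis by (auto simp: dist_commute)
  qed
  obtain y where y: "y \<in> interior K" "y \<in> ball x r" using meet KT by blast
  define V where "V = interior K' \<inter> ball x r"
  have V: "open V" "V \<noteq> {}" unfolding V_def using meet KT by auto
  define P where "P = {(K1, K2). K1 \<in> \<T> \<and> K2 \<in> \<T> \<and> K1 \<noteq> K2 \<and> aff_dim (K1 \<inter> K2) \<le> int DIM('a) - 2}"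
  \<comment> \<open>Adding the point \<open>y\<close> raises the dimension to at most
    \<open>d - 1\<close>, so \<open>B\<close> is negligible and the endpoint \<open>y'\<close> can
    be chosen off it. A point of the segment other than \<open>y\<close> in a bad intersection would
    place \<open>y'\<close> in the corresponding affine hull; the point \<open>y\<close> itself is
    interior to \<open>K\<close>.\<close>
  define B where "B = (\<Union>(K1,K2)\<in>P. affine hull (insert y (K1 \<inter> K2)))"
  have "finite P" by (rule finite_subset[of _ "\<T> \<times> \<T>"]) (auto simp: P_def)
  then have "negligible B" unfolding B_def
  proof (intro negligible_Union
 finite_imageI ballI; clarsimp)
    fix K1 K2 assume "(K1, K2) \<in> P"
    then have "aff_dim (insert y (K1 \<inter> K2)) \<le> int DIM('a) - 1" unfolding P_def by (auto simp: aff_dim_insert)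
    then have "interior (affine hull (insert y (K1 \<inter> K2))) = {}" by (intro low_dim_interior) simp
    then show "negligible (affine hull (insert y (K1 \<inter> K2)))"
      by (simp add: negligible_convex_interior affine_imp_convex)
  qed
  moreover have "\<not> negligible V" using V open_not_negligible by blast
  ultimately obtain y' where y': "y' \<in> V" "y' \<notin> B" using negligible_subset by blast
  have avoid: "p \<notin> closed_segment y y'" if "(K1, K2) \<in> P" "p \<in> K1 \<inter> K2" for p K1 K2
  proof
    assume p: "p \<in> closed_segment y y'"
    show False
    proof (cases "p = y")
      case True
      have "K1 \<noteq> K \<or> K2 \<noteq> K" using that by (auto simp: P_def)
      then show False using inter_interior[OF KT(1)] y True that by (auto simp: P_def)
    next
      case False
      obtain u where u: "p = (1 - u) *\<^sub>R y + u *\<^sub>R y'" using p unfolding in_segment by auto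
      then have "u \<noteq> 0" using False by auto
      then have "y' = (1 - 1/u) *\<^sub>R y + (1/u) *\<^sub>R p"
        unfolding u by (simp add: algebra_simps)
      moreover have "(1 - 1/u) *\<^sub>R y + (1/u) *\<^sub>R p \<in> affine hull (insert y (K1 \<inter> K2))"
        using that(2) by (intro mem_affine[OF affine_affine_hull]) (auto intro: hull_inc)
      ultimately show False using y' that unfolding B_def by auto
    qed
  qed
  define R where "R = {L \<in> star x. (K, L) \<in> (star_adj x)\<^sup>*}"
  have fin: "finite R" "finite (star x - R)" unfolding R_def star_def by auto
  have seg: "closed_segment y y' \<subseteq> \<Union>R \<union> \<Union>(star x - R)"
  proof
    fix p assume p: "p \<in> closed_segment y y'"
    have "y \<in> closure \<Omega>" "y' \<in> closure \<Omega>"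
      using y y' KT elem_subset interior_subset unfolding V_def by blast+
    then have "p \<in> closure \<Omega>" using p convex_closure[OF convex_dom] by (meson closed_segment_subset subsetD)
    moreover have "p \<in> ball x r" using p y y' convex_ball[of x r] unfolding V_def
      by (meson IntD2 closed_segment_subset subsetD)
    ultimately show "p \<in> \<Union>R \<union> \<Union>(star x - R)" using r(2) Union_mesh by blast
  qed
  have "closed (\<Union>R)" "closed (\<Union>(star x - R))"
    using fin elem_compact(3) unfolding R_def star_def by (auto intro!: closed_Union)
  moreover have "y \<in> \<Union>R" using y K interior_subset unfolding R_def by auto
  moreover have "y' \<in> \<Union>(star x - R)" using y' nr K interior_subset unfolding V_def R_def by auto
  \<comment> \<open>Elements reachable from \<open>K\<close> and the other elements of the star form
    two closed sets that cover the connected segment, and each contains an endpoint. So they meet on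
    it, at a point outside all intersections of codimension two.\<close>
  ultimately have "\<Union>R \<inter> \<Union>(star x - R) \<inter> closed_segment y y' \<noteq> {}"
    using connected_closedD[of "closed_segment y y'" "\<Union>R" "\<Union>(star x - R)"] seg by auto
  then obtain p K1 K2 where p: "p \<in> closed_segment y y'" "K1 \<in> R" "p \<in> K1" "K2 \<in> star x - R" "p \<in> K2" by auto
  then have K12: "K1 \<in> \<T>" "K2 \<in> \<T>" "K1 \<noteq> K2" "x \<in> K1" "x \<in> K2" unfolding R_def star_def by auto
  have "(K1, K2) \<notin> P" using avoid p by blast
  then have ad: "aff_dim (K1 \<inter> K2) > int DIM('a) - 2" using K12 unfolding P_def by auto
  interpret S1: full_simplex "verts K1" using elem K12 by auto
  obtain c where c: "c \<subseteq> verts K1" "c \<subseteq> verts K2" "K1 \<inter> K2 = convex hull c" using inter_hull K12 by metis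
  have "c \<noteq> verts K1" using inter_proper[OF K12(1-3)] c elem K12 by auto
  then have "card c < card (verts K1)" using c(1) by (intro psubset_card_mono) auto
  then have "aff_dim (K1 \<inter> K2) = int DIM('a) - 1"
    using ad S1.aff_dim_face[OF c(1)] c(3) S1.card_S by simp
  moreover have "aff_dim K1 = DIM('a)" "aff_dim K2 = DIM('a)"
    using elem_interior(1) K12 aff_dim_nonempty_interior by blast+
  ultimately have "K1 \<inter> K2 facet_of K1" "K1 \<inter> K2 facet_of K2"
    unfolding facet_of_def using inter_face[OF K12(1,2)] inter_face[OF K12(2,1)] K12 by (auto simp: Int_commute)
  then have "(K1, K2) \<in> star_adj x" unfolding star_adj_def using K12 by (auto simp: star_def)
  moreover have "(K, K1) \<in> (star_adj x)\<^sup>*" using p(2) R_def by auto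
  ultimately have "K2 \<in> R" unfolding R_def using p(4) by (auto intro: rtrancl_into_rtrancl)
  then show False using p(4) by simp
qed

lemma finite_star [simp, intro]: "finite (star x)" unfolding star_def by simp

text \<open>A reachable element is reached in at most as many steps as the relation has pairs. The
  bound is crude, but it depends on the size of the star alone.\<close>

lemma star_connected_relpow:
  assumes "K \<in> star x" "K' \<in> star x"
  obtains n where "n \<le> (card (star x))\<^sup>2" "(K, K') \<in> star_adj x ^^ n"
proof -
  have sub: "star_adj x \<subseteq> star x \<times> star x" unfolding star_adj_def by auto
  then have fin: "finite (star_adj x)" by (rule finite_subset) simp
  have "card (star_adj x) \<le> (card (star x))\<^sup>2"
    using card_mono[OF _ sub] by (simp add: card_cartesian_product power2_eq_square)
  moreover obtain n where "n \<le> card (star_adj x)" "(K, K') \<in> star_adj x ^^ n"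
    using star_connected[OF assms] unfolding rtrancl_finite_eq_relpow[OF fin] by blast
  ultimately show thesis using that[of n] by linarith
qed

text \<open>Only half of the supremum is asked for, so that its attainment is not at issue; a ball
  whose diameter exceeds half the inball diameter has radius above a quarter of it.\<close>

lemma elem_ball:
  assumes "K \<in> \<T>" obtains c s where "cball c s \<subseteq> K" "s \<ge> inball_diameter K / 4" "s > 0"
proof -
  interpret full_simplex "verts K" using elem assms by auto
  have pos: "inball_diameter K > 0" using inball_diameter_pos elem(2)[OF assms] by simp
  then have "inball_diameter K / 2 < inball_diameter (convex hull verts K)" using elem(2)[OF assms] by simp
  then obtain c s where cs: "0 \<le> s" "inball_diameter K / 2 < 2 * s" "cball c s \<subseteq> convex hull verts K"
    by (rule inball_exists)

  have "inball_diameter K / 4 \<le> s" "s > 0" using cs(2) pos by linarith+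
  then show thesis using that[of c s] cs(3) elem(2)[OF assms] by simp

qed

lemma shape_regularity_elem: assumes "K \<in> \<T>"
  shows "diameter K \<le> shape_regularity \<T> * inball_diameter K" "0 < inball_diameter K" "0 < diameter K"
    "0 < shape_regularity \<T>"
proof -
  interpret full_simplex "verts K" using elem assms by auto
  show p: "inball_diameter K > 0" "0 < diameter K" using inball_diameter_pos diameter_pos elem(2)[OF assms] by auto
  have m: "diameter K / inball_diameter K \<le> shape_regularity \<T>"
    unfolding shape_regularity_def using assms by (intro Max_ge) auto
  then show "diameter K \<le> shape_regularity \<T> * inball_diameter K" using p by (simp add: field_simps)
  have "0 < diameter K / inball_diameter K" using p by simp
  then show "0 < shape_regularity \<T>" using m by linarith
qed

text \<open>A packing argument. The elements at \<open>x\<close> may differ in size, so each is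
  shrunk towards \<open>x\<close> by the factor \<open>r / diameter K\<close>, where
  \<open>r\<close> is the least diameter in the star. The images of the inscribed balls then have
  radius at least \<open>r / (4 * \<theta>)\<close>, lie in disjoint interiors, and all fit into the
  ball of radius \<open>r\<close> about \<open>x\<close>.\<close>

lemma card_star_le:
  assumes "star x \<noteq> {}" shows "real (card (star x)) \<le> (4 * shape_regularity \<T>) ^ DIM('a)"
proof -
  define \<theta> where "\<theta> = shape_regularity \<T>"
  define r where "r = Min (diameter ` star x)"
  have inT: "K \<in> \<T>" "x \<in> K" if "K \<in> star x" for K using that by (auto simp: star_def)
  have \<theta>: "\<theta> > 0" using assms inT(1) shape_regularity_elem(4) unfolding \<theta>_def by blast
  have "r \<in> diameter ` star x" unfolding r_def using assms by (intro Min_in) auto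
  then have r: "r > 0" using shape_regularity_elem(3) inT by auto
  have rle: "r \<le> diameter K" if "K \<in> star x" for K unfolding r_def using that by simp
  have "\<exists>c. ball c (r / (4 * \<theta>)) \<subseteq> interior K \<inter> cball x r" if K: "K \<in> star x" for K
  proof -
    obtain c s where c: "cball c s \<subseteq> K" "s \<ge> inball_diameter K / 4" "s > 0" using elem_ball inT K by metis
    have dp: "diameter K > 0" using shape_regularity_elem inT K by blast
    define t where "t = r / diameter K"
    have t: "0 < t" "t \<le> 1" using r rle[OF K] dp by (auto simp: t_def)
    have "diameter K \<le> \<theta> * inball_diameter K" using shape_regularity_elem(1) inT K \<theta>_def by blast
    also have "\<dots> \<le> \<theta> * (4 * s)" using c(2) \<theta> by (intro mult_left_mono) auto
    finally have "r / (4 * \<theta>) \<le> t * s"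
      using r dp \<theta> by (simp add: t_def field_simps)
    moreover have "cball (x + t *\<^sub>R (c - x)) (t * s) \<subseteq> K \<inter> cball x r"
    proof
      fix u assume u: "u \<in> cball (x + t *\<^sub>R (c - x)) (t * s)"
      define w where "w = x + (1 / t) *\<^sub>R (u - x)"
      have uw: "u = (1 - t) *\<^sub>R x + t *\<^sub>R w" using t by (simp add: w_def algebra_simps)
      have "w - c = (1 / t) *\<^sub>R (u - (x + t *\<^sub>R (c - x)))" using t by (simp add: w_def algebra_simps)
      then have "norm (w - c) = norm (u - (x + t *\<^sub>R (c - x))) / t" using t by simp
      also have "\<dots> \<le> s" using u t by (simp add: dist_norm norm_minus_commute field_simps)
      finally have w: "w \<in> K" using c(1) by (auto simp: dist_norm norm_minus_commute)
      then have "u \<in> K" unfolding uw using elem_compact(2)[OF inT(1)[OF K]] inT(2)[OF K] t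
        by (intro convexD_alt) auto
      moreover have "dist x u \<le> r"
      proof -
        have "dist x u = t * dist x w" unfolding uw dist_norm using t
          by (simp add: algebra_simps flip: scaleR_diff_right)
        also have "\<dots> \<le> t * diameter K"
          using t w inT K elem_compact(4) by (intro mult_left_mono diameter_bounded_bound) auto
        finally show ?thesis using dp by (simp add: t_def)
      qed
      ultimately show "u \<in> K \<inter> cball x r" by simp
    qed
    ultimately have "ball (x + t *\<^sub>R (c - x)) (r / (4 * \<theta>)) \<subseteq> K \<inter> cball x r"
      using ball_subset_cball subset_ball by (smt (verit, best) subset_trans)
    then have "ball (x + t *\<^sub>R (c - x)) (r / (4 * \<theta>)) \<subseteq> interior K \<inter> cball x r"
      using interior_maximal by (metis Int_subset_iff open_ball)
    then show ?thesis by blast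
  qed
  then obtain c where c: "\<And>K. K \<in> star x \<Longrightarrow> ball (c K) (r / (4 * \<theta>)) \<subseteq> interior K \<inter> cball x r" by metis
  have disj: "disjoint_family_on (\<lambda>K. ball (c K) (r / (4 * \<theta>))) (star x)"
    unfolding disjoint_family_on_def
  proof (intro ballI impI)
    fix K L assume KL: "K \<in> star x" "L \<in> star x" "K \<noteq> L"
    then have "interior K \<inter> interior L = {}" using inter_interior[of K L] inT interior_subset by blast
    then show "ball (c K) (r / (4 * \<theta>)) \<inter> ball (c L) (r / (4 * \<theta>)) = {}" using c KL by blast
  qed
  have "real (card (star x)) * (unit_ball_vol DIM('a) * (r / (4 * \<theta>)) ^ DIM('a)) = (\<Sum>K\<in>star x. measure lborel (ball (c K) (r / (4 * \<theta>))))"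
    using r \<theta> by (simp add: content_ball)
  also have "\<dots> = measure lborel (\<Union>K\<in>star x. ball (c K) (r / (4 * \<theta>)))"
    using disj emeasure_lborel_ball_finite[THEN less_imp_neq]
    by (intro measure_finite_Union[symmetric]) auto

  also have "\<dots> \<le> measure lborel (cball x r)"
    using c by (intro measure_mono_fmeasurable) (auto intro: fmeasurableI[OF _ emeasure_lborel_cball_finite])
  also have "\<dots> = unit_ball_vol DIM('a) * r ^ DIM('a)" using r by (simp add: content_cball)
  finally have "unit_ball_vol DIM('a) * (real (card (star x)) * (r / (4 * \<theta>)) ^ DIM('a)) \<le> unit_ball_vol DIM('a) * r ^ DIM('a)"
    by (simp add: mult.left_commute)
  then have "real (card (star x)) * (r / (4 * \<theta>)) ^ DIM('a) \<le> r ^ DIM('a)"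
    by (rule mult_left_le_imp_le) simp
  then show ?thesis using r \<theta> unfolding \<theta>_def[symmetric]
    by (simp add: power_divide pos_divide_le_eq mult.commute)
qed

end

section \<open>Polynomials and lattice nodes\<close>

text \<open>Affine factors in place of coordinates make the notion invariant under affine changes of variables.\<close>

inductive poly_deg :: "nat \<Rightarrow> ('a::euclidean_space \<Rightarrow> real) \<Rightarrow> bool" where
  const: "poly_deg 0 (\<lambda>x. c)"
| Suc: "poly_deg k f \<Longrightarrow> poly_deg (Suc k) f"
| mult: "poly_deg k f \<Longrightarrow> poly_deg (Suc k) (\<lambda>x. f x * (a \<bullet> x + b))"
| add: "poly_deg k f \<Longrightarrow> poly_deg k g \<Longrightarrow> poly_deg k (\<lambda>x. f x + g x)"

lemma poly_deg_mono: "poly_deg k f \<Longrightarrow> k \<le> l \<Longrightarrow> poly_deg l f"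
  by (induction l) (auto simp: le_Suc_eq intro: poly_deg.Suc)

lemma poly_deg_const: "poly_deg k (\<lambda>x. c)"
  using poly_deg_mono[OF poly_deg.const] by simp

lemma poly_deg_sum:
  assumes "\<And>i. i \<in> I \<Longrightarrow> poly_deg k (f i)" shows "poly_deg k (\<lambda>x. \<Sum>i\<in>I. f i x)"
proof (cases "finite I")
  case True
  then show ?thesis using assms by (induction I) (auto intro: poly_deg_const poly_deg.add)
qed (simp add: poly_deg_const)

lemma poly_deg_cmult: "poly_deg k f \<Longrightarrow> poly_deg k (\<lambda>x. c * f x)"
proof (induction rule: poly_deg.induct)
  case (mult k f a b)
  then show ?case using poly_deg.mult[of k "\<lambda>x. c * f x" a b] by (simp add: mult.assoc)
next
  case (add k f g)
  then show ?case using poly_deg.add[of k "\<lambda>x. c * f x" "\<lambda>x. c * g x"] by (simp add: distrib_left)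
qed (auto intro: poly_deg.intros)

lemma poly_deg_diff: "poly_deg k f \<Longrightarrow> poly_deg k g \<Longrightarrow> poly_deg k (\<lambda>x. f x - g x)"
  using poly_deg.add[of k f "\<lambda>x. (-1) * g x"] poly_deg_cmult[of k g "-1"] by simp

lemma poly_deg_mult_power: "poly_deg k f \<Longrightarrow> poly_deg (k + n) (\<lambda>x. f x * (a \<bullet> x + b) ^ n)"
proof (induction n)
  case (Suc n)
  then show ?case using poly_deg.mult[of "k + n" "\<lambda>x. f x * (a \<bullet> x + b) ^ n" a b] by (simp add: mult_ac)
qed simp

lemma poly_deg_monomial:
  "finite I \<Longrightarrow> poly_deg (sum \<alpha> I) (\<lambda>x::real^'n. \<Prod>i\<in>I. (x $ i) ^ \<alpha> i)"
proof (induction I rule: finite_induct)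
  case (insert i I)
  then show ?case using poly_deg_mult_power[of "sum \<alpha> I" "\<lambda>x. \<Prod>i\<in>I. (x $ i) ^ \<alpha> i" "\<alpha> i" "axis i 1" 0]
    by (simp add: inner_axis' mult.commute add.commute)
qed (simp add: poly_deg.const)

lemma polynomial_of_degree_le_imp_poly_deg:
  fixes f :: "real^'n \<Rightarrow> real"
  assumes "polynomial_of_degree_le k f" shows "poly_deg k f"
proof -
  obtain c where f: "f = (\<lambda>x. \<Sum>\<alpha> | (\<Sum>i\<in>UNIV. \<alpha> i) \<le> k. c \<alpha> * (\<Prod>i\<in>UNIV. (x $ i) ^ \<alpha> i))"
    using assms unfolding polynomial_of_degree_le_def by blast
  show ?thesis unfolding f
    by (intro poly_deg_sum poly_deg_cmult) (auto intro: poly_deg_mono[OF poly_deg_monomial])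
qed

lemma poly_deg_continuous: "poly_deg k f \<Longrightarrow> continuous_on A f"
  by (induction rule: poly_deg.induct) (auto intro!: continuous_intros)

text \<open>Induction along the construction: multiplying by an affine factor with linear part
  \<open>a\<close> adds the symmetrised product of \<open>a\<close> and the gradient to the Hessian.
  Symmetry is what later makes the second-order terms of the null Lagrangian cancel.\<close>

lemma poly_deg_has_symmetric_hessian:
  fixes f :: "real^'n \<Rightarrow> real"
  assumes "poly_deg k f"
  shows "\<exists>g H. (\<forall>x. (f has_derivative (\<lambda>h. g x \<bullet> h)) (at x)) \<and>
    (\<forall>x. (g has_derivative (\<lambda>h. H x *v h)) (at x)) \<and> (\<forall>x. transpose (H x) = H x) \<and> continuous_on UNIV H"
  using assms
proof (induction rule: poly_deg.induct)
  case (const c)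
  then show ?case
    by (intro exI[of _ "\<lambda>_. 0"]) (auto simp: transpose_def vec_eq_iff)
next
  case (mult k f a b)
  then obtain g H where g: "\<And>x. (f has_derivative (\<lambda>h. g x \<bullet> h)) (at x)"
    and H: "\<And>x. (g has_derivative (\<lambda>h. H x *v h)) (at x)" "\<And>x. transpose (H x) = H x" "continuous_on UNIV H"
    by blast
  have cg: "continuous_on UNIV g"
    using H(1) by (meson has_derivative_continuous continuous_at_imp_continuous_on)
  define g' where "g' x = (a \<bullet> x + b) *\<^sub>R g x + f x *\<^sub>R a" for x
  define H' where "H' x = (a \<bullet> x + b) *\<^sub>R H x + (\<chi> i j. g x $ i * a $ j + a $ i * g x $ j)" for x
  have "((\<lambda>x. f x * (a \<bullet> x + b)) has_derivative (\<lambda>h. g' x \<bullet> h)) (at x)" for x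
    unfolding g'_def by (rule derivative_eq_intros g refl)+ (simp add: algebra_simps inner_add_left)
  moreover have "(g' has_derivative (\<lambda>h. H' x *v h)) (at x)" for x
  proof -
    have "(g' has_derivative (\<lambda>h. (a \<bullet> x + b) *\<^sub>R (H x *v h) + (a \<bullet> h) *\<^sub>R g x + (g x \<bullet> h) *\<^sub>R a)) (at x)"
      unfolding g'_def by (rule derivative_eq_intros g H refl)+ (simp add: algebra_simps)
    moreover have "(a \<bullet> x + b) *\<^sub>R (H x *v h) + (a \<bullet> h) *\<^sub>R g x + (g x \<bullet> h) *\<^sub>R a = H' x *v h" for h
      by (simp add: H'_def vec_eq_iff matrix_vector_mult_def inner_vec_def sum.distrib distrib_right distrib_left
          sum_distrib_left sum_distrib_right mult_ac)
    ultimately show ?thesis by simp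
  qed
  moreover have "transpose (H' x) = H' x" for x
  proof -
    have "H x $ j $ i = H x $ i $ j" for i j using H(2)[of x] by (simp add: transpose_def vec_eq_iff)
    then show ?thesis by (simp add: H'_def transpose_def vec_eq_iff mult.commute add.commute)
  qed
  moreover have "continuous_on UNIV H'" unfolding H'_def
    by (intro continuous_intros H(3) cg continuous_on_vec_lambda)
  ultimately show ?case by blast
next
  case (add k f1 f2)
  then obtain g1 H1 g2 H2 where 1: "\<And>x. (f1 has_derivative (\<lambda>h. g1 x \<bullet> h)) (at x)"
     "\<And>x. (g1 has_derivative (\<lambda>h. H1 x *v h)) (at x)" "\<And>x. transpose (H1 x) = H1 x" "continuous_on UNIV H1"
    and 2: "\<And>x. (f2 has_derivative (\<lambda>h. g2 x \<bullet> h)) (at x)"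
     "\<And>x. (g2 has_derivative (\<lambda>h. H2 x *v h)) (at x)" "\<And>x. transpose (H2 x) = H2 x" "continuous_on UNIV H2"
    by blast
  have "((\<lambda>x. f1 x + f2 x) has_derivative (\<lambda>h. (g1 x + g2 x) \<bullet> h)) (at x)" for x
    using has_derivative_add[OF 1(1) 2(1)] by (simp add: inner_add_left)
  moreover have "((\<lambda>x. g1 x + g2 x) has_derivative (\<lambda>h. (H1 x + H2 x) *v h)) (at x)" for x
    using has_derivative_add[OF 1(2) 2(2)] by (simp add: matrix_vector_mult_add_rdistrib)
  moreover have "transpose (H1 x + H2 x) = H1 x + H2 x" for x
    using 1(3)[of x] 2(3)[of x] by (simp add: transpose_def vec_eq_iff)
  moreover have "continuous_on UNIV (\<lambda>x. H1 x + H2 x)" using 1(4) 2(4) by (intro continuous_intros)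
  ultimately show ?case by (intro exI[of _ "\<lambda>x. g1 x + g2 x"] exI[of _ "\<lambda>x. H1 x + H2 x"]) blast
qed

text \<open>Vanishing off \<open>T\<close> makes the set finite and lets an index of a face serve
  unchanged as an index of the whole simplex. The points indexed in this way form the principal
  lattice of order \<open>k\<close>.\<close>

definition node_idx :: "nat \<Rightarrow> 'a set \<Rightarrow> ('a \<Rightarrow> nat) set" where
  "node_idx k T = {\<alpha>. sum \<alpha> T = k \<and> (\<forall>v. v \<notin> T \<longrightarrow> \<alpha> v = 0)}"

definition node :: "nat \<Rightarrow> 'a::real_vector set \<Rightarrow> ('a \<Rightarrow> nat) \<Rightarrow> 'a" where
  "node k T \<alpha> = (\<Sum>v\<in>T. (real (\<alpha> v) / real k) *\<^sub>R v)"

definition bounded_idx :: "nat \<Rightarrow> 'a set \<Rightarrow> ('a \<Rightarrow> nat) set" where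
  "bounded_idx k I = {\<gamma>. sum \<gamma> I \<le> k \<and> (\<forall>v. v \<notin> I \<longrightarrow> \<gamma> v = 0)}"

text \<open>Newton basis: the values at lattice points form a unitriangular matrix, which gives unisolvence.\<close>

definition binom_prod :: "'a set \<Rightarrow> ('a \<Rightarrow> nat) \<Rightarrow> ('a \<Rightarrow> real) \<Rightarrow> real" where
  "binom_prod I \<gamma> s = (\<Prod>v\<in>I. s v gchoose \<gamma> v)"

definition binom_span :: "nat \<Rightarrow> 'a set \<Rightarrow> (('a \<Rightarrow> real) \<Rightarrow> real) \<Rightarrow> bool" where
  "binom_span k I f \<longleftrightarrow> (\<exists>c. \<forall>s. f s = (\<Sum>\<gamma>\<in>bounded_idx k I. c \<gamma> * binom_prod I \<gamma> s))"

lemma finite_bounded_idx: assumes "finite I" shows "finite (bounded_idx k I)"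
proof (rule finite_subset)
  show "bounded_idx k I \<subseteq> {f. \<forall>v. (v \<in> I \<longrightarrow> f v \<in> {0..k}) \<and> (v \<notin> I \<longrightarrow> f v = 0)}"
    using member_le_sum[OF _ _ assms, of _ "_ :: 'a \<Rightarrow> nat"] by (fastforce simp: bounded_idx_def intro: order_trans)
  show "finite {f. \<forall>v. (v \<in> I \<longrightarrow> f v \<in> {0..k}) \<and> (v \<notin> I \<longrightarrow> f v = (0::nat))}"
    using assms by (intro finite_set_of_finite_funs) auto
qed

lemma finite_node_idx: "finite T \<Longrightarrow> finite (node_idx k T)"
  by (rule finite_subset[OF _ finite_bounded_idx[of T k]]) (auto simp: node_idx_def bounded_idx_def)

lemma binom_span_basis:
  assumes "finite I" "\<gamma> \<in> bounded_idx k I" shows "binom_span k I (\<lambda>s. c * binom_prod I \<gamma> s)"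
  unfolding binom_span_def using assms finite_bounded_idx[OF assms(1)]
  by (intro exI[of _ "\<lambda>\<delta>. if \<delta> = \<gamma> then c else 0"]) (auto simp: if_distrib[of "\<lambda>c. c * _"] cong: if_cong)

lemma binom_span_add: "binom_span k I f \<Longrightarrow> binom_span k I g \<Longrightarrow> binom_span k I (\<lambda>s. f s + g s)"
  unfolding binom_span_def
proof (elim exE)
  fix c d assume "\<forall>s. f s = (\<Sum>\<gamma>\<in>bounded_idx k I. c \<gamma> * binom_prod I \<gamma> s)"
    "\<forall>s. g s = (\<Sum>\<gamma>\<in>bounded_idx k I. d \<gamma> * binom_prod I \<gamma> s)"
  then show "\<exists>c. \<forall>s. f s + g s = (\<Sum>\<gamma>\<in>bounded_idx k I. c \<gamma> * binom_prod I \<gamma> s)"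
    by (intro exI[of _ "\<lambda>\<gamma>. c \<gamma> + d \<gamma>"]) (simp add: distrib_right sum.distrib)
qed

lemma binom_span_zero: "binom_span k I (\<lambda>s. 0)"
  unfolding binom_span_def by (intro exI[of _ "\<lambda>_. 0"]) simp

lemma binom_span_sum:
  "finite J \<Longrightarrow> (\<And>j. j \<in> J \<Longrightarrow> binom_span k I (f j)) \<Longrightarrow> binom_span k I (\<lambda>s. \<Sum>j\<in>J. f j s)"
  by (induction J rule: finite_induct) (auto intro: binom_span_zero binom_span_add)

lemma binom_span_cmult: "binom_span k I f \<Longrightarrow> binom_span k I (\<lambda>s. c * f s)"
  unfolding binom_span_def
proof (elim exE)
  fix d assume "\<forall>s. f s = (\<Sum>\<gamma>\<in>bounded_idx k I. d \<gamma> * binom_prod I \<gamma> s)"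
  then show "\<exists>d. \<forall>s. c * f s = (\<Sum>\<gamma>\<in>bounded_idx k I. d \<gamma> * binom_prod I \<gamma> s)"
    by (intro exI[of _ "\<lambda>\<gamma>. c * d \<gamma>"]) (simp add: sum_distrib_left mult.assoc)
qed

lemma binom_span_Suc:
  assumes "finite I" "binom_span k I f" shows "binom_span (Suc k) I f"
proof -
  obtain c where c: "f = (\<lambda>s. \<Sum>\<gamma>\<in>bounded_idx k I. c \<gamma> * binom_prod I \<gamma> s)"
    using assms(2) unfolding binom_span_def by blast
  show ?thesis unfolding c
    using assms(1) by (intro binom_span_sum finite_bounded_idx binom_span_basis) (auto simp: bounded_idx_def)
qed

text \<open>The identity \<open>s * (s gchoose n) = n * (s gchoose n) + (n + 1) * (s gchoose (n +
  1))\<close> expresses a product with a variable in the Newton basis, with a single index raised by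
  one.\<close>

lemma binom_span_mult_var:
  assumes I: "finite I" and f: "binom_span k I f" and w: "w \<in> I"
  shows "binom_span (Suc k) I (\<lambda>s. s w * f s)"
proof -
  obtain c where c: "f = (\<lambda>s. \<Sum>\<gamma>\<in>bounded_idx k I. c \<gamma> * binom_prod I \<gamma> s)"
    using f unfolding binom_span_def by blast
  have split: "binom_prod I \<gamma> s = (s w gchoose \<gamma> w) * binom_prod (I - {w}) \<gamma> s" for \<gamma> s
    unfolding binom_prod_def using I w by (simp add: prod.remove)
  have upd: "binom_prod (I - {w}) (\<gamma>(w := n)) s = binom_prod (I - {w}) \<gamma> s" for \<gamma> s n
    unfolding binom_prod_def by (intro prod.cong) auto
  have "s w * binom_prod I \<gamma> s = real (\<gamma> w) * binom_prod I \<gamma> s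
       + real (Suc (\<gamma> w)) * binom_prod I (\<gamma>(w := Suc (\<gamma> w))) s" for \<gamma> s
    using arg_cong[OF gbinomial_mult_1[of "s w" "\<gamma> w"], of "\<lambda>u. u * binom_prod (I - {w}) \<gamma> s"]
    by (simp add: split upd algebra_simps)
  then have "s w * (c \<gamma> * binom_prod I \<gamma> s) = c \<gamma> * (real (\<gamma> w) * binom_prod I \<gamma> s
       + real (Suc (\<gamma> w)) * binom_prod I (\<gamma>(w := Suc (\<gamma> w))) s)" for \<gamma> s
    by (metis mult.left_commute)
  then have eq: "(\<lambda>s. s w * f s) = (\<lambda>s. \<Sum>\<gamma>\<in>bounded_idx k I. (c \<gamma> * real (\<gamma> w)) * binom_prod I \<gamma> s
       + (c \<gamma> * real (Suc (\<gamma> w))) * binom_prod I (\<gamma>(w := Suc (\<gamma> w))) s)"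
    unfolding c by (simp add: sum_distrib_left distrib_left mult.assoc del: of_nat_Suc)
  show
 ?thesis unfolding eq
  proof (intro binom_span_sum finite_bounded_idx binom_span_add binom_span_basis I)
    fix \<gamma> assume g: "\<gamma> \<in> bounded_idx k I"
    then show "\<gamma> \<in> bounded_idx (Suc k) I" by (auto simp: bounded_idx_def)
    have "sum (\<gamma>(w := Suc (\<gamma> w))) I = Suc (\<gamma> w) + sum (\<gamma>(w := Suc (\<gamma> w))) (I - {w})"
      using I w by (simp add: sum.remove)
    also have "sum (\<gamma>(w := Suc (\<gamma> w))) (I - {w}) = sum \<gamma> (I - {w})" by (intro sum.cong) auto
    also have "Suc (\<gamma> w) + \<dots> = Suc (sum \<gamma> I)" using I w by (simp add: sum.remove)
    finally show "\<gamma>(w := Suc (\<gamma> w)) \<in> bounded_idx (Suc k) I" using g w by (auto simp: bounded_idx_def)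
  qed
qed

lemma poly_deg_binom_span:
  assumes "poly_deg k f" "finite I"
  shows "binom_span k I (\<lambda>s. f (z0 + (\<Sum>v\<in>I. s v *\<^sub>R u v)))"
  using assms(1)
proof (induction rule: poly_deg.induct)
  case (const c)
  have "binom_span 0 I (\<lambda>s. c * binom_prod I (\<lambda>_. 0) s)"
    using assms(2) by (intro binom_span_basis) (auto simp: bounded_idx_def)
  then show ?case by (simp add: binom_prod_def)
next
  case (Suc k f) then show ?case using binom_span_Suc assms(2) by blast
next
  case (mult k f a b)
  have eq: "f (z0 + (\<Sum>v\<in>I. s v *\<^sub>R u v)) * (a \<bullet> (z0 + (\<Sum>v\<in>I. s v *\<^sub>R u v)) + b)
    = (a \<bullet> z0 + b) * f (z0 + (\<Sum>v\<in>I. s v *\<^sub>R u v)) + (\<Sum>w\<in>I. (a \<bullet> u w) * (s w * f (z0 + (\<Sum>v\<in>I. s v *\<^sub>R u v))))" for s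
    by (simp add: inner_add_right inner_sum_right algebra_simps sum_distrib_left sum_distrib_right)
  show ?case unfolding eq
    using mult.IH assms(2)
    by (intro binom_span_add binom_span_sum binom_span_cmult binom_span_mult_var binom_span_Suc) auto
next
  case (add k f g)
  then show ?case by (intro binom_span_add)
qed

text \<open>Induction on the total degree of \<beta>. At the lattice point \<beta> a basis function
  with index \<gamma> survives only if \<gamma> is componentwise at most \<beta>. Those with
  \<gamma> different from \<beta> have smaller degree, so their coefficients already vanish, and the
  value at \<beta> is its own coefficient.\<close>

lemma binom_span_unisolvent:
  assumes I: "finite I" and f: "binom_span k I f"
    and van: "\<And>\<beta>. \<beta> \<in> bounded_idx k I \<Longrightarrow> f (\<lambda>v. real (\<beta> v)) = 0"
  shows "f s = 0"
proof -
  obtain c where c: "\<And>s. f s = (\<Sum>\<gamma>\<in>bounded_idx k I. c \<gamma> * binom_prod I \<gamma> s)"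
    using f unfolding binom_span_def by blast
  have "c \<beta> = 0" if "\<beta> \<in> bounded_idx k I" for \<beta> using that
  proof (induction "sum \<beta> I" arbitrary: \<beta> rule: less_induct)
    case less
    have "c \<gamma> * binom_prod I \<gamma> (\<lambda>v. real (\<beta> v)) = (if \<gamma> = \<beta> then c \<beta> else 0)"
      if g: "\<gamma> \<in> bounded_idx k I" for \<gamma>
    proof (cases "\<forall>v\<in>I. \<gamma> v \<le> \<beta> v")
      case True
      show ?thesis
      proof (cases "\<gamma> = \<beta>")
        case True then show ?thesis
          by (simp add: binom_prod_def binomial_gbinomial[symmetric])
      next
        case False
        then obtain v where "\<gamma> v \<noteq> \<beta> v" by auto
        then have "v \<in> I" using g less.prems by (metis (mono_tags, lifting) bounded_idx_def mem_Collect_eq)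
        then have "\<gamma> v < \<beta> v" using True \<open>\<gamma> v \<noteq> \<beta> v\<close> by (simp add: le_neq_implies_less)
        then have "sum \<gamma> I < sum \<beta> I" using True I \<open>v \<in> I\<close> by (intro sum_strict_mono_ex1) auto
        then show ?thesis using less.hyps[OF _ g] False by simp
      qed
    next
      case False
      then obtain v where v: "v \<in> I" "\<beta> v < \<gamma> v" by (auto simp: not_le)
      then have "real (\<beta> v) gchoose \<gamma> v = 0" by (simp add: binomial_gbinomial[symmetric])
      then have "binom_prod I \<gamma> (\<lambda>v. real (\<beta> v)) = 0"
        unfolding binom_prod_def using I v(1) by (intro prod_zero) auto
      then show ?thesis using v by auto
    qed
    then have "f (\<lambda>v. real (\<beta> v)) = (\<Sum>\<gamma>\<in>bounded_idx k I. if \<gamma> = \<beta> then c \<beta> else 0)"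
      unfolding c by (intro sum.cong) auto
    also have "\<dots> = c \<beta>" using less.prems finite_bounded_idx[OF I] by simp
    finally show ?case using van[OF less.prems] by simp
  qed
  then show ?thesis unfolding c by simp
qed

text \<open>One vertex serves as origin and \<open>k\<close> times the other coordinates are the
  variables. The nodes become the integer points of total degree at most \<open>k\<close>, the
  missing weight going to the origin vertex. As \<open>T\<close> may span a proper subspace, the
  lemma also determines traces on facets from their own nodes.\<close>

lemma poly_deg_unisolvent:
  fixes f :: "'a::euclidean_space \<Rightarrow> real"
  assumes T: "finite T" and k: "1 \<le> k" and f: "poly_deg k f"
    and van: "\<And>\<alpha>. \<alpha> \<in> node_idx k T \<Longrightarrow> f (node k T \<alpha>) = 0" and x: "x \<in> affine hull T"
  shows "f x = 0"
proof -
  obtain u where u: "sum u T = 1" "(\<Sum>v\<in>T. u v *\<^sub>R v) = x"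
    using x unfolding affine_hull_finite[OF T] by auto
  then obtain z where z: "z \<in> T" by (metis sum.empty zero_neq_one all_not_in_conv)
  define I where "I = T - {z}"
  have I: "finite I" "T = insert z I" "z \<notin> I" using T z by (auto simp: I_def)
  define X where "X s = z + (\<Sum>v\<in>I. s v *\<^sub>R ((1 / real k) *\<^sub>R (v - z)))" for s
  have X: "X s = (1 - (\<Sum>v\<in>I. s v / real k)) *\<^sub>R z + (\<Sum>v\<in>I. (s v / real k) *\<^sub>R v)" for s
    by (simp add: X_def scaleR_right_diff_distrib scaleR_left_diff_distrib sum_subtractf scaleR_sum_left)
  have bs: "binom_span k I (\<lambda>s. f (X s))"
    unfolding X_def by (rule poly_deg_binom_span[OF f I(1)])
  have "f (X (\<lambda>v. real (\<beta> v))) = 0" if b: "\<beta> \<in> bounded_idx k I" for \<beta>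
  proof -
    define \<alpha> where "\<alpha> = \<beta>(z := k - sum \<beta> I)"
    have aI: "\<alpha> v = \<beta> v" if "v \<in> I" for v using that I(3) by (auto simp: \<alpha>_def)
    have "sum \<alpha> T = k" using I b aI by (simp add: \<alpha>_def bounded_idx_def cong: sum.cong)
    then have "\<alpha> \<in> node_idx k T" using b I by (auto simp: node_idx_def bounded_idx_def \<alpha>_def)
    moreover have "node k T \<alpha> = X (\<lambda>v. real (\<beta> v))"
    proof -
      have "real (\<alpha> z) / real k = 1 - (\<Sum>v\<in>I. real (\<beta> v) / real k)"
        using b k by (simp add: \<alpha>_def bounded_idx_def of_nat_diff diff_divide_distrib sum_divide_distrib)
      then show ?thesis unfolding X node_def using I aI by simp
    qed
    ultimately show ?thesis using van by metis
  qed
  from binom_span_unisolvent[OF I(1) bs this] have "f (X (\<lambda>v. real k * u v)) = 0" by simp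
  moreover have "X (\<lambda>v. real k * u v) = x"
  proof -
    have "u z = 1 - sum u I" using u(1) I by simp
    then show ?thesis using u(2) k I unfolding X by simp
  qed
  ultimately show ?thesis by simp
qed

section \<open>Cut-off Gauss formula on a simplex\<close>

lemma integrable_lborel_bounded_support:
  fixes f :: "'a::euclidean_space \<Rightarrow> real"
  assumes "f \<in> borel_measurable borel" "bounded A" "\<And>x. x \<in> A \<Longrightarrow> \<bar>f x\<bar> \<le> B" "\<And>x. x \<notin> A \<Longrightarrow> f x = 0"
  shows "integrable lborel f"
proof -
  obtain R where R: "A \<subseteq> cball 0 R" using assms(2) unfolding bounded_iff by (metis mem_cball_0 subsetI)
  show ?thesis
  proof (rule integrableI_bounded_set)
    show "emeasure lborel (cball 0 R :: 'a set) < \<infinity>" by (rule emeasure_lborel_cball_finite)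
    have "norm (f x) \<le> max B 0" for x using assms(3,4)[of x] by (cases "x \<in> A") (auto intro: max.coboundedI1)
    then show "AE x in lborel. x \<in> cball 0 R \<longrightarrow> norm (f x) \<le> max B 0" by simp
    show "AE x in lborel. x \<notin> cball 0 R \<longrightarrow> f x = 0" proof (intro AE_I2 impI)
      fix x :: 'a assume "x \<notin> cball 0 R"
      then have "x \<notin> A" using R by blast
      then show "f x = 0" by (rule assms(4))
    qed
  qed (use assms(1) in auto)
qed

lemma integral_lborel_translation:
  fixes f :: "'a::euclidean_space \<Rightarrow> real"
  assumes "f \<in> borel_measurable borel"
  shows "(\<integral>x. f (c + x) \<partial>lborel) = (\<integral>x. f x \<partial>lborel)"
proof -
  have "(\<integral>x. f x \<partial>lborel) = (\<integral>x. f x \<partial>(distr lborel borel ((+) c)))" by (simp add: lborel_distr_plus)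
  also have "\<dots> = (\<integral>x. f (c + x) \<partial>lborel)" using assms by (intro integral_distr) auto
  finally show ?thesis by simp
qed

text \<open>The difference quotients have integral zero by translation invariance.\<close>

lemma integral_directional_derivative_zero:
  fixes \<phi> :: "'a::euclidean_space \<Rightarrow> real"
  assumes lip: "\<And>x y. \<bar>\<phi> x - \<phi> y\<bar> \<le> L * norm (x - y)" and A: "bounded A" "\<And>x. x \<notin> A \<Longrightarrow> \<phi> x = 0"
    and der: "AE x in lborel. (\<phi> has_derivative \<phi>' x) (at x)"
    and meas: "(\<lambda>x. \<phi>' x e) \<in> borel_measurable borel"
  shows "(\<integral>x. \<phi>' x e \<partial>lborel) = 0"
proof -
  have L: "0 \<le> L * norm e" using lip[of e 0] by (metis abs_ge_zero diff_zero order_trans)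
  have cont: "continuous_on UNIV \<phi>"
  proof (rule continuous_on_iff[THEN iffD2], intro ballI allI impI)
    fix x :: 'a and \<epsilon> :: real assume e: "\<epsilon> > 0"
    have "dist (\<phi> y) (\<phi> x) < \<epsilon>" if "dist y x < \<epsilon> / (\<bar>L\<bar> + 1)" for y
    proof -
      have "dist (\<phi> y) (\<phi> x) \<le> L * norm (y - x)" using lip[of y x] by (simp add: dist_real_def)
      also have "\<dots> \<le> (\<bar>L\<bar> + 1) * norm (y - x)" by (intro mult_right_mono) auto
      also have "\<dots> < \<epsilon>" using that by (simp add: dist_norm pos_less_divide_eq mult.commute)
      finally show ?thesis .
    qed
    then show "\<exists>d>0. \<forall>y\<in>UNIV. dist y x < d \<longrightarrow> dist (\<phi> y) (\<phi> x) < \<epsilon>"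
      using e by (intro exI[of _ "\<epsilon> / (\<bar>L\<bar> + 1)"]) auto
  qed
  then have [measurable]: "\<phi> \<in> borel_measurable borel" by (rule borel_measurable_continuous_onI)
  obtain R where R: "A \<subseteq> cball 0 R" using A(1) unfolding bounded_iff by (metis mem_cball_0 subsetI)
  define D where "D n x = real (Suc n) * (\<phi> ((1 / real (Suc n)) *\<^sub>R e + x) - \<phi> x)" for n x
  \<comment> \<open>The ball is enlarged by \<open>norm e\<close> so that it contains the supports
    of all shifted copies; on it every difference quotient is bounded by
    \<open>L * norm e\<close>.\<close>
  define w where "w x = indicator (cball 0 (R + norm e)) x * (L * norm e)" for x :: 'a
  have bd: "\<exists>M. \<forall>x. \<bar>\<phi> x\<bar> \<le> M"
  proof (cases "A = {}")
    case True then show ?thesis using A(2) by (intro exI[of _ 0]) auto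
  next
    case False
    then have R0: "R \<ge> 0" using R by auto

    obtain x0 where x0: "\<bar>\<phi> x\<bar> \<le> \<bar>\<phi> 0\<bar> + \<bar>L\<bar> * R" if "x \<in> A" for x
    proof
      fix x assume "x \<in> A"
      then have "norm x \<le> R" using R by auto
      have "\<bar>\<phi> x - \<phi> 0\<bar> \<le> L * norm x" using lip[of x 0] by simp
      also have "\<dots> \<le> \<bar>L\<bar> * R" using \<open>norm x \<le> R\<close> by (intro mult_mono) auto
      finally show "\<bar>\<phi> x\<bar> \<le> \<bar>\<phi> 0\<bar> + \<bar>L\<bar> * R" by linarith
    qed
    have "\<bar>\<phi> x\<bar> \<le> \<bar>\<phi> 0\<bar> + \<bar>L\<bar> * R" for x using x0 A(2)[of x] R0 by (cases "x \<in> A") auto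
    then show ?thesis by blast
  qed
  then obtain M where M: "\<And>x. \<bar>\<phi> x\<bar> \<le> M" by blast
  have int: "integrable lborel \<phi>"
    by (rule integrable_lborel_bounded_support[OF _ A(1) M]) (use A in auto)
  have int': "integrable lborel (\<lambda>x. \<phi> (c + x))" for c
  proof (rule integrable_lborel_bounded_support)
    show "bounded ((\<lambda>x. x - c) ` A)" using A(1) by (rule bounded_translation_minus)
    show "\<phi> (c + x) = 0" if "x \<notin> (\<lambda>x. x - c) ` A" for x
      using that A(2)[of "c + x"] by (auto simp: image_iff) (metis add_diff_cancel_left')
  qed (use M in auto)
  have zero: "(\<integral>x. D n x \<partial>lborel) = 0" for n
    unfolding D_def using int int' by (simp add: integral_lborel_translation)
  have "(\<lambda>n. \<integral>x. D n x \<partial>lborel) \<longlonglongrightarrow> (\<integral>x. \<phi>' x e \<partial>lborel)"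
  proof (rule integral_dominated_convergence[where w=w])
    show "(\<lambda>x. \<phi>' x e) \<in> borel_measurable lborel" using meas by simp
    show "D n \<in> borel_measurable lborel" for n unfolding D_def by measurable
    show "integrable lborel w" unfolding w_def
      by (intro integrable_mult_left integrable_real_indicator) (auto simp: emeasure_lborel_cball_finite[unfolded infinity_ennreal_def])

    show "AE x in lborel. (\<lambda>n. D n x) \<longlonglongrightarrow> \<phi>' x e" using der
    proof eventually_elim
      case (elim x)
      have lim: "(\<lambda>n. 1 / real (Suc n)) \<longlonglongrightarrow> 0" using LIMSEQ_inverse_real_of_nat by (simp add: inverse_eq_divide)
      then have "filterlim (\<lambda>n. 1 / real (Suc n)) (at 0) sequentially"
        unfolding filterlim_at by auto
      moreover have "((\<lambda>t. (\<phi> (x + t *\<^sub>R e) - \<phi> x) / t) \<longlongrightarrow> \<phi>' x e) (at 0)"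
      proof -
        have "((\<lambda>t::real. x + t *\<^sub>R e) has_derivative (\<lambda>t. t *\<^sub>R e)) (at 0)" by (auto intro!: derivative_eq_intros)
        moreover have "(\<phi> has_derivative \<phi>' x) (at (x + (0::real) *\<^sub>R e))" using elim by simp
        ultimately have "((\<lambda>t. \<phi> (x + t *\<^sub>R e)) has_derivative (\<lambda>t. \<phi>' x (t *\<^sub>R e))) (at 0)"
          by (rule has_derivative_compose)
        moreover have "(\<lambda>t. \<phi>' x (t *\<^sub>R e)) = (*) (\<phi>' x e)"
          using linear_scale[OF has_derivative_linear[OF elim]] by (auto simp: mult.commute)
        ultimately show ?thesis
          using DERIV_def[of "\<lambda>t. \<phi> (x + t *\<^sub>R e)" "\<phi>' x e" 0] by (simp add: has_field_derivative_def)
      qed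
      ultimately have "(\<lambda>n. (\<phi> (x + (1 / real (Suc n)) *\<^sub>R e) - \<phi> x) / (1 / real (Suc n))) \<longlonglongrightarrow> \<phi>' x e"
        by (rule filterlim_compose[rotated])
      then show ?case unfolding D_def by (simp add: add.commute mult.commute)

    qed
    show "AE x in lborel. norm (D n x) \<le> w x" for n
    proof (rule AE_I2)
      fix x :: 'a
      let ?h = "(1 / real (Suc n)) *\<^sub>R e"
      have nh: "norm ?h = norm e / real (Suc n)" by simp
      show "norm (D n x) \<le> w x"
      proof (cases "x \<in> cball 0 (R + norm e)")
        case True
        have "\<bar>D n x\<bar> = real (Suc n) * \<bar>\<phi> (?h + x) - \<phi> x\<bar>" unfolding D_def by (simp add: abs_mult)
        also have "\<dots> \<le> real (Suc n) * (L * norm (?h + x - x))" by (intro mult_left_mono lip) auto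
        also have "\<dots> = L * norm e" using nh by simp
        finally show ?thesis using True by (simp add: w_def)
      next
        case False
        then have "norm x > R + norm e" by simp
        moreover have "norm ?h \<le> norm e" unfolding nh by (simp add: divide_le_eq mult_left_le_one_le[of _ "1"] field_simps)
        moreover have "norm x - norm ?h \<le> norm (?h + x)" using norm_diff_ineq[of x ?h] by (simp only: add.commute)
        moreover have "r > R" "t > R" if "r > R + E" "s \<le> E" "r - s \<le> t" "0 \<le> E" for r s t E :: real
          using that by linarith+
        ultimately have "norm x > R" "norm (?h + x) > R" using norm_ge_zero by blast+
        then have "x \<notin> A" "?h + x \<notin> A" using R by (auto simp: subset_iff not_le)
        then show ?thesis using A(2) L by (simp add: D_def w_def)
      qed
    qed
  qed
  then show ?thesis using zero by (simp add: LIMSEQ_const_iff)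
qed

section \<open>Barycentric cut-off and slab integrals\<close>

definition clamp01 :: "real \<Rightarrow> real" where "clamp01 t = max 0 (min 1 t)"

lemma clamp01_bounds: "0 \<le> clamp01 t" "clamp01 t \<le> 1" by (auto simp: clamp01_def)

lemma clamp01_pos_iff: "clamp01 t \<noteq> 0 \<longleftrightarrow> 0 < t" by (auto simp: clamp01_def)

lemma clamp01_lipschitz: "\<bar>clamp01 s - clamp01 t\<bar> \<le> \<bar>s - t\<bar>" by (auto simp: clamp01_def)

lemma clamp01_has_derivative:
  assumes "t \<noteq> 0" "t \<noteq> 1"
  shows "(clamp01 has_derivative (\<lambda>h. (if 0 < t \<and> t < 1 then 1 else 0) * h)) (at t)"
proof -
  consider "t < 0" | "0 < t" "t < 1" | "1 < t" using assms by linarith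
  then show ?thesis
  proof cases
    case 1
    have "((\<lambda>_. 0) has_derivative (\<lambda>h. 0)) (at t)" by simp
    from has_derivative_transform_within_open[OF this, of "{..<0}" clamp01]
    show ?thesis using 1 by (simp add: clamp01_def)
  next
    case 2
    have "((\<lambda>x. x) has_derivative (\<lambda>h. h)) (at t)" by simp
    from has_derivative_transform_within_open[OF this, of "{0<..<1}" clamp01]
    show ?thesis using 2 by (simp add: clamp01_def)
  next
    case 3
    have "((\<lambda>_. 1) has_derivative (\<lambda>h. 0)) (at t)" by simp
    from has_derivative_transform_within_open[OF this, of "{1<..}" clamp01]
    show ?thesis using 3 by (simp add: clamp01_def)
  qed
qed

lemma continuous_on_clamp01 [continuous_intros]: "continuous_on A f \<Longrightarrow> continuous_on A (\<lambda>x. clamp01 (f x))"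
  unfolding clamp01_def by (intro continuous_intros)

definition C1_with_grad :: "('a::euclidean_space \<Rightarrow> real) \<Rightarrow> ('a \<Rightarrow> 'a) \<Rightarrow> bool" where
  "C1_with_grad f g \<longleftrightarrow> (\<forall>x. (f has_derivative (\<lambda>h. g x \<bullet> h)) (at x)) \<and> continuous_on UNIV g"

lemma C1_continuous: "C1_with_grad f g \<Longrightarrow> continuous_on A f"
  unfolding C1_with_grad_def by (meson has_derivative_continuous continuous_at_imp_continuous_on)

lemma C1_lipschitz_on_compact_convex:
  assumes "C1_with_grad f g" "compact K" "convex K"
  obtains L where "0 \<le> L" "\<And>x y. x \<in> K \<Longrightarrow> y \<in> K \<Longrightarrow> \<bar>f x - f y\<bar> \<le> L * norm (x - y)"
proof -
  have "compact (g ` K)" using assms unfolding C1_with_grad_def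
    by (intro compact_continuous_image) (auto intro: continuous_on_subset)
  then have "bounded (g ` K)" by (rule compact_imp_bounded)
  then obtain L where L: "0 < L" "\<And>x. x \<in> K \<Longrightarrow> norm (g x) \<le> L" unfolding bounded_pos by blast
  have "norm (f x - f y) \<le> L * norm (x - y)" if "x \<in> K" "y \<in> K" for x y
  proof (rule differentiable_bound[OF assms(3) _ _ that])
    show "(f has_derivative (\<lambda>h. g x \<bullet> h)) (at x within K)" if "x \<in> K" for x
      using assms(1) unfolding C1_with_grad_def by (auto intro: has_derivative_at_withinI)
    show "onorm (\<lambda>h. g x \<bullet> h) \<le> L" if "x \<in> K" for x
    proof (rule onorm_le)
      fix h
      have "norm (g x \<bullet> h) \<le> norm (g x) * norm h" using Cauchy_Schwarz_ineq2 by simp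
      also have "\<dots> \<le> L * norm h" using L that by (intro mult_right_mono) auto
      finally show "norm (g x \<bullet> h) \<le> L * norm h" .
    qed
  qed
  then show thesis using that[of L] L by auto
qed

lemma C1_diff: "C1_with_grad f g \<Longrightarrow> C1_with_grad f' g' \<Longrightarrow> C1_with_grad (\<lambda>x. f x - f' x) (\<lambda>x. g x - g' x)"
  unfolding C1_with_grad_def
  by (auto intro!: derivative_eq_intros continuous_intros simp: inner_diff_left)

lemma C1_sum: "(\<And>i. i \<in> I \<Longrightarrow> C1_with_grad (f i) (g i)) \<Longrightarrow> C1_with_grad (\<lambda>x. \<Sum>i\<in>I. f i x) (\<lambda>x. \<Sum>i\<in>I. g i x)"
  unfolding C1_with_grad_def
  by (auto intro!: derivative_eq_intros continuous_intros simp: inner_sum_left)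

lemma C1_cmult: "C1_with_grad f g \<Longrightarrow> C1_with_grad (\<lambda>x. f x * c) (\<lambda>x. c *\<^sub>R g x)"
  unfolding C1_with_grad_def
  by (auto intro!: derivative_eq_intros continuous_intros simp: mult.commute)

context full_simplex begin

definition cutoff :: "real \<Rightarrow> 'a \<Rightarrow> real" where
  "cutoff \<epsilon> x = (\<Prod>v\<in>S. clamp01 (bary S v x / \<epsilon>))"

text \<open>The gradient of \<open>cutoff\<close> is the sum of \<open>slab_weight \<epsilon> z\<close> times \<open>bary_grad S z\<close>; the weight concentrates on the facet opposite to \<open>z\<close> as \<open>\<epsilon>\<close> tends to zero.\<close>

definition slab_weight :: "real \<Rightarrow> 'a \<Rightarrow> 'a \<Rightarrow> real" where
  "slab_weight \<epsilon> z x = (if 0 < bary S z x \<and> bary S z x < \<epsilon> then 1 / \<epsilon> else 0) * (\<Prod>v\<in>S-{z}. clamp01 (bary S v x / \<epsilon>))"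

definition slab_integral :: "real \<Rightarrow> 'a \<Rightarrow> ('a \<Rightarrow> real) \<Rightarrow> real" where
  "slab_integral \<epsilon> z f = (\<integral>x. slab_weight \<epsilon> z x * f x \<partial>lborel)"

lemma bounded_hull: "bounded (convex hull S)" by (simp add: compact_imp_bounded)

lemma continuous_bounded_on_hull:
  fixes f :: "'a \<Rightarrow> real" assumes "continuous_on UNIV f"
  obtains B where "0 < B" "\<And>x. x \<in> convex hull S \<Longrightarrow> \<bar>f x\<bar> \<le> B"
proof -
  have "compact (f ` (convex hull S))"
    using assms by (intro compact_continuous_image) (auto intro: continuous_on_subset)
  then have "bounded (f ` (convex hull S))" by (rule compact_imp_bounded)
  then obtain B where "0 < B" "\<And>x. x \<in> convex hull S \<Longrightarrow> \<bar>f x\<bar> \<le> B" unfolding bounded_pos by auto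
  then show thesis by (rule that)
qed

lemma bary_measurable [measurable]: "z \<in> S \<Longrightarrow> bary S z \<in> borel_measurable borel"
  by (simp add: borel_measurable_continuous_onI continuous_on_bary)

lemma cutoff_continuous: "\<epsilon> > 0 \<Longrightarrow> continuous_on A (cutoff \<epsilon>)"
  unfolding cutoff_def by (intro continuous_intros continuous_on_bary) auto

lemma cutoff_bounds: "0 \<le> cutoff \<epsilon> x" "cutoff \<epsilon> x \<le> 1"
  unfolding cutoff_def by (auto intro!: prod_nonneg prod_le_1 simp: clamp01_bounds)

lemma cutoff_zero: assumes "\<epsilon> > 0" "x \<notin> convex hull S" shows "cutoff \<epsilon> x = 0"
proof -
  obtain v where v: "v \<in> S" "bary S v x < 0" using hull_iff[of x] assms(2) by (meson not_le)
  then have "clamp01 (bary S v x / \<epsilon>) = 0" using assms(1) by (simp add: clamp01_def divide_le_0_iff)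
  then show ?thesis unfolding cutoff_def using v(1) by (intro prod_zero) auto
qed

lemma slab_weight_measurable: "z \<in> S \<Longrightarrow> slab_weight \<epsilon> z \<in> borel_measurable borel"
proof -
  assume z: "z \<in> S"
  have "(\<lambda>x. \<Prod>v\<in>S-{z}. clamp01 (bary S v x / \<epsilon>)) \<in> borel_measurable borel"
    unfolding divide_inverse
    by (intro borel_measurable_continuous_onI continuous_intros continuous_on_bary) auto
  then show ?thesis unfolding slab_weight_def using z by measurable
qed

lemma slab_weight_bounds: "\<epsilon> > 0 \<Longrightarrow> 0 \<le> slab_weight \<epsilon> z x" "\<epsilon> > 0 \<Longrightarrow> slab_weight \<epsilon> z x \<le> 1 / \<epsilon>"
proof -
  have p: "0 \<le> (\<Prod>v\<in>S-{z}. clamp01 (bary S v x / \<epsilon>))" "(\<Prod>v\<in>S-{z}. clamp01 (bary S v x / \<epsilon>)) \<le> 1"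
    by (auto intro!: prod_nonneg prod_le_1 simp: clamp01_bounds)
  then show "\<epsilon> > 0 \<Longrightarrow> 0 \<le> slab_weight \<epsilon> z x" unfolding slab_weight_def by auto
  assume "\<epsilon> > 0"
  then have "slab_weight \<epsilon> z x \<le> (1 / \<epsilon>) * 1" unfolding slab_weight_def using p
    by (intro mult_mono) auto
  then show "slab_weight \<epsilon> z x \<le> 1 / \<epsilon>" by simp
qed

lemma slab_weight_nonzero: assumes "\<epsilon> > 0" "slab_weight \<epsilon> z x \<noteq> 0" "z \<in> S"
  shows "0 < bary S z x" "bary S z x < \<epsilon>" "x \<in> convex hull S"
proof -
  show 1: "0 < bary S z x" "bary S z x < \<epsilon>" using assms(2) by (auto simp: slab_weight_def split: if_splits)
  have "clamp01 (bary S v x / \<epsilon>) \<noteq> 0" if "v \<in> S - {z}" for v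
    using assms(2) that by (auto simp: slab_weight_def)
  then have "0 < bary S v x" if "v \<in> S - {z}" for v
    using that assms(1) by (metis clamp01_pos_iff zero_less_divide_iff less_asym)
  then show "x \<in> convex hull S" unfolding hull_iff using 1 by (metis Diff_iff empty_iff insert_iff less_imp_le)
qed

lemma cutoff_lipschitz:
  assumes "\<epsilon> > 0"
  shows "\<bar>cutoff \<epsilon> x - cutoff \<epsilon> y\<bar> \<le> ((\<Sum>v\<in>S. norm (bary_grad S v)) / \<epsilon>) * norm (x - y)"
proof -
  have "norm (cutoff \<epsilon> x - cutoff \<epsilon> y) \<le> (\<Sum>v\<in>S. norm (clamp01 (bary S v x / \<epsilon>) - clamp01 (bary S v y / \<epsilon>)))"
    unfolding cutoff_def by (rule norm_prod_diff) (auto simp: clamp01_bounds)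
  also have "\<dots> \<le> (\<Sum>v\<in>S. norm (bary_grad S v) / \<epsilon> * norm (x - y))"
  proof (rule sum_mono)
    fix v assume v: "v \<in> S"
    have "norm (clamp01 (bary S v x / \<epsilon>) - clamp01 (bary S v y / \<epsilon>)) \<le> \<bar>bary S v x / \<epsilon> - bary S v y / \<epsilon>\<bar>"
      using clamp01_lipschitz by simp
    also have "\<dots> = \<bar>bary_grad S v \<bullet> (x - y)\<bar> / \<epsilon>" using assms bary_diff[OF v, of x y]
      by (simp add: diff_divide_distrib[symmetric])
    also have "\<dots> \<le> (norm (bary_grad S v) * norm (x - y)) / \<epsilon>"
      using assms Cauchy_Schwarz_ineq2 by (intro divide_right_mono) auto
    finally show "norm (clamp01 (bary S v x / \<epsilon>) - clamp01 (bary S v y / \<epsilon>)) \<le> norm (bary_grad S v) / \<epsilon> * norm (x - y)" by simp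
  qed
  also have "\<dots> = ((\<Sum>v\<in>S. norm (bary_grad S v)) / \<epsilon>) * norm (x - y)"
    by (simp add: sum_distrib_right sum_divide_distrib)
  finally show ?thesis by simp
qed

lemma negligible_bary_level: assumes "v \<in> S" shows "{x. bary S v x = c} \<in> null_sets lborel"
proof -
  have "{x. bary S v x = c} = {x. bary_grad S v \<bullet> x = c - bary S v 0}"
  proof (intro Collect_cong)
    fix x show "bary S v x = c \<longleftrightarrow> bary_grad S v \<bullet> x = c - bary S v 0"
      using bary_eq[OF assms, of x] by linarith
  qed
  moreover have "negligible {x. bary_grad S v \<bullet> x = c - bary S v 0}"
    using negligible_hyperplane bary_grad_nonzero[OF assms] by blast
  moreover have "{x. bary S v x = c} \<in> sets borel"
    using continuous_on_bary[OF assms, of UNIV] by (intro borel_closed closed_Collect_eq) auto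
  ultimately show ?thesis by (auto simp: negligible_iff_emeasure0 null_sets_def)
qed

text \<open>The product rule away from the kinks of the clamped factors, which sit at the levels 0
  and \<epsilon>. These levels are hyperplanes, so the formula holds almost everywhere, which is
  enough under the integral.\<close>

lemma cutoff_has_derivative:
  assumes e: "\<epsilon> > 0" and x: "\<And>v. v \<in> S \<Longrightarrow> bary S v x \<noteq> 0 \<and> bary S v x \<noteq> \<epsilon>"
  shows "(cutoff \<epsilon> has_derivative (\<lambda>h. \<Sum>v\<in>S. slab_weight \<epsilon> v x * (bary_grad S v \<bullet> h))) (at x)"
proof -
  have "((\<lambda>x. clamp01 (bary S v x / \<epsilon>)) has_derivative
     (\<lambda>h. (if 0 < bary S v x \<and> bary S v x < \<epsilon> then 1 / \<epsilon> else 0) * (bary_grad S v \<bullet> h))) (at x)" if v: "v \<in> S" for v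
  proof -
    have "((\<lambda>x. bary S v x / \<epsilon>) has_derivative (\<lambda>h. (bary_grad S v \<bullet> h) / \<epsilon>)) (at x)"
      using bary_has_derivative[OF v] e by (auto intro!: derivative_eq_intros)
    from has_derivative_compose[OF this clamp01_has_derivative]
    have "((\<lambda>x. clamp01 (bary S v x / \<epsilon>)) has_derivative
      (\<lambda>h. (if 0 < bary S v x / \<epsilon> \<and> bary S v x / \<epsilon> < 1 then 1 else 0) * ((bary_grad S v \<bullet> h) / \<epsilon>))) (at x)"
      using x[OF v] e by auto
    moreover have "(\<lambda>h. (if 0 < bary S v x / \<epsilon> \<and> bary S v x / \<epsilon> < 1 then 1 else 0) * ((bary_grad S v \<bullet> h) / \<epsilon>))
       = (\<lambda>h. (if 0 < bary S v x \<and> bary S v x < \<epsilon> then 1 / \<epsilon> else 0) * (bary_grad S v \<bullet> h))"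
      using e by (auto simp: zero_less_divide_iff)
    ultimately show ?thesis by simp
  qed
  then have "((\<lambda>x. \<Prod>v\<in>S. clamp01 (bary S v x / \<epsilon>)) has_derivative
     (\<lambda>h. \<Sum>v\<in>S. ((if 0 < bary S v x \<and> bary S v x < \<epsilon> then 1 / \<epsilon> else 0) * (bary_grad S v \<bullet> h)) * (\<Prod>w\<in>S-{v}. clamp01 (bary S w x / \<epsilon>)))) (at x)"
    by (rule has_derivative_prod)
  then show ?thesis unfolding cutoff_def[abs_def] slab_weight_def by (simp add: mult_ac)
qed

lemma slab_integrable:
  assumes "\<epsilon> > 0" "z \<in> S" "continuous_on UNIV f" shows "integrable lborel (\<lambda>x. slab_weight \<epsilon> z x * f x)"
proof -
  obtain B where B: "0 < B" "\<And>x. x \<in> convex hull S \<Longrightarrow> \<bar>f x\<bar> \<le> B"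
    using continuous_bounded_on_hull[OF assms(3)] by auto
  show ?thesis
  proof (rule integrable_lborel_bounded_support[OF _ bounded_hull])
    show "(\<lambda>x. slab_weight \<epsilon> z x * f x) \<in> borel_measurable borel"
      using slab_weight_measurable[OF assms(2)] borel_measurable_continuous_onI[OF assms(3)] by measurable
    show "\<bar>slab_weight \<epsilon> z x * f x\<bar> \<le> (1 / \<epsilon>) * B" if "x \<in> convex hull S" for x
      using slab_weight_bounds[OF assms(1)] B that assms(1) unfolding abs_mult by (intro mult_mono) auto
  qed (use slab_weight_nonzero(3)[OF assms(1) _ assms(2)] in auto)
qed

lemma cutoff_integrable:
  assumes "\<epsilon> > 0" "continuous_on UNIV f" shows "integrable lborel (\<lambda>x. cutoff \<epsilon> x * f x)"
proof -
  obtain B where B: "0 < B" "\<And>x. x \<in> convex hull S \<Longrightarrow> \<bar>f x\<bar> \<le> B"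
    using continuous_bounded_on_hull[OF assms(2)] by auto
  show ?thesis
  proof (rule integrable_lborel_bounded_support[OF _ bounded_hull])
    show "(\<lambda>x. cutoff \<epsilon> x * f x) \<in> borel_measurable borel"
      using assms by (intro borel_measurable_continuous_onI continuous_intros cutoff_continuous)
    show "\<bar>cutoff \<epsilon> x * f x\<bar> \<le> 1 * B" if "x \<in> convex hull S" for x
      using cutoff_bounds B that unfolding abs_mult by (intro mult_mono) auto
  qed (use cutoff_zero[OF assms(1)] in auto)
qed

text \<open>The product of cut-off and \<open>G\<close> is globally Lipschitz with bounded support,
  so its directional derivatives integrate to zero. The product rule separates a volume term from
  one slab term per facet; the latter plays the part of the boundary flux.\<close>

lemma gauss_cutoff:
  assumes e: "\<epsilon> > 0" and G: "C1_with_grad G g"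
  shows "(\<integral>x. cutoff \<epsilon> x * (g x \<bullet> e) \<partial>lborel) + (\<Sum>z\<in>S. (bary_grad S z \<bullet> e) * slab_integral \<epsilon> z G) = 0"
proof -
  have cG: "continuous_on UNIV G" "continuous_on UNIV g" using G C1_continuous by (auto simp: C1_with_grad_def)
  have cge: "continuous_on UNIV (\<lambda>x. g x \<bullet> e)" using cG by (intro continuous_intros)
  define \<phi>' where "\<phi>' x h = cutoff \<epsilon> x * (g x \<bullet> h) + (\<Sum>z\<in>S. slab_weight \<epsilon> z x * (bary_grad S z \<bullet> h)) * G x" for x h
  obtain B where B: "0 < B" "\<And>x. x \<in> convex hull S \<Longrightarrow> \<bar>G x\<bar> \<le> B"
    using continuous_bounded_on_hull[OF cG(1)] by auto
  obtain L where L: "0 \<le> L" "\<And>x y. x \<in> convex hull S \<Longrightarrow> y \<in> convex hull S \<Longrightarrow> \<bar>G x - G y\<bar> \<le> L * norm (x - y)"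
    using C1_lipschitz_on_compact_convex[OF G compact_hull] by auto
  define M where "M = (\<Sum>v\<in>S. norm (bary_grad S v)) / \<epsilon>"
  have M: "0 \<le> M" unfolding M_def using e by (intro divide_nonneg_pos sum_nonneg) auto
  \<comment> \<open>Only \<open>x\<close> has to lie in the simplex: the value of \<open>G\<close>
    is taken at \<open>x\<close>, and the increment of \<open>G\<close> is multiplied by the cut-off
    at \<open>y\<close>, which vanishes outside.\<close>
  have one: "\<bar>cutoff \<epsilon> x * G x - cutoff \<epsilon> y * G y\<bar> \<le> (M * B + L) * norm (x - y)" if x: "x \<in> convex hull S" for x y
  proof -
    have "cutoff \<epsilon> x * G x - cutoff \<epsilon> y * G y = (cutoff \<epsilon> x - cutoff \<epsilon> y) * G x + cutoff \<epsilon> y * (G x - G y)"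
      by (simp add: algebra_simps)
    also have "\<bar>\<dots>\<bar> \<le> \<bar>cutoff \<epsilon> x - cutoff \<epsilon> y\<bar> * \<bar>G x\<bar> + \<bar>cutoff \<epsilon> y * (G x - G y)\<bar>"
      by (metis abs_mult abs_triangle_ineq)
    also have "\<bar>cutoff \<epsilon> x - cutoff \<epsilon> y\<bar> * \<bar>G x\<bar> \<le> (M * norm (x - y)) * B"
      using cutoff_lipschitz[OF e] B(2)[OF x] M unfolding M_def[symmetric] by (intro mult_mono) auto
    also have "\<bar>cutoff \<epsilon> y * (G x - G y)\<bar> \<le> L * norm (x - y)"
    proof (cases "y \<in> convex hull S")
      case True
      have "\<bar>cutoff \<epsilon> y * (G x - G y)\<bar> \<le> 1 * (L * norm (x - y))"
        unfolding abs_mult using L(2)[OF x True] cutoff_bounds[of \<epsilon> y] by (intro mult_mono) auto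
      then show ?thesis by simp
    qed (use cutoff_zero[OF e] L in auto)
    finally show ?thesis by (simp add: algebra_simps)
  qed
  have "(\<integral>x. \<phi>' x e \<partial>lborel) = 0"
  proof (rule integral_directional_derivative_zero[OF _ bounded_hull])
    show "\<bar>cutoff \<epsilon> x * G x - cutoff \<epsilon> y * G y\<bar> \<le> (M * B + L) * norm (x - y)" for x y
    proof (cases "x \<in> convex hull S \<or> y \<in> convex hull S")
      case True
      then show ?thesis using one[of x y] one[of y x] by (auto simp: abs_minus_commute norm_minus_commute)
    next
      case False
      then show ?thesis using cutoff_zero[OF e] M B L by simp
    qed
    show "x \<notin> convex hull S \<Longrightarrow> cutoff \<epsilon> x * G x = 0" for x using cutoff_zero[OF e] by simp
    have "AE x in lborel. \<forall>v\<in>S. x \<notin> {x. bary S v x = 0} \<and> x \<notin> {x. bary S v x = \<epsilon>}"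
      using AE_not_in[OF negligible_bary_level] by (intro AE_finite_allI) auto
    then show "AE x in lborel. ((\<lambda>x. cutoff \<epsilon> x * G x) has_derivative \<phi>' x) (at x)"
    proof eventually_elim
      case (elim x)
      then have "(cutoff \<epsilon> has_derivative (\<lambda>h. \<Sum>v\<in>S. slab_weight \<epsilon> v x * (bary_grad S v \<bullet> h))) (at x)"
        by (intro cutoff_has_derivative e) auto
      moreover have "(G has_derivative (\<lambda>h. g x \<bullet> h)) (at x)" using G by (simp add: C1_with_grad_def)
      ultimately show ?case unfolding \<phi>'_def by (rule has_derivative_mult)
    qed
    have [measurable]: "slab_weight \<epsilon> z \<in> borel_measurable borel" if "z \<in> S" for z using slab_weight_measurable that .
    have [measurable]: "G \<in> borel_measurable borel" "(\<lambda>x. g x \<bullet> e) \<in> borel_measurable borel" "cutoff \<epsilon> \<in> borel_measurable borel"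
      using cG cge cutoff_continuous[OF e] by (auto intro: borel_measurable_continuous_onI)
    show "(\<lambda>x. \<phi>' x e) \<in> borel_measurable borel" unfolding \<phi>'_def by measurable
  qed
  moreover have "(\<integral>x. \<phi>' x e \<partial>lborel) = (\<integral>x. cutoff \<epsilon> x * (g x \<bullet> e) \<partial>lborel) + (\<Sum>z\<in>S. (bary_grad S z \<bullet> e) * slab_integral \<epsilon> z G)"
  proof -
    have "\<phi>' x e = cutoff \<epsilon> x * (g x \<bullet> e) + (\<Sum>z\<in>S. (bary_grad S z \<bullet> e) * (slab_weight \<epsilon> z x * G x))" for x
      by (simp add: \<phi>'_def sum_distrib_right sum_distrib_left mult_ac)
    then show ?thesis unfolding slab_integral_def
      using cutoff_integrable[OF e cge] slab_integrable[OF e _ cG(1)] by (simp add: integral_sum)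
  qed
  ultimately show ?thesis by simp
qed

lemma cutoff_tendsto:
  assumes f: "continuous_on UNIV f"
  shows "(\<lambda>n. \<integral>x. cutoff (1 / real (Suc n)) x * f x \<partial>lborel) \<longlonglongrightarrow> (LINT x:interior (convex hull S)|lborel. f x)"
  unfolding set_lebesgue_integral_def
proof (rule integral_dominated_convergence[where w="\<lambda>x. indicator (convex hull S) x * \<bar>f x\<bar>"])
  have [measurable]: "f \<in> borel_measurable borel" using f by (rule borel_measurable_continuous_onI)
  have [measurable]: "convex hull S \<in> sets borel" by (simp add: borel_closed compact_imp_closed)
  show "(\<lambda>x. indicator (interior (convex hull S)) x *\<^sub>R f x) \<in> borel_measurable lborel" by measurable
  show "(\<lambda>x. cutoff (1 / real (Suc n)) x * f x) \<in> borel_measurable lborel" for n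
    using borel_measurable_integrable[OF cutoff_integrable[OF _ f, of "1 / real (Suc n)"]] by simp
  obtain B where B: "0 < B" "\<And>x. x \<in> convex hull S \<Longrightarrow> \<bar>f x\<bar> \<le> B"
    using continuous_bounded_on_hull[OF f] by auto
  show "integrable lborel (\<lambda>x. indicator (convex hull S) x * \<bar>f x\<bar>)"
    by (rule integrable_lborel_bounded_support[OF _ bounded_hull, of _ B]) (use B(2) in auto)
  show "AE x in lborel. norm (cutoff (1 / real (Suc n)) x * f x) \<le> indicator (convex hull S) x * \<bar>f x\<bar>" for n
  proof (rule AE_I2)
    fix x
    show "norm (cutoff (1 / real (Suc n)) x * f x) \<le> indicator (convex hull S) x * \<bar>f x\<bar>"
      using cutoff_zero[of "1 / real (Suc n)" x] cutoff_bounds[of "1 / real (Suc n)" x]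
      by (cases "x \<in> convex hull S") (auto simp: abs_mult intro!: mult_left_le_one_le)
  qed
  show "AE x in lborel. (\<lambda>n. cutoff (1 / real (Suc n)) x * f x) \<longlonglongrightarrow> indicator (interior (convex hull S)) x *\<^sub>R f x"
  proof (rule AE_I2)
    fix x
    show "(\<lambda>n. cutoff (1 / real (Suc n)) x * f x) \<longlonglongrightarrow> indicator (interior (convex hull S)) x *\<^sub>R f x"
    proof (cases "x \<in> interior (convex hull S)")
      case True
      then have pos: "0 < bary S v x" if "v \<in> S" for v using that interior_iff by blast
      have "\<forall>v\<in>S. \<forall>\<^sub>F n in sequentially. clamp01 (bary S v x / (1 / real (Suc n))) = 1"
      proof
        fix v assume v: "v \<in> S"
        obtain N where N: "inverse (real (Suc N)) < bary S v x" using reals_Archimedean[OF pos[OF v]] by blast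
        show "\<forall>\<^sub>F n in sequentially. clamp01 (bary S v x / (1 / real (Suc n))) = 1"
        proof (rule eventually_sequentiallyI[of N])
          fix n assume "N \<le> n"
          have "1 < bary S v x * real (Suc N)" using N by (simp add: field_simps)
          also have "\<dots> \<le> bary S v x * real (Suc n)" using \<open>N \<le> n\<close> pos[OF v] by (intro mult_left_mono) auto
          finally show "clamp01 (bary S v x / (1 / real (Suc n))) = 1" by (simp add: clamp01_def del: of_nat_Suc)
        qed
      qed
      then have "\<forall>\<^sub>F n in sequentially. \<forall>v\<in>S. clamp01 (bary S v x / (1 / real (Suc n))) = 1"
        by (simp add: eventually_ball_finite)
      then have "\<forall>\<^sub>F n in sequentially. cutoff (1 / real (Suc n)) x * f x = indicator (interior (convex hull S)) x *\<^sub>R f x"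
        by eventually_elim (use True in \<open>simp add: cutoff_def del: of_nat_Suc\<close>)
      then show ?thesis by (rule tendsto_eventually)
    next
      case False
      then obtain v where v: "v \<in> S" "bary S v x \<le> 0" using interior_iff by (force simp: not_less)
      have "cutoff (1 / real (Suc n)) x = 0" for n
        unfolding cutoff_def using v clamp01_pos_iff[of "bary S v x / (1 / real (Suc n))"]
        by (intro prod_zero) (auto simp: zero_less_mult_iff intro!: bexI[of _ v])
      then show ?thesis using False by simp
    qed
  qed
qed

text \<open>On the slab the weight is at most \<open>1 / \<epsilon>\<close> and the function at most
  \<open>L * \<epsilon>\<close>, so the integrand is bounded by \<open>L\<close>; at each point it
  is eventually zero. Dominated convergence thus replaces any estimate of the volume of the
  slab.\<close>

lemma slab_tendsto_zero:
  assumes f: "continuous_on UNIV f" and z: "z \<in> S" and L: "0 \<le> L" "\<And>x. x \<in> convex hull S \<Longrightarrow> \<bar>f x\<bar> \<le> L * bary S z x"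
  shows "(\<lambda>n. slab_integral (1 / real (Suc n)) z f) \<longlonglongrightarrow> 0"
proof -
  have "(\<lambda>n. \<integral>x. slab_weight (1 / real (Suc n)) z x * f x \<partial>lborel) \<longlonglongrightarrow> (\<integral>x. 0 \<partial>(lborel :: 'a measure))"
  proof (rule integral_dominated_convergence[where w="\<lambda>x. indicator (convex hull S) x * L"])
    show "(\<lambda>x. slab_weight (1 / real (Suc n)) z x * f x) \<in> borel_measurable lborel" for n
      using borel_measurable_integrable[OF slab_integrable[OF _ z f, of "1 / real (Suc n)"]] by simp
    show "integrable lborel (\<lambda>x. indicator (convex hull S) x * L)"
      by (rule integrable_lborel_bounded_support[OF _ bounded_hull, of _ L])
        (use L(1) in \<open>auto intro!: borel_measurable_times borel_measurable_indicator borel_closed compact_imp_closed\<close>)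
    have bnd: "norm (slab_weight (1 / real (Suc n)) z x * f x) \<le> indicator (convex hull S) x * L" for n x
    proof (cases "slab_weight (1 / real (Suc n)) z x = 0")
      case False
      note * = slab_weight_nonzero[OF _ False z]
      have "0 \<le> slab_weight (1 / real (Suc n)) z x" "slab_weight (1 / real (Suc n)) z x \<le> real (Suc n)"
        using slab_weight_bounds[of "1 / real (Suc n)" z x] by auto
      moreover have "x \<in> convex hull S" using *(3) by simp
      ultimately have "norm (slab_weight (1 / real (Suc n)) z x * f x) \<le> real (Suc n) * (L * bary S z x)"
        unfolding real_norm_def abs_mult using L(2)[of x] by (intro mult_mono) auto

      also have "\<dots> = L * (real (Suc n) * bary S z x)" by (simp only: mult_ac)
      also have "\<dots> \<le> L * 1" using * L(1) by (intro mult_left_mono) (auto simp: field_simps)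
      finally show ?thesis using * by simp
    qed (use L(1) in simp)
    then show "AE x in lborel. norm (slab_weight (1 / real (Suc n)) z x * f x) \<le> indicator (convex hull S) x * L" for n by simp
    show "AE x in lborel. (\<lambda>n. slab_weight (1 / real (Suc n)) z x * f x) \<longlonglongrightarrow> 0"
    proof (rule AE_I2)
      fix x
      have "\<forall>\<^sub>F n in sequentially. slab_weight (1 / real (Suc n)) z x * f x = 0"
      proof (cases "0 < bary S z x")
        case True
        obtain N where N: "inverse (real (Suc N)) < bary S z x" using reals_Archimedean[OF True] by blast
        show ?thesis
        proof (rule eventually_sequentiallyI[of N])
          fix n assume "N \<le> n"
          then have "1 / real (Suc n) \<le> 1 / real (Suc N)" by (intro divide_left_mono) auto
          then show "slab_weight (1 / real (Suc n)) z x * f x = 0"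
            using N by (simp add: slab_weight_def inverse_eq_divide)
        qed
      qed (simp add: slab_weight_def)
      then show "(\<lambda>n. slab_weight (1 / real (Suc n)) z x * f x) \<longlonglongrightarrow> 0" by (rule tendsto_eventually)
    qed
  qed simp
  then show ?thesis by (simp add: slab_integral_def)
qed

text \<open>The line from \<open>z\<close> through \<open>x\<close> is continued to the opposite
  facet. At \<open>x = z\<close> this line is undefined and any vertex of the facet will do.\<close>

lemma radial_projection:
  assumes z: "z \<in> S" and x: "x \<in> convex hull S"
  obtains y where "y \<in> convex hull (S - {z})" "x = (1 - bary S z x) *\<^sub>R y + bary S z x *\<^sub>R z"
proof (cases "bary S z x = 1")
  case True
  have "bary S v x = 0" if "v \<in> S - {z}" for v
  proof -
    have "(\<Sum>v\<in>S-{z}. bary S v x) = 0" using bary_sum[of x] z True by (simp add: sum.remove)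
    then show ?thesis using that hull_iff[of x] x by (subst (asm) sum_nonneg_eq_0_iff) auto
  qed
  then have "x = z" using bary_comb[of x] z True by (simp add: sum.remove)
  moreover obtain v where "v \<in> S" "v \<noteq> z" by (rule other_vertex)
  ultimately show thesis using that[of v] True by (auto simp: hull_inc)
next
  case False
  define b where "b = bary S z x"
  have b: "0 \<le> b" "b \<le> 1" "b \<noteq> 1" using bary_bounds[OF x z] False by (auto simp: b_def)
  define y where "y = (1 - - (b / (1 - b))) *\<^sub>R x + (- (b / (1 - b))) *\<^sub>R z"
  have eq: "1 + b / (1 - b) = 1 / (1 - b)" using b by (simp add: field_simps)
  have yz: "bary S z y = 0"
    unfolding y_def bary_segment[OF z] using bary_vertex[OF z z] eq b by (simp add: b_def[symmetric])
  have "0 \<le> bary S v y" if "v \<in> S" for v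
  proof (cases "v = z")
    case False': False
    have "bary S v y = (1 / (1 - b)) * bary S v x"
      unfolding y_def bary_segment[OF that] using bary_vertex[OF that z] eq False' by simp
    then show ?thesis using that hull_iff[of x] x b by simp
  qed (use yz in simp)
  then have "y \<in> convex hull (S - {z})" using facet_iff[OF z] hull_iff[of y] yz by simp
  moreover have "(1 - b) * (b / (1 - b)) = b" "(1 - b) * (1 + b / (1 - b)) = 1" using b by (simp_all add: eq)
  then have "(1 - b) *\<^sub>R y = x - b *\<^sub>R z" unfolding y_def by (simp add: scaleR_diff_right)
  ultimately show thesis using that[of y] by (simp add: b_def)
qed

lemma lipschitz_vanishing_on_facet:
  assumes lip: "0 \<le> L" "\<And>x y. x \<in> convex hull S \<Longrightarrow> y \<in> convex hull S \<Longrightarrow> \<bar>f x - f y\<bar> \<le> L * norm (x - y)"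
    and z: "z \<in> S" and van: "\<And>y. y \<in> convex hull (S - {z}) \<Longrightarrow> f y = (0::real)" and x: "x \<in> convex hull S"
  shows "\<bar>f x\<bar> \<le> (L * diameter (convex hull S)) * bary S z x"
proof -
  define b where "b = bary S z x"
  have b: "0 \<le> b" using bary_bounds[OF x z] by (auto simp: b_def)
  obtain y where y: "y \<in> convex hull (S - {z})" "x = (1 - b) *\<^sub>R y + b *\<^sub>R z"
    using radial_projection[OF z x] unfolding b_def by blast
  then have yS: "y \<in> convex hull S" using hull_mono[of "S - {z}" S] by blast
  have "x - y = b *\<^sub>R (z - y)" unfolding y(2) by (simp add: algebra_simps)
  then have "norm (x - y) = b * dist z y" using b by (simp add: dist_norm)
  also have "\<dots> \<le> b * diameter (convex hull S)"
    using b z yS by (intro mult_left_mono diameter_bounded_bound bounded_hull) (auto simp: hull_inc)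
  finally have n: "norm (x - y) \<le> b * diameter (convex hull S)" .
  have "\<bar>f x - f y\<bar> \<le> L * norm (x - y)" using lip(2) x yS by blast
  also have "\<dots> \<le> L * (b * diameter (convex hull S))" using n lip(1) by (intro mult_left_mono) auto
  finally show ?thesis using van[OF y(1)] by (simp add: b_def mult_ac)
qed

lemma slab_tendsto_zero_C1:
  assumes f: "C1_with_grad f g" and z: "z \<in> S" and van: "\<And>y. y \<in> convex hull (S - {z}) \<Longrightarrow> f y = 0"
  shows "(\<lambda>n. slab_integral (1 / real (Suc n)) z f) \<longlonglongrightarrow> 0"
proof -
  obtain L where L: "0 \<le> L" "\<And>x y. x \<in> convex hull S \<Longrightarrow> y \<in> convex hull S \<Longrightarrow> \<bar>f x - f y\<bar> \<le> L * norm (x - y)"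
    using C1_lipschitz_on_compact_convex[OF f compact_hull] by auto
  show ?thesis
  proof (rule slab_tendsto_zero[OF C1_continuous[OF f] z])
    show "0 \<le> L * diameter (convex hull S)" using L diameter_pos by simp
  qed (rule lipschitz_vanishing_on_facet[OF L z van])
qed

end

section \<open>Divergence theorem on a conforming mesh\<close>

lemma det_rank_one_aux:
  fixes u v :: "real^'n"
  assumes "finite J" "k \<notin> J"
  shows "det (\<chi> i. if i = k then v else if i \<in> J then axis i 1 + u $ i *s v else axis i 1 :: real^'n^'n) = v $ k"
  using assms
proof (induction J rule: finite_induct)
  case empty
  have v: "(\<Sum>i\<in>UNIV. v $ i *s row i (mat 1 :: real^'n^'n)) = v"
    by (simp add: vec_eq_iff row_def mat_def if_distrib[of "\<lambda>c. _ * c"] cong: if_cong)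
  have "det (\<chi> i. if i = k then (\<Sum>i\<in>UNIV. v $ i *s row i (mat 1)) else row i (mat 1 :: real^'n^'n)) = v $ k"
    by (simp add: cramer_lemma_transpose)
  moreover have "row i (mat 1 :: real^'n^'n) = axis i 1" for i
    by (simp add: row_def mat_def axis_def vec_eq_iff eq_commute)
  ultimately show ?case unfolding v by (simp cong: if_cong)
next
  case (insert l J)
  let ?A = "\<chi> i. if i = k then v else if i \<in> J then axis i 1 + u $ i *s v else axis i 1 :: real^'n^'n"
  have "(\<chi> i. if i = k then v else if i \<in> insert l J then axis i 1 + u $ i *s v else axis i 1 :: real^'n^'n)
     = (\<chi> i. if i = l then row l ?A + u $ l *s row k ?A else row i ?A)"
    using insert by (auto simp: vec_eq_iff row_def)
  then show ?case using det_row_operation[of l k ?A "u $ l"] insert by auto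
qed

text \<open>The rows are perturbed one at a time. Linearity in row \<open>k\<close> splits off a
  determinant with \<open>v\<close> as its \<open>k\<close>-th row; subtracting multiples of that
  row removes the other perturbations, so it equals \<open>v $ k\<close>.\<close>

lemma det_rank_one:
  fixes u v :: "real^'n"
  shows "det (\<chi> i. axis i 1 + u $ i *s v :: real^'n^'n) = 1 + u \<bullet> v"
proof -
  have "det (\<chi> i. if i \<in> J then axis i 1 + u $ i *s v else axis i 1 :: real^'n^'n) = 1 + (\<Sum>i\<in>J. u $ i * v $ i)"
    if "finite J" for J
    using that
  proof (induction J rule: finite_induct)
    case empty
    have "(\<chi> i. axis i 1) = (mat 1 :: real^'n^'n)" by (simp add: mat_def axis_def vec_eq_iff eq_commute)
    then show ?case by simp
  next
    case (insert k J)
    let ?B = "\<lambda>i. if i \<in> J then axis i 1 + u $ i *s v else axis i 1 :: real^'n"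
    have "(\<chi> i. if i \<in> insert k J then axis i 1 + u $ i *s v else axis i 1 :: real^'n^'n)
      = (\<chi> i. if i = k then axis i 1 + u $ i *s v else ?B i)" by (auto simp: vec_eq_iff)
    then have "det (\<chi> i. if i \<in> insert k J then axis i 1 + u $ i *s v else axis i 1 :: real^'n^'n)
      = det (\<chi> i. if i = k then axis i 1 else ?B i :: real^'n^'n) + det (\<chi> i. if i = k then u $ i *s v else ?B i)"
      by (simp add: det_row_add)
    also have "(\<chi> i. if i = k then axis i 1 else ?B i :: real^'n^'n) = (\<chi> i. ?B i)"
      using insert by (auto simp: vec_eq_iff)
    also have "det (\<chi> i. if i = k then u $ i *s v else ?B i) = u $ k * det (\<chi> i. if i = k then v else ?B i)"
      using det_row_mul[of k "u $ k" "\<lambda>i. v" ?B] by (simp cong: if_cong)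
    also have "det (\<chi> i. if i = k then v else ?B i :: real^'n^'n) = v $ k"
      using det_rank_one_aux[OF insert(1,2)] by simp
    finally show ?case using insert by simp
  qed
  from this[OF finite_class.finite_UNIV] show ?thesis by (simp add: inner_vec_def)
qed

section \<open>Transport of slab integrals across a shared facet\<close>

locale facet_pair_cart = facet_pair S S' z z'
  for S S' :: "(real^'n::{finite,wellorder}) set" and z z'
begin

lemma flip_alt: "flip x = x + (bary S z 0 + bary_grad S z \<bullet> x) *\<^sub>R (z' - z)"
  unfolding flip_def S.bary_eq[OF z, of x] by (rule refl)

lemma flip_has_derivative: "(flip has_derivative (\<lambda>h. h + (bary_grad S z \<bullet> h) *\<^sub>R (z' - z))) (at x within A)"
proof -
  have "flip = (\<lambda>x. x + (bary S z 0 + bary_grad S z \<bullet> x) *\<^sub>R (z' - z))" using flip_alt by blast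
  moreover have "((\<lambda>x. x + (bary S z 0 + bary_grad S z \<bullet> x) *\<^sub>R (z' - z)) has_derivative
      (\<lambda>h. h + (bary_grad S z \<bullet> h) *\<^sub>R (z' - z))) (at x within A)"
    by (auto intro!: derivative_eq_intros)
  ultimately show ?thesis by simp
qed

lemma det_flip: "det (matrix (\<lambda>h. h + (bary_grad S z \<bullet> h) *\<^sub>R (z' - z))) = bary S z z'"
proof -
  have "matrix (\<lambda>h. h + (bary_grad S z \<bullet> h) *\<^sub>R (z' - z)) = (\<chi> i. axis i 1 + (z' - z) $ i *s bary_grad S z)"
    by (simp add: matrix_def vec_eq_iff inner_axis) (simp add: axis_def eq_commute algebra_simps)

  then have "det (matrix (\<lambda>h. h + (bary_grad S z \<bullet> h) *\<^sub>R (z' - z))) = 1 + (z' - z) \<bullet> bary_grad S z"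
    by (simp only: det_rank_one)

  also have "\<dots> = bary S z z'" using S.bary_diff[OF z, of z' z] S.bary_vertex[OF z z] by (simp add: inner_commute)
  finally show ?thesis .
qed

lemma inj_flip: "inj flip"
proof (rule injI)
  fix x y assume eq: "flip x = flip y"
  have "bary S z x = bary S z y" using bary_flip(1)[of x] bary_flip(1)[of y] eq by simp
  then show "x = y" using eq unfolding flip_def by simp
qed

lemma surj_flip: "surj flip"
proof -
  have "\<exists>y. x = flip y" for x
  proof -
    define y where "y = x - (bary S' z' x) *\<^sub>R (z' - z)"
    have "bary S z y = bary S z x - bary S' z' x * (bary S z z' - 1)"
      using S.bary_diff[OF z, of y x] S.bary_diff[OF z, of z' z] S.bary_vertex[OF z z] unfolding y_def by simp
    also have "\<dots> = bary S' z' x" using bary_scale[of x] by (simp add: algebra_simps)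
    finally have "flip y = x" unfolding flip_def y_def by simp
    then show ?thesis by metis
  qed
  then show ?thesis unfolding surj_def by blast
qed

lemma slab_weight_flip: "S'.slab_weight \<epsilon> z' (flip x) = S.slab_weight \<epsilon> z x"
proof -
  have "(\<Prod>v\<in>S'-{z'}. clamp01 (bary S' v (flip x) / \<epsilon>)) = (\<Prod>v\<in>S-{z}. clamp01 (bary S v x / \<epsilon>))"
    unfolding common[symmetric] by (intro prod.cong refl) (simp add: bary_flip(2))
  then show ?thesis unfolding S.slab_weight_def S'.slab_weight_def bary_flip(1) by simp
qed

lemma continuous_flip: "continuous_on A flip"
  using flip_has_derivative by (meson has_derivative_continuous_on)

text \<open>The affine bijection \<open>flip\<close> carries one slab weight into the other, and its
  Jacobian determinant is the height ratio \<open>bary S z z'\<close>. This is the exact counterpart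
  of both elements seeing the same area on their common facet.\<close>

lemma slab_integral_flip:
  assumes e: "\<epsilon> > 0" and f: "continuous_on UNIV f"
  shows "S'.slab_integral \<epsilon> z' f = \<bar>bary S z z'\<bar> * S.slab_integral \<epsilon> z (f \<circ> flip)"
proof -
  \<comment> \<open>The change of variables is applied to vector-valued integrands, so the scalar
    integrand is copied into every component and read off again afterwards.\<close>
  define F :: "(real, 'n) vec \<Rightarrow> (real, 'n) vec" where "F x = (\<chi> i. S'.slab_weight \<epsilon> z' x * f x)" for x
  let ?h = "\<lambda>x. S.slab_weight \<epsilon> z x * (f \<circ> flip) x"
  have int': "integrable lborel (\<lambda>x. S'.slab_weight \<epsilon> z' x * f x)" by (rule S'.slab_integrable[OF e z' f])
  have int: "integrable lborel ?h"
    using f continuous_flip by (intro S.slab_integrable[OF e z] continuous_on_compose) (auto intro: continuous_on_subset)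
  have c: "integral UNIV (\<lambda>x. F x $ k) = S'.slab_integral \<epsilon> z' f" for k
    unfolding F_def S'.slab_integral_def using integral_lborel[OF int'] by simp
  have ai: "(\<lambda>x. S'.slab_weight \<epsilon> z' x * f x) absolutely_integrable_on UNIV"
    using integrable_completion[of "\<lambda>x. S'.slab_weight \<epsilon> z' x * f x" lborel] int'
    by (simp add: set_integrable_def borel_measurable_integrable)
  have F: "F absolutely_integrable_on UNIV"
    by (subst absolutely_integrable_componentwise_iff) (auto simp: F_def Basis_vec_def inner_axis ai)
  have "integral (range flip) F = integral UNIV (\<lambda>x. \<bar>det (matrix (\<lambda>h. h + (bary_grad S z \<bullet> h) *\<^sub>R (z' - z)))\<bar> *\<^sub>R F (flip x))"
    by (rule integral_change_of_variables) (use flip_has_derivative inj_flip F surj_flip in auto)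
  then have eq: "integral UNIV F = integral UNIV (\<lambda>x. \<bar>bary S z z'\<bar> *\<^sub>R F (flip x))"
    by (simp add: surj_flip det_flip)
  have "integral UNIV F $ k = integral UNIV (\<lambda>x. F x $ k)" for k
    using F by (simp add: absolutely_integrable_on_def)
  moreover have "integral UNIV (\<lambda>x. \<bar>bary S z z'\<bar> *\<^sub>R F (flip x)) $ k = integral UNIV (\<lambda>x. \<bar>bary S z z'\<bar> * ?h x)" for k
  proof -
    have "?h absolutely_integrable_on UNIV"
      using integrable_completion[of ?h lborel] int by (simp add: set_integrable_def borel_measurable_integrable)
    then have "?h integrable_on UNIV" by (simp add: absolutely_integrable_on_def)
    then have "(\<lambda>x. \<bar>bary S z z'\<bar> * ?h x) integrable_on UNIV" by (rule integrable_on_mult_right)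
    moreover have Fk: "(\<lambda>x. \<bar>bary S z z'\<bar> *\<^sub>R F (flip x)) = (\<lambda>x. \<chi> i. \<bar>bary S z z'\<bar> * ?h x)"
      by (simp add: F_def slab_weight_flip vec_eq_iff fun_eq_iff)
    moreover have "(\<lambda>x. (\<chi> i. \<bar>bary S z z'\<bar> * ?h x) :: (real, 'n) vec) integrable_on UNIV"

      by (subst integrable_componentwise_iff) (use calculation(1) in \<open>auto simp: Basis_vec_def inner_axis\<close>)
    ultimately show ?thesis by (simp flip: integral_component_eq_cart)
  qed
  moreover have "integral UNIV (\<lambda>x. \<bar>bary S z z'\<bar> * ?h x) = \<bar>bary S z z'\<bar> * S.slab_integral \<epsilon> z (f \<circ> flip)"
    unfolding S.slab_integral_def using integral_lborel[OF int] by simp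
  ultimately show ?thesis using eq c by metis
qed

text \<open>Transporting the far slab by \<open>flip\<close> leaves a single slab integral, of
  \<open>G\<close> minus a multiple of \<open>G'\<close> composed with \<open>flip\<close>. Since
  \<open>flip\<close> fixes the common facet, this function vanishes there, and being C1 it vanishes
  to first order in the distance from the facet.\<close>

lemma slab_cancel:
  assumes neg: "bary S z z' < 0"
    and G: "C1_with_grad G g" and G': "C1_with_grad G' g'"
    and agree: "\<And>y. y \<in> convex hull (S - {z}) \<Longrightarrow> G y = (- bary S z z') * G' y"
  shows "(\<lambda>n. S.slab_integral (1 / real (Suc n)) z G - S'.slab_integral (1 / real (Suc n)) z' G') \<longlonglongrightarrow> 0"
proof -
  define c where "c = - bary S z z'"
  define f where "f x = G x - G' (flip x) * c" for x
  define g2 where "g2 x = g' (flip x) + (g' (flip x) \<bullet> (z' - z)) *\<^sub>R bary_grad S z" for x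
  have "C1_with_grad (\<lambda>x. G' (flip x)) g2" unfolding C1_with_grad_def
  proof
    show "continuous_on UNIV g2" unfolding g2_def
      using G' by (intro continuous_intros continuous_on_compose2[OF _ continuous_flip]) (auto simp: C1_with_grad_def)
    have "((\<lambda>x. G' (flip x)) has_derivative (\<lambda>h. g' (flip x) \<bullet> (h + (bary_grad S z \<bullet> h) *\<^sub>R (z' - z)))) (at x)" for x
      by (rule has_derivative_compose[OF flip_has_derivative]) (use G' in \<open>simp add: C1_with_grad_def\<close>)
    moreover have "g' (flip x) \<bullet> (h + (bary_grad S z \<bullet> h) *\<^sub>R (z' - z)) = g2 x \<bullet> h" for x h
      by (simp add: g2_def inner_add_left inner_add_right)
    ultimately show "\<forall>x. ((\<lambda>x. G' (flip x)) has_derivative (\<lambda>h. g2 x \<bullet> h)) (at x)" by simp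
  qed
  then have f: "C1_with_grad f (\<lambda>x. g x - c *\<^sub>R g2 x)" unfolding f_def by (intro C1_diff G C1_cmult)
  have "f y = 0" if "y \<in> convex hull (S - {z})" for y
  proof -
    have "bary S z y = 0" using that S.facet_iff[OF z] by blast
    then show ?thesis using agree[OF that] by (simp add: f_def flip_def c_def)
  qed
  then have "(\<lambda>n. S.slab_integral (1 / real (Suc n)) z f) \<longlonglongrightarrow> 0"
    by (rule S.slab_tendsto_zero_C1[OF f z])
  moreover have "S.slab_integral (1 / real (Suc n)) z f
     = S.slab_integral (1 / real (Suc n)) z G - S'.slab_integral (1 / real (Suc n)) z' G'" for n
  proof -
    have e: "0 < 1 / real (Suc n)" by simp
    have cG: "continuous_on UNIV G" "continuous_on UNIV G'" using G G' C1_continuous by auto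
    have cf: "continuous_on UNIV (G' \<circ> flip)"
      using cG continuous_flip by (intro continuous_on_compose) (auto intro: continuous_on_subset)
    have "S.slab_integral (1 / real (Suc n)) z f
      = S.slab_integral (1 / real (Suc n)) z G - c * S.slab_integral (1 / real (Suc n)) z (G' \<circ> flip)"
      unfolding S.slab_integral_def f_def
      using S.slab_integrable[OF e z cG(1)] S.slab_integrable[OF e z cf]
      by (simp add: right_diff_distrib mult.assoc[symmetric] comp_def)
    then show ?thesis using slab_integral_flip[OF e cG(2)] neg by (simp add: c_def)
  qed
  ultimately show ?thesis by simp
qed

end

context full_simplex begin

text \<open>A vector \<open>h\<close> is the combination of the vertices with coefficients
  \<open>bary_grad S v \<bullet> h\<close>, which sum to zero. If \<open>d\<close> has the same
  inner product with all vertices but \<open>z\<close>, only the coefficient of \<open>z\<close>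
  remains in \<open>d \<bullet> h\<close>.\<close>

lemma orthogonal_to_facet:
  assumes z: "z \<in> S" and c: "\<And>v. v \<in> S - {z} \<Longrightarrow> d \<bullet> v = c"
  shows "\<exists>a. d = a *\<^sub>R bary_grad S z"
proof -
  have "d \<bullet> h = ((d \<bullet> z - c) *\<^sub>R bary_grad S z) \<bullet> h" for h
  proof -
    have "d \<bullet> h = d \<bullet> (\<Sum>v\<in>S. (bary_grad S v \<bullet> h) *\<^sub>R v)" by (simp add: bary_grad_comb)
    also have "\<dots> = (\<Sum>v\<in>S. (bary_grad S v \<bullet> h) * (d \<bullet> v))" by (simp add: inner_sum_right)
    also have "\<dots> = (bary_grad S z \<bullet> h) * (d \<bullet> z) + (\<Sum>v\<in>S-{z}. (bary_grad S v \<bullet> h) * (d \<bullet> v))"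
      using z by (simp add: sum.remove)
    also have "(\<Sum>v\<in>S-{z}. (bary_grad S v \<bullet> h) * (d \<bullet> v)) = (\<Sum>v\<in>S-{z}. (bary_grad S v \<bullet> h)) * c"
      by (simp add: sum_distrib_right c)
    also have "(\<Sum>v\<in>S-{z}. (bary_grad S v \<bullet> h)) = - (bary_grad S z \<bullet> h)"
    proof -
      have "(\<Sum>v\<in>S. bary_grad S v \<bullet> h) = 0" using sum_bary_grad by (simp flip: inner_sum_left)
      then show ?thesis using z by (simp add: sum.remove)
    qed
    finally show ?thesis by (simp add: algebra_simps)
  qed
  then have "d = (d \<bullet> z - c) *\<^sub>R bary_grad S z" by (metis vector_eq_rdot)
  then show ?thesis by blast
qed

text \<open>The derivatives towards the vertices of the facet vanish; a one-sided limit is taken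
  because \<open>y\<close> may lie on the relative boundary of the facet.\<close>

lemma gradient_normal_on_facet:
  assumes f: "C1_with_grad f d" and z: "z \<in> S" and van: "\<And>y. y \<in> convex hull (S - {z}) \<Longrightarrow> f y = 0"
    and y: "y \<in> convex hull (S - {z})"
  shows "\<exists>a. d y = a *\<^sub>R bary_grad S z"
proof -
  have dir: "d y \<bullet> (v - y) = 0" if v: "v \<in> S - {z}" for v
  proof -
    have "((\<lambda>t::real. y + t *\<^sub>R (v - y)) has_derivative (\<lambda>t. t *\<^sub>R (v - y))) (at 0)" by (auto intro!: derivative_eq_intros)
    moreover have "(f has_derivative (\<lambda>h. d y \<bullet> h)) (at (y + (0::real) *\<^sub>R (v - y)))"
      using f by (simp add: C1_with_grad_def)
    ultimately have "((\<lambda>t. f (y + t *\<^sub>R (v - y))) has_derivative (\<lambda>t. d y \<bullet> (t *\<^sub>R (v - y)))) (at 0)"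
      by (rule has_derivative_compose)
    then have "((\<lambda>t. f (y + t *\<^sub>R (v - y))) has_field_derivative (d y \<bullet> (v - y))) (at 0)"
      by (simp add: has_field_derivative_def mult.commute[of _ "d y \<bullet> (v - y)"] flip: inner_scaleR_right)
        (simp add: mult_commute_abs)
    then have "((\<lambda>t. (f (y + t *\<^sub>R (v - y)) - f y) / t) \<longlongrightarrow> d y \<bullet> (v - y)) (at 0)"
      using DERIV_def[of "\<lambda>t. f (y + t *\<^sub>R (v - y))" "d y \<bullet> (v - y)" 0] by simp
    then have "((\<lambda>t. (f (y + t *\<^sub>R (v - y)) - f y) / t) \<longlongrightarrow> d y \<bullet> (v - y)) (at_right 0)"
      by (rule tendsto_mono[OF at_le[OF subset_UNIV]])
    moreover have "\<forall>\<^sub>F t in at_right 0. (f (y + t *\<^sub>R (v - y)) - f y) / t = 0"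
    proof -
      have "\<forall>\<^sub>F t in at_right 0. t \<in> {0<..<(1::real)}" by (rule eventually_at_right_real) simp
      then show ?thesis
      proof eventually_elim
        case (elim t)
        have "y + t *\<^sub>R (v - y) = (1 - t) *\<^sub>R y + t *\<^sub>R v" by (simp add: algebra_simps)
        then have "y + t *\<^sub>R (v - y) \<in> convex hull (S - {z})"
          using elim y v by (simp add: convexD_alt[OF convex_convex_hull] hull_inc)
        then show ?case using van y by simp
      qed
    qed
    then have "((\<lambda>t. (f (y + t *\<^sub>R (v - y)) - f y) / t) \<longlongrightarrow> 0) (at_right 0)" by (rule tendsto_eventually)
    ultimately show ?thesis by (intro tendsto_unique[OF trivial_limit_at_right_real])
  qed
  then have "d y \<bullet> v = d y \<bullet> y" if "v \<in> S - {z}" for v using that by (simp add: inner_diff_right)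
  then show ?thesis by (rule orthogonal_to_facet[OF z])
qed

lemma slab_integral_minus: "slab_integral \<epsilon> z (\<lambda>x. - f x) = - slab_integral \<epsilon> z f"
  unfolding slab_integral_def by simp

end

locale mesh_cart = mesh \<Omega> \<T> for \<Omega> :: "(real^'n::{finite,wellorder}) set" and \<T>
begin

definition opposite_facet :: "((real,'n) vec) set \<times> ((real,'n) vec) \<Rightarrow> ((real,'n) vec) set" where
  "opposite_facet p = convex hull (verts (fst p) - {snd p})"

lemma opposite_facet_of: "K \<in> \<T> \<Longrightarrow> z \<in> verts K \<Longrightarrow> opposite_facet (K, z) facet_of K"
  using full_simplex.facet_of_hull_iff[OF elem(1)] elem(2) unfolding opposite_facet_def by (metis fst_conv snd_conv)

lemma opposite_facet_unique:
  assumes "K \<in> \<T>" "z \<in> verts K" "w \<in> verts K" "opposite_facet (K, z) = opposite_facet (K, w)" shows "z = w"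
  using full_simplex.opposite_vertex_unique[OF elem(1)[OF assms(1)]] assms(2-4) by (auto simp: opposite_facet_def)

text \<open>The Gauss formulas produce a sum over pairs of an element and one of its vertices,
  whereas cancellation happens facet by facet. Regrouping by the opposite facet gives fibres of one
  pair, on the boundary, or of two.\<close>

lemma facet_fiber:
  assumes K: "K \<in> \<T>" "z \<in> verts K"
  defines "A \<equiv> {p \<in> Sigma \<T> verts. opposite_facet p = opposite_facet (K, z)}"
  obtains (boundary) "A = {(K, z)}" "opposite_facet (K, z) \<subseteq> frontier \<Omega>"
    | (interior) K' z' where "A = {(K, z), (K', z')}" "K' \<in> \<T>" "K' \<noteq> K" "z' \<in> verts K'"
        "facet_pair (verts K) (verts K') z z'" "bary (verts K) z z' < 0"
proof (cases "\<exists>K'\<in>\<T>. K' \<noteq> K \<and> opposite_facet (K, z) facet_of K'")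
  case False
  have "A = {(K, z)}"
  proof
    show "A \<subseteq> {(K, z)}"
    proof
      fix p assume p: "p \<in> A"
      obtain L w where Lw: "p = (L, w)" by force
      then have L: "L \<in> \<T>" "w \<in> verts L" "opposite_facet (L, w) = opposite_facet (K, z)" using p by (auto simp: A_def)
      then have "L = K" using False opposite_facet_of[OF L(1,2)] by auto
      then show "p \<in> {(K, z)}" using opposite_facet_unique[OF K(1)] L K Lw by auto
    qed
  qed (use K in \<open>auto simp: A_def\<close>)
  moreover have "opposite_facet (K, z) \<subseteq> frontier \<Omega>"
    using unshared_boundary[OF K(1) opposite_facet_of[OF K]] False by blast
  ultimately show thesis by (rule boundary)
next
  case True
  then obtain K' where K': "K' \<in> \<T>" "K' \<noteq> K" "opposite_facet (K, z) facet_of K'" by auto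
  obtain w z' where fp: "facet_pair (verts K) (verts K') w z'" "opposite_facet (K, z) = convex hull (verts K - {w})"
    "bary (verts K) w z' < 0" using facet_shared[OF K(1) K'(1) K'(2)[symmetric] opposite_facet_of[OF K] K'(3)] by metis
  interpret fp: facet_pair "verts K" "verts K'" w z' by fact
  have w: "w = z" using opposite_facet_unique[OF K(1) K(2) fp.z] fp(2) by (simp add: opposite_facet_def)
  have eq: "opposite_facet (K', z') = opposite_facet (K, z)"
    using fp(2) fp.common by (simp add: opposite_facet_def)
  have "A = {(K, z), (K', z')}"
  proof
    show "A \<subseteq> {(K, z), (K', z')}"
    proof
      fix p assume p: "p \<in> A"
      obtain L u where Lw: "p = (L, u)" by force
      then have L: "L \<in> \<T>" "u \<in> verts L" "opposite_facet (L, u) = opposite_facet (K, z)" using p by (auto simp: A_def)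
      then have "L = K \<or> L = K'"
        using facet_shared_by_two[OF K(1) K'(1) L(1) opposite_facet_of[OF K] K'(3)] opposite_facet_of[OF L(1,2)] K'(2) by auto
      then show "p \<in> {(K, z), (K', z')}"
        using opposite_facet_unique[OF K(1)] opposite_facet_unique[OF K'(1)] L K Lw eq fp.z' by auto
    qed
  qed (use K K'(1) fp.z' eq in \<open>auto simp: A_def\<close>)
  then show thesis using interior K' fp fp.z' w by blast
qed

text \<open>Sum the cut-off Gauss formula over all elements. The slab integrals of the two sides of an
  interior facet cancel in the limit, since the affine flip identifies them.\<close>

lemma mesh_divergence_zero:
  fixes G :: "((real,'n) vec) set \<Rightarrow> 'n \<Rightarrow> (real,'n) vec \<Rightarrow> real" and g :: "((real,'n) vec) set \<Rightarrow> 'n \<Rightarrow> (real,'n) vec \<Rightarrow> (real,'n) vec"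
  assumes C1: "\<And>K i. K \<in> \<T> \<Longrightarrow> C1_with_grad (G K i) (g K i)"
    and inner: "\<And>K K' z z' y. \<lbrakk>K \<in> \<T>; K' \<in> \<T>; K \<noteq> K'; facet_pair (verts K) (verts K') z z';
        y \<in> convex hull (verts K - {z})\<rbrakk>
      \<Longrightarrow> (\<Sum>i\<in>UNIV. bary_grad (verts K) z $ i * G K i y) = (\<Sum>i\<in>UNIV. bary_grad (verts K) z $ i * G K' i y)"
    and bdry: "\<And>K z y. \<lbrakk>K \<in> \<T>; z \<in> verts K; convex hull (verts K - {z}) \<subseteq> frontier \<Omega>;
        y \<in> convex hull (verts K - {z})\<rbrakk> \<Longrightarrow> (\<Sum>i\<in>UNIV. bary_grad (verts K) z $ i * G K i y) = 0"
  shows "(\<Sum>K\<in>\<T>. \<Sum>i\<in>UNIV. LINT x:interior K|lborel. g K i x $ i) = 0"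
proof -
  define N where "N = (\<lambda>(K, z) x. \<Sum>i\<in>UNIV. G K i x * bary_grad (verts K) z $ i)"
  define dN where "dN = (\<lambda>(K, z) x. \<Sum>i\<in>UNIV. bary_grad (verts K) z $ i *\<^sub>R g K i x)"
  define h where "h n p = full_simplex.slab_integral (verts (fst p)) (1 / real (Suc n)) (snd p) (N p)" for n p
  have C1N: "C1_with_grad (N p) (dN p)" if "p \<in> Sigma \<T> verts" for p
    using that unfolding N_def dN_def by (auto intro!: C1_sum C1_cmult C1)
  define I where "I n K = (\<Sum>i\<in>UNIV. \<integral>x. full_simplex.cutoff (verts K) (1 / real (Suc n)) x * g K i x $ i \<partial>lborel)" for n K
  have gauss: "I n K + (\<Sum>z\<in>verts K. h n (K, z)) = 0" if K: "K \<in> \<T>" for n K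
  proof -
    interpret full_simplex "verts K" using elem K by auto
    have e: "0 < 1 / real (Suc n)" by simp
    have "0 = (\<Sum>i\<in>UNIV. (\<integral>x. cutoff (1 / real (Suc n)) x * (g K i x \<bullet> axis i 1) \<partial>lborel)
       + (\<Sum>z\<in>verts K. (bary_grad (verts K) z \<bullet> axis i 1) * slab_integral (1 / real (Suc n)) z (G K i)))"
      using gauss_cutoff[OF e C1[OF K]] by simp
    also have "\<dots> = I n K + (\<Sum>z\<in>verts K. \<Sum>i\<in>UNIV. bary_grad (verts K) z $ i * slab_integral (1 / real (Suc n)) z (G K i))"
      unfolding I_def sum.distrib by (subst sum.swap) (simp add: inner_axis)
    also have "(\<Sum>z\<in>verts K. \<Sum>i\<in>UNIV. bary_grad (verts K) z $ i * slab_integral (1 / real (Suc n)) z (G K i))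
       = (\<Sum>z\<in>verts K. h n (K, z))"
    proof (rule sum.cong[OF refl])
      fix z assume z: "z \<in> verts K"
      have "h n (K, z) = (\<integral>x. (\<Sum>i\<in>UNIV. bary_grad (verts K) z $ i * (slab_weight (1 / real (Suc n)) z x * G K i x)) \<partial>lborel)"
      proof -
        have "h n (K, z) = slab_integral (1 / real (Suc n)) z (\<lambda>x. \<Sum>i\<in>UNIV. G K i x * bary_grad (verts K) z $ i)"
          by (simp add: h_def N_def)
        then show ?thesis unfolding slab_integral_def by (simp add: sum_distrib_left mult_ac)
      qed
      also have "\<dots> = (\<Sum>i\<in>UNIV. bary_grad (verts K) z $ i * slab_integral (1 / real (Suc n)) z (G K i))"
        unfolding slab_integral_def
        using slab_integrable[OF e z C1_continuous[OF C1[OF K]]] by (subst Bochner_Integration.integral_sum) auto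
      finally show "(\<Sum>i\<in>UNIV. bary_grad (verts K) z $ i * slab_integral (1 / real (Suc n)) z (G K i)) = h n (K, z)" by simp
    qed
    finally show ?thesis by simp
  qed
  have finP: "finite (Sigma \<T> verts)"
    using full_simplex.finite_S[OF elem(1)] by (intro finite_SigmaI) auto
  have "(\<lambda>n. \<Sum>p\<in>Sigma \<T> verts. h n p) \<longlonglongrightarrow> 0"
  proof -
    have "(\<lambda>n. \<Sum>p\<in>{p \<in> Sigma \<T> verts. opposite_facet p = F}. h n p) \<longlonglongrightarrow> 0" if F: "F \<in> opposite_facet ` Sigma \<T> verts" for F
    proof -
      obtain K z where Kz: "K \<in> \<T>" "z \<in> verts K" "F = opposite_facet (K, z)" using F by auto
      interpret S: full_simplex "verts K" using elem Kz by auto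
      from Kz(1,2) show ?thesis
      proof (cases rule: facet_fiber)
        case boundary
        have "N (K, z) y = 0" if "y \<in> convex hull (verts K - {z})" for y
          using bdry[OF Kz(1,2) _ that] boundary(2) unfolding N_def opposite_facet_def by (simp add: mult.commute)
        then have "(\<lambda>n. h n (K, z)) \<longlonglongrightarrow> 0"
          using S.slab_tendsto_zero_C1[OF C1N[of "(K, z)"] Kz(2)] Kz(1,2) unfolding h_def by simp
        then show ?thesis using boundary(1) Kz(3) by simp
      next
        case (interior K' z')
        interpret S': full_simplex "verts K'" using elem interior by auto
        interpret fp: facet_pair "verts K" "verts K'" z z' by (rule interior)
        interpret fpc: facet_pair_cart "verts K" "verts K'" z z' by unfold_locales
        have C1': "C1_with_grad (\<lambda>x. - N (K', z') x) (\<lambda>x. (-1) *\<^sub>R dN (K', z') x)"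
          using C1_cmult[OF C1N[of "(K', z')"], of "-1"] interior by simp
        \<comment> \<open>The fluxes are formed with the gradients of two different elements, whose
          ratio \<open>bary (verts K) z z'\<close> is negative. The factor in
          \<open>slab_cancel\<close> is a positive Jacobian, so the sign is moved to the far flux:
          this expresses that the outer normals are opposite.\<close>
        have ag: "N (K, z) y = (- bary (verts K) z z') * (- N (K', z') y)" if y: "y \<in> convex hull (verts K - {z})" for y
        proof -
          have "N (K, z) y = (\<Sum>i\<in>UNIV. bary_grad (verts K) z $ i * G K' i y)"
            using inner[OF Kz(1) interior(2) interior(3)[symmetric] interior(5) y] by (simp add: N_def mult.commute)
          also have "\<dots> = bary (verts K) z z' * N (K', z') y"
            unfolding fp.bary_grad_scale N_def by (simp add: sum_distrib_left mult_ac)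
          finally show ?thesis by simp
        qed
        have "(\<lambda>n. S.slab_integral (1 / real (Suc n)) z (N (K, z)) - S'.slab_integral (1 / real (Suc n)) z' (\<lambda>x. - N (K', z') x)) \<longlonglongrightarrow> 0"
          using fpc.slab_cancel[OF interior(6) C1N[of "(K, z)"] C1'] ag Kz by simp
        then have "(\<lambda>n. h n (K, z) + h n (K', z')) \<longlonglongrightarrow> 0"
          unfolding h_def by (simp add: S'.slab_integral_minus)
        then show ?thesis using interior(1,3) Kz(3) by simp
      qed
    qed
    then have "(\<lambda>n. \<Sum>F\<in>opposite_facet ` Sigma \<T> verts. \<Sum>p\<in>{p \<in> Sigma \<T> verts. opposite_facet p = F}. h n p) \<longlonglongrightarrow>
      (\<Sum>F\<in>opposite_facet ` Sigma \<T> verts. 0)" by (rule tendsto_sum)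
    then show ?thesis unfolding sum.image_gen[OF finP, of _ opposite_facet, symmetric] by simp
  qed
  moreover have "(\<Sum>p\<in>Sigma \<T> verts. h n p) = - (\<Sum>K\<in>\<T>. I n K)" for n
  proof -
    have "(\<Sum>p\<in>Sigma \<T> verts. h n p) = (\<Sum>K\<in>\<T>. \<Sum>z\<in>verts K. h n (K, z))"
      using full_simplex.finite_S[OF elem(1)] by (subst sum.Sigma) auto
    also have "\<dots> = (\<Sum>K\<in>\<T>. - I n K)" using gauss by (intro sum.cong refl) (metis add.commute eq_neg_iff_add_eq_0)
    finally show ?thesis by (simp add: sum_negf)
  qed
  ultimately have "(\<lambda>n. - (\<Sum>K\<in>\<T>. I n K)) \<longlonglongrightarrow> 0" by simp
  moreover have "(\<lambda>n. - (\<Sum>K\<in>\<T>. I n K)) \<longlonglongrightarrow> - (\<Sum>K\<in>\<T>. \<Sum>i\<in>UNIV. LINT x:interior K|lborel. g K i x $ i)"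
    unfolding I_def
  proof (intro tendsto_intros)
    fix K i assume K: "K \<in> \<T>"
    interpret full_simplex "verts K" using elem K by auto
    have "continuous_on UNIV (\<lambda>x. g K i x $ i)"
      using C1[OF K, of i] unfolding C1_with_grad_def by (intro continuous_intros) auto
    from cutoff_tendsto[OF this]
    show "(\<lambda>n. \<integral>x. cutoff (1 / real (Suc n)) x * g K i x $ i \<partial>lborel) \<longlonglongrightarrow> (LINT x:interior K|lborel. g K i x $ i)"
      using elem(2)[OF K] by simp
  qed
  ultimately show ?thesis using LIMSEQ_unique by fastforce
qed

end

text \<open>The integrand is a null Lagrangian: it is the divergence of
  \<open>G\<^sub>i = \<Sum>\<^sub>j (w\<^sub>j \<partial>\<^sub>j w\<^sub>i - w\<^sub>i \<partial>\<^sub>j w\<^sub>j)\<close>, whose normal component involves tangential derivatives only.\<close>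

lemma null_lagrangian_divergence:
  fixes w :: "'n::finite \<Rightarrow> real^'n \<Rightarrow> real" and D :: "'n \<Rightarrow> real^'n \<Rightarrow> real^'n" and H :: "'n \<Rightarrow> real^'n \<Rightarrow> real^'n^'n"
  assumes D: "\<And>i x. (w i has_derivative (\<lambda>h. D i x \<bullet> h)) (at x)"
    and H: "\<And>i x. (D i has_derivative (\<lambda>h. H i x *v h)) (at x)" and sym: "\<And>i x. transpose (H i x) = H i x"
    and cont: "\<And>i. continuous_on UNIV (H i)"
  defines "G \<equiv> \<lambda>i x. \<Sum>j\<in>UNIV. w j x * D i x $ j - w i x * D j x $ j"
  obtains g where "\<And>i. C1_with_grad (G i) (g i)"
    "\<And>x. (\<Sum>i\<in>UNIV. g i x $ i) = (\<Sum>i\<in>UNIV. \<Sum>j\<in>UNIV. D i x $ j * D j x $ i - D i x $ i * D j x $ j)"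
proof -
  define g where "g i x = (\<Sum>j\<in>UNIV. (D i x $ j *\<^sub>R D j x + w j x *\<^sub>R H i x $ j) - (D j x $ j *\<^sub>R D i x + w i x *\<^sub>R H j x $ j))" for i x
  have cD: "continuous_on UNIV (D i)" for i
    using H by (meson has_derivative_continuous continuous_at_imp_continuous_on)
  have cw: "continuous_on UNIV (w i)" for i
    using D by (meson has_derivative_continuous continuous_at_imp_continuous_on)
  have Dj: "((\<lambda>x. D i x $ j) has_derivative (\<lambda>h. H i x $ j \<bullet> h)) (at x)" for i j x
  proof -
    have "((\<lambda>x. D i x $ j) has_derivative (\<lambda>h. (H i x *v h) $ j)) (at x)"
      using bounded_linear.has_derivative[OF bounded_linear_vec_nth H] .
    then show ?thesis by (simp add: matrix_vector_mult_def inner_vec_def)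
  qed
  have 1: "C1_with_grad (G i) (g i)" for i unfolding C1_with_grad_def
  proof
    show "continuous_on UNIV (g i)" unfolding g_def by (intro continuous_intros cD cw cont)
    have "(G i has_derivative (\<lambda>h. \<Sum>j\<in>UNIV. (w j x * (H i x $ j \<bullet> h) + (D j x \<bullet> h) * D i x $ j)
        - (w i x * (H j x $ j \<bullet> h) + (D i x \<bullet> h) * D j x $ j))) (at x)" for x
      unfolding G_def by (intro has_derivative_sum has_derivative_diff has_derivative_mult D Dj)
    then show "\<forall>x. (G i has_derivative (\<lambda>h. g i x \<bullet> h)) (at x)"
      unfolding g_def by (simp add: inner_sum_left inner_diff_left inner_add_left algebra_simps)
  qed
  have 2: "(\<Sum>i\<in>UNIV. g i x $ i) = (\<Sum>i\<in>UNIV. \<Sum>j\<in>UNIV. D i x $ j * D j x $ i - D i x $ i * D j x $ j)" for x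
  proof -
    have s: "H i x $ j $ k = H i x $ k $ j" for i j k using sym[of i x] by (simp add: transpose_def vec_eq_iff)
    have "(\<Sum>i\<in>UNIV. g i x $ i) = (\<Sum>i\<in>UNIV. \<Sum>j\<in>UNIV. D i x $ j * D j x $ i - D i x $ i * D j x $ j)
       + ((\<Sum>i\<in>UNIV. \<Sum>j\<in>UNIV. w j x * H i x $ j $ i) - (\<Sum>i\<in>UNIV. \<Sum>j\<in>UNIV. w i x * H j x $ j $ i))"
      unfolding g_def by (simp add: sum_component sum.distrib sum_subtractf algebra_simps)
    also have "(\<Sum>i\<in>UNIV. \<Sum>j\<in>UNIV. w j x * H i x $ j $ i) = (\<Sum>i\<in>UNIV. \<Sum>j\<in>UNIV. w i x * H j x $ j $ i)"
      by (subst sum.swap) (simp add: s)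
    finally show ?thesis by simp
  qed
  show thesis by (rule that[OF 1 2])
qed

context mesh_cart begin

text \<open>On an interior facet with normal \<nu> the gradients of the components jump by multiples
  \<open>a i *\<^sub>R \<nu>\<close>, and the jump of the flux is the product of the sums of
  \<open>a i * \<nu> $ i\<close> and \<open>w j * \<nu> $ j\<close> minus itself. On a boundary
  facet the field equals its normal component times \<nu>, so all tangential derivatives come from
  that one scalar, and the two terms of the flux, the normal part of its gradient \<open>B\<close>
  and the divergence, cancel.\<close>

lemma green_conforming:
  fixes w :: "((real,'n) vec) set \<Rightarrow> 'n \<Rightarrow> (real,'n) vec \<Rightarrow> real" and D :: "((real,'n) vec) set \<Rightarrow> 'n \<Rightarrow> (real,'n) vec \<Rightarrow> (real,'n) vec"
  assumes poly: "\<And>K i. K \<in> \<T> \<Longrightarrow> poly_deg k (w K i)"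
    and D: "\<And>K i x. K \<in> \<T> \<Longrightarrow> (w K i has_derivative (\<lambda>h. D K i x \<bullet> h)) (at x)"
    and conf: "\<And>K K' z z' y i. \<lbrakk>K \<in> \<T>; K' \<in> \<T>; K \<noteq> K'; facet_pair (verts K) (verts K') z z';
        y \<in> convex hull (verts K - {z})\<rbrakk> \<Longrightarrow> w K i y = w K' i y"
    and bdry: "\<And>K z y. \<lbrakk>K \<in> \<T>; z \<in> verts K; convex hull (verts K - {z}) \<subseteq> frontier \<Omega>;
        y \<in> convex hull (verts K - {z})\<rbrakk> \<Longrightarrow> \<exists>\<beta>. \<forall>i. w K i y = \<beta> * bary_grad (verts K) z $ i"
  shows "(\<Sum>K\<in>\<T>. LINT x:interior K|lborel. (\<Sum>i\<in>UNIV. \<Sum>j\<in>UNIV. D K i x $ j * D K j x $ i - D K i x $ i * D K j x $ j)) = 0"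
proof -
  define G where "G K i x = (\<Sum>j\<in>UNIV. w K j x * D K i x $ j - w K i x * D K j x $ j)" for K i x
  have "\<exists>g. (\<forall>i. C1_with_grad (G K i) (g i)) \<and> (\<forall>x. (\<Sum>i\<in>UNIV. g i x $ i) =
      (\<Sum>i\<in>UNIV. \<Sum>j\<in>UNIV. D K i x $ j * D K j x $ i - D K i x $ i * D K j x $ j)) \<and> (\<forall>i. C1_with_grad (w K i) (D K i))"
    if K: "K \<in> \<T>" for K
  proof -
    have "\<exists>H. (\<forall>x. (D K i has_derivative (\<lambda>h. H x *v h)) (at x)) \<and> (\<forall>x. transpose (H x) = H x) \<and> continuous_on UNIV H" for i
    proof -
      obtain g H where gH: "\<forall>x. (w K i has_derivative (\<lambda>h. g x \<bullet> h)) (at x)"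
        "\<forall>x. (g has_derivative (\<lambda>h. H x *v h)) (at x)" "\<forall>x. transpose (H x) = H x" "continuous_on UNIV H"
        using poly_deg_has_symmetric_hessian[OF poly[OF K, of i]] by blast
      have "g x = D K i x" for x
      proof -
        have "(\<lambda>h. g x \<bullet> h) = (\<lambda>h. D K i x \<bullet> h)" using has_derivative_unique gH(1) D[OF K] by blast
        then show ?thesis by (metis vector_eq_rdot)
      qed
      then have "g = D K i" by auto
      then show ?thesis using gH by blast
    qed
    then obtain H where H: "\<And>i x. (D K i has_derivative (\<lambda>h. H i x *v h)) (at x)"
      "\<And>i x. transpose (H i x) = H i x" "\<And>i. continuous_on UNIV (H i)" by metis
    have "C1_with_grad (w K i) (D K i)" for i unfolding C1_with_grad_def
      using D[OF K] H(1) by (meson has_derivative_continuous continuous_at_imp_continuous_on)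
    moreover obtain g where "\<And>i. C1_with_grad (\<lambda>x. \<Sum>j\<in>UNIV. w K j x * D K i x $ j - w K i x * D K j x $ j) (g i)"
      "\<And>x. (\<Sum>i\<in>UNIV. g i x $ i) = (\<Sum>i\<in>UNIV. \<Sum>j\<in>UNIV. D K i x $ j * D K j x $ i - D K i x $ i * D K j x $ j)"
      by (rule null_lagrangian_divergence[where w="w K" and D="D K" and H=H, OF D[OF K] H]) blast

    ultimately show ?thesis unfolding G_def[abs_def] by blast
  qed
  note ex = this
  have "\<exists>g. \<forall>K\<in>\<T>. (\<forall>i. C1_with_grad (G K i) (g K i)) \<and> (\<forall>x. (\<Sum>i\<in>UNIV. g K i x $ i) =
      (\<Sum>i\<in>UNIV. \<Sum>j\<in>UNIV. D K i x $ j * D K j x $ i - D K i x $ i * D K j x $ j)) \<and> (\<forall>i. C1_with_grad (w K i) (D K i))"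
    by (rule bchoice) (use ex in blast)
  then obtain g where gg: "\<forall>K\<in>\<T>. (\<forall>i. C1_with_grad (G K i) (g K i)) \<and> (\<forall>x. (\<Sum>i\<in>UNIV. g K i x $ i) =
      (\<Sum>i\<in>UNIV. \<Sum>j\<in>UNIV. D K i x $ j * D K j x $ i - D K i x $ i * D K j x $ j)) \<and> (\<forall>i. C1_with_grad (w K i) (D K i))"
    by (elim exE) (rule that)
  have g: "\<And>K i. K \<in> \<T> \<Longrightarrow> C1_with_grad (G K i) (g K i)"
    "\<And>K x. K \<in> \<T> \<Longrightarrow> (\<Sum>i\<in>UNIV. g K i x $ i) = (\<Sum>i\<in>UNIV. \<Sum>j\<in>UNIV. D K i x $ j * D K j x $ i - D K i x $ i * D K j x $ j)"
    and C1: "\<And>K i. K \<in> \<T> \<Longrightarrow> C1_with_grad (w K i) (D K i)" using gg by blast+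

  have "(\<Sum>K\<in>\<T>. \<Sum>i\<in>UNIV. LINT x:interior K|lborel. g K i x $ i) = 0"
  proof (rule mesh_divergence_zero[OF g(1)])
    fix K K' z z' y
    assume K: "K \<in> \<T>" "K' \<in> \<T>" "K \<noteq> K'" "facet_pair (verts K) (verts K') z z'" "y \<in> convex hull (verts K - {z})"
    interpret full_simplex "verts K" using elem K by auto
    interpret fp: facet_pair "verts K" "verts K'" z z' by (rule K)
    let ?\<nu> = "bary_grad (verts K) z"
    have "\<exists>a. D K i y - D K' i y = a *\<^sub>R ?\<nu>" for i
      using gradient_normal_on_facet[OF C1_diff[OF C1[OF K(1), of i] C1[OF K(2), of i]] fp.z _ K(5)] conf[OF K(1-4), of _ i] by auto
    then obtain a where "\<And>i. D K i y - D K' i y = a i *\<^sub>R ?\<nu>" by metis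
    then have a: "D K i y $ j = D K' i y $ j + a i * ?\<nu> $ j" for i j
      by (metis add.commute diff_add_cancel vector_add_component vector_scaleR_component real_scaleR_def)
    have w: "w K i y = w K' i y" for i using conf K by blast
    have "(\<Sum>i\<in>UNIV. ?\<nu> $ i * G K i y) - (\<Sum>i\<in>UNIV. ?\<nu> $ i * G K' i y)
      = (\<Sum>i\<in>UNIV. \<Sum>j\<in>UNIV. (a i * ?\<nu> $ i) * (w K' j y * ?\<nu> $ j)) - (\<Sum>i\<in>UNIV. \<Sum>j\<in>UNIV. (w K' i y * ?\<nu> $ i) * (a j * ?\<nu> $ j))"
      unfolding G_def a w by (simp add: sum_subtractf[symmetric] sum_distrib_left right_diff_distrib distrib_left mult_ac)
    also have "\<dots> = 0" unfolding sum_product[symmetric] by (simp add: mult.commute)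
    finally show "(\<Sum>i\<in>UNIV. ?\<nu> $ i * G K i y) = (\<Sum>i\<in>UNIV. ?\<nu> $ i * G K' i y)" by simp
  next
    fix K z y
    assume K: "K \<in> \<T>" "z \<in> verts K" "convex hull (verts K - {z}) \<subseteq> frontier \<Omega>" "y \<in> convex hull (verts K - {z})"
    interpret full_simplex "verts K" using elem K by auto
    define \<nu> where "\<nu> = bary_grad (verts K) z"
    define n2 where "n2 = \<nu> \<bullet> \<nu>"
    have n2: "n2 > 0" "\<nu> \<noteq> 0" using bary_grad_nonzero[OF K(2)] by (auto simp: n2_def \<nu>_def)
    have n2s: "n2 = (\<Sum>i\<in>UNIV. \<nu> $ i * \<nu> $ i)" by (simp add: n2_def inner_vec_def)
    define b where "b x = (\<Sum>i\<in>UNIV. w K i x * \<nu> $ i)" for x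
    define B where "B x = (\<Sum>i\<in>UNIV. \<nu> $ i *\<^sub>R D K i x)" for x
    have C1b: "C1_with_grad b B" unfolding b_def B_def by (intro C1_sum C1_cmult C1 K)
    have par: "\<exists>\<beta>. \<forall>i. w K i x = \<beta> * \<nu> $ i" if "x \<in> convex hull (verts K - {z})" for x
      using bdry[OF K(1-3) that] by (simp add: \<nu>_def)
    have van: "w K i x - b x * (\<nu> $ i / n2) = 0" if x: "x \<in> convex hull (verts K - {z})" for i x
    proof -
      obtain \<beta> where \<beta>: "\<And>i. w K i x = \<beta> * \<nu> $ i" using par[OF x] by blast
      have "b x = \<beta> * n2" unfolding b_def \<beta> n2s by (simp add: sum_distrib_left mult.assoc)
      then show ?thesis using \<beta> n2 by simp
    qed
    have "\<exists>a. D K i y - (\<nu> $ i / n2) *\<^sub>R B y = a *\<^sub>R \<nu>" for i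
      using gradient_normal_on_facet[OF C1_diff[OF C1[OF K(1), of i] C1_cmult[OF C1b, of "\<nu> $ i / n2"]] K(2) _ K(4)] van

      unfolding \<nu>_def by auto
    then obtain a where "\<And>i. D K i y - (\<nu> $ i / n2) *\<^sub>R B y = a i *\<^sub>R \<nu>" by metis
    then have a: "D K i y = (\<nu> $ i / n2) *\<^sub>R B y + a i *\<^sub>R \<nu>" for i by (metis add.commute diff_add_cancel)
    \<comment> \<open>Inserting the decomposition of the gradients into the definition of
      \<open>B\<close> reproduces \<open>B y\<close> plus the sum of \<open>\<nu> $ i * a i\<close>
      times \<nu>; hence that sum is zero.\<close>
    have "B y = (\<Sum>i\<in>UNIV. \<nu> $ i *\<^sub>R ((\<nu> $ i / n2) *\<^sub>R B y + a i *\<^sub>R \<nu>))"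
      unfolding B_def[of y] by (subst (1) a) (simp add: B_def)
    also have "\<dots> = ((\<Sum>i\<in>UNIV. \<nu> $ i * \<nu> $ i) / n2) *\<^sub>R B y + (\<Sum>i\<in>UNIV. \<nu> $ i * a i) *\<^sub>R \<nu>"
      by (simp add: scaleR_add_right sum.distrib scaleR_sum_left sum_divide_distrib)
    also have "(\<Sum>i\<in>UNIV. \<nu> $ i * \<nu> $ i) / n2 = 1" using n2 n2s by simp
    finally have an: "(\<Sum>i\<in>UNIV. \<nu> $ i * a i) = 0" using n2(2) by simp
    obtain \<beta> where \<beta>: "\<And>i. w K i y = \<beta> * \<nu> $ i" using par[OF K(4)] by blast
    have divw: "(\<Sum>j\<in>UNIV. D K j y $ j) = (\<Sum>j\<in>UNIV. \<nu> $ j * B y $ j) / n2"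
    proof -
      have "(\<Sum>j\<in>UNIV. D K j y $ j) = (\<Sum>j\<in>UNIV. \<nu> $ j * B y $ j / n2 + \<nu> $ j * a j)"
        by (subst a) (simp add: mult.commute)
      then show ?thesis using an by (simp add: sum.distrib sum_divide_distrib)
    qed
    have "(\<Sum>i\<in>UNIV. \<nu> $ i * G K i y) = (\<Sum>i\<in>UNIV. \<Sum>j\<in>UNIV. \<beta> * (\<nu> $ j * (\<nu> $ i * D K i y $ j)))
       - (\<Sum>i\<in>UNIV. \<Sum>j\<in>UNIV. (\<beta> * (\<nu> $ i * \<nu> $ i)) * D K j y $ j)"
      unfolding G_def \<beta> by (simp add: sum_subtractf[symmetric] sum_distrib_left right_diff_distrib mult_ac)
    also have "(\<Sum>i\<in>UNIV. \<Sum>j\<in>UNIV. (\<beta> * (\<nu> $ i * \<nu> $ i)) * D K j y $ j) = \<beta> * (n2 * (\<Sum>j\<in>UNIV. D K j y $ j))"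
      unfolding sum_product[symmetric] n2s by (simp only: sum_distrib_left[symmetric] mult.assoc)
    also have "(\<Sum>i\<in>UNIV. \<Sum>j\<in>UNIV. \<beta> * (\<nu> $ j * (\<nu> $ i * D K i y $ j))) = \<beta> * (\<Sum>j\<in>UNIV. \<nu> $ j * B y $ j)"
      by (subst sum.swap) (simp add: B_def sum_component sum_distrib_left)
    finally show "(\<Sum>i\<in>UNIV. bary_grad (verts K) z $ i * G K i y) = 0"
      using n2 by (simp add: divw \<nu>_def[symmetric])
  qed
  moreover have "(\<Sum>i\<in>UNIV. LINT x:interior K|lborel. g K i x $ i)
    = (LINT x:interior K|lborel. (\<Sum>i\<in>UNIV. \<Sum>j\<in>UNIV. D K i x $ j * D K j x $ i - D K i x $ i * D K j x $ j))" if K: "K \<in> \<T>" for K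
  proof -
    interpret full_simplex "verts K" using elem K by auto
    have "set_integrable lborel (interior K) (\<lambda>x. g K i x $ i)" for i
    proof -
      have c: "continuous_on UNIV (\<lambda>x. g K i x $ i)"
        using g(1)[OF K, of i] unfolding C1_with_grad_def by (intro continuous_intros) auto
      have "set_integrable lborel K (\<lambda>x. g K i x $ i)"
        using elem_compact(1)[OF K] c by (intro borel_integrable_compact[unfolded set_integrable_def[symmetric]]) (auto intro: continuous_on_subset)
      then show ?thesis by (rule set_integrable_subset) (auto simp: interior_subset)
    qed
    then show ?thesis unfolding g(2)[OF K, symmetric] set_lebesgue_integral_def scaleR_sum_right set_integrable_def
      by (subst Bochner_Integration.integral_sum) auto
  qed
  ultimately show ?thesis by simp
qed

end

section \<open>Lagrange basis\<close>

lemma gbinomial_Suc_real: "(a::real) gchoose Suc n = (a gchoose n) * (a - real n) / real (Suc n)"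
  by (simp add: gbinomial_prod_rev atLeast0LessThan lessThan_Suc mult.commute divide_simps)

text \<open>Induction over the factors: the next factor \<open>(k * s - a) / (a + 1)\<close> is
  bounded by \<open>B\<close>, and its increments by \<open>B\<close> times those of
  \<open>s\<close>, so both constants grow by at most \<open>2 * B\<close>. The result depends on
  the degree only.\<close>

lemma gbinomial_scaled_bounds:
  "\<exists>M\<ge>1. \<forall>s\<in>{0..1}. \<forall>t\<in>{0..1}. \<bar>((real k * s) gchoose a)\<bar> \<le> M \<and>
     \<bar>((real k * s) gchoose a) - ((real k * t) gchoose a)\<bar> \<le> M * \<bar>s - t\<bar>"
proof (induction a)
  case 0 then show ?case by (intro exI[of _ 1]) auto
next
  case (Suc a)
  then obtain M where M: "1 \<le> M" "\<And>s t. s \<in> {0..1} \<Longrightarrow> t \<in> {0..1} \<Longrightarrow> \<bar>((real k * s) gchoose a)\<bar> \<le> M \<and>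
     \<bar>((real k * s) gchoose a) - ((real k * t) gchoose a)\<bar> \<le> M * \<bar>s - t\<bar>" by blast
  define B where "B = real k + real a + 1"
  have B: "B \<ge> 1" by (simp add: B_def)
  let ?p = "\<lambda>s. ((real k * s) gchoose a)"
  have lin: "\<bar>real k * s - real a\<bar> \<le> B" if "s \<in> {0..1}" for s
  proof -
    have "0 \<le> real k * s" "real k * s \<le> real k" using that by (auto intro: mult_left_le)
    then show ?thesis by (simp add: B_def abs_le_iff)
  qed
  have Sg: "((real k * s) gchoose Suc a) = ?p s * (real k * s - real a) / real (Suc a)" for s
    by (rule gbinomial_Suc_real)
  have q: "\<bar>y / real (Suc a)\<bar> \<le> \<bar>y\<bar>" for y :: real
    by (simp add: divide_le_eq mult_left_le abs_divide) (metis abs_ge_zero le_add_same_cancel1 mult_le_cancel_left1 mult_nonneg_nonneg of_nat_0_le_iff distrib_left mult.right_neutral)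
  have 1: "\<bar>((real k * s) gchoose Suc a)\<bar> \<le> 2 * M * B" if "s \<in> {0..1}" for s
  proof -
    have "\<bar>((real k * s) gchoose Suc a)\<bar> \<le> \<bar>?p s\<bar> * \<bar>real k * s - real a\<bar>" unfolding Sg by (metis q abs_mult)
    also have "\<dots> \<le> M * B" using M(2)[OF that that] lin[OF that] M(1) by (intro mult_mono) auto
    finally show ?thesis using M(1) B by simp
  qed
  have 2: "\<bar>((real k * s) gchoose Suc a) - ((real k * t) gchoose Suc a)\<bar> \<le> 2 * M * B * \<bar>s - t\<bar>"
    if st: "s \<in> {0..1}" "t \<in> {0..1}" for s t
  proof -
    have "\<bar>((real k * s) gchoose Suc a) - ((real k * t) gchoose Suc a)\<bar>
      \<le> \<bar>?p s * (real k * s - real a) - ?p t * (real k * t - real a)\<bar>"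
      unfolding Sg diff_divide_distrib[symmetric] by (rule q)
    also have "?p s * (real k * s - real a) - ?p t * (real k * t - real a)
      = (?p s - ?p t) * (real k * s - real a) + ?p t * (real k * (s - t))" by (simp add: algebra_simps)
    also have "\<bar>\<dots>\<bar> \<le> \<bar>?p s - ?p t\<bar> * \<bar>real k * s - real a\<bar> + \<bar>?p t\<bar> * (real k * \<bar>s - t\<bar>)"
      by (rule order_trans[OF abs_triangle_ineq]) (simp add: abs_mult)
    also have "\<dots> \<le> (M * \<bar>s - t\<bar>) * B + M * (B * \<bar>s - t\<bar>)"
      using M(2)[OF st] M(2)[OF st(2,1)] lin[OF st(1)] M(1)
      by (intro add_mono mult_mono) (auto simp: B_def)
    finally show ?thesis by (simp add: algebra_simps)
  qed
  show ?case using 1 2 M(1) B by (intro exI[of _ "2 * M * B"] conjI ballI) (auto intro: order_trans[OF _ mult_mono[of 1 "2*M" 1 B]])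
qed

definition binom_bound :: "nat \<Rightarrow> real" where
  "binom_bound k = (SOME M. M \<ge> 1 \<and> (\<forall>a\<le>k. \<forall>s\<in>{0..1}. \<forall>t\<in>{0..1}. \<bar>((real k * s) gchoose a)\<bar> \<le> M \<and>
     \<bar>((real k * s) gchoose a) - ((real k * t) gchoose a)\<bar> \<le> M * \<bar>s - t\<bar>))"

lemma binom_bound:
  "binom_bound k \<ge> 1"
  "a \<le> k \<Longrightarrow> s \<in> {0..1} \<Longrightarrow> \<bar>((real k * s) gchoose a)\<bar> \<le> binom_bound k"
  "a \<le> k \<Longrightarrow> s \<in> {0..1} \<Longrightarrow> t \<in> {0..1} \<Longrightarrow> \<bar>((real k * s) gchoose a) - ((real k * t) gchoose a)\<bar> \<le> binom_bound k * \<bar>s - t\<bar>"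
proof -
  obtain M where M: "\<And>a. 1 \<le> M a" "\<And>a s t. s\<in>{0..1} \<Longrightarrow> t \<in> {0..1} \<Longrightarrow> \<bar>((real k * s) gchoose a)\<bar> \<le> M a \<and>
     \<bar>((real k * s) gchoose a) - ((real k * t) gchoose a)\<bar> \<le> M a * \<bar>s - t\<bar>"
    using gbinomial_scaled_bounds[of k] by metis
  have le: "M a \<le> (\<Sum>a\<le>k. M a)" if "a \<le> k" for a
    using that M(1) by (intro member_le_sum) (auto intro: order_trans[OF zero_le_one])
  have "\<exists>M\<ge>1. \<forall>a\<le>k. \<forall>s\<in>{0..1}. \<forall>t\<in>{0..1}. \<bar>((real k * s) gchoose a)\<bar> \<le> M \<and>
     \<bar>((real k * s) gchoose a) - ((real k * t) gchoose a)\<bar> \<le> M * \<bar>s - t\<bar>"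
  proof (intro exI[of _ "\<Sum>a\<le>k. M a"] conjI allI impI ballI)
    show "1 \<le> (\<Sum>a\<le>k. M a)" using le[of 0] M(1)[of 0] by simp
    fix a s t assume a: "a \<le> k" and st: "s \<in> {0..1::real}" "t \<in> {0..1::real}"
    show "\<bar>((real k * s) gchoose a)\<bar> \<le> (\<Sum>a\<le>k. M a)" using M(2)[OF st, of a] le[OF a] by simp
    have "\<bar>((real k * s) gchoose a) - ((real k * t) gchoose a)\<bar> \<le> M a * \<bar>s - t\<bar>" using M(2)[OF st] by simp
    also have "\<dots> \<le> (\<Sum>a\<le>k. M a) * \<bar>s - t\<bar>" by (intro mult_right_mono le a) auto
    finally show "\<bar>((real k * s) gchoose a) - ((real k * t) gchoose a)\<bar> \<le> (\<Sum>a\<le>k. M a) * \<bar>s - t\<bar>" .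
  qed
  from someI_ex[OF this] have *: "binom_bound k \<ge> 1 \<and> (\<forall>a\<le>k. \<forall>s\<in>{0..1}. \<forall>t\<in>{0..1}. \<bar>((real k * s) gchoose a)\<bar> \<le> binom_bound k \<and>
     \<bar>((real k * s) gchoose a) - ((real k * t) gchoose a)\<bar> \<le> binom_bound k * \<bar>s - t\<bar>)"
    unfolding binom_bound_def .
  then show "binom_bound k \<ge> 1" by blast
  show "a \<le> k \<Longrightarrow> s \<in> {0..1} \<Longrightarrow> \<bar>((real k * s) gchoose a)\<bar> \<le> binom_bound k" using * by blast
  show "a \<le> k \<Longrightarrow> s \<in> {0..1} \<Longrightarrow> t \<in> {0..1} \<Longrightarrow> \<bar>((real k * s) gchoose a) - ((real k * t) gchoose a)\<bar> \<le> binom_bound k * \<bar>s - t\<bar>"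
    using * by blast
qed

lemma node_idx_le: "finite T \<Longrightarrow> \<alpha> \<in> node_idx k T \<Longrightarrow> \<alpha> v \<le> k"
  using member_le_sum[of v T \<alpha>] by (cases "v \<in> T") (auto simp: node_idx_def)

lemma card_node_idx_le:
  assumes "finite T" shows "card (node_idx k T) \<le> (k + 1) ^ card T"
proof -
  have "card (node_idx k T) \<le> card (PiE T (\<lambda>_. {0..k}))"
  proof (rule card_inj_on_le)
    show "inj_on (\<lambda>\<alpha>. restrict \<alpha> T) (node_idx k T)"
    proof (rule inj_onI)
      fix \<alpha> \<beta> assume *: "\<alpha> \<in> node_idx k T" "\<beta> \<in> node_idx k T" "restrict \<alpha> T = restrict \<beta> T"
      show "\<alpha> = \<beta>"
      proof
        fix v show "\<alpha> v = \<beta> v" using *(1,2) fun_cong[OF *(3), of v] by (cases "v \<in> T") (auto simp: node_idx_def)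
      qed
    qed
    show "(\<lambda>\<alpha>. restrict \<alpha> T) ` node_idx k T \<subseteq> PiE T (\<lambda>_. {0..k})"
      using node_idx_le[OF assms] by auto
  qed (use assms in \<open>auto intro: finite_PiE\<close>)
  then show ?thesis using assms by (simp add: card_PiE)
qed

lemma node_idx_mono: "T \<subseteq> S \<Longrightarrow> finite S \<Longrightarrow> node_idx k T \<subseteq> node_idx k S"
proof
  fix \<alpha> assume sub: "T \<subseteq> S" "finite S" and a: "\<alpha> \<in> node_idx k T"
  then have "sum \<alpha> T = sum \<alpha> S" by (intro sum.mono_neutral_left) (auto simp: node_idx_def)
  then show "\<alpha> \<in> node_idx k S" using a sub(1) by (auto simp: node_idx_def)
qed

lemma node_mono:
  assumes "T \<subseteq> S" "finite S" "\<alpha> \<in> node_idx k T" shows "node k S \<alpha> = node k T \<alpha>"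
  unfolding node_def using assms by (intro sum.mono_neutral_right) (auto simp: node_idx_def)

lemma node_in_hull: assumes "finite T" "1 \<le> k" "\<alpha> \<in> node_idx k T" shows "node k T \<alpha> \<in> convex hull T"
proof -
  have "(\<Sum>v\<in>T. real (\<alpha> v) / real k) = 1"
    using assms by (simp add: sum_divide_distrib[symmetric] node_idx_def flip: of_nat_sum)
  then show ?thesis unfolding convex_hull_finite[OF assms(1)] node_def by (auto intro!: exI[of _ "\<lambda>v. real (\<alpha> v) / real k"])
qed

context full_simplex begin

text \<open>The Lagrange basis polynomial of the principal lattice: each generalised binomial
  coefficient is the product of the factors \<open>(k * bary S z x - j) / (j + 1)\<close> for
  \<open>j < \<alpha> z\<close>, which vanish on the lattice hyperplanes between the node and the
  facet opposite to \<open>z\<close>, that facet included.\<close>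

definition lagrange :: "nat \<Rightarrow> ('a \<Rightarrow> nat) \<Rightarrow> 'a \<Rightarrow> real" where
  "lagrange k \<alpha> x = (\<Prod>z\<in>S. (real k * bary S z x) gchoose \<alpha> z)"

lemma bary_node: assumes "1 \<le> k" "\<alpha> \<in> node_idx k S" "z \<in> S" shows "bary S z (node k S \<alpha>) = real (\<alpha> z) / real k"
proof (rule bary_unique[OF _ _ assms(3)])
  show "(\<Sum>v\<in>S. real (\<alpha> v) / real k) = 1"
    using assms by (simp add: sum_divide_distrib[symmetric] node_idx_def flip: of_nat_sum)
qed (simp add: node_def)

text \<open>Two different indices have the same sum \<open>k\<close>, so \<beta> is smaller than
  \<alpha> at some vertex, and the binomial coefficient of that vertex vanishes.\<close>

lemma lagrange_node:
  assumes k: "1 \<le> k" and a: "\<alpha> \<in> node_idx k S" "\<beta> \<in> node_idx k S"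
  shows "lagrange k \<alpha> (node k S \<beta>) = (if \<alpha> = \<beta> then 1 else 0)"
proof -
  have *: "lagrange k \<alpha> (node k S \<beta>) = (\<Prod>z\<in>S. real (\<beta> z) gchoose \<alpha> z)"
    unfolding lagrange_def using bary_node[OF k a(2)] k by (intro prod.cong) auto
  show ?thesis
  proof (cases "\<alpha> = \<beta>")
    case True then show ?thesis unfolding * by (simp add: binomial_gbinomial[symmetric])
  next
    case False
    have "\<exists>z\<in>S. \<beta> z < \<alpha> z"
    proof (rule ccontr)
      assume "\<not> ?thesis"
      then have le: "\<forall>z\<in>S. \<alpha> z \<le> \<beta> z" by (auto simp: not_less)
      obtain v where "\<alpha> v \<noteq> \<beta> v" using False by auto
      then have "v \<in> S" using a unfolding node_idx_def by (metis (mono_tags, lifting) mem_Collect_eq)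
      moreover from this have "\<alpha> v < \<beta> v" using le \<open>\<alpha> v \<noteq> \<beta> v\<close> by (simp add: le_neq_implies_less)
      ultimately have "sum \<alpha> S < sum \<beta> S" by (intro sum_strict_mono_ex1[OF finite_S le]) auto
      then show False using a by (simp add: node_idx_def)
    qed
    then obtain z where "z \<in> S" "\<beta> z < \<alpha> z" by blast
    then have "(\<Prod>z\<in>S. real (\<beta> z) gchoose \<alpha> z) = 0"
      by (intro prod_zero) (auto simp: binomial_gbinomial[symmetric])
    then show ?thesis unfolding * using False by simp
  qed
qed

lemma poly_deg_mult_gbinomial:
  assumes z: "z \<in> S" and f: "poly_deg m f"
  shows "poly_deg (m + a) (\<lambda>x. f x * ((real k * bary S z x) gchoose a))"
proof (induction a)
  case 0 then show ?case using f by simp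
next
  case (Suc a)
  have eq: "f x * ((real k * bary S z x) gchoose Suc a)
      = (1 / real (Suc a)) * ((f x * ((real k * bary S z x) gchoose a)) * ((real k *\<^sub>R bary_grad S z) \<bullet> x + (real k * bary S z 0 - real a)))" for x
  proof -
    have "(real k *\<^sub>R bary_grad S z) \<bullet> x + (real k * bary S z 0 - real a) = real k * bary S z x - real a"
      unfolding bary_eq[OF z, of x] by (simp add: algebra_simps)
    then show ?thesis unfolding gbinomial_Suc_real by simp
  qed
  show ?case unfolding eq add_Suc_right by (rule poly_deg_cmult[OF poly_deg.mult[OF Suc]])
qed

lemma poly_deg_lagrange: assumes "\<alpha> \<in> node_idx k S" shows "poly_deg k (lagrange k \<alpha>)"
proof -
  have "poly_deg (sum \<alpha> T) (\<lambda>x. \<Prod>z\<in>T. (real k * bary S z x) gchoose \<alpha> z)" if "T \<subseteq> S" for T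
    using finite_subset[OF that finite_S] that
  proof (induction T rule: finite_induct)
    case empty then show ?case by (simp add: poly_deg.const)
  next
    case (insert v T)
    then show ?case using poly_deg_mult_gbinomial[of v "sum \<alpha> T" "\<lambda>x. \<Prod>z\<in>T. (real k * bary S z x) gchoose \<alpha> z" "\<alpha> v" k]
      by (simp add: mult.commute add.commute)
  qed
  from this[of S] show ?thesis using assms unfolding lagrange_def[abs_def] by (simp add: node_idx_def)
qed

definition lagrange_const :: "nat \<Rightarrow> real" where
  "lagrange_const k = binom_bound k ^ Suc DIM('a)"

text \<open>The factors are divided by \<open>binom_bound k\<close> to bring them into the unit
  interval about zero, where the difference of two products is at most the sum of the differences.
  Undoing this costs one such factor for each of the \<open>d + 1\<close> vertices.\<close>

lemma lagrange_lipschitz: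
  assumes "\<alpha> \<in> node_idx k S" "x \<in> convex hull S" "y \<in> convex hull S"
  shows "\<bar>lagrange k \<alpha> x - lagrange k \<alpha> y\<bar> \<le> lagrange_const k * (\<Sum>z\<in>S. \<bar>bary S z x - bary S z y\<bar>)"
proof -
  define M where "M = binom_bound k"
  have M: "M \<ge> 1" using binom_bound(1) M_def by simp
  let ?p = "\<lambda>x z. ((real k * bary S z x) gchoose \<alpha> z) / M"
  have u: "bary S z x \<in> {0..1}" "bary S z y \<in> {0..1}" if "z \<in> S" for z using bary_bounds assms that by auto
  have ak: "\<alpha> z \<le> k" for z using node_idx_le[OF finite_S assms(1)] .
  have sc: "lagrange k \<alpha> w = M ^ card S * (\<Prod>z\<in>S. ?p w z)" for w
    unfolding lagrange_def using M by (simp add: prod_dividef)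
  have "norm ((\<Prod>z\<in>S. ?p x z) - (\<Prod>z\<in>S. ?p y z)) \<le> (\<Sum>z\<in>S. norm (?p x z - ?p y z))"
    using binom_bound(2)[OF ak] u M by (intro norm_prod_diff) (auto simp: M_def)
  also have "\<dots> \<le> (\<Sum>z\<in>S. \<bar>bary S z x - bary S z y\<bar>)"
  proof (rule sum_mono)
    fix z assume "z \<in> S"
    then have "\<bar>((real k * bary S z x) gchoose \<alpha> z) - ((real k * bary S z y) gchoose \<alpha> z)\<bar> \<le> M * \<bar>bary S z x - bary S z y\<bar>"
      using binom_bound(3)[OF ak] u M_def by blast
    then show "norm (?p x z - ?p y z) \<le> \<bar>bary S z x - bary S z y\<bar>"
      using M by (simp add: diff_divide_distrib[symmetric] abs_divide divide_le_eq mult.commute)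
  qed
  finally have "M ^ card S * norm ((\<Prod>z\<in>S. ?p x z) - (\<Prod>z\<in>S. ?p y z)) \<le> M ^ card S * (\<Sum>z\<in>S. \<bar>bary S z x - bary S z y\<bar>)"
    using M by (intro mult_left_mono) auto
  moreover have "\<bar>lagrange k \<alpha> x - lagrange k \<alpha> y\<bar> = M ^ card S * norm ((\<Prod>z\<in>S. ?p x z) - (\<Prod>z\<in>S. ?p y z))"
    unfolding sc right_diff_distrib[symmetric] abs_mult using M by simp
  ultimately show ?thesis by (simp add: lagrange_const_def M_def card_S)
qed

text \<open>On a face the basis functions of the whole simplex whose nodes lie on the face suffice.
  Both sides have equal values at these nodes, and unisolvence is applied to the vertices of the
  face.\<close>

lemma lagrange_interpolation:
  assumes T: "T \<subseteq> S" and k: "1 \<le> k" and f: "poly_deg k f" and x: "x \<in> convex hull T"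
  shows "f x = (\<Sum>\<alpha>\<in>node_idx k T. f (node k T \<alpha>) * lagrange k \<alpha> x)"
proof -
  have fT: "finite T" using T finite_subset by blast
  define g where "g x = f x - (\<Sum>\<alpha>\<in>node_idx k T. f (node k T \<alpha>) * lagrange k \<alpha> x)" for x
  have sub: "node_idx k T \<subseteq> node_idx k S" using node_idx_mono[OF T] by simp
  have "g x = 0"
  proof (rule poly_deg_unisolvent[OF fT k])
    show "poly_deg k g" unfolding g_def using sub
      by (intro poly_deg_diff f poly_deg_sum poly_deg_cmult poly_deg_lagrange) auto
    show "x \<in> affine hull T" using x convex_hull_subset_affine_hull by blast
    fix \<beta> assume b: "\<beta> \<in> node_idx k T"
    have "(\<Sum>\<alpha>\<in>node_idx k T. f (node k T \<alpha>) * lagrange k \<alpha> (node k T \<beta>)) = (\<Sum>\<alpha>\<in>node_idx k T. if \<alpha> = \<beta> then f (node k T \<beta>) else 0)"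
    proof (rule sum.cong[OF refl])
      fix \<alpha> assume a: "\<alpha> \<in> node_idx k T"
      have "lagrange k \<alpha> (node k S \<beta>) = (if \<alpha> = \<beta> then 1 else 0)" using lagrange_node[OF k] a b sub by blast
      then show "f (node k T \<alpha>) * lagrange k \<alpha> (node k T \<beta>) = (if \<alpha> = \<beta> then f (node k T \<beta>) else 0)"
        using node_mono[OF T finite_S b] by simp
    qed
    also have "\<dots> = f (node k T \<beta>)" using b finite_node_idx[OF fT] by simp
    finally show "g (node k T \<beta>) = 0" by (simp add: g_def)
  qed
  then show ?thesis by (simp add: g_def)
qed

lemma lagrange_sum_lipschitz:
  assumes "x \<in> convex hull S" "y \<in> convex hull S"
  shows "\<bar>(\<Sum>\<alpha>\<in>node_idx k S. c \<alpha> * lagrange k \<alpha> x) - (\<Sum>\<alpha>\<in>node_idx k S. c \<alpha> * lagrange k \<alpha> y)\<bar>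
    \<le> (lagrange_const k * real (Suc DIM('a)) / inball_diameter (convex hull S) * (\<Sum>\<alpha>\<in>node_idx k S. \<bar>c \<alpha>\<bar>)) * norm (x - y)"
proof -
  let ?r = "inball_diameter (convex hull S)"
  have Lc: "lagrange_const k \<ge> 0" unfolding lagrange_const_def using binom_bound(1)[of k] by simp
  have "(\<Sum>z\<in>S. \<bar>bary S z x - bary S z y\<bar>) \<le> (\<Sum>z\<in>S. (1 / ?r) * norm (x - y))"
  proof (rule sum_mono)
    fix z assume z: "z \<in> S"
    have "\<bar>bary S z x - bary S z y\<bar> \<le> norm (bary_grad S z) * norm (x - y)"
      unfolding bary_diff[OF z] by (rule Cauchy_Schwarz_ineq2)
    also have "\<dots> \<le> (1 / ?r) * norm (x - y)"
      using inball_diameter_norm_grad[OF z] inball_diameter_pos by (intro mult_right_mono) (auto simp: field_simps)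
    finally show "\<bar>bary S z x - bary S z y\<bar> \<le> (1 / ?r) * norm (x - y)" .
  qed
  also have "\<dots> = real (Suc DIM('a)) / ?r * norm (x - y)" by (simp add: card_S)
  finally have b: "(\<Sum>z\<in>S. \<bar>bary S z x - bary S z y\<bar>) \<le> real (Suc DIM('a)) / ?r * norm (x - y)" .
  have "\<bar>(\<Sum>\<alpha>\<in>node_idx k S. c \<alpha> * lagrange k \<alpha> x) - (\<Sum>\<alpha>\<in>node_idx k S. c \<alpha> * lagrange k \<alpha> y)\<bar>
    = \<bar>\<Sum>\<alpha>\<in>node_idx k S. c \<alpha> * (lagrange k \<alpha> x - lagrange k \<alpha> y)\<bar>"
    by (simp add: sum_subtractf right_diff_distrib)
  also have "\<dots> \<le> (\<Sum>\<alpha>\<in>node_idx k S. \<bar>c \<alpha> * (lagrange k \<alpha> x - lagrange k \<alpha> y)\<bar>)" by (rule sum_abs)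
  also have "\<dots> \<le> (\<Sum>\<alpha>\<in>node_idx k S. \<bar>c \<alpha>\<bar> * (lagrange_const k * (real (Suc DIM('a)) / ?r * norm (x - y))))"
  proof (rule sum_mono)
    fix \<alpha> assume a: "\<alpha> \<in> node_idx k S"
    have "\<bar>lagrange k \<alpha> x - lagrange k \<alpha> y\<bar> \<le> lagrange_const k * (\<Sum>z\<in>S. \<bar>bary S z x - bary S z y\<bar>)"
      by (rule lagrange_lipschitz[OF a assms])
    also have "\<dots> \<le> lagrange_const k * (real (Suc DIM('a)) / ?r * norm (x - y))" by (intro mult_left_mono b Lc)
    finally show "\<bar>c \<alpha> * (lagrange k \<alpha> x - lagrange k \<alpha> y)\<bar> \<le> \<bar>c \<alpha>\<bar> * (lagrange_const k * (real (Suc DIM('a)) / ?r * norm (x - y)))"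
      unfolding abs_mult by (intro mult_left_mono) auto
  qed
  also have "\<dots> = (\<Sum>\<alpha>\<in>node_idx k S. \<bar>c \<alpha>\<bar>) * (lagrange_const k * (real (Suc DIM('a)) / ?r * norm (x - y)))"
    by (rule sum_distrib_right[symmetric])
  finally show ?thesis by (simp add: ac_simps del: of_nat_Suc)
qed

end

text \<open>The derivative in the direction of the gradient itself is the square of its
  norm.\<close>

lemma norm_gradient_le_lipschitz:
  fixes f :: "'a::euclidean_space \<Rightarrow> real"
  assumes der: "(f has_derivative (\<lambda>h. g \<bullet> h)) (at x)" and x: "x \<in> interior K" and L: "0 \<le> L"
    and lip: "\<And>y. y \<in> K \<Longrightarrow> \<bar>f y - f x\<bar> \<le> L * norm (y - x)"
  shows "norm g \<le> L"
proof -
  have "((\<lambda>t::real. x + t *\<^sub>R g) has_derivative (\<lambda>t. t *\<^sub>R g)) (at 0)" by (auto intro!: derivative_eq_intros)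
  moreover have "(f has_derivative (\<lambda>h. g \<bullet> h)) (at (x + (0::real) *\<^sub>R g))" using der by simp
  ultimately have "((\<lambda>t. f (x + t *\<^sub>R g)) has_derivative (\<lambda>t. g \<bullet> (t *\<^sub>R g))) (at 0)"
    by (rule has_derivative_compose)
  then have "((\<lambda>t. f (x + t *\<^sub>R g)) has_field_derivative (g \<bullet> g)) (at 0)"
    by (simp add: has_field_derivative_def mult_commute_abs)
  then have lim: "((\<lambda>t. (f (x + t *\<^sub>R g) - f x) / t) \<longlongrightarrow> g \<bullet> g) (at 0)"
    using DERIV_def[of "\<lambda>t. f (x + t *\<^sub>R g)" "g \<bullet> g" 0] by simp
  have lim: "((\<lambda>t. (f (x + t *\<^sub>R g) - f x) / t) \<longlongrightarrow> g \<bullet> g) (at_right 0)"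
    by (rule tendsto_mono[OF at_le[OF subset_UNIV] lim])
  have "((\<lambda>t::real. x + t *\<^sub>R g) \<longlongrightarrow> x + 0 *\<^sub>R g) (at_right 0)" by (intro tendsto_intros)
  then have "\<forall>\<^sub>F t in at_right (0::real). x + t *\<^sub>R g \<in> interior K"
    using x by (intro topological_tendstoD) auto
  moreover have "\<forall>\<^sub>F t in at_right 0. t \<in> {0<..<(1::real)}" by (rule eventually_at_right_real) simp
  ultimately have "\<forall>\<^sub>F t in at_right 0. (f (x + t *\<^sub>R g) - f x) / t \<le> L * norm g"
  proof eventually_elim
    case (elim t)
    have "\<bar>f (x + t *\<^sub>R g) - f x\<bar> \<le> L * norm (x + t *\<^sub>R g - x)"
      using elim interior_subset by (intro lip) auto
    then have "f (x + t *\<^sub>R g) - f x \<le> (L * norm g) * t" using elim by (simp add: mult_ac)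
    then show ?case using elim by (simp add: divide_le_eq)
  qed
  then have "g \<bullet> g \<le> L * norm g" by (intro tendsto_upperbound[OF lim]) auto
  then have "norm g * norm g \<le> L * norm g" by (simp add: dot_square_norm power2_eq_square)
  then show ?thesis using L by (cases "g = 0") auto
qed

section \<open>Nodal values and face integrals\<close>

text \<open>The factor in \<open>emeasure_cone_le_hausdorff\<close>, without the diameter
  \<open>D\<close>.\<close>

definition cone_const :: "nat \<Rightarrow> real" where
  "cone_const d = 3 * unit_ball_vol (real d) * 4 ^ d / unit_ball_vol (real (d - 1))"

lemma cone_const_pos: "cone_const d > 0"
  unfolding cone_const_def by (intro divide_pos_pos mult_pos_pos) auto

context full_simplex begin

lemma facet_borel [measurable]: "convex hull (S - {z}) \<in> sets borel"
  by (intro borel_closed compact_imp_closed finite_imp_compact_convex_hull) simp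

lemma facet_measure_finite:
  assumes "z \<in> S" "2 \<le> DIM('a)"
  shows "emeasure (surface_measure :: 'a measure) (convex hull (S - {z})) < \<infinity>"
    "emeasure (surface_measure :: 'a measure) (convex hull (S - {z})) = hausdorff_outer (DIM('a) - 1) (convex hull (S - {z}))"
proof -
  have "card (S - {z}) = Suc (DIM('a) - 1)" using card_S assms by (simp add: card_Diff_singleton)
  then have "hausdorff_outer (DIM('a) - 1) (convex hull (S - {z})) < top"
    using assms(2) by (intro hausdorff_outer_convex_hull_finite) auto
  moreover show "emeasure (surface_measure :: 'a measure) (convex hull (S - {z})) = hausdorff_outer (DIM('a) - 1) (convex hull (S - {z}))"
    using assms(2) by (intro emeasure_hausdorff_measure) auto
  ultimately show "emeasure (surface_measure :: 'a measure) (convex hull (S - {z})) < \<infinity>" by simp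
qed

text \<open>The simplex is the cone over the facet with apex \<open>z\<close>, and it contains a
  ball of radius \<open>D / (8 * \<theta>)\<close>. The cone inequality compares the volume of this
  ball with \<open>D\<close> times the measure of the facet, and one power of \<open>D\<close>
  cancels.\<close>

lemma facet_measure_lower:
  assumes z: "z \<in> S" and d2: "2 \<le> DIM('a)" and \<theta>: "diameter (convex hull S) \<le> \<theta> * inball_diameter (convex hull S)"
  shows "unit_ball_vol (real DIM('a)) / (cone_const DIM('a) * (8 * \<theta>) ^ DIM('a)) * diameter (convex hull S) ^ (DIM('a) - 1)
    \<le> measure (surface_measure :: 'a measure) (convex hull (S - {z}))"
    "0 < \<theta>"
proof -
  let ?F = "convex hull (S - {z})" and ?K = "convex hull S" and ?d = "DIM('a)"
  define D where "D = diameter ?K"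
  define r where "r = inball_diameter ?K"
  have pos: "D > 0" "r > 0" using diameter_pos inball_diameter_pos by (auto simp: D_def r_def)
  have "0 < \<theta> * r" using \<theta> pos by (simp add: D_def r_def)
  then show \<theta>p: "0 < \<theta>" using pos by (simp add: zero_less_mult_iff)
  obtain c s where cs: "0 \<le> s" "r / 2 < 2 * s" "cball c s \<subseteq> ?K"
    by (rule inball_exists[of "r / 2"]) (use pos in \<open>auto simp: r_def\<close>)
  have "D / (8 * \<theta>) \<le> s"
  proof -
    have "D \<le> \<theta> * r" using \<theta> by (simp add: D_def r_def)
    also have "\<dots> \<le> \<theta> * (4 * s)" using cs(2) \<theta>p by (intro mult_left_mono) auto
    also have "\<dots> \<le> s * (8 * \<theta>)" using cs(1) \<theta>p by simp
    finally show ?thesis using \<theta>p by (simp add: divide_le_eq)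
  qed
  have "ennreal (unit_ball_vol ?d * (D / (8 * \<theta>)) ^ ?d) \<le> emeasure lborel (cball c (D / (8 * \<theta>)))"
    using pos \<theta>p by (subst emeasure_cball) auto
  also have "\<dots> \<le> emeasure lborel ?K"
  proof (rule emeasure_mono)
    show "cball c (D / (8 * \<theta>)) \<subseteq> ?K" using cs(3) subset_cball[OF \<open>D / (8 * \<theta>) \<le> s\<close>] by blast
  qed (simp add: borel_closed compact_imp_closed)
  also have "\<dots> \<le> ennreal (3 * unit_ball_vol ?d * 4 ^ ?d / unit_ball_vol (real (?d - 1)) * D) * hausdorff_outer (?d - 1) ?F"
  proof (rule emeasure_cone_le_hausdorff[where z=z])
    show "?K \<subseteq> (\<Union>y\<in>?F. closed_segment y z)"
    proof
      fix x assume x: "x \<in> ?K"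
      obtain y where y: "y \<in> ?F" "x = (1 - bary S z x) *\<^sub>R y + bary S z x *\<^sub>R z" using radial_projection[OF z x] .
      then have "x \<in> closed_segment y z" using bary_bounds[OF x z] unfolding in_segment by blast
      then show "x \<in> (\<Union>y\<in>?F. closed_segment y z)" using y by blast
    qed
    show "dist y z \<le> D" if "y \<in> ?F" for y
      unfolding D_def using that z hull_mono[of "S - {z}" S] by (intro diameter_bounded_bound bounded_hull) (auto simp: hull_inc)
  qed (use d2 pos in \<open>auto simp: borel_closed compact_imp_closed\<close>)
  also have "3 * unit_ball_vol ?d * 4 ^ ?d / unit_ball_vol (real (?d - 1)) * D = cone_const ?d * D" by (simp add: cone_const_def)
  also have "hausdorff_outer (?d - 1) ?F = ennreal (measure (surface_measure :: 'a measure) ?F)"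
    using facet_measure_finite[OF z d2] by (simp add: emeasure_eq_ennreal_measure)
  also have "ennreal (cone_const ?d * D) * \<dots> = ennreal (cone_const ?d * D * measure (surface_measure :: 'a measure) ?F)"
    using cone_const_pos[of ?d] pos by (simp add: ennreal_mult)
  finally have "unit_ball_vol ?d * (D / (8 * \<theta>)) ^ ?d \<le> cone_const ?d * D * measure (surface_measure :: 'a measure) ?F"
    using cone_const_pos[of ?d] pos by (subst (asm) ennreal_le_iff) auto
  moreover have "D ^ ?d = D * D ^ (?d - 1)" using d2 by (cases ?d) auto
  ultimately have "D * (unit_ball_vol ?d * D ^ (?d - 1) / (8 * \<theta>) ^ ?d) \<le> D * (cone_const ?d * measure (surface_measure :: 'a measure) ?F)"
    by (simp add: power_divide mult_ac)
  then have "unit_ball_vol ?d * D ^ (?d - 1) / (8 * \<theta>) ^ ?d \<le> cone_const ?d * measure (surface_measure :: 'a measure) ?F"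
    by (rule mult_left_le_imp_le) (rule pos(1))
  then show "unit_ball_vol ?d / (cone_const ?d * (8 * \<theta>) ^ ?d) * diameter ?K ^ (?d - 1) \<le> measure (surface_measure :: 'a measure) ?F"
    unfolding D_def[symmetric] using cone_const_pos[of ?d] \<theta>p by (simp add: field_simps)
qed

text \<open>The homothety ratio at which a polynomial loses at most half of its largest nodal value:
  at most \<open>(k + 1) ^ (d + 1)\<close> basis functions vary, each by at most
  \<open>lagrange_const k\<close> times the change of the \<open>d + 1\<close> coordinates, which is
  at most the ratio apiece. The summand 1 keeps the ratio at most 1.\<close>

definition facet_eps :: "nat \<Rightarrow> real" where
  "facet_eps k = 1 / (2 * (real ((k + 1) ^ Suc DIM('a)) * lagrange_const k * real (Suc DIM('a))) + 1)"

lemma facet_eps: "0 < facet_eps k" "facet_eps k \<le> 1"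
  "real ((k + 1) ^ Suc DIM('a)) * lagrange_const k * real (Suc DIM('a)) * facet_eps k \<le> 1 / 2"
proof -
  define N where "N = real ((k + 1) ^ Suc DIM('a)) * lagrange_const k * real (Suc DIM('a))"
  have "0 \<le> lagrange_const k" unfolding lagrange_const_def using binom_bound(1)[of k] by simp
  then have N: "0 \<le> N" unfolding N_def by (intro mult_nonneg_nonneg) auto
  have e: "facet_eps k = 1 / (2 * N + 1)" unfolding facet_eps_def N_def ..
  show "0 < facet_eps k" "facet_eps k \<le> 1" unfolding e using N by auto
  have "N * (1 / (2 * N + 1)) \<le> 1 / 2" using N by (simp add: field_simps)
  then show "real ((k + 1) ^ Suc DIM('a)) * lagrange_const k * real (Suc DIM('a)) * facet_eps k \<le> 1 / 2"
    unfolding e N_def[symmetric] .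
qed

text \<open>Around its largest nodal value a polynomial keeps half of its size on a homothetic copy of the
  facet, and the Hausdorff measure scales exactly under homotheties.\<close>

lemma facet_node_le_integral:
  fixes q :: "'a \<Rightarrow> 'b::euclidean_space"
  assumes z: "z \<in> S" and d2: "2 \<le> DIM('a)" and k: "1 \<le> k"
    and q: "\<And>b. b \<in> Basis \<Longrightarrow> poly_deg k (\<lambda>x. q x \<bullet> b)" and a: "\<alpha> \<in> node_idx k (S - {z})"
  shows "facet_eps k ^ (DIM('a) - 1) / 4 * measure (surface_measure :: 'a measure) (convex hull (S - {z})) * (norm (q (node k (S - {z}) \<alpha>)))\<^sup>2
    \<le> (LINT x:convex hull (S - {z})|surface_measure. (norm (q x))\<^sup>2)"
proof -
  let ?T = "S - {z}" and ?F = "convex hull (S - {z})" and ?H = "surface_measure :: 'a measure" and ?m = "DIM('a) - 1"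
  let ?I = "node_idx k ?T"
  define e where "e = facet_eps k"
  have e: "0 < e" "e \<le> 1" using facet_eps by (auto simp: e_def)
  have fI: "finite ?I" by (simp add: finite_node_idx)
  define M where "M = Max ((\<lambda>\<alpha>. norm (q (node k ?T \<alpha>))) ` ?I)"
  have "M \<in> (\<lambda>\<alpha>. norm (q (node k ?T \<alpha>))) ` ?I" unfolding M_def using fI a by (intro Max_in) auto
  then obtain \<beta> where b: "\<beta> \<in> ?I" "M = norm (q (node k ?T \<beta>))" by auto
  have Mge: "norm (q (node k ?T \<alpha>)) \<le> M" if "\<alpha> \<in> ?I" for \<alpha> unfolding M_def using fI that by simp
  have M0: "0 \<le> M" using b by simp
  define x0 where "x0 = node k ?T \<beta>"
  have x0: "x0 \<in> ?F" unfolding x0_def by (rule node_in_hull[OF _ k b(1)]) simp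
  have FS: "?F \<subseteq> convex hull S" by (rule hull_mono) auto
  have cq: "continuous_on UNIV q"
    using q poly_deg_continuous by (subst continuous_on_componentwise) auto
  have qI: "q x = (\<Sum>\<alpha>\<in>?I. lagrange k \<alpha> x *\<^sub>R q (node k ?T \<alpha>))" if "x \<in> ?F" for x
  proof (rule euclidean_eqI)
    fix b :: 'b assume "b \<in> Basis"
    then show "q x \<bullet> b = (\<Sum>\<alpha>\<in>?I. lagrange k \<alpha> x *\<^sub>R q (node k ?T \<alpha>)) \<bullet> b"
      using lagrange_interpolation[OF Diff_subset k q that] by (simp add: inner_sum_left mult.commute)
  qed
  define f where "f u = x0 + e *\<^sub>R (u - x0)" for u
  define A where "A = f ` ?F"
  have f_seg: "f u = (1 - e) *\<^sub>R x0 + e *\<^sub>R u" for u by (simp add: f_def algebra_simps)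
  have AF: "A \<subseteq> ?F" unfolding A_def f_seg using x0 e by (auto intro!: convexD_alt)
  have Lc: "lagrange_const k \<ge> 0" unfolding lagrange_const_def using binom_bound(1)[of k] by simp
  have big: "M / 2 \<le> norm (q y)" if y: "y \<in> A" for y
  proof -
    obtain u where u: "u \<in> ?F" "y = f u" using y by (auto simp: A_def)
    have yF: "y \<in> ?F" using y AF by blast
    have "(\<Sum>v\<in>S. \<bar>bary S v y - bary S v x0\<bar>) \<le> (\<Sum>v\<in>S. e)"
    proof (rule sum_mono)
      fix v assume v: "v \<in> S"
      have "bary S v y - bary S v x0 = e * (bary S v u - bary S v x0)"
        unfolding u(2) f_seg bary_segment[OF v] by (simp add: algebra_simps)
      moreover have "\<bar>bary S v u - bary S v x0\<bar> \<le> 1"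
        using bary_bounds[of u v] bary_bounds[of x0 v] v u(1) x0 FS by fastforce
      ultimately show "\<bar>bary S v y - bary S v x0\<bar> \<le> e" using e by (simp add: abs_mult mult_left_le)
    qed
    then have s: "(\<Sum>v\<in>S. \<bar>bary S v y - bary S v x0\<bar>) \<le> real (Suc DIM('a)) * e" by (simp add: card_S)
    have "q y - q x0 = (\<Sum>\<alpha>\<in>?I. (lagrange k \<alpha> y - lagrange k \<alpha> x0) *\<^sub>R q (node k ?T \<alpha>))"
      by (simp add: qI[OF yF] qI[OF x0] sum_subtractf scaleR_left_diff_distrib)
    then have "norm (q y - q x0) \<le> (\<Sum>\<alpha>\<in>?I. lagrange_const k * (real (Suc DIM('a)) * e) * M)"
    proof (simp only:, intro sum_norm_le)
      fix \<alpha> assume a: "\<alpha> \<in> ?I"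
      then have "\<alpha> \<in> node_idx k S" using node_idx_mono[of ?T S k] by auto
      then have "\<bar>lagrange k \<alpha> y - lagrange k \<alpha> x0\<bar> \<le> lagrange_const k * (\<Sum>v\<in>S. \<bar>bary S v y - bary S v x0\<bar>)"
        using yF x0 FS by (intro lagrange_lipschitz) auto
      also have "\<dots> \<le> lagrange_const k * (real (Suc DIM('a)) * e)" by (intro mult_left_mono s Lc)
      finally show "norm ((lagrange k \<alpha> y - lagrange k \<alpha> x0) *\<^sub>R q (node k ?T \<alpha>)) \<le> lagrange_const k * (real (Suc DIM('a)) * e) * M"
        using Mge[OF a] M0 unfolding norm_scaleR by (intro mult_mono) auto
    qed
    also have "\<dots> = real (card ?I) * (lagrange_const k * (real (Suc DIM('a)) * e) * M)" by simp
    also have "\<dots> \<le> real ((k + 1) ^ Suc DIM('a)) * (lagrange_const k * (real (Suc DIM('a)) * e) * M)"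
    proof (rule mult_right_mono)
      have "card ?I \<le> card (node_idx k S)" using node_idx_mono[of ?T S k] by (intro card_mono finite_node_idx) auto
      also have "\<dots> \<le> (k + 1) ^ Suc DIM('a)" using card_node_idx_le[of S k] card_S by simp
      finally show "real (card ?I) \<le> real ((k + 1) ^ Suc DIM('a))" by (simp only: of_nat_le_iff)
    qed (use Lc e M0 in \<open>auto intro!: mult_nonneg_nonneg\<close>)
    also have "\<dots> = (real ((k + 1) ^ Suc DIM('a)) * lagrange_const k * real (Suc DIM('a)) * e) * M" by (simp only: mult.assoc)
    also have "\<dots> \<le> 1 / 2 * M" using facet_eps(3)[of k] M0 unfolding e_def by (intro mult_right_mono)
    finally have "norm (q y - q x0) \<le> M / 2" by simp
    moreover have "norm (q x0) = M" using b x0_def by simp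
    ultimately show ?thesis using norm_triangle_ineq2[of "q x0" "q y"] by (simp add: norm_minus_commute)
  qed
  have compA: "compact A" unfolding A_def f_def
    by (intro compact_continuous_image continuous_intros finite_imp_compact_convex_hull) simp
  then have Ab [measurable]: "A \<in> sets borel" by (simp add: borel_closed compact_imp_closed)
  have finF: "emeasure ?H ?F < \<infinity>" by (rule facet_measure_finite(1)[OF z d2])
  have finA: "emeasure ?H A < \<infinity>"
    using emeasure_mono[OF AF, of ?H] finF by (metis (no_types, lifting) facet_borel le_less_trans sets_hausdorff_measure)
  have scale: "e ^ ?m * measure ?H ?F \<le> measure ?H A"
  proof -
    \<comment> \<open>The inverse homothety: Lipschitz maps bound Hausdorff measure only from above,
      so the lower bound for the measure of \<open>A\<close> comes from mapping \<open>A\<close>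
      back onto the facet with Lipschitz constant \<open>1 / e\<close>.\<close>
    define g where "g y = x0 + (1 / e) *\<^sub>R (y - x0)" for y
    have gf: "g (f u) = u" for u using e by (simp add: g_def f_def)
    then have "?F = g ` A" unfolding A_def image_image by simp
    then have "hausdorff_outer ?m ?F \<le> ennreal ((1 / e) ^ ?m) * hausdorff_outer ?m A"
      using hausdorff_outer_lipschitz_image_le[of "1 / e" ?m A g] e d2
      by (simp add: g_def dist_norm norm_divide flip: scaleR_diff_right)
    then have "emeasure ?H ?F \<le> ennreal ((1 / e) ^ ?m) * emeasure ?H A"
      using d2 by (simp add: emeasure_hausdorff_measure)
    then have "ennreal (measure ?H ?F) \<le> ennreal ((1 / e) ^ ?m * measure ?H A)"
      using finF finA e by (simp add: emeasure_eq_ennreal_measure ennreal_mult)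
    then have "measure ?H ?F \<le> (1 / e) ^ ?m * measure ?H A" using e by (subst (asm) ennreal_le_iff) auto
    then have "e ^ ?m * measure ?H ?F \<le> e ^ ?m * ((1 / e) ^ ?m * measure ?H A)" using e by (intro mult_left_mono) auto
    also have "\<dots> = measure ?H A" using e by (simp add: power_one_over field_simps)
    finally show ?thesis .
  qed
  have [measurable]: "q \<in> borel_measurable borel" using cq by (rule borel_measurable_continuous_onI)
  have "compact ?F" by (simp add: finite_imp_compact_convex_hull)
  then have "bounded (q ` ?F)" using cq by (intro compact_imp_bounded compact_continuous_image) (auto intro: continuous_on_subset)
  then obtain B where B: "\<And>x. x \<in> ?F \<Longrightarrow> norm (q x) \<le> B" unfolding bounded_iff by auto
  have intF: "set_integrable ?H ?F (\<lambda>x. (norm (q x))\<^sup>2)" unfolding set_integrable_def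
  proof (rule integrableI_bounded_set_indicator)
    show "AE x in ?H. x \<in> ?F \<longrightarrow> norm ((norm (q x))\<^sup>2) \<le> B\<^sup>2" using B by (intro AE_I2) (auto intro: power_mono)
  qed (use finF in auto)
  have intA: "set_integrable ?H A (\<lambda>x. (M / 2)\<^sup>2)" unfolding set_integrable_def
    by (rule integrableI_bounded_set_indicator[where B="(M/2)\<^sup>2"]) (use finA in auto)
  have "facet_eps k ^ ?m / 4 * measure ?H ?F * (norm (q (node k ?T \<alpha>)))\<^sup>2 \<le> facet_eps k ^ ?m / 4 * measure ?H ?F * M\<^sup>2"
    using Mge[OF a] e by (intro mult_left_mono power_mono) (auto simp: e_def[symmetric])
  also have "\<dots> = (e ^ ?m * measure ?H ?F) * (M / 2)\<^sup>2" by (simp add: e_def power_divide)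
  also have "\<dots> \<le> measure ?H A * (M / 2)\<^sup>2" by (intro mult_right_mono scale) auto
  also have "\<dots> = (LINT x:A|?H. (M / 2)\<^sup>2)" using finA by (simp add: set_lebesgue_integral_def)
  also have "\<dots> \<le> (LINT x:?F|?H. (norm (q x))\<^sup>2)" unfolding set_lebesgue_integral_def
  proof (rule integral_mono)
    fix x
    show "indicator A x *\<^sub>R (M / 2)\<^sup>2 \<le> indicator ?F x *\<^sub>R (norm (q x))\<^sup>2"
      using big[of x] AF M0 by (cases "x \<in> A") (auto intro!: power_mono simp: indicator_def)
  qed (use intF intA in \<open>auto simp: set_integrable_def\<close>)
  finally show ?thesis .
qed

text \<open>Constant of the lower bound of \<open>h\<^sub>F\<^sup>-\<^sup>1 \<integral>\<^sub>F |f|\<^sup>2\<close> by \<open>h\<^sub>K\<^sup>d\<^sup>-\<^sup>2 |f(x)|\<^sup>2\<close> at the nodes \<open>x\<close> of a polynomial \<open>f\<close>.\<close>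

definition facet_const :: "nat \<Rightarrow> real \<Rightarrow> real" where
  "facet_const k \<theta> = facet_eps k ^ (DIM('a) - 1) / 4 *
     (unit_ball_vol (real DIM('a)) / (cone_const DIM('a) * (8 * \<theta>) ^ DIM('a))) powr ((real DIM('a) - 2) / (real DIM('a) - 1))"

lemma facet_const_pos: assumes "\<theta> > 0" shows "facet_const k \<theta> > 0"
proof -
  have "0 < unit_ball_vol (real DIM('a)) / (cone_const DIM('a) * (8 * \<theta>) ^ DIM('a))"
    using cone_const_pos[of "DIM('a)"] assms by (intro divide_pos_pos mult_pos_pos) auto
  then have "0 < (unit_ball_vol (real DIM('a)) / (cone_const DIM('a) * (8 * \<theta>) ^ DIM('a))) powr ((real DIM('a) - 2) / (real DIM('a) - 1))"
    by (simp only: powr_gt_zero)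
  then show ?thesis unfolding facet_const_def using facet_eps(1)[of k] by (intro mult_pos_pos divide_pos_pos zero_less_power) auto
qed

text \<open>As \<open>face_size\<close> is the power \<open>1 / (d - 1)\<close> of the measure \<mu>
  of the facet, \<open>inverse (face_size F) * \<mu>\<close> is the power
  \<open>(d - 2) / (d - 1)\<close> of \<mu>. This exponent is nonnegative, so the lower bound of
  order \<open>D ^ (d - 1)\<close> for \<mu> becomes one of order
  \<open>D ^ (d - 2)\<close>.\<close>

lemma facet_node_bound:
  fixes q :: "'a \<Rightarrow> 'b::euclidean_space"
  assumes z: "z \<in> S" and d2: "2 \<le> DIM('a)" and k: "1 \<le> k"
    and \<theta>: "diameter (convex hull S) \<le> \<theta> * inball_diameter (convex hull S)"
    and q: "\<And>b. b \<in> Basis \<Longrightarrow> poly_deg k (\<lambda>x. q x \<bullet> b)" and a: "\<alpha> \<in> node_idx k (S - {z})"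
  defines "F \<equiv> convex hull (S - {z})"
  shows "facet_const k \<theta> * diameter (convex hull S) ^ (DIM('a) - 2) * (norm (q (node k (S - {z}) \<alpha>)))\<^sup>2
    \<le> (LINT x:F|surface_measure. inverse (face_size F) * (norm (q x))\<^sup>2)"
proof -
  let ?d = "real DIM('a)" and ?H = "surface_measure :: 'a measure"
  define D where "D = diameter (convex hull S)"
  define \<kappa> where "\<kappa> = unit_ball_vol ?d / (cone_const DIM('a) * (8 * \<theta>) ^ DIM('a))"
  define \<mu> where "\<mu> = measure ?H F"
  define t where "t = (?d - 2) / (?d - 1)"
  have D: "D > 0" using diameter_pos D_def by simp
  have \<theta>p: "\<theta> > 0" by (rule facet_measure_lower(2)[OF z d2 \<theta>])
  have \<kappa>: "\<kappa> > 0" unfolding \<kappa>_def using cone_const_pos[of "DIM('a)"] \<theta>p by (intro divide_pos_pos mult_pos_pos) auto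
  have mu: "\<kappa> * D ^ (DIM('a) - 1) \<le> \<mu>" using facet_measure_lower(1)[OF z d2 \<theta>] unfolding \<kappa>_def D_def \<mu>_def F_def .
  then have mu0: "\<mu> > 0" using \<kappa> D by (meson less_le_trans mult_pos_pos zero_less_power)
  have t: "0 \<le> t" using d2 by (simp add: t_def)
  have "\<kappa> powr t * D ^ (DIM('a) - 2) = (\<kappa> * D ^ (DIM('a) - 1)) powr t"
  proof -
    have "(D ^ (DIM('a) - 1)) powr t = D powr (real (DIM('a) - 1) * t)"
      using D by (simp add: powr_realpow[symmetric] powr_powr)
    also have "real (DIM('a) - 1) * t = real (DIM('a) - 2)"
      using d2 by (simp add: t_def of_nat_diff)
    also have "D powr real (DIM('a) - 2) = D ^ (DIM('a) - 2)" using D by (simp add: powr_realpow)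
    finally show ?thesis using \<kappa> D by (simp add: powr_mult)
  qed
  also have "\<dots> \<le> \<mu> powr t" using mu \<kappa> D t by (intro powr_mono2) auto
  also have "\<mu> powr t = inverse (face_size F) * \<mu>"
  proof -
    have "t = 1 - 1 / (?d - 1)" using d2 by (simp add: t_def field_simps)
    then have "\<mu> powr t = \<mu> powr 1 / \<mu> powr (1 / (?d - 1))" by (simp only: powr_diff)
    then show ?thesis using mu0 by (simp add: face_size_def \<mu>_def divide_inverse mult.commute)
  qed
  finally have pw: "\<kappa> powr t * D ^ (DIM('a) - 2) \<le> inverse (face_size F) * \<mu>" .
  let ?n = "(norm (q (node k (S - {z}) \<alpha>)))\<^sup>2" and ?c = "facet_eps k ^ (DIM('a) - 1) / 4"
  have "facet_const k \<theta> * D ^ (DIM('a) - 2) * ?n = (?c * ?n) * (\<kappa> powr t * D ^ (DIM('a) - 2))"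
    unfolding facet_const_def \<kappa>_def[symmetric] t_def[symmetric] by (simp only: mult_ac)
  also have "\<dots> \<le> (?c * ?n) * (inverse (face_size F) * \<mu>)"
    using pw facet_eps(1)[of k] by (intro mult_left_mono mult_nonneg_nonneg) auto
  also have "\<dots> = inverse (face_size F) * (?c * \<mu> * ?n)" by (simp only: mult_ac)
  also have "\<dots> \<le> inverse (face_size F) * (LINT x:F|?H. (norm (q x))\<^sup>2)"
    using facet_node_le_integral[OF z d2 k q a] unfolding F_def \<mu>_def
    by (intro mult_left_mono) (auto simp: face_size_def)
  also have "\<dots> = (LINT x:F|?H. inverse (face_size F) * (norm (q x))\<^sup>2)" by simp
  finally show ?thesis unfolding D_def .
qed

end

section \<open>Face normals and traces\<close>

context full_simplex begin

lemma facet_orthogonal_iff: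
  assumes z: "z \<in> S"
  shows "(\<forall>x\<in>convex hull (S - {z}). \<forall>y\<in>convex hull (S - {z}). n \<bullet> (x - y) = 0) \<longleftrightarrow> (\<exists>a. n = a *\<^sub>R bary_grad S z)"
proof
  assume n: "\<forall>x\<in>convex hull (S - {z}). \<forall>y\<in>convex hull (S - {z}). n \<bullet> (x - y) = 0"
  obtain w where w: "w \<in> S" "w \<noteq> z" by (rule other_vertex)
  have "n \<bullet> v = n \<bullet> w" if "v \<in> S - {z}" for v
  proof -
    have "n \<bullet> (v - w) = 0" using n that w by (simp add: hull_inc)
    then show ?thesis by (simp add: inner_diff_right)
  qed
  then show "\<exists>a. n = a *\<^sub>R bary_grad S z" by (rule orthogonal_to_facet[OF z])
next
  assume "\<exists>a. n = a *\<^sub>R bary_grad S z"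
  then obtain a where a: "n = a *\<^sub>R bary_grad S z" by blast
  have "bary_grad S z \<bullet> (x - y) = 0" if "x \<in> convex hull (S - {z})" "y \<in> convex hull (S - {z})" for x y
    using that facet_iff[OF z] bary_diff[OF z, of x y] by simp
  then show "\<forall>x\<in>convex hull (S - {z}). \<forall>y\<in>convex hull (S - {z}). n \<bullet> (x - y) = 0" by (simp add: a)
qed

lemma face_normal:
  assumes z: "z \<in> S"
  shows "norm (face_normal (convex hull (S - {z}))) = 1"
    "\<exists>a. a \<noteq> 0 \<and> face_normal (convex hull (S - {z})) = a *\<^sub>R bary_grad S z"
proof -
  let ?F = "convex hull (S - {z})"
  have "\<exists>n. norm n = 1 \<and> (\<forall>x\<in>?F. \<forall>y\<in>?F. n \<bullet> (x - y) = 0)"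
    using bary_grad_nonzero[OF z] facet_orthogonal_iff[OF z]
    by (intro exI[of _ "(1 / norm (bary_grad S z)) *\<^sub>R bary_grad S z"]) (auto intro: exI[of _ 1])
  from someI_ex[OF this] have *: "norm (face_normal ?F) = 1" "\<forall>x\<in>?F. \<forall>y\<in>?F. face_normal ?F \<bullet> (x - y) = 0"
    unfolding face_normal_def by auto
  then show "norm (face_normal ?F) = 1" by simp
  obtain a where a: "face_normal ?F = a *\<^sub>R bary_grad S z" using * facet_orthogonal_iff[OF z] by blast
  moreover from this have "a \<noteq> 0" using *(1) by auto
  ultimately show "\<exists>a. a \<noteq> 0 \<and> face_normal ?F = a *\<^sub>R bary_grad S z" by blast
qed

lemma unit_normal_unique:
  assumes z: "z \<in> S" and n: "norm n = 1" "\<forall>x\<in>convex hull (S - {z}). \<forall>y\<in>convex hull (S - {z}). n \<bullet> (x - y) = 0"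
    and m: "norm m = 1" "\<forall>x\<in>convex hull (S - {z}). \<forall>y\<in>convex hull (S - {z}). m \<bullet> (x - y) = 0"
  shows "n = m \<or> n = - m"
proof -
  obtain a b where ab: "n = a *\<^sub>R bary_grad S z" "m = b *\<^sub>R bary_grad S z"
    using n(2) m(2) facet_orthogonal_iff[OF z] by blast
  then have "\<bar>a\<bar> * norm (bary_grad S z) = \<bar>b\<bar> * norm (bary_grad S z)" using n(1) m(1) by simp
  then have "a = b \<or> a = - b" using bary_grad_nonzero[OF z] by (simp add: abs_eq_iff)
  then show ?thesis using ab by auto
qed

end

text \<open>Every boundary face lies in one of the finitely many facets of the domain, so the angle between two of its normals takes finitely many values. Pairs with parallel normals contribute the harmless value \<open>1\<close>, by division by zero.\<close>

definition angle_const :: "'a::euclidean_space set \<Rightarrow> real" where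
  "angle_const \<Omega> = (\<Sum>(G1, G2)\<in>{G. G facet_of closure \<Omega>} \<times> {G. G facet_of closure \<Omega>}.
     \<bar>1 + 1 / (1 - \<bar>face_normal G1 \<bullet> face_normal G2\<bar>)\<bar>)"

text \<open>With \<open>a\<close> and \<open>b\<close> the tangential parts,
  \<open>(u \<bullet> n) *\<^sub>R n - (u \<bullet> m) *\<^sub>R m\<close> equals
  \<open>b - a\<close>, so each normal component is the cosine \<gamma> times the other up to
  \<open>norm (b - a)\<close>. Inserting one relation into the other leaves the factor
  \<open>1 - \<bar>\<gamma>\<bar>\<close> after a cancellation; it is positive by the equality case
  of Cauchy-Schwarz.\<close>

lemma norm_le_two_projections:
  fixes u n m :: "'a::euclidean_space"
  assumes "norm n = 1" "norm m = 1" "n \<noteq> m" "n \<noteq> - m"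
  shows "norm u \<le> (1 + 1 / (1 - \<bar>n \<bullet> m\<bar>)) * (norm (u - (u \<bullet> n) *\<^sub>R n) + norm (u - (u \<bullet> m) *\<^sub>R m))"
proof -
  define \<gamma> where "\<gamma> = n \<bullet> m"
  define a where "a = u - (u \<bullet> n) *\<^sub>R n"
  define b where "b = u - (u \<bullet> m) *\<^sub>R m"
  have "\<bar>\<gamma>\<bar> \<le> 1" using Cauchy_Schwarz_ineq2[of n m] assms by (simp add: \<gamma>_def)
  moreover have "\<bar>\<gamma>\<bar> \<noteq> 1" using norm_cauchy_schwarz_abs_eq[of n m] assms by (auto simp: \<gamma>_def)
  ultimately have g: "\<bar>\<gamma>\<bar> < 1" by simp
  have nn: "n \<bullet> n = 1" "m \<bullet> m = 1" using assms by (simp_all add: dot_square_norm)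
  have s: "(u \<bullet> n) *\<^sub>R n - (u \<bullet> m) *\<^sub>R m = b - a" by (simp add: a_def b_def)
  have 1: "u \<bullet> n = (b - a) \<bullet> n + (u \<bullet> m) * \<gamma>"
    unfolding s[symmetric] by (simp add: inner_diff_left nn \<gamma>_def inner_commute[of m n])
  have 2: "u \<bullet> m = (a - b) \<bullet> m + (u \<bullet> n) * \<gamma>"
  proof -
    have "(a - b) \<bullet> m = - ((b - a) \<bullet> m)" by (simp add: inner_diff_left)
    then show ?thesis unfolding s[symmetric] by (simp add: inner_diff_left nn \<gamma>_def)
  qed
  have ba: "\<bar>(b - a) \<bullet> n\<bar> \<le> norm (b - a)" "\<bar>(a - b) \<bullet> m\<bar> \<le> norm (b - a)"
    using Cauchy_Schwarz_ineq2[of "b - a" n] Cauchy_Schwarz_ineq2[of "a - b" m] assms by (simp_all add: norm_minus_commute)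
  have "\<bar>u \<bullet> n\<bar> \<le> norm (b - a) + \<bar>u \<bullet> m\<bar> * \<bar>\<gamma>\<bar>" using 1 ba(1) abs_triangle_ineq[of "(b - a) \<bullet> n" "(u \<bullet> m) * \<gamma>"] by (simp add: abs_mult)
  moreover have "\<bar>u \<bullet> m\<bar> \<le> norm (b - a) + \<bar>u \<bullet> n\<bar> * \<bar>\<gamma>\<bar>" using 2 ba(2) abs_triangle_ineq[of "(a - b) \<bullet> m" "(u \<bullet> n) * \<gamma>"] by (simp add: abs_mult)
  then have "\<bar>u \<bullet> m\<bar> * \<bar>\<gamma>\<bar> \<le> (norm (b - a) + \<bar>u \<bullet> n\<bar> * \<bar>\<gamma>\<bar>) * \<bar>\<gamma>\<bar>" by (intro mult_right_mono) auto
  ultimately have "\<bar>u \<bullet> n\<bar> \<le> norm (b - a) * (1 + \<bar>\<gamma>\<bar>) + \<bar>u \<bullet> n\<bar> * \<bar>\<gamma>\<bar> * \<bar>\<gamma>\<bar>" by (simp add: algebra_simps)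
  then have "(1 + \<bar>\<gamma>\<bar>) * ((1 - \<bar>\<gamma>\<bar>) * \<bar>u \<bullet> n\<bar>) \<le> (1 + \<bar>\<gamma>\<bar>) * norm (b - a)" by (simp add: algebra_simps)
  then have "(1 - \<bar>\<gamma>\<bar>) * \<bar>u \<bullet> n\<bar> \<le> norm (b - a)" by (rule mult_left_le_imp_le) simp
  then have un: "\<bar>u \<bullet> n\<bar> \<le> norm (b - a) / (1 - \<bar>\<gamma>\<bar>)" using g by (simp add: pos_le_divide_eq mult.commute)
  have "norm u \<le> norm a + norm ((u \<bullet> n) *\<^sub>R n)" using norm_triangle_ineq[of a "(u \<bullet> n) *\<^sub>R n"] by (simp add: a_def)
  also have "\<dots> \<le> norm a + norm (b - a) / (1 - \<bar>\<gamma>\<bar>)" using un assms by simp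
  also have "\<dots> \<le> (norm a + norm b) + (norm a + norm b) / (1 - \<bar>\<gamma>\<bar>)"
    using g norm_triangle_ineq4[of b a] by (intro add_mono divide_right_mono) auto
  also have "\<dots> = (1 + 1 / (1 - \<bar>\<gamma>\<bar>)) * (norm a + norm b)" by (simp add: algebra_simps)
  finally show ?thesis by (simp add: a_def b_def \<gamma>_def)
qed

context mesh begin

text \<open>A relative interior point of \<open>F\<close> lies in some facet \<open>G\<close> of the
  polytope, as these facets cover the frontier. A face that meets the relative interior of a convex
  subset contains this subset, so \<open>F\<close> lies in \<open>G\<close>; equal dimensions then
  give equal affine hulls and normals up to sign.\<close>

lemma boundary_facet_in_domain_facet:
  assumes F: "F \<in> boundary_faces \<Omega> \<T>"
  shows "\<exists>G. G facet_of closure \<Omega> \<and> (face_normal F = face_normal G \<or> face_normal F = - face_normal G)"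
proof -
  obtain K where K: "F \<subseteq> frontier \<Omega>" "K \<in> \<T>" "F facet_of K" using F by (auto simp: boundary_faces_def)
  interpret full_simplex "verts K" using elem K by auto
  obtain z where z: "z \<in> verts K" "F = convex hull (verts K - {z})"
    using K facet_of_hull_iff elem(2) by metis
  have ne: "interior (closure \<Omega>) \<noteq> {}" using elem_interior[OF K(2)] interior_closure_dom by auto
  then have "rel_frontier (closure \<Omega>) = frontier (closure \<Omega>)" by (rule rel_frontier_nonempty_interior)
  also have "\<dots> = frontier \<Omega>" unfolding frontier_def closure_closure interior_closure_dom interior_open[OF open_dom] ..
  finally have U: "frontier \<Omega> = \<Union>{G. G facet_of closure \<Omega>}"
    using rel_frontier_of_polyhedron[OF polytope_imp_polyhedron[OF polytope_dom]] by simp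
  have "F \<noteq> {}" "convex F" using K(3) z(2) by (auto simp: facet_of_def)
  then obtain p where p: "p \<in> rel_interior F" using rel_interior_eq_empty by blast
  then have "p \<in> frontier \<Omega>" using K(1) rel_interior_subset by blast
  then obtain G where G: "G facet_of closure \<Omega>" "p \<in> G" using U by auto
  have FG: "F \<subseteq> G"
  proof (rule subset_of_face_of)
    show "G face_of closure \<Omega>" using G(1) by (rule facet_of_imp_face_of)
    show "F \<subseteq> closure \<Omega>" using K(1) by (auto simp: frontier_def)
    show "G \<inter> rel_interior F \<noteq> {}" using G p by auto
  qed
  have "aff_dim F = aff_dim K - 1" "aff_dim K = DIM('a)" "aff_dim G = DIM('a) - 1"
    using K G aff_dim_nonempty_interior[OF elem_interior(1)[OF K(2)]] aff_dim_nonempty_interior[OF ne]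
    by (auto simp: facet_of_def)
  then have "affine hull F = affine hull G"
    using FG \<open>F \<noteq> {}\<close> by (intro affine_dim_equal) (auto simp: hull_mono)
  then have GF: "G \<subseteq> affine hull F" using hull_subset[of G affine] by simp
  have orth: "\<forall>x\<in>G. \<forall>y\<in>G. face_normal F \<bullet> (x - y) = 0"
  proof -
    obtain a where a: "face_normal F = a *\<^sub>R bary_grad (verts K) z" using face_normal(2)[OF z(1)] z(2) by auto
    have "affine hull F \<subseteq> {x. bary_grad (verts K) z \<bullet> x = - bary (verts K) z 0}"
    proof (rule hull_minimal)
      show "F \<subseteq> {x. bary_grad (verts K) z \<bullet> x = - bary (verts K) z 0}"
      proof
        fix x assume "x \<in> F"
        then have "bary (verts K) z x = 0" using facet_iff[OF z(1)] z(2) by blast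
        then show "x \<in> {x. bary_grad (verts K) z \<bullet> x = - bary (verts K) z 0}"
          using bary_diff[OF z(1), of x 0] by simp
      qed
    qed (rule affine_hyperplane)
    then have "bary_grad (verts K) z \<bullet> x = - bary (verts K) z 0" if "x \<in> G" for x using GF that by blast
    then show ?thesis by (simp add: a inner_diff_right)
  qed
  have nF: "norm (face_normal F) = 1" using face_normal(1)[OF z(1)] z(2) by simp
  from someI[of "\<lambda>n. norm n = 1 \<and> (\<forall>x\<in>G. \<forall>y\<in>G. n \<bullet> (x - y) = 0)", OF conjI[OF nF orth]]
  have nG: "norm (face_normal G) = 1" "\<forall>x\<in>G. \<forall>y\<in>G. face_normal G \<bullet> (x - y) = 0"
    unfolding face_normal_def by auto
  have "face_normal F = face_normal G \<or> face_normal F = - face_normal G"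
  proof (rule unit_normal_unique[OF z(1) nF _ nG(1)])
    show "\<forall>x\<in>convex hull (verts K - {z}). \<forall>y\<in>convex hull (verts K - {z}). face_normal F \<bullet> (x - y) = 0"
      unfolding z(2)[symmetric] using orth FG by blast
    show "\<forall>x\<in>convex hull (verts K - {z}). \<forall>y\<in>convex hull (verts K - {z}). face_normal G \<bullet> (x - y) = 0"
      unfolding z(2)[symmetric] using nG(2) FG by blast
  qed
  then show ?thesis using G(1) by blast
qed

lemma boundary_normals:
  assumes F: "F1 \<in> boundary_faces \<Omega> \<T>" "F2 \<in> boundary_faces \<Omega> \<T>"
  defines "n1 \<equiv> face_normal F1" and "n2 \<equiv> face_normal F2"
  assumes ne: "n1 \<noteq> n2" "n1 \<noteq> - n2"
  shows "norm u \<le> angle_const \<Omega> * (norm (u - (u \<bullet> n1) *\<^sub>R n1) + norm (u - (u \<bullet> n2) *\<^sub>R n2))"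
proof -
  have unit: "norm (face_normal F) = 1" if bF: "F \<in> boundary_faces \<Omega> \<T>" for F
  proof -
    obtain K where K: "K \<in> \<T>" "F facet_of K" using bF by (auto simp: boundary_faces_def)
    interpret full_simplex "verts K" using elem K by auto
    obtain z where z: "z \<in> verts K" "F = convex hull (verts K - {z})"
      using K facet_of_hull_iff elem(2) by metis
    then show ?thesis using face_normal(1) by simp
  qed
  obtain G1 G2 where G: "G1 facet_of closure \<Omega>" "n1 = face_normal G1 \<or> n1 = - face_normal G1"
    "G2 facet_of closure \<Omega>" "n2 = face_normal G2 \<or> n2 = - face_normal G2"
    using boundary_facet_in_domain_facet[OF F(1)] boundary_facet_in_domain_facet[OF F(2)] unfolding n1_def n2_def by blast
  have fin: "finite {G. G facet_of closure \<Omega>}" using finite_polytope_facets[OF polytope_dom] .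
  have "1 + 1 / (1 - \<bar>n1 \<bullet> n2\<bar>) = 1 + 1 / (1 - \<bar>face_normal G1 \<bullet> face_normal G2\<bar>)"
    using G by auto
  also have "\<dots> \<le> \<bar>1 + 1 / (1 - \<bar>face_normal G1 \<bullet> face_normal G2\<bar>)\<bar>" by simp
  also have "\<dots> \<le> angle_const \<Omega>" unfolding angle_const_def
    using member_le_sum[of "(G1, G2)" "{G. G facet_of closure \<Omega>} \<times> {G. G facet_of closure \<Omega>}"
      "\<lambda>(G1, G2). \<bar>1 + 1 / (1 - \<bar>face_normal G1 \<bullet> face_normal G2\<bar>)\<bar>"] G fin by auto
  finally have c: "1 + 1 / (1 - \<bar>n1 \<bullet> n2\<bar>) \<le> angle_const \<Omega>" .
  have "norm u \<le> (1 + 1 / (1 - \<bar>n1 \<bullet> n2\<bar>)) * (norm (u - (u \<bullet> n1) *\<^sub>R n1) + norm (u - (u \<bullet> n2) *\<^sub>R n2))"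
    using unit F ne unfolding n1_def n2_def by (intro norm_le_two_projections) auto
  also have "\<dots> \<le> angle_const \<Omega> * (norm (u - (u \<bullet> n1) *\<^sub>R n1) + norm (u - (u \<bullet> n2) *\<^sub>R n2))"
    by (intro mult_right_mono c) auto
  finally show ?thesis .
qed

lemma angle_const_nonneg: "0 \<le> angle_const \<Omega>"
  unfolding angle_const_def by (intro sum_nonneg) auto

text \<open>Every point of \<open>K\<close> is a limit point of the interior, so the limit that
  defines the trace is taken along a nontrivial filter and is unique.\<close>

lemma elem_trace_eq:
  fixes v :: "'a \<Rightarrow> 'b::t2_space"
  assumes K: "K \<in> \<T>" "x \<in> K" and v: "\<And>y. y \<in> interior K \<Longrightarrow> v y = q y" and q: "continuous_on UNIV q"
  shows "elem_trace v K x = q x"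
proof -
  have "x \<in> closure (interior K)" using elem_interior(2)[OF K(1)] K(2) by simp
  then have "x islimpt interior K"
    using open_imp_islimpt[OF open_interior] by (auto simp: closure_def)
  then have nt: "\<not> trivial_limit (at x within interior K)" by (simp add: trivial_limit_within)
  have "(q \<longlongrightarrow> q x) (at x within interior K)"
    using q by (meson UNIV_I continuous_on_def tendsto_within_subset subset_UNIV)
  moreover have "\<forall>\<^sub>F y in at x within interior K. q y = v y"
    unfolding eventually_at_filter using v by (intro always_eventually) auto
  ultimately have "(v \<longlongrightarrow> q x) (at x within interior K)" by (rule Lim_transform_eventually)
  then show ?thesis unfolding elem_trace_def by (rule tendsto_Lim[OF nt])
qed

section \<open>Lattice nodes, local mesh sizes and overlap counts\<close>

definition mesh_nodes :: "nat \<Rightarrow> 'a set \<Rightarrow> 'a set" where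
  "mesh_nodes k K = node k (verts K) ` node_idx k (verts K)"

lemma mesh_nodes_subset: "1 \<le> k \<Longrightarrow> K \<in> \<T> \<Longrightarrow> mesh_nodes k K \<subseteq> K"
  unfolding mesh_nodes_def using node_in_hull[OF full_simplex.finite_S[OF elem(1)]] elem(2) by fastforce

lemma node_face:
  assumes k: "1 \<le> k" and K: "K \<in> \<T>" and c: "c \<subseteq> verts K" and x: "x \<in> mesh_nodes k K" "x \<in> convex hull c"
  shows "\<exists>\<alpha>\<in>node_idx k c. x = node k c \<alpha>"
proof -
  interpret full_simplex "verts K" using elem K by auto
  obtain \<alpha> where \<alpha>: "\<alpha> \<in> node_idx k (verts K)" "x = node k (verts K) \<alpha>" using x(1) by (auto simp: mesh_nodes_def)
  have a0: "\<alpha> v = 0" if v: "v \<notin> c" for v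
  proof (cases "v \<in> verts K")
    case True
    then have "bary (verts K) v x = 0" using x(2) face_iff[OF c] v by blast
    then show ?thesis using bary_node[OF k \<alpha>(1) True] \<alpha>(2) k by simp
  qed (use \<alpha> in \<open>auto simp: node_idx_def\<close>)
  have "sum \<alpha> c = sum \<alpha> (verts K)" using c a0 by (intro sum.mono_neutral_left) auto
  then have "\<alpha> \<in> node_idx k c" using \<alpha>(1) a0 by (simp add: node_idx_def)
  moreover from node_mono[OF c finite_S this] have "x = node k c \<alpha>" using \<alpha> by simp
  ultimately show ?thesis by blast
qed

text \<open>The node lies in the common face, where its index is supported on the common vertices.
  The lattice of a face depends on these vertices alone, so neighbouring elements have the same
  nodes on it.\<close>

lemma node_of_neighbour:
  assumes k: "1 \<le> k" and K: "K \<in> \<T>" "K' \<in> \<T>" and x: "x \<in> mesh_nodes k K" "x \<in> K'"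
  shows "x \<in> mesh_nodes k K'"
proof -
  obtain c where c: "c \<subseteq> verts K" "c \<subseteq> verts K'" "K \<inter> K' = convex hull c" using inter_hull K by metis
  have "x \<in> convex hull c" using x c mesh_nodes_subset[OF k K(1)] by blast
  then obtain \<alpha> where "\<alpha> \<in> node_idx k c" "x = node k c \<alpha>" using node_face[OF k K(1) c(1) x(1)] by blast
  then show ?thesis
    using node_mono[OF c(2)] node_idx_mono[OF c(2)] full_simplex.finite_S[OF elem(1)[OF K(2)]]
    unfolding mesh_nodes_def by force
qed

lemma shape_regularity_ge_1: assumes "K \<in> \<T>" shows "1 \<le> shape_regularity \<T>"
proof -
  interpret full_simplex "verts K" using elem assms by auto
  obtain v where v: "v \<in> verts K" using S_nonempty by auto
  obtain w where w: "w \<in> verts K" "w \<noteq> v" by (rule other_vertex)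
  have "inball_diameter K \<le> dist v w" using edge_length v w elem(2)[OF assms] by metis
  also have "\<dots> \<le> diameter K"
    using v w elem_compact(4)[OF assms] elem(2)[OF assms] by (intro diameter_bounded_bound) (metis hull_inc)+
  finally have "inball_diameter K \<le> shape_regularity \<T> * inball_diameter K"
    using shape_regularity_elem(1)[OF assms] by simp
  then show ?thesis using shape_regularity_elem(2)[OF assms] by simp
qed

text \<open>In dimension at least two a shared facet contains an edge. Its length is at least the
  inball diameter of \<open>K\<close> and at most the diameter of \<open>K'\<close>.\<close>

lemma adjacent_diameter:
  assumes "(K, K') \<in> star_adj x" shows "diameter K \<le> shape_regularity \<T> * diameter K'"
proof -
  obtain F where F: "K \<in> \<T>" "K' \<in> \<T>" "K \<noteq> K'" "F facet_of K" "F facet_of K'"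
    using assms by (auto simp: star_adj_def star_def)
  interpret full_simplex "verts K" using elem F by auto
  obtain z where z: "z \<in> verts K" "F = convex hull (verts K - {z})" using F facet_of_hull_iff elem(2) by metis
  have "2 \<le> card (verts K - {z})" using card_S z dim2 by (simp add: card_Diff_singleton)
  then obtain v w where vw: "v \<in> verts K - {z}" "w \<in> verts K - {z}" "v \<noteq> w"
    by (metis card_2_iff' card_le_Suc0_iff_eq finite_Diff finite_S not_less_eq_eq numeral_2_eq_2)
  then have "v \<in> K'" "w \<in> K'" using z(2) facet_of_imp_subset[OF F(5)] hull_inc by (metis subsetD)+
  then have "dist v w \<le> diameter K'" using elem_compact(4)[OF F(2)] by (intro diameter_bounded_bound)
  moreover have "inball_diameter K \<le> dist v w" using edge_length vw elem(2)[OF F(1)] by (metis DiffD1)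
  ultimately have "shape_regularity \<T> * inball_diameter K \<le> shape_regularity \<T> * diameter K'"
    using shape_regularity_elem(4)[OF F(1)] by (intro mult_left_mono) auto
  then show ?thesis using shape_regularity_elem(1)[OF F(1)] by simp
qed

text \<open>Elements that meet have a common vertex, because their intersection is spanned by common
  vertices; so the stars of the \<open>d + 1\<close> vertices of \<open>K\<close> exhaust
  them.\<close>

lemma card_touching_le:
  assumes K: "K \<in> \<T>"
  shows "real (card {L \<in> \<T>. L \<inter> K \<noteq> {}}) \<le> real (Suc DIM('a)) * (4 * shape_regularity \<T>) ^ DIM('a)"
proof -
  interpret full_simplex "verts K" using elem K by auto
  have "{L \<in> \<T>. L \<inter> K \<noteq> {}} \<subseteq> (\<Union>v\<in>verts K. star v)"
  proof
    fix L assume "L \<in> {L \<in> \<T>. L \<inter> K \<noteq> {}}"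
    then have L: "L \<in> \<T>" "L \<inter> K \<noteq> {}" by auto
    obtain c where c: "c \<subseteq> verts L" "c \<subseteq> verts K" "L \<inter> K = convex hull c" using inter_hull[OF L(1) K] by metis
    then obtain v where "v \<in> c" using L by auto
    then have "v \<in> verts K" "v \<in> L" using c hull_inc[of v c convex] by blast+
    then show "L \<in> (\<Union>v\<in>verts K. star v)" using L by (auto simp: star_def)
  qed
  then have "card {L \<in> \<T>. L \<inter> K \<noteq> {}} \<le> card (\<Union>v\<in>verts K. star v)" by (intro card_mono) auto
  also have "\<dots> \<le> (\<Sum>v\<in>verts K. card (star v))" by (rule card_UN_le) simp
  finally have "real (card {L \<in> \<T>. L \<inter> K \<noteq> {}}) \<le> (\<Sum>v\<in>verts K. real (card (star v)))" unfolding of_nat_sum[symmetric] of_nat_le_iff .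

  also have "\<dots> \<le> (\<Sum>v\<in>verts K. (4 * shape_regularity \<T>) ^ DIM('a))"
  proof (intro sum_mono card_star_le)
    fix v assume "v \<in> verts K"
    then have "v \<in> K" using elem(2)[OF K] hull_inc by metis
    then show "star v \<noteq> {}" using K by (auto simp: star_def)
  qed
  also have "\<dots> = real (Suc DIM('a)) * (4 * shape_regularity \<T>) ^ DIM('a)" by (simp add: card_S)
  finally show ?thesis .
qed

lemma finite_faces: "finite (interior_faces \<T>)" "finite (boundary_faces \<Omega> \<T>)"
proof -
  have "finite (\<Union>K\<in>\<T>. {F. F facet_of K})"
  proof (intro finite_UN_I)
    fix K assume K: "K \<in> \<T>"
    interpret full_simplex "verts K" using elem K by auto
    have "{F. F facet_of K} \<subseteq> (\<lambda>z. convex hull (verts K - {z})) ` verts K"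
      using facet_of_hull_iff elem(2)[OF K] by auto
    then show "finite {F. F facet_of K}" by (rule finite_subset) simp
  qed simp
  then show "finite (interior_faces \<T>)" "finite (boundary_faces \<Omega> \<T>)"
    unfolding interior_faces_def boundary_faces_def by (auto elim: rev_finite_subset)
qed

lemma faces_disjoint: "interior_faces \<T> \<inter> boundary_faces \<Omega> \<T> = {}"
  using shared_not_boundary by (auto simp: interior_faces_def boundary_faces_def)

end

section \<open>Nodal values compatible with the jumps\<close>

text \<open>A star has at most \<open>(4 \<theta>)\<^sup>d\<close> elements, and a path between two of them takes at most the square of this number of steps.\<close>

definition chain_len :: "nat \<Rightarrow> real \<Rightarrow> nat" where "chain_len d \<theta> = nat \<lceil>((4 * \<theta>) ^ d)\<^sup>2\<rceil>"

text \<open>The reciprocal of the constant in \<open>facet_node_bound\<close>, times the price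
  \<theta> per step of exchanging diameters along a chain, raised to the power \<open>d - 2\<close>
  with which the diameter occurs.\<close>

definition node_const :: "'a::euclidean_space set \<Rightarrow> nat \<Rightarrow> real \<Rightarrow> real" where
  "node_const \<Omega> k \<theta> = \<theta> ^ (chain_len DIM('a) \<theta> * (DIM('a) - 2)) / full_simplex.facet_const TYPE('a) k \<theta>"

text \<open>A chain of jumps followed by one tangential trace gives the first factor. The second
  covers both kinds of boundary nodes: 1 if the value is a normal part, and twice the angle constant
  if it is zero and two tangential traces are combined.\<close>

definition nodal_const :: "'a::euclidean_space set \<Rightarrow> real \<Rightarrow> real" where
  "nodal_const \<Omega> \<theta> = (real (chain_len DIM('a) \<theta>) + 1) * (1 + 2 * angle_const \<Omega>)"

text \<open>Each \<open>q K\<close> is a polynomial on the whole space, so traces become evaluations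
  and the integrands of an element are continuous everywhere.\<close>

locale broken_field = mesh_cart \<Omega> \<T> for \<Omega> :: "(real^'n::{finite,wellorder}) set" and \<T> +
  fixes k :: nat and v :: "(real, 'n) vec \<Rightarrow> (real, 'n) vec" and q :: "(real, 'n) vec set \<Rightarrow> (real, 'n) vec \<Rightarrow> (real, 'n) vec"
  assumes k1: "1 \<le> k" and poly: "\<And>K i. K \<in> \<T> \<Longrightarrow> poly_deg k (\<lambda>x. q K x $ i)"
    and rep: "\<And>K y. K \<in> \<T> \<Longrightarrow> y \<in> interior K \<Longrightarrow> v y = q K y"
begin

abbreviation (input) \<theta> :: real where "\<theta> \<equiv> shape_regularity \<T>"

lemma d2: "2 \<le> CARD('n)" using dim2 by simp

definition faces :: "(real, 'n) vec set set" where "faces = interior_faces \<T> \<union> boundary_faces \<Omega> \<T>"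

definition face_energy :: "(real, 'n) vec set \<Rightarrow> real" where
  "face_energy F = (if F \<in> interior_faces \<T>
     then LINT x:F|surface_measure. inverse (face_size F) * (norm (jump \<T> v F x))\<^sup>2
     else LINT x:F|surface_measure. inverse (face_size F) * (norm (tangential_trace \<T> v F x))\<^sup>2)"

lemma finite_faces' [simp, intro]: "finite faces" unfolding faces_def using finite_faces by simp

lemma face_energy_nonneg: "0 \<le> face_energy F"
proof -
  have "0 \<le> face_size F" by (simp add: face_size_def)
  then show ?thesis unfolding face_energy_def set_lebesgue_integral_def by (auto intro!: integral_nonneg_AE AE_I2)
qed

lemma jump_seminorm_eq: "jump_seminorm \<Omega> \<T> v = sqrt (\<Sum>F\<in>faces. face_energy F)"
proof -
  have "(\<Sum>F\<in>faces. face_energy F) = (\<Sum>F\<in>interior_faces \<T>. face_energy F) + (\<Sum>F\<in>boundary_faces \<Omega> \<T>. face_energy F)"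
    unfolding faces_def by (rule sum.union_disjoint) (use finite_faces faces_disjoint in auto)
  moreover have "(\<Sum>F\<in>boundary_faces \<Omega> \<T>. face_energy F) = (\<Sum>F\<in>boundary_faces \<Omega> \<T>.
      LINT x:F|surface_measure. inverse (face_size F) * (norm (tangential_trace \<T> v F x))\<^sup>2)"
    using faces_disjoint by (intro sum.cong) (auto simp: face_energy_def)
  ultimately show ?thesis unfolding jump_seminorm_def by (simp add: face_energy_def)
qed

lemma poly_basis: assumes "K \<in> \<T>" "b \<in> Basis" shows "poly_deg k (\<lambda>x. q K x \<bullet> b)"
proof -
  obtain i where "b = axis i 1" using assms(2) by (auto simp: Basis_vec_def)
  then show ?thesis using poly[OF assms(1), of i] by (simp add: inner_axis)
qed

lemma poly_inner: assumes "K \<in> \<T>" shows "poly_deg k (\<lambda>x. q K x \<bullet> n)"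
proof -
  have "(\<lambda>x. q K x \<bullet> n) = (\<lambda>x. \<Sum>i\<in>UNIV. n $ i * q K x $ i)" by (simp add: inner_vec_def mult.commute)
  then show ?thesis by (simp only:) (intro poly_deg_sum poly_deg_cmult poly assms)
qed

lemma continuous_q: assumes "K \<in> \<T>" shows "continuous_on UNIV (q K)"
  using poly_basis[OF assms] poly_deg_continuous by (subst continuous_on_componentwise) auto

lemma trace_q: "K \<in> \<T> \<Longrightarrow> x \<in> K \<Longrightarrow> elem_trace v K x = q K x"
  using elem_trace_eq[OF _ _ rep continuous_q] by blast

lemma facet_node:
  assumes K: "K \<in> \<T>" "F facet_of K" and x: "x \<in> mesh_nodes k K" "x \<in> F"
  obtains z \<alpha> where "z \<in> verts K" "F = convex hull (verts K - {z})" "\<alpha> \<in> node_idx k (verts K - {z})"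
    "x = node k (verts K - {z}) \<alpha>"
proof -
  interpret full_simplex "verts K" using elem K by auto
  obtain z where z: "z \<in> verts K" "F = convex hull (verts K - {z})" using K facet_of_hull_iff elem(2) by metis
  have "x \<in> convex hull (verts K - {z})" using x z by simp
  from node_face[OF k1 K(1) Diff_subset x(1) this] show thesis using that z by blast
qed

text \<open>The ordered pair chosen in the definition of the jump is \<open>K\<close> and
  \<open>K'\<close> up to order, because at most two elements share a facet; the order affects only
  the sign.\<close>

lemma jump_node_bound:
  assumes K: "K \<in> \<T>" "K' \<in> \<T>" "K \<noteq> K'" and F: "F facet_of K" "F facet_of K'"
    and x: "x \<in> mesh_nodes k K" "x \<in> F"
  shows "full_simplex.facet_const TYPE((real, 'n) vec) k \<theta> * diameter K ^ (CARD('n) - 2) * (norm (q K x - q K' x))\<^sup>2 \<le> face_energy F" "F \<in> faces"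
proof -
  interpret full_simplex "verts K" using elem K by auto
  have Fi: "F \<in> interior_faces \<T>" using K F by (auto simp: interior_faces_def)
  then show "F \<in> faces" by (simp add: faces_def)
  obtain z \<alpha> where z: "z \<in> verts K" "F = convex hull (verts K - {z})" "\<alpha> \<in> node_idx k (verts K - {z})"
    "x = node k (verts K - {z}) \<alpha>" using facet_node[OF K(1) F(1) x] .
  obtain L L' where LL: "face_elements \<T> F = (L, L')" by force
  have "\<exists>p. case p of (K, K') \<Rightarrow> K \<in> \<T> \<and> K' \<in> \<T> \<and> K \<noteq> K' \<and> F facet_of K \<and> F facet_of K'"
    using K F by (intro exI[of _ "(K, K')"]) simp
  from someI_ex[OF this] have L: "L \<in> \<T>" "L' \<in> \<T>" "L \<noteq> L'" "F facet_of L" "F facet_of L'"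
    using LL unfolding face_elements_def by auto
  have "{L, L'} = {K, K'}"
    using facet_shared_by_two[OF K(1,2) L(1) F L(4)] facet_shared_by_two[OF K(1,2) L(2) F L(5)] K(3) L(3) by blast
  then have eq: "norm (q L y - q L' y) = norm (q K y - q K' y)" for y
    by (auto simp: doubleton_eq_iff norm_minus_commute)
  have "face_energy F = (LINT x:F|surface_measure. inverse (face_size F) * (norm (q K x - q K' x))\<^sup>2)"
  proof -
    have "norm (jump \<T> v F y) = norm (q K y - q K' y)" if y: "y \<in> F" for y
    proof -
      have "y \<in> L" "y \<in> L'" using y facet_of_imp_subset L by blast+
      then show ?thesis unfolding jump_def LL using trace_q L eq by simp
    qed
    then show ?thesis using Fi z(2) unfolding face_energy_def
      by (auto intro!: set_lebesgue_integral_cong simp del: set_integral_mult_right)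
  qed
  moreover have "full_simplex.facet_const TYPE((real, 'n) vec) k \<theta> * diameter K ^ (CARD('n) - 2) * (norm (q K x - q K' x))\<^sup>2
      \<le> (LINT x:F|surface_measure. inverse (face_size F) * (norm (q K x - q K' x))\<^sup>2)"
    using facet_node_bound[OF z(1) dim2 k1 _ _ z(3), of \<theta> "\<lambda>x. q K x - q K' x"] shape_regularity_elem(1)[OF K(1)]
      elem(2)[OF K(1)] poly_deg_diff[OF poly_basis[OF K(1)] poly_basis[OF K(2)]] z(2,4)
    by (simp add: inner_diff_left del: set_integral_mult_right)
  ultimately show "full_simplex.facet_const TYPE((real, 'n) vec) k \<theta> * diameter K ^ (CARD('n) - 2) * (norm (q K x - q K' x))\<^sup>2 \<le> face_energy F" by simp
qed

lemma boundary_node_bound: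
  assumes F: "F \<in> boundary_faces \<Omega> \<T>" and K: "K \<in> \<T>" "F facet_of K" and x: "x \<in> mesh_nodes k K" "x \<in> F"
  defines "n \<equiv> face_normal F"
  shows "full_simplex.facet_const TYPE((real, 'n) vec) k \<theta> * diameter K ^ (CARD('n) - 2) * (norm (q K x - (q K x \<bullet> n) *\<^sub>R n))\<^sup>2 \<le> face_energy F" "F \<in> faces"
proof -
  interpret full_simplex "verts K" using elem K by auto
  show "F \<in> faces" using F by (simp add: faces_def)
  have Fi: "F \<notin> interior_faces \<T>" using F faces_disjoint by auto
  obtain z \<alpha> where z: "z \<in> verts K" "F = convex hull (verts K - {z})" "\<alpha> \<in> node_idx k (verts K - {z})"
    "x = node k (verts K - {z}) \<alpha>" using facet_node[OF K x] .
  have uniq: "L = K" if "L \<in> \<T>" "F facet_of L" for L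
    using shared_not_boundary[OF K(1) that(1) _ K(2) that(2)] F by (auto simp: boundary_faces_def)
  have "(THE K. K \<in> \<T> \<and> F facet_of K) = K"
    by (rule the_equality) (use K in blast, use uniq in blast)
  then have tt: "tangential_trace \<T> v F y = q K y - (q K y \<bullet> n) *\<^sub>R n" if "y \<in> F" for y
    using trace_q[OF K(1)] that facet_of_imp_subset[OF K(2)] unfolding tangential_trace_def n_def Let_def by auto
  have "face_energy F = (LINT x:F|surface_measure. inverse (face_size F) * (norm (q K x - (q K x \<bullet> n) *\<^sub>R n))\<^sup>2)"
    using Fi z(2) tt unfolding face_energy_def
    by (auto intro!: set_lebesgue_integral_cong simp del: set_integral_mult_right)
  moreover have "poly_deg k (\<lambda>x. (q K x - (q K x \<bullet> n) *\<^sub>R n) \<bullet> b)" if "b \<in> Basis" for b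
    using poly_deg_diff[OF poly_basis[OF K(1) that] poly_deg_cmult[OF poly_inner[OF K(1), of n], of "n \<bullet> b"]]
    by (simp add: inner_diff_left mult.commute)
  then have "full_simplex.facet_const TYPE((real, 'n) vec) k \<theta> * diameter K ^ (CARD('n) - 2) * (norm (q K x - (q K x \<bullet> n) *\<^sub>R n))\<^sup>2
      \<le> (LINT x:F|surface_measure. inverse (face_size F) * (norm (q K x - (q K x \<bullet> n) *\<^sub>R n))\<^sup>2)"
    using facet_node_bound[OF z(1) dim2 k1 _ _ z(3), of \<theta> "\<lambda>x. q K x - (q K x \<bullet> n) *\<^sub>R n"] shape_regularity_elem(1)[OF K(1)]
      elem(2)[OF K(1)] z(2,4)
    by (simp del: set_integral_mult_right)
  ultimately show "full_simplex.facet_const TYPE((real, 'n) vec) k \<theta> * diameter K ^ (CARD('n) - 2) * (norm (q K x - (q K x \<bullet> n) *\<^sub>R n))\<^sup>2 \<le> face_energy F" by simp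
qed

lemma chain_len_ge: assumes "star x \<noteq> {}" shows "(card (star x))\<^sup>2 \<le> chain_len CARD('n) \<theta>"
proof -
  have "real (card (star x)) \<le> (4 * \<theta>) ^ CARD('n)" using card_star_le[OF assms] by simp
  then have "(real (card (star x)))\<^sup>2 \<le> ((4 * \<theta>) ^ CARD('n))\<^sup>2" by (intro power_mono) auto
  also have "\<dots> \<le> real (chain_len CARD('n) \<theta>)" unfolding chain_len_def by (rule real_nat_ceiling_ge)
  finally show ?thesis by (metis of_nat_le_iff of_nat_power)
qed

text \<open>Each step of a chain of adjacent elements costs one factor \<theta>. As \<theta> is at
  least 1, the actual length may be replaced by its bound.\<close>

lemma star_diameter:
  assumes K: "K \<in> star x" "K' \<in> star x" shows "diameter K \<le> \<theta> ^ chain_len CARD('n) \<theta> * diameter K'"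
proof -
  have T: "K \<in> \<T>" "K' \<in> \<T>" using K by (auto simp: star_def)
  have \<theta>: "1 \<le> \<theta>" using shape_regularity_ge_1 T by blast
  have rel: "diameter K \<le> \<theta> ^ n * diameter L" if "(K, L) \<in> star_adj x ^^ n" for n L using that
  proof (induction n arbitrary: L)
    case (Suc n)
    then obtain M where M: "(K, M) \<in> star_adj x ^^ n" "(M, L) \<in> star_adj x" by auto
    have "diameter K \<le> \<theta> ^ n * diameter M" by (rule Suc.IH[OF M(1)])
    also have "\<dots> \<le> \<theta> ^ n * (\<theta> * diameter L)" using adjacent_diameter[OF M(2)] \<theta> by (intro mult_left_mono) auto
    finally show ?case by (simp add: mult.commute mult.left_commute)
  qed simp
  obtain n where n: "n \<le> (card (star x))\<^sup>2" "(K, K') \<in> star_adj x ^^ n" using star_connected_relpow[OF K] .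
  have "diameter K \<le> \<theta> ^ n * diameter K'" by (rule rel[OF n(2)])
  also have "\<dots> \<le> \<theta> ^ chain_len CARD('n) \<theta> * diameter K'"
  proof (intro mult_right_mono power_increasing \<theta>)
    have "star x \<noteq> {}" using K by auto
    then show "n \<le> chain_len CARD('n) \<theta>" using n(1) chain_len_ge order_trans by blast
  qed (use shape_regularity_elem(3)[OF T(2)] in simp)
  finally show ?thesis .
qed

definition node_energy :: "(real, 'n) vec \<Rightarrow> real" where
  "node_energy x = (\<Sum>F\<in>{F \<in> faces. x \<in> F}. face_energy F)"

text \<open>The largest size that a single jump or tangential trace at \<open>x\<close> can have,
  given the energies of the faces through \<open>x\<close>. It is expressed with the diameter of
  \<open>K\<close> alone, whichever elements of the star are adjacent to the face.\<close>

definition node_jump :: "(real, 'n) vec set \<Rightarrow> (real, 'n) vec \<Rightarrow> real" where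
  "node_jump K x = sqrt (node_const \<Omega> k \<theta> * node_energy x / diameter K ^ (CARD('n) - 2))"

lemma c0_pos: "K \<in> \<T> \<Longrightarrow> 0 < full_simplex.facet_const TYPE((real, 'n) vec) k \<theta>"
  using full_simplex.facet_const_pos[OF elem(1)] shape_regularity_elem(4) by blast

lemma node_energy_nonneg: "0 \<le> node_energy x"
  unfolding node_energy_def by (intro sum_nonneg face_energy_nonneg)

lemma node_const_pos: "K \<in> \<T> \<Longrightarrow> 0 < node_const \<Omega> k \<theta>"
  unfolding node_const_def using c0_pos shape_regularity_elem(4) by simp

lemma node_jump_sq: assumes "K \<in> \<T>" shows "(node_jump K x)\<^sup>2 = node_const \<Omega> k \<theta> * node_energy x / diameter K ^ (CARD('n) - 2)"
  "0 \<le> node_jump K x"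
proof -
  have "0 \<le> node_const \<Omega> k \<theta> * node_energy x / diameter K ^ (CARD('n) - 2)"
    using node_const_pos[OF assms] node_energy_nonneg shape_regularity_elem(3)[OF assms]
    by (intro divide_nonneg_nonneg mult_nonneg_nonneg) (auto simp: less_imp_le)
  then show "(node_jump K x)\<^sup>2 = node_const \<Omega> k \<theta> * node_energy x / diameter K ^ (CARD('n) - 2)"
    "0 \<le> node_jump K x" unfolding node_jump_def by auto
qed

lemma le_node_jump:
  assumes K: "K \<in> star x" and L: "L \<in> star x" and F: "F \<in> faces" "x \<in> F"
    and t: "full_simplex.facet_const TYPE((real, 'n) vec) k \<theta> * diameter L ^ (CARD('n) - 2) * t\<^sup>2 \<le> face_energy F"
  shows "t \<le> node_jump K x"
proof -
  have T: "K \<in> \<T>" "L \<in> \<T>" using K L by (auto simp: star_def)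
  let ?c = "full_simplex.facet_const TYPE((real, 'n) vec) k \<theta>"
  define P where "P = \<theta> ^ (chain_len CARD('n) \<theta> * (CARD('n) - 2))"
  define dK where "dK = diameter K ^ (CARD('n) - 2)"
  define dL where "dL = diameter L ^ (CARD('n) - 2)"
  have pos: "dK > 0" "dL > 0" "?c > 0" "P > 0" using shape_regularity_elem T c0_pos unfolding dK_def dL_def P_def by auto
  have "dK \<le> (\<theta> ^ chain_len CARD('n) \<theta> * diameter L) ^ (CARD('n) - 2)" unfolding dK_def
    using star_diameter[OF K L] shape_regularity_elem(3)[OF T(1)] by (intro power_mono) auto
  then have dKL: "dK \<le> P * dL" by (simp add: P_def dL_def power_mult_distrib power_mult)
  have "face_energy F \<le> node_energy x" unfolding node_energy_def
    using F by (intro member_le_sum face_energy_nonneg) auto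
  then have "?c * dL * t\<^sup>2 \<le> node_energy x" using t unfolding dL_def by linarith
  then have "P * (?c * dL * t\<^sup>2) \<le> P * node_energy x" using pos by (intro mult_left_mono) auto
  moreover have "dK * (?c * t\<^sup>2) \<le> (P * dL) * (?c * t\<^sup>2)" using dKL pos by (intro mult_right_mono) auto
  ultimately have "t\<^sup>2 * (?c * dK) \<le> P * node_energy x" by (simp add: mult_ac)
  then have "t\<^sup>2 \<le> P * node_energy x / (?c * dK)" using pos by (simp add: pos_le_divide_eq)
  also have "\<dots> = node_const \<Omega> k \<theta> * node_energy x / dK" by (simp add: node_const_def P_def)
  finally show ?thesis unfolding node_jump_def dK_def by (rule real_le_rsqrt)
qed

lemma star_values:
  assumes x: "x \<in> mesh_nodes k K" and K: "K \<in> \<T>" and L: "L \<in> star x" "L' \<in> star x"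
  shows "norm (q L x - q L' x) \<le> real (chain_len CARD('n) \<theta>) * node_jump K x"
proof -
  have Ks: "K \<in> star x" using x K mesh_nodes_subset[OF k1 K] by (auto simp: star_def)
  have step: "norm (q M x - q N x) \<le> node_jump K x" if MN: "(M, N) \<in> star_adj x" for M N
  proof -
    obtain F where F: "M \<in> star x" "N \<in> star x" "M \<noteq> N" "F facet_of M" "F facet_of N" "x \<in> F"
      using MN by (auto simp: star_adj_def)
    have T: "M \<in> \<T>" "N \<in> \<T>" "x \<in> M" using F by (auto simp: star_def)
    have "x \<in> mesh_nodes k M" by (rule node_of_neighbour[OF k1 K T(1) x T(3)])
    from jump_node_bound[OF T(1,2) F(3-5) this F(6)] show ?thesis
      using le_node_jump[OF Ks F(1) _ F(6)] by blast
  qed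
  have rel: "norm (q L x - q M x) \<le> real n * node_jump K x" if "(L, M) \<in> star_adj x ^^ n" for n M using that
  proof (induction n arbitrary: M)
    case (Suc n)
    then obtain N where N: "(L, N) \<in> star_adj x ^^ n" "(N, M) \<in> star_adj x" by auto
    have "norm (q L x - q M x) \<le> norm (q L x - q N x) + norm (q N x - q M x)"
      using norm_triangle_ineq[of "q L x - q N x" "q N x - q M x"] by simp
    also have "\<dots> \<le> real n * node_jump K x + node_jump K x" by (intro add_mono Suc.IH[OF N(1)] step[OF N(2)])
    finally show ?case by (simp add: algebra_simps)
  qed simp
  obtain n where n: "n \<le> (card (star x))\<^sup>2" "(L, L') \<in> star_adj x ^^ n" using star_connected_relpow[OF L] .
  have "norm (q L x - q L' x) \<le> real n * node_jump K x" by (rule rel[OF n(2)])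
  also have "\<dots> \<le> real (chain_len CARD('n) \<theta>) * node_jump K x"
  proof (rule mult_right_mono)
    have "star x \<noteq> {}" using L by auto
    then show "real n \<le> real (chain_len CARD('n) \<theta>)" using n(1) chain_len_ge order_trans by (metis of_nat_le_iff)
  qed (rule node_jump_sq(2)[OF K])

  finally show ?thesis .
qed

lemma nodal_const_ge: "real (chain_len CARD('n) \<theta>) + 1 \<le> nodal_const \<Omega> \<theta>"
  unfolding nodal_const_def using angle_const_nonneg
  by (simp add: mult_le_cancel_left1 ring_distribs)

text \<open>At a boundary node the value has to be normal to every boundary face through the node: it is the
  normal part of a trace if all these normals are parallel, and zero otherwise; in the second case the
  tangential traces on two non-parallel faces control the full trace.\<close>

lemma nodal_value_exists:
  assumes x: "x \<in> mesh_nodes k K0" "K0 \<in> \<T>"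
  shows "\<exists>W. (\<forall>F\<in>boundary_faces \<Omega> \<T>. x \<in> F \<longrightarrow> (\<exists>\<beta>. W = \<beta> *\<^sub>R face_normal F)) \<and>
    (\<forall>K\<in>star x. norm (q K x - W) \<le> nodal_const \<Omega> \<theta> * node_jump K x)"
proof -
  have node: "x \<in> mesh_nodes k K" "K \<in> \<T>" "x \<in> K" if "K \<in> star x" for K
    using node_of_neighbour[OF k1 x(2) _ x(1)] that by (auto simp: star_def)
  have K0: "K0 \<in> star x" using x mesh_nodes_subset[OF k1 x(2)] by (auto simp: star_def)
  define B where "B = {F \<in> boundary_faces \<Omega> \<T>. x \<in> F}"
  have el: "\<exists>L\<in>star x. F facet_of L" if "F \<in> B" for F
    using that facet_of_imp_subset unfolding B_def boundary_faces_def star_def by blast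
  let ?P = "\<lambda>F u. u - (u \<bullet> face_normal F) *\<^sub>R face_normal F"
  let ?n = "real (chain_len CARD('n) \<theta>)"
  have tang: "norm (?P F (q L x)) \<le> node_jump K x" if "F \<in> B" "L \<in> star x" "F facet_of L" "K \<in> star x" for F L K
  proof -
    have F: "F \<in> boundary_faces \<Omega> \<T>" "x \<in> F" using that by (auto simp: B_def)
    show ?thesis using boundary_node_bound[OF F(1) node(2)[OF that(2)] that(3) node(1)[OF that(2)] F(2)]
        le_node_jump[OF that(4) that(2) _ F(2)] by blast
  qed
  have diff: "norm (q L x - q L' x) \<le> ?n * node_jump K x" if "K \<in> star x" "L \<in> star x" "L' \<in> star x" for K L L'
    using star_values[OF node(1,2)[OF that(1)] that(2,3)] .
  have J0: "0 \<le> node_jump K x" if "K \<in> star x" for K using node_jump_sq(2)[OF node(2)[OF that]] .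
  have normF: "norm (face_normal F) = 1" if "F \<in> B" for F
  proof -
    obtain L where L: "L \<in> star x" "F facet_of L" using el \<open>F \<in> B\<close> by blast
    interpret full_simplex "verts L" using elem node(2)[OF L(1)] by auto
    show ?thesis using face_normal(1) facet_of_hull_iff L(2) elem(2)[OF node(2)[OF L(1)]] by metis
  qed
  consider "B = {}" | F0 where "F0 \<in> B" "\<forall>F\<in>B. face_normal F = face_normal F0 \<or> face_normal F = - face_normal F0"
    | F1 F2 where "F1 \<in> B" "F2 \<in> B" "face_normal F1 \<noteq> face_normal F2" "face_normal F1 \<noteq> - face_normal F2"
    by (metis ex_in_conv minus_equation_iff)
  then show ?thesis
  proof cases
    case 1
    have "norm (q K x - q K0 x) \<le> nodal_const \<Omega> \<theta> * node_jump K x" if "K \<in> star x" for K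
    proof -
      have "?n * node_jump K x \<le> nodal_const \<Omega> \<theta> * node_jump K x"
        using nodal_const_ge J0[OF that] by (intro mult_right_mono) auto
      then show ?thesis using diff[OF that that K0] by linarith
    qed
    then show ?thesis using 1 unfolding B_def by (intro exI[of _ "q K0 x"]) auto
  next
    case (2 F0)
    obtain L where L: "L \<in> star x" "F0 facet_of L" using el 2(1) by blast
    define W where "W = (q L x \<bullet> face_normal F0) *\<^sub>R face_normal F0"
    have "norm (q K x - W) \<le> nodal_const \<Omega> \<theta> * node_jump K x" if K: "K \<in> star x" for K
    proof -
      have "norm (q K x - W) \<le> norm (q K x - q L x) + norm (?P F0 (q L x))"
        using norm_triangle_ineq[of "q K x - q L x" "?P F0 (q L x)"] by (simp add: W_def)
      also have "\<dots> \<le> ?n * node_jump K x + node_jump K x" by (intro add_mono diff tang K L 2(1))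
      also have "\<dots> = (?n + 1) * node_jump K x" by (simp add: algebra_simps)
      also have "\<dots> \<le> nodal_const \<Omega> \<theta> * node_jump K x" using nodal_const_ge J0[OF K] by (intro mult_right_mono) auto
      finally show ?thesis .
    qed
    moreover have "\<exists>\<beta>. W = \<beta> *\<^sub>R face_normal F" if "F \<in> boundary_faces \<Omega> \<T>" "x \<in> F" for F
    proof -
      have "face_normal F = face_normal F0 \<or> face_normal F = - face_normal F0" using 2(2) that by (auto simp: B_def)
      then show ?thesis unfolding W_def
      proof
        assume "face_normal F = face_normal F0" then show "\<exists>\<beta>. (q L x \<bullet> face_normal F0) *\<^sub>R face_normal F0 = \<beta> *\<^sub>R face_normal F"
          by (intro exI[of _ "q L x \<bullet> face_normal F0"]) simp
      next
        assume "face_normal F = - face_normal F0" then show "\<exists>\<beta>. (q L x \<bullet> face_normal F0) *\<^sub>R face_normal F0 = \<beta> *\<^sub>R face_normal F"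
          by (intro exI[of _ "- (q L x \<bullet> face_normal F0)"]) simp
      qed
    qed
    ultimately show ?thesis by blast
  next
    case (3 F1 F2)
    have "norm (q K x - 0) \<le> nodal_const \<Omega> \<theta> * node_jump K x" if K: "K \<in> star x" for K
    proof -
      \<comment> \<open>A tangential trace is controlled only for the element \<open>L\<close> that
        has the face as a facet. The trace of \<open>K\<close> differs from it by a chain of jumps,
        and the tangential projection does not increase the norm of that difference.\<close>
      have P: "norm (?P F (q K x)) \<le> (?n + 1) * node_jump K x" if F: "F \<in> B" for F
      proof -
        obtain L where L: "L \<in> star x" "F facet_of L" using el F by blast
        define u where "u = q K x - q L x"
        have "norm (?P F u) \<le> norm u"
        proof -
          have "(norm (?P F u))\<^sup>2 = (norm u)\<^sup>2 - (u \<bullet> face_normal F)\<^sup>2"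
          proof -
            have "face_normal F \<bullet> face_normal F = 1" using normF[OF F] by (simp add: dot_square_norm)
            then show ?thesis unfolding power2_norm_eq_inner
              by (simp add: inner_diff_left inner_diff_right inner_commute power2_eq_square)
          qed
          then have "(norm (?P F u))\<^sup>2 \<le> (norm u)\<^sup>2" by simp
          then show ?thesis by (rule power2_le_imp_le) simp
        qed
        also have "norm u \<le> ?n * node_jump K x" unfolding u_def by (rule diff[OF K K L(1)])
        finally have Pu: "norm (?P F u) \<le> ?n * node_jump K x" .
        have eq: "?P F (q K x) = ?P F u + ?P F (q L x)" by (simp add: u_def inner_diff_left scaleR_left_diff_distrib)
        have "norm (?P F (q K x)) \<le> norm (?P F u) + norm (?P F (q L x))" unfolding eq by (rule norm_triangle_ineq)
        also have "\<dots> \<le> ?n * node_jump K x + node_jump K x" by (intro add_mono Pu tang F L K)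
        finally show ?thesis by (simp add: distrib_right)
      qed
      have "norm (q K x) \<le> angle_const \<Omega> * (norm (?P F1 (q K x)) + norm (?P F2 (q K x)))"
        by (rule boundary_normals) (use 3 in \<open>auto simp: B_def\<close>)
      also have "\<dots> \<le> angle_const \<Omega> * ((?n + 1) * node_jump K x + (?n + 1) * node_jump K x)"
        using P[OF 3(1)] P[OF 3(2)] angle_const_nonneg by (intro mult_left_mono add_mono) auto
      also have "\<dots> \<le> nodal_const \<Omega> \<theta> * node_jump K x"
        unfolding nodal_const_def using J0[OF K] by (simp add: algebra_simps)
      finally show ?thesis by simp
    qed
    then show ?thesis by (intro exI[of _ 0]) (auto intro: exI[of _ 0])
  qed
qed

end

section \<open>Conforming approximation\<close>

definition poly_grad :: "(real^'n \<Rightarrow> real) \<Rightarrow> real^'n \<Rightarrow> real^'n" where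
  "poly_grad f = (SOME g. C1_with_grad f g)"

lemma poly_grad: assumes "poly_deg k f" shows "C1_with_grad f (poly_grad f)"
proof -
  obtain g H where g: "\<And>x. (f has_derivative (\<lambda>h. g x \<bullet> h)) (at x)" "\<And>x. (g has_derivative (\<lambda>h. H x *v h)) (at x)"
    using poly_deg_has_symmetric_hessian[OF assms] by blast
  then have "C1_with_grad f g" unfolding C1_with_grad_def
    by (meson has_derivative_continuous continuous_at_imp_continuous_on)
  then show ?thesis unfolding poly_grad_def by (rule someI[where P="C1_with_grad f"])
qed

lemma C1_grad_unique: assumes "C1_with_grad f g" "C1_with_grad f g'" shows "g = g'"
proof
  fix x
  have "(\<lambda>h. g x \<bullet> h) = (\<lambda>h. g' x \<bullet> h)" using assms has_derivative_unique unfolding C1_with_grad_def by blast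
  then show "g x = g' x" by (metis vector_eq_rdot)
qed

lemma poly_grad_diff:
  assumes "poly_deg k f" "poly_deg k f'"
  shows "poly_grad (\<lambda>x. f x - f' x) x = poly_grad f x - poly_grad f' x"
  using C1_grad_unique[OF poly_grad[OF poly_deg_diff[OF assms]] C1_diff[OF poly_grad[OF assms(1)] poly_grad[OF assms(2)]]]
  by (rule fun_cong)

text \<open>In order: the number of components, the squared constant of the inverse estimate, the
  number of nodes from Cauchy-Schwarz, the volume bound of an element, and the squared nodal defect
  in terms of the face energies.\<close>

definition grad_err_const :: "'a::euclidean_space set \<Rightarrow> nat \<Rightarrow> real \<Rightarrow> real" where
  "grad_err_const \<Omega> k \<theta> = real DIM('a) * (full_simplex.lagrange_const TYPE('a) k * real (Suc DIM('a)) * \<theta>)\<^sup>2 *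
     real ((k + 1) ^ Suc DIM('a)) * unit_ball_vol (real DIM('a)) * (nodal_const \<Omega> \<theta>)\<^sup>2 * node_const \<Omega> k \<theta>"

text \<open>The last factor bounds how often the energy of one face is counted: nodes per element
  times elements that touch the face.\<close>

definition err_const :: "'a::euclidean_space set \<Rightarrow> nat \<Rightarrow> real \<Rightarrow> real" where
  "err_const \<Omega> k \<theta> = grad_err_const \<Omega> k \<theta> * (real ((k + 1) ^ Suc DIM('a)) * (real (Suc DIM('a)) * (4 * \<theta>) ^ DIM('a)))"

context broken_field begin

text \<open>The value is chosen for the point and not for an element with an index, so that all
  elements at a node receive the same value.\<close>

definition nodal :: "(real, 'n) vec \<Rightarrow> (real, 'n) vec" where
  "nodal x = (SOME W. (\<forall>F\<in>boundary_faces \<Omega> \<T>. x \<in> F \<longrightarrow> (\<exists>\<beta>. W = \<beta> *\<^sub>R face_normal F)) \<and>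
    (\<forall>K\<in>star x. norm (q K x - W) \<le> nodal_const \<Omega> \<theta> * node_jump K x))"

lemma nodal:
  assumes "x \<in> mesh_nodes k K" "K \<in> \<T>"
  shows "F \<in> boundary_faces \<Omega> \<T> \<Longrightarrow> x \<in> F \<Longrightarrow> \<exists>\<beta>. nodal x = \<beta> *\<^sub>R face_normal F"
    "norm (q K x - nodal x) \<le> nodal_const \<Omega> \<theta> * node_jump K x"
proof -
  from someI_ex[OF nodal_value_exists[OF assms]]
  have *: "(\<forall>F\<in>boundary_faces \<Omega> \<T>. x \<in> F \<longrightarrow> (\<exists>\<beta>. nodal x = \<beta> *\<^sub>R face_normal F)) \<and>
    (\<forall>K\<in>star x. norm (q K x - nodal x) \<le> nodal_const \<Omega> \<theta> * node_jump K x)"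
    unfolding nodal_def .
  then show "F \<in> boundary_faces \<Omega> \<T> \<Longrightarrow> x \<in> F \<Longrightarrow> \<exists>\<beta>. nodal x = \<beta> *\<^sub>R face_normal F" by blast
  have "K \<in> star x" using assms mesh_nodes_subset[OF k1] by (auto simp: star_def)
  then show "norm (q K x - nodal x) \<le> nodal_const \<Omega> \<theta> * node_jump K x" using * by blast
qed

definition idx :: "(real, 'n) vec set \<Rightarrow> ((real, 'n) vec \<Rightarrow> nat) set" where "idx K = node_idx k (verts K)"

definition pt :: "(real, 'n) vec set \<Rightarrow> ((real, 'n) vec \<Rightarrow> nat) \<Rightarrow> (real, 'n) vec" where "pt K = node k (verts K)"

definition defect :: "(real, 'n) vec set \<Rightarrow> ((real, 'n) vec \<Rightarrow> nat) \<Rightarrow> (real, 'n) vec" where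
  "defect K \<alpha> = q K (pt K \<alpha>) - nodal (pt K \<alpha>)"

definition corr :: "(real, 'n) vec set \<Rightarrow> 'n \<Rightarrow> (real, 'n) vec \<Rightarrow> real" where
  "corr K i x = (\<Sum>\<alpha>\<in>idx K. defect K \<alpha> $ i * full_simplex.lagrange (verts K) k \<alpha> x)"

text \<open>Although it is the Lagrange interpolant of the nodal values, the field is written as
  \<open>q K\<close> minus a correction: the error is then the correction itself, whose coefficients
  are the small defects.\<close>

definition conf_field :: "(real, 'n) vec set \<Rightarrow> 'n \<Rightarrow> (real, 'n) vec \<Rightarrow> real" where
  "conf_field K i x = q K x $ i - corr K i x"

lemma poly_corr: "K \<in> \<T> \<Longrightarrow> poly_deg k (corr K i)"
  unfolding corr_def[abs_def] idx_def
  by (intro poly_deg_sum poly_deg_cmult full_simplex.poly_deg_lagrange elem)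

lemma poly_conf_field: "K \<in> \<T> \<Longrightarrow> poly_deg k (conf_field K i)"
  unfolding conf_field_def[abs_def] by (intro poly_deg_diff poly poly_corr)

lemma conf_field_node:
  assumes K: "K \<in> \<T>" and b: "\<beta> \<in> idx K" shows "conf_field K i (pt K \<beta>) = nodal (pt K \<beta>) $ i"
proof -
  interpret full_simplex "verts K" using elem K by auto
  have "corr K i (pt K \<beta>) = (\<Sum>\<alpha>\<in>idx K. if \<alpha> = \<beta> then defect K \<beta> $ i else 0)"
    unfolding corr_def using b lagrange_node[OF k1] by (intro sum.cong) (auto simp: idx_def pt_def)
  also have "\<dots> = defect K \<beta> $ i" using b by (simp add: idx_def finite_node_idx)
  finally show ?thesis by (simp add: conf_field_def defect_def)
qed

text \<open>Both polynomials take the values of \<open>nodal\<close> at the nodes of the common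
  facet, so unisolvence on the facet identifies their restrictions.\<close>

lemma conf_field_conforming:
  assumes K: "K \<in> \<T>" "K' \<in> \<T>" and fp: "facet_pair (verts K) (verts K') z z'" and y: "y \<in> convex hull (verts K - {z})"
  shows "conf_field K i y = conf_field K' i y"
proof -
  interpret fp: facet_pair "verts K" "verts K'" z z' by (rule fp)
  have "conf_field K i y - conf_field K' i y = 0"
  proof (rule poly_deg_unisolvent[where T="verts K - {z}" and k=k])
    show "poly_deg k (\<lambda>y. conf_field K i y - conf_field K' i y)" by (intro poly_deg_diff poly_conf_field K)
    show "y \<in> affine hull (verts K - {z})" using y convex_hull_subset_affine_hull by blast
    fix \<alpha> assume a: "\<alpha> \<in> node_idx k (verts K - {z})"
    have "\<alpha> \<in> idx K" "node k (verts K - {z}) \<alpha> = pt K \<alpha>"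
      using node_idx_mono[of "verts K - {z}" "verts K" k] node_mono[of "verts K - {z}" "verts K" \<alpha> k] a by (auto simp: idx_def pt_def)
    moreover have "\<alpha> \<in> idx K'" "node k (verts K - {z}) \<alpha> = pt K' \<alpha>"
      using node_idx_mono[of "verts K' - {z'}" "verts K'" k] node_mono[of "verts K' - {z'}" "verts K'" \<alpha> k] a
      unfolding fp.common by (auto simp: idx_def pt_def)
    ultimately show "conf_field K i (node k (verts K - {z}) \<alpha>) - conf_field K' i (node k (verts K - {z}) \<alpha>) = 0"
      using conf_field_node K by (metis diff_self)
  qed (use k1 in auto)
  then show ?thesis by simp
qed

text \<open>A flat face has a constant normal, so the tangential part of the field is again
  polynomial of degree \<open>k\<close> on it. It vanishes at all nodes of the facet, hence on the
  whole facet.\<close>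

lemma conf_field_boundary:
  assumes K: "K \<in> \<T>" "z \<in> verts K" and bd: "convex hull (verts K - {z}) \<subseteq> frontier \<Omega>" and y: "y \<in> convex hull (verts K - {z})"
  shows "\<exists>\<beta>. \<forall>i. conf_field K i y = \<beta> * bary_grad (verts K) z $ i"
proof -
  interpret full_simplex "verts K" using elem K by auto
  let ?F = "convex hull (verts K - {z})"
  have "?F facet_of K" using facet_of_hull_iff[of ?F] K elem(2) by auto
  then have F: "?F \<in> boundary_faces \<Omega> \<T>" using bd K by (auto simp: boundary_faces_def)
  define n where "n = face_normal ?F"
  obtain a where a: "n = a *\<^sub>R bary_grad (verts K) z" using face_normal(2)[OF K(2)] n_def by auto
  have nn: "(\<Sum>j\<in>UNIV. n $ j * n $ j) = 1"
    using face_normal(1)[OF K(2)] unfolding n_def[symmetric] by (simp add: norm_eq_1 inner_vec_def)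
  define f where "f i x = conf_field K i x - n $ i * (\<Sum>j\<in>UNIV. n $ j * conf_field K j x)" for i x
  have "f i y = 0" for i
  proof (rule poly_deg_unisolvent[where T="verts K - {z}" and k=k])
    show "poly_deg k (f i)" unfolding f_def by (intro poly_deg_diff poly_deg_sum poly_deg_cmult poly_conf_field K)
    show "y \<in> affine hull (verts K - {z})" using y convex_hull_subset_affine_hull by blast
    fix \<alpha> assume a: "\<alpha> \<in> node_idx k (verts K - {z})"
    have al: "\<alpha> \<in> idx K" "node k (verts K - {z}) \<alpha> = pt K \<alpha>"
      using node_idx_mono[of "verts K - {z}" "verts K" k] node_mono[of "verts K - {z}" "verts K" \<alpha> k] a by (auto simp: idx_def pt_def)
    have "pt K \<alpha> \<in> ?F" using node_in_hull[of "verts K - {z}" k \<alpha>] a k1 al(2) by simp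
    moreover have "pt K \<alpha> \<in> mesh_nodes k K" using al by (auto simp: mesh_nodes_def idx_def pt_def)
    ultimately obtain \<beta> where "nodal (pt K \<alpha>) = \<beta> *\<^sub>R n" using nodal(1)[OF _ K(1) F] n_def by blast
    then have c: "conf_field K j (pt K \<alpha>) = \<beta> * n $ j" for j using conf_field_node[OF K(1) al(1)] by simp
    have "(\<Sum>j\<in>UNIV. n $ j * conf_field K j (pt K \<alpha>)) = \<beta> * (\<Sum>j\<in>UNIV. n $ j * n $ j)"
      by (simp add: c sum_distrib_left mult_ac)
    then show "f i (node k (verts K - {z}) \<alpha>) = 0" by (simp add: f_def al(2) c nn)
  qed (use k1 in auto)
  define c where "c = (\<Sum>j\<in>UNIV. n $ j * conf_field K j y)"
  have "conf_field K i y = n $ i * c" for i using \<open>f i y = 0\<close> unfolding f_def c_def by simp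
  moreover have "n $ i = a * bary_grad (verts K) z $ i" for i unfolding a by simp
  ultimately have "conf_field K i y = (a * c) * bary_grad (verts K) z $ i" for i by simp
  then show ?thesis by blast
qed

lemma green_conf_field:
  defines "D \<equiv> \<lambda>K i. poly_grad (conf_field K i)"
  shows "(\<Sum>K\<in>\<T>. LINT x:interior K|lborel. (\<Sum>i\<in>UNIV. \<Sum>j\<in>UNIV. D K i x $ j * D K j x $ i - D K i x $ i * D K j x $ j)) = 0"
proof (rule green_conforming[OF poly_conf_field])
  show "K \<in> \<T> \<Longrightarrow> (conf_field K i has_derivative (\<lambda>h. D K i x \<bullet> h)) (at x)" for K i x
    using poly_grad[OF poly_conf_field] unfolding D_def C1_with_grad_def by blast
  show "conf_field K i y = conf_field K' i y"
    if "K \<in> \<T>" "K' \<in> \<T>" "K \<noteq> K'" "facet_pair (verts K) (verts K') z z'" "y \<in> convex hull (verts K - {z})" for K K' z z' y i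
    using conf_field_conforming[OF that(1,2,4,5)] .
  show "\<exists>\<beta>. \<forall>i. conf_field K i y = \<beta> * bary_grad (verts K) z $ i"
    if "K \<in> \<T>" "z \<in> verts K" "convex hull (verts K - {z}) \<subseteq> frontier \<Omega>" "y \<in> convex hull (verts K - {z})" for K z y
    using conf_field_boundary[OF that] .
qed

lemma finite_idx: "K \<in> \<T> \<Longrightarrow> finite (idx K)"
  unfolding idx_def using full_simplex.finite_S[OF elem(1)] by (intro finite_node_idx)

lemma card_idx_le: assumes "K \<in> \<T>" shows "real (card (idx K)) \<le> real ((k + 1) ^ Suc CARD('n))"
proof -
  interpret full_simplex "verts K" using elem assms by auto
  show ?thesis using card_node_idx_le[of "verts K" k] card_S unfolding idx_def by (simp only: of_nat_le_iff) simp
qed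

text \<open>An inverse estimate without norm equivalence on a reference simplex: the explicit
  Lipschitz constant of a combination of Lagrange functions bounds its gradient, and Cauchy-Schwarz
  turns the sum of the coefficients into a sum of squares.\<close>

lemma norm_grad_corr_le:
  assumes K: "K \<in> \<T>" and x: "x \<in> interior K"
  shows "(norm (poly_grad (corr K i) x))\<^sup>2 \<le>
    (full_simplex.lagrange_const TYPE((real, 'n) vec) k * real (Suc CARD('n)) * \<theta>)\<^sup>2 / (diameter K)\<^sup>2
      * real ((k + 1) ^ Suc CARD('n)) * (\<Sum>\<alpha>\<in>idx K. (norm (defect K \<alpha>))\<^sup>2)"
proof -
  interpret full_simplex "verts K" using elem K by auto
  define Q where "Q = lagrange_const k * real (Suc CARD('n))"
  define s where "s = (\<Sum>\<alpha>\<in>idx K. \<bar>defect K \<alpha> $ i\<bar>)"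
  have Q: "0 \<le> Q" unfolding Q_def lagrange_const_def using binom_bound(1)[of k] by simp
  have s: "0 \<le> s" unfolding s_def by (intro sum_nonneg) auto
  have pos: "0 < inball_diameter K" "0 < diameter K" "0 < \<theta>" using shape_regularity_elem[OF K] by auto
  have "norm (poly_grad (corr K i) x) \<le> Q / inball_diameter K * s"
  proof (rule norm_gradient_le_lipschitz[OF _ x])
    show "(corr K i has_derivative (\<lambda>h. poly_grad (corr K i) x \<bullet> h)) (at x)"
      using poly_grad[OF poly_corr[OF K]] unfolding C1_with_grad_def by blast
    show "0 \<le> Q / inball_diameter K * s" using Q s pos by (intro mult_nonneg_nonneg divide_nonneg_pos) auto
    have xK: "x \<in> K" using x interior_subset by blast
    show "\<bar>corr K i y - corr K i x\<bar> \<le> Q / inball_diameter K * s * norm (y - x)" if "y \<in> K" for y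
      using lagrange_sum_lipschitz[of y x "\<lambda>\<alpha>. defect K \<alpha> $ i" k] that xK elem(2)[OF K]
      unfolding corr_def idx_def s_def Q_def by simp
  qed
  also have "\<dots> \<le> Q * \<theta> / diameter K * s"
  proof (rule mult_right_mono[OF _ s])
    have "diameter K \<le> \<theta> * inball_diameter K" using shape_regularity_elem(1)[OF K] .
    then have "Q * diameter K \<le> Q * (\<theta> * inball_diameter K)" using Q by (rule mult_left_mono)
    then show "Q / inball_diameter K \<le> Q * \<theta> / diameter K" using pos by (simp add: divide_le_eq le_divide_eq mult_ac)
  qed
  finally have "(norm (poly_grad (corr K i) x))\<^sup>2 \<le> (Q * \<theta> / diameter K * s)\<^sup>2" by (rule power_mono) simp
  also have "\<dots> = (Q * \<theta>)\<^sup>2 / (diameter K)\<^sup>2 * s\<^sup>2" by (simp add: power_mult_distrib power_divide)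
  also have "\<dots> \<le> (Q * \<theta>)\<^sup>2 / (diameter K)\<^sup>2 * (real ((k + 1) ^ Suc CARD('n)) * (\<Sum>\<alpha>\<in>idx K. (norm (defect K \<alpha>))\<^sup>2))"
  proof (rule mult_left_mono)
    have "s\<^sup>2 \<le> (\<Sum>\<alpha>\<in>idx K. \<bar>defect K \<alpha> $ i\<bar>\<^sup>2) * real (card (idx K))"
      unfolding s_def using finite_idx[OF K] by (intro sum_squared_le_sum_of_squares)
    also have "\<dots> \<le> (\<Sum>\<alpha>\<in>idx K. (norm (defect K \<alpha>))\<^sup>2) * real ((k + 1) ^ Suc CARD('n))"
      using card_idx_le[OF K] component_le_norm_cart[of "defect K _" i]
      by (intro mult_mono sum_mono power_mono sum_nonneg) auto
    finally show "s\<^sup>2 \<le> real ((k + 1) ^ Suc CARD('n)) * (\<Sum>\<alpha>\<in>idx K. (norm (defect K \<alpha>))\<^sup>2)" by (simp add: mult.commute)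
  qed auto
  finally show ?thesis by (simp add: Q_def mult.assoc)
qed

lemma set_integrable_interior:
  assumes "K \<in> \<T>" "continuous_on UNIV f" shows "set_integrable lborel (interior K) (f :: (real, 'n) vec \<Rightarrow> real)"
proof -
  have "set_integrable lborel K f"
    using elem_compact(1)[OF assms(1)] assms(2)
    by (intro borel_integrable_compact[unfolded set_integrable_def[symmetric]]) (auto intro: continuous_on_subset)
  then show ?thesis by (rule set_integrable_subset) (auto simp: interior_subset)
qed

lemma volume_le: assumes "K \<in> \<T>"
  shows "measure lborel (interior K) \<le> unit_ball_vol (real CARD('n)) * diameter K ^ CARD('n)" "emeasure lborel (interior K) < \<infinity>"
proof -
  obtain x where x: "x \<in> K" using elem_interior(1)[OF assms] interior_subset by blast
  have sub: "interior K \<subseteq> cball x (diameter K)"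
  proof
    fix y assume "y \<in> interior K"
    then have "y \<in> K" using interior_subset by blast
    then show "y \<in> cball x (diameter K)" using diameter_bounded_bound[OF elem_compact(4)[OF assms] x] by simp
  qed
  then have "measure lborel (interior K) \<le> measure lborel (cball x (diameter K))"
    by (intro measure_mono_fmeasurable) (auto intro: fmeasurableI[OF _ emeasure_lborel_cball_finite])
  also have "\<dots> = unit_ball_vol (real CARD('n)) * diameter K ^ CARD('n)"
    using shape_regularity_elem(3)[OF assms] by (simp add: content_cball)
  finally show "measure lborel (interior K) \<le> unit_ball_vol (real CARD('n)) * diameter K ^ CARD('n)" .
  show "emeasure lborel (interior K) < \<infinity>"
    using emeasure_mono[OF sub, of lborel] emeasure_lborel_cball_finite[of x "diameter K"] by (auto intro: le_less_trans)
qed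

lemma defect_sq_le:
  assumes K: "K \<in> \<T>" and a: "\<alpha> \<in> idx K"
  shows "(norm (defect K \<alpha>))\<^sup>2 \<le> (nodal_const \<Omega> \<theta>)\<^sup>2 * (node_const \<Omega> k \<theta> * node_energy (pt K \<alpha>) / diameter K ^ (CARD('n) - 2))"
proof -
  have "pt K \<alpha> \<in> mesh_nodes k K" using a by (auto simp: mesh_nodes_def idx_def pt_def)
  then have "norm (defect K \<alpha>) \<le> nodal_const \<Omega> \<theta> * node_jump K (pt K \<alpha>)"
    unfolding defect_def by (rule nodal(2)[OF _ K])
  then have "(norm (defect K \<alpha>))\<^sup>2 \<le> (nodal_const \<Omega> \<theta> * node_jump K (pt K \<alpha>))\<^sup>2" by (rule power_mono) simp
  then show ?thesis by (simp add: power_mult_distrib node_jump_sq(1)[OF K])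
qed

lemma grad_corr_elem:
  assumes K: "K \<in> \<T>"
  shows "(LINT x:interior K|lborel. \<Sum>i\<in>UNIV. (norm (poly_grad (corr K i) x))\<^sup>2)
    \<le> grad_err_const \<Omega> k \<theta> * (\<Sum>\<alpha>\<in>idx K. node_energy (pt K \<alpha>))"
proof -
  let ?d = "CARD('n)" and ?N = "real ((k + 1) ^ Suc CARD('n))" and ?V = "unit_ball_vol (real CARD('n))"
  define L where "L = (full_simplex.lagrange_const TYPE((real, 'n) vec) k * real (Suc ?d) * \<theta>)\<^sup>2"
  define h where "h = diameter K"
  define E where "E = (\<Sum>\<alpha>\<in>idx K. node_energy (pt K \<alpha>))"
  have h: "h > 0" using shape_regularity_elem(3)[OF K] h_def by simp
  have L: "0 \<le> L" by (simp add: L_def)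
  define B where "B = L / h\<^sup>2 * ?N * (\<Sum>\<alpha>\<in>idx K. (norm (defect K \<alpha>))\<^sup>2)"
  have B0: "0 \<le> B" unfolding B_def using L by (intro mult_nonneg_nonneg sum_nonneg divide_nonneg_nonneg) auto
  have cont: "continuous_on UNIV (\<lambda>x. \<Sum>i\<in>UNIV. (norm (poly_grad (corr K i) x))\<^sup>2)"
    using poly_grad[OF poly_corr[OF K]] unfolding C1_with_grad_def by (intro continuous_intros) auto
  have "(LINT x:interior K|lborel. \<Sum>i\<in>UNIV. (norm (poly_grad (corr K i) x))\<^sup>2) \<le> (LINT x:interior K|lborel. real ?d * B)"
    unfolding set_lebesgue_integral_def
  proof (rule integral_mono)
    show "integrable lborel (\<lambda>x. indicator (interior K) x *\<^sub>R (\<Sum>i\<in>UNIV. (norm (poly_grad (corr K i) x))\<^sup>2))"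
      using set_integrable_interior[OF K cont] by (simp add: set_integrable_def)
    show "integrable lborel (\<lambda>x. indicator (interior K) x *\<^sub>R (real ?d * B))"
      using set_integrable_interior[OF K, of "\<lambda>_. real ?d * B"] by (simp add: set_integrable_def)
    fix x
    show "indicator (interior K) x *\<^sub>R (\<Sum>i\<in>UNIV. (norm (poly_grad (corr K i) x))\<^sup>2) \<le> indicator (interior K) x *\<^sub>R (real ?d * B)"
    proof (cases "x \<in> interior K")
      case True
      have "(\<Sum>i\<in>UNIV. (norm (poly_grad (corr K i) x))\<^sup>2) \<le> (\<Sum>i\<in>(UNIV::'n set). B)"
        unfolding B_def L_def h_def by (intro sum_mono norm_grad_corr_le K True)
      then show ?thesis using True by simp
    qed simp
  qed
  also have "\<dots> = measure lborel (interior K) * (real ?d * B)"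
    using volume_le(2)[OF K] by (simp add: set_lebesgue_integral_def)
  also have "\<dots> \<le> (?V * h ^ ?d) * (real ?d * B)"
    using volume_le(1)[OF K] B0 by (intro mult_right_mono) (auto simp: h_def)
  also have "\<dots> = (real ?d * L * ?N * ?V) * (h ^ (?d - 2) * (\<Sum>\<alpha>\<in>idx K. (norm (defect K \<alpha>))\<^sup>2))"
  proof -
    have "2 + (?d - 2) = ?d" using d2 by linarith
    then have "h ^ ?d = h\<^sup>2 * h ^ (?d - 2)" by (metis power_add)

    then show ?thesis unfolding B_def using h by (simp add: field_simps)
  qed
  also have "\<dots> \<le> (real ?d * L * ?N * ?V) * ((nodal_const \<Omega> \<theta>)\<^sup>2 * node_const \<Omega> k \<theta> * E)"
  proof (rule mult_left_mono)
    have "(\<Sum>\<alpha>\<in>idx K. (norm (defect K \<alpha>))\<^sup>2) \<le> (\<Sum>\<alpha>\<in>idx K. (nodal_const \<Omega> \<theta>)\<^sup>2 * (node_const \<Omega> k \<theta> * node_energy (pt K \<alpha>) / h ^ (?d - 2)))"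
      unfolding h_def by (intro sum_mono defect_sq_le K)
    also have "\<dots> = ((nodal_const \<Omega> \<theta>)\<^sup>2 * node_const \<Omega> k \<theta> * E) / h ^ (?d - 2)"
      by (simp add: E_def sum_distrib_left sum_divide_distrib mult.assoc)
    finally show "h ^ (?d - 2) * (\<Sum>\<alpha>\<in>idx K. (norm (defect K \<alpha>))\<^sup>2) \<le> (nodal_const \<Omega> \<theta>)\<^sup>2 * node_const \<Omega> k \<theta> * E"
      using h by (simp add: pos_le_divide_eq mult.commute)
  qed (use L in \<open>auto intro!: mult_nonneg_nonneg\<close>)
  also have "\<dots> = grad_err_const \<Omega> k \<theta> * E" unfolding grad_err_const_def L_def by simp
  finally show ?thesis by (simp add: E_def)
qed

text \<open>Double counting: after exchanging the sums, the energy of a face appears only for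
  elements that touch it, at most once for each of their nodes.\<close>

lemma sum_node_energy_le:
  "(\<Sum>K\<in>\<T>. \<Sum>\<alpha>\<in>idx K. node_energy (pt K \<alpha>))
    \<le> (real ((k + 1) ^ Suc CARD('n)) * (real (Suc CARD('n)) * (4 * \<theta>) ^ CARD('n))) * (\<Sum>F\<in>faces. face_energy F)"
proof -
  let ?N = "real ((k + 1) ^ Suc CARD('n))" and ?M = "real (Suc CARD('n)) * (4 * \<theta>) ^ CARD('n)"
  have "(\<Sum>\<alpha>\<in>idx K. node_energy (pt K \<alpha>)) \<le> (\<Sum>F\<in>faces. if K \<inter> F \<noteq> {} then ?N * face_energy F else 0)" if K: "K \<in> \<T>" for K
  proof -
    have sub: "pt K \<alpha> \<in> K" if "\<alpha> \<in> idx K" for \<alpha>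
      using that mesh_nodes_subset[OF k1 K] unfolding idx_def pt_def mesh_nodes_def by blast
    have "(\<Sum>\<alpha>\<in>idx K. node_energy (pt K \<alpha>)) = (\<Sum>\<alpha>\<in>idx K. \<Sum>F\<in>faces. if pt K \<alpha> \<in> F then face_energy F else 0)"
      unfolding node_energy_def by (intro sum.cong refl sum.inter_filter) simp
    also have "\<dots> \<le> (\<Sum>\<alpha>\<in>idx K. \<Sum>F\<in>faces. if K \<inter> F \<noteq> {} then face_energy F else 0)"
      using sub face_energy_nonneg by (intro sum_mono) auto
    also have "\<dots> = real (card (idx K)) * (\<Sum>F\<in>faces. if K \<inter> F \<noteq> {} then face_energy F else 0)" by simp
    also have "\<dots> \<le> ?N * (\<Sum>F\<in>faces. if K \<inter> F \<noteq> {} then face_energy F else 0)"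
      using face_energy_nonneg by (intro mult_right_mono card_idx_le K sum_nonneg) auto
    also have "\<dots> = (\<Sum>F\<in>faces. if K \<inter> F \<noteq> {} then ?N * face_energy F else 0)"
      unfolding sum_distrib_left by (intro sum.cong) auto
    finally show ?thesis .
  qed
  then have "(\<Sum>K\<in>\<T>. \<Sum>\<alpha>\<in>idx K. node_energy (pt K \<alpha>)) \<le> (\<Sum>K\<in>\<T>. \<Sum>F\<in>faces. if K \<inter> F \<noteq> {} then ?N * face_energy F else 0)"
    by (rule sum_mono)
  also have "\<dots> = (\<Sum>F\<in>faces. \<Sum>K\<in>\<T>. if K \<inter> F \<noteq> {} then ?N * face_energy F else 0)" by (rule sum.swap)
  also have "\<dots> = (\<Sum>F\<in>faces. real (card {K \<in> \<T>. K \<inter> F \<noteq> {}}) * (?N * face_energy F))"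
    by (intro sum.cong refl) (simp flip: sum.inter_filter)
  also have "\<dots> \<le> (\<Sum>F\<in>faces. ?M * (?N * face_energy F))"
  proof (intro sum_mono mult_right_mono)
    fix F assume "F \<in> faces"
    then obtain L where L: "L \<in> \<T>" "F facet_of L"
      unfolding faces_def interior_faces_def boundary_faces_def by blast
    have "card {K \<in> \<T>. K \<inter> F \<noteq> {}} \<le> card {K \<in> \<T>. K \<inter> L \<noteq> {}}"
      using facet_of_imp_subset[OF L(2)] by (intro card_mono) auto
    then show "real (card {K \<in> \<T>. K \<inter> F \<noteq> {}}) \<le> ?M" using card_touching_le[OF L(1)] by simp
  qed (use face_energy_nonneg in auto)
  also have "\<dots> = (?N * ?M) * (\<Sum>F\<in>faces. face_energy F)"     by (simp only: sum_distrib_left[symmetric]) (simp only: mult_ac)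
  finally show ?thesis .
qed

lemma grad_corr_total:
  "(\<Sum>K\<in>\<T>. LINT x:interior K|lborel. \<Sum>i\<in>UNIV. (norm (poly_grad (corr K i) x))\<^sup>2)
    \<le> err_const \<Omega> k \<theta> * (\<Sum>F\<in>faces. face_energy F)"
proof (cases "\<T> = {}")
  case True
  \<comment> \<open>For the empty mesh \<open>shape_regularity\<close> is the maximum of an empty
    set, so the sign of the constant is unknown; here both sums are zero.\<close>
  have "faces = {}" unfolding faces_def interior_faces_def boundary_faces_def using True by blast
  then have "(\<Sum>F\<in>faces. face_energy F) = 0" by simp
  moreover have "(\<Sum>K\<in>\<T>. LINT x:interior K|lborel. \<Sum>i\<in>UNIV. (norm (poly_grad (corr K i) x))\<^sup>2) = 0"
    by (rule sum.neutral) (use True in blast)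
  ultimately show ?thesis by simp
next
  case False
  then obtain K0 where "K0 \<in> \<T>" by auto
  then have g: "0 \<le> grad_err_const \<Omega> k \<theta>" unfolding grad_err_const_def using node_const_pos
    by (intro mult_nonneg_nonneg) (auto simp: less_imp_le)
  have "(\<Sum>K\<in>\<T>. LINT x:interior K|lborel. \<Sum>i\<in>UNIV. (norm (poly_grad (corr K i) x))\<^sup>2)
    \<le> (\<Sum>K\<in>\<T>. grad_err_const \<Omega> k \<theta> * (\<Sum>\<alpha>\<in>idx K. node_energy (pt K \<alpha>)))" by (intro sum_mono grad_corr_elem)
  also have "\<dots> = grad_err_const \<Omega> k \<theta> * (\<Sum>K\<in>\<T>. \<Sum>\<alpha>\<in>idx K. node_energy (pt K \<alpha>))" by (simp add: sum_distrib_left)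
  also have "\<dots> \<le> grad_err_const \<Omega> k \<theta> * ((real ((k + 1) ^ Suc CARD('n)) * (real (Suc CARD('n)) * (4 * \<theta>) ^ CARD('n))) * (\<Sum>F\<in>faces. face_energy F))"
    by (intro mult_left_mono sum_node_energy_le g)
  finally show ?thesis by (simp add: err_const_def mult.assoc)
qed

end

section \<open>Comparison of the energies\<close>

definition grad_sq :: "('n::finite \<Rightarrow> real^'n) \<Rightarrow> real" where
  "grad_sq a = (\<Sum>i\<in>UNIV. (norm (a i))\<^sup>2)"

text \<open>The sum counts each component of the curl twice.\<close>

definition div_curl_sq :: "('n::finite \<Rightarrow> real^'n) \<Rightarrow> real" where
  "div_curl_sq a = (\<Sum>i\<in>UNIV. a i $ i)\<^sup>2 + (\<Sum>i\<in>UNIV. \<Sum>j\<in>UNIV. (a i $ j - a j $ i)\<^sup>2) / 2"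

lemma norm_sq_vec: "(norm (x :: real^'n))\<^sup>2 = (\<Sum>j\<in>UNIV. (x $ j)\<^sup>2)"
  unfolding power2_norm_eq_inner inner_vec_def by (simp add: power2_eq_square)

text \<open>Expanding the squares leaves the full gradient minus the products of transposed entries,
  plus the products of diagonal entries. The correction is exactly the null Lagrangian that
  integrates to zero for conforming fields.\<close>

lemma div_curl_sq_eq:
  "div_curl_sq a = grad_sq a - (\<Sum>i\<in>UNIV. \<Sum>j\<in>UNIV. a i $ j * a j $ i - a i $ i * a j $ j)"
proof -
  have "(\<Sum>i\<in>UNIV. \<Sum>j\<in>UNIV. (a i $ j - a j $ i)\<^sup>2)
      = (\<Sum>i\<in>UNIV. \<Sum>j\<in>UNIV. (a i $ j)\<^sup>2) + (\<Sum>i\<in>UNIV. \<Sum>j\<in>UNIV. (a j $ i)\<^sup>2) - 2 * (\<Sum>i\<in>UNIV. \<Sum>j\<in>UNIV. a i $ j * a j $ i)"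
    by (simp add: power2_diff sum.distrib sum_subtractf sum_distrib_left mult.assoc)
  moreover have "(\<Sum>i\<in>UNIV. \<Sum>j\<in>UNIV. (a j $ i)\<^sup>2) = grad_sq a"
    unfolding grad_sq_def norm_sq_vec by (rule sum.swap)
  moreover have "(\<Sum>i\<in>UNIV. a i $ i)\<^sup>2 = (\<Sum>i\<in>UNIV. \<Sum>j\<in>UNIV. a i $ i * a j $ j)"
    by (simp add: power2_eq_square sum_product)
  ultimately show ?thesis unfolding div_curl_sq_def
    by (simp add: grad_sq_def norm_sq_vec sum_subtractf)
qed

lemma grad_sq_nonneg: "0 \<le> grad_sq a" and div_curl_sq_nonneg: "0 \<le> div_curl_sq a"
  unfolding grad_sq_def div_curl_sq_def by (intro sum_nonneg add_nonneg_nonneg divide_nonneg_nonneg; simp)+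

text \<open>Cauchy-Schwarz for the trace contributes the dimension. For the antisymmetric part
  \<open>(x - y)\<^sup>2 \<le> 2 * x\<^sup>2 + 2 * y\<^sup>2\<close> yields four times the gradient,
  halved by the double counting.\<close>

lemma div_curl_sq_le: "div_curl_sq (a :: 'n::finite \<Rightarrow> real^'n) \<le> (real CARD('n) + 2) * grad_sq a"
proof -
  have "(\<Sum>i\<in>UNIV. a i $ i)\<^sup>2 \<le> (\<Sum>i\<in>UNIV. (a i $ i)\<^sup>2) * real CARD('n)"
    using sum_squared_le_sum_of_squares[of "\<lambda>i. a i $ i" UNIV] by simp
  also have "\<dots> \<le> grad_sq a * real CARD('n)"
    unfolding grad_sq_def norm_sq_vec by (intro mult_right_mono sum_mono member_le_sum) auto
  finally have 1: "(\<Sum>i\<in>UNIV. a i $ i)\<^sup>2 \<le> real CARD('n) * grad_sq a" by (simp add: mult.commute)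
  have "(x - y)\<^sup>2 \<le> 2 * x\<^sup>2 + 2 * y\<^sup>2" for x y :: real
    using zero_le_power2[of "x + y"] by (simp add: power2_diff power2_sum)
  then have "(\<Sum>i\<in>UNIV. \<Sum>j\<in>UNIV. (a i $ j - a j $ i)\<^sup>2) \<le> (\<Sum>i\<in>UNIV. \<Sum>j\<in>UNIV. 2 * (a i $ j)\<^sup>2 + 2 * (a j $ i)\<^sup>2)"
    by (intro sum_mono) auto
  also have "\<dots> = 2 * grad_sq a + 2 * (\<Sum>i\<in>UNIV. \<Sum>j\<in>UNIV. (a j $ i)\<^sup>2)"
    unfolding grad_sq_def norm_sq_vec by (simp add: sum.distrib sum_distrib_left)
  also have "(\<Sum>i\<in>UNIV. \<Sum>j\<in>UNIV. (a j $ i)\<^sup>2) = grad_sq a"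
    unfolding grad_sq_def norm_sq_vec by (rule sum.swap)
  finally show ?thesis using 1 unfolding div_curl_sq_def by (simp add: algebra_simps)
qed

text \<open>Young's inequality. As a family in \<open>t\<close> it passes through finite sums and
  integrals, and \<open>sqrt_triangle\<close> recovers the triangle inequality at the end; this
  serves both energies without introducing inner products for them.\<close>

lemma weighted_square_sum:
  fixes x y t :: real assumes "t > 0" shows "(x + y)\<^sup>2 \<le> (1 + t) * x\<^sup>2 + (1 + 1 / t) * y\<^sup>2"
proof -
  have "0 \<le> (t * x - y)\<^sup>2 / t" using assms by simp
  also have "\<dots> = t * x\<^sup>2 + y\<^sup>2 / t - 2 * x * y" using assms by (simp add: power2_eq_square field_simps)
  finally show ?thesis by (simp add: power2_sum algebra_simps)
qed

lemma grad_sq_add: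
  assumes t: "t > 0" shows "grad_sq (\<lambda>i. b i + c i) \<le> (1 + t) * grad_sq b + (1 + 1 / t) * grad_sq c"
proof -
  have "(norm (b i + c i))\<^sup>2 \<le> (1 + t) * (norm (b i))\<^sup>2 + (1 + 1 / t) * (norm (c i))\<^sup>2" for i
    by (rule order_trans[OF power_mono[OF norm_triangle_ineq norm_ge_zero] weighted_square_sum[OF t]])
  then show ?thesis unfolding grad_sq_def sum_distrib_left sum.distrib[symmetric] by (rule sum_mono)
qed

lemma div_curl_sq_add:
  assumes t: "t > 0" shows "div_curl_sq (\<lambda>i. b i + c i) \<le> (1 + t) * div_curl_sq b + (1 + 1 / t) * div_curl_sq c"
proof -
  have 1: "(\<Sum>i\<in>UNIV. (b i + c i) $ i)\<^sup>2 \<le> (1 + t) * (\<Sum>i\<in>UNIV. b i $ i)\<^sup>2 + (1 + 1 / t) * (\<Sum>i\<in>UNIV. c i $ i)\<^sup>2"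
    using weighted_square_sum[OF t] by (simp add: sum.distrib)
  have "(\<Sum>i\<in>UNIV. \<Sum>j\<in>UNIV. ((b i + c i) $ j - (b j + c j) $ i)\<^sup>2)
    \<le> (\<Sum>i\<in>UNIV. \<Sum>j\<in>UNIV. (1 + t) * (b i $ j - b j $ i)\<^sup>2 + (1 + 1 / t) * (c i $ j - c j $ i)\<^sup>2)"
  proof (intro sum_mono)
    fix i j
    show "((b i + c i) $ j - (b j + c j) $ i)\<^sup>2 \<le> (1 + t) * (b i $ j - b j $ i)\<^sup>2 + (1 + 1 / t) * (c i $ j - c j $ i)\<^sup>2"
      using weighted_square_sum[OF t, of "b i $ j - b j $ i" "c i $ j - c j $ i"] by (simp add: algebra_simps)
  qed
  also have "\<dots> = (1 + t) * (\<Sum>i\<in>UNIV. \<Sum>j\<in>UNIV. (b i $ j - b j $ i)\<^sup>2) + (1 + 1 / t) * (\<Sum>i\<in>UNIV. \<Sum>j\<in>UNIV. (c i $ j - c j $ i)\<^sup>2)"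
    by (simp add: sum.distrib sum_distrib_left)
  finally have 2: "(\<Sum>i\<in>UNIV. \<Sum>j\<in>UNIV. ((b i + c i) $ j - (b j + c j) $ i)\<^sup>2)
    \<le> (1 + t) * (\<Sum>i\<in>UNIV. \<Sum>j\<in>UNIV. (b i $ j - b j $ i)\<^sup>2) + (1 + 1 / t) * (\<Sum>i\<in>UNIV. \<Sum>j\<in>UNIV. (c i $ j - c j $ i)\<^sup>2)" .
  have "A + X / 2 \<le> r * (B + Y / 2) + s * (C + Z / 2)" if "A \<le> r * B + s * C" "X \<le> r * Y + s * Z" for A B C X Y Z r s :: real
  proof -
    have "r * (B + Y / 2) + s * (C + Z / 2) = (r * B + s * C) + (r * Y + s * Z) / 2" by (simp add: field_simps)
    also have "\<dots> \<ge> A + X / 2" by (intro add_mono divide_right_mono that) simp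
    finally show ?thesis .
  qed
  from this[OF 1 2] show ?thesis unfolding div_curl_sq_def .
qed

text \<open>A triangle inequality for square roots, from the family of its quadratic consequences; the optimal
  parameter is \<open>t = sqrt (E / Y)\<close>.\<close>

lemma sqrt_triangle:
  fixes X Y E :: real
  assumes "0 \<le> Y" "0 \<le> E" and le: "\<And>t. t > 0 \<Longrightarrow> X \<le> (1 + t) * Y + (1 + 1 / t) * E"
  shows "sqrt X \<le> sqrt Y + sqrt E"
proof -
  have "X \<le> (sqrt Y + sqrt E)\<^sup>2"
  proof (cases "Y = 0 \<or> E = 0")
    case True
    show ?thesis
    proof (rule field_le_epsilon)
      fix e :: real assume e: "e > 0"
      consider "Y = 0" | "E = 0" "Y \<noteq> 0" using True by blast
      then show "X \<le> (sqrt Y + sqrt E)\<^sup>2 + e"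
      proof cases
        case 1
        \<comment> \<open>In the degenerate cases no optimal parameter exists, so the bound is
          reached only up to \<open>e\<close>, with \<open>t\<close> large if \<open>Y\<close> is
          zero and small if \<open>E\<close> is zero. The summand 1 keeps \<open>t\<close> positive
          when both vanish.\<close>
        define t where "t = (E + 1) / e"
        have t: "t > 0" using e assms by (simp add: t_def)
        have "E / t \<le> e" using e assms by (simp add: t_def field_simps)
        then show ?thesis using le[OF t] assms 1 by (simp add: algebra_simps)
      next
        case 2
        define t where "t = e / Y"
        have t: "t > 0" using e assms 2 by (simp add: t_def)
        have "t * Y = e" using 2 by (simp add: t_def)
        then show ?thesis using le[OF t] assms 2 by (simp add: algebra_simps)
      qed
    qed
  next
    case False
    define y where "y = sqrt Y"
    define e where "e = sqrt E"
    have p: "y > 0" "e > 0" "Y = y\<^sup>2" "E = e\<^sup>2" using False assms unfolding y_def e_def by auto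
    have "X \<le> (1 + e / y) * Y + (1 + 1 / (e / y)) * E" using p by (intro le) simp
    also have "\<dots> = (y + e)\<^sup>2" unfolding p(3,4) using p(1,2) by (simp add: power2_eq_square field_simps)
    finally show ?thesis by (simp add: y_def e_def)
  qed
  then show ?thesis by (intro real_le_lsqrt) (use assms in auto)
qed

context broken_field begin

definition mesh_integral :: "((real, 'n) vec set \<Rightarrow> (real, 'n) vec \<Rightarrow> real) \<Rightarrow> real" where
  "mesh_integral f = (\<Sum>K\<in>\<T>. LINT x:interior K|lborel. f K x)"

lemma mesh_integral_mono:
  assumes "\<And>K. K \<in> \<T> \<Longrightarrow> continuous_on UNIV (f K)" "\<And>K. K \<in> \<T> \<Longrightarrow> continuous_on UNIV (g K)"
    and "\<And>K x. K \<in> \<T> \<Longrightarrow> f K x \<le> g K x"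
  shows "mesh_integral f \<le> mesh_integral g"
  unfolding mesh_integral_def
  by (intro sum_mono set_integral_mono set_integrable_interior assms)

lemma mesh_integral_linear:
  assumes "\<And>K. K \<in> \<T> \<Longrightarrow> continuous_on UNIV (f K)" "\<And>K. K \<in> \<T> \<Longrightarrow> continuous_on UNIV (g K)"
  shows "mesh_integral (\<lambda>K x. a * f K x + b * g K x) = a * mesh_integral f + b * mesh_integral g"
proof -
  have "(LINT x:interior K|lborel. a * f K x + b * g K x) =
      a * (LINT x:interior K|lborel. f K x) + b * (LINT x:interior K|lborel. g K x)" if "K \<in> \<T>" for K
    using set_integrable_interior[OF that assms(1)[OF that]] set_integrable_interior[OF that assms(2)[OF that]]
    by (subst set_integral_add(2)) auto
  then show ?thesis unfolding mesh_integral_def by (simp add: sum.distrib sum_distrib_left)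
qed

lemma mesh_integral_nonneg: assumes "\<And>K x. K \<in> \<T> \<Longrightarrow> 0 \<le> f K x" shows "0 \<le> mesh_integral f"
  unfolding mesh_integral_def using assms
  by (intro sum_nonneg) (auto simp: set_lebesgue_integral_def intro!: integral_nonneg_AE AE_I2)

lemma sqrt_mesh_integral_triangle:
  assumes cont: "\<And>K. K \<in> \<T> \<Longrightarrow> continuous_on UNIV (f K)" "\<And>K. K \<in> \<T> \<Longrightarrow> continuous_on UNIV (g K)" "\<And>K. K \<in> \<T> \<Longrightarrow> continuous_on UNIV (e K)"
    and nonneg: "\<And>K x. 0 \<le> g K x" "\<And>K x. 0 \<le> e K x"
    and le: "\<And>t K x. t > 0 \<Longrightarrow> K \<in> \<T> \<Longrightarrow> f K x \<le> (1 + t) * g K x + (1 + 1 / t) * e K x"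
  shows "sqrt (mesh_integral f) \<le> sqrt (mesh_integral g) + sqrt (mesh_integral e)"
proof (rule sqrt_triangle)
  fix t :: real assume t: "t > 0"
  have "mesh_integral f \<le> mesh_integral (\<lambda>K x. (1 + t) * g K x + (1 + 1 / t) * e K x)"
    by (intro mesh_integral_mono cont le t continuous_intros)
  also have "\<dots> = (1 + t) * mesh_integral g + (1 + 1 / t) * mesh_integral e"
    by (intro mesh_integral_linear cont)
  finally show "mesh_integral f \<le> (1 + t) * mesh_integral g + (1 + 1 / t) * mesh_integral e" .
qed (intro mesh_integral_nonneg nonneg)+

abbreviation (input) grad_q where "grad_q K x \<equiv> (\<lambda>i. poly_grad (\<lambda>x. q K x $ i) x)"
abbreviation (input) grad_corr where "grad_corr K x \<equiv> (\<lambda>i. poly_grad (corr K i) x)"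
abbreviation (input) grad_conf where "grad_conf K x \<equiv> (\<lambda>i. poly_grad (conf_field K i) x)"

lemma grad_q_eq: assumes "K \<in> \<T>" shows "grad_q K x = (\<lambda>i. grad_conf K x i + grad_corr K x i)"
  using poly_grad_diff[OF poly[OF assms] poly_corr[OF assms]] unfolding conf_field_def[abs_def] by simp

lemma continuous_sq:
  assumes "\<And>i. continuous_on UNIV (D i)"
  shows "continuous_on UNIV (\<lambda>x. grad_sq (\<lambda>i. D i x :: (real, 'n) vec))" "continuous_on UNIV (\<lambda>x. div_curl_sq (\<lambda>i. D i x))"
  unfolding grad_sq_def div_curl_sq_def by (intro continuous_intros assms)+ simp

lemma continuous_grads:
  assumes "K \<in> \<T>"
  shows "continuous_on UNIV (poly_grad (\<lambda>x. q K x $ i))" "continuous_on UNIV (poly_grad (corr K i))" "continuous_on UNIV (poly_grad (conf_field K i))"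
  using poly_grad[OF poly[OF assms]] poly_grad[OF poly_corr[OF assms]] poly_grad[OF poly_conf_field[OF assms]]
  unfolding C1_with_grad_def by auto

lemma conf_field_energies:
  "mesh_integral (\<lambda>K x. grad_sq (grad_conf K x)) = mesh_integral (\<lambda>K x. div_curl_sq (grad_conf K x))"
proof -
  let ?B = "\<lambda>K x. \<Sum>i\<in>UNIV. \<Sum>j\<in>UNIV. grad_conf K x i $ j * grad_conf K x j $ i - grad_conf K x i $ i * grad_conf K x j $ j"
  have cB: "continuous_on UNIV (?B K)" if "K \<in> \<T>" for K
    by (intro continuous_intros continuous_grads that)
  have "mesh_integral (\<lambda>K x. div_curl_sq (grad_conf K x)) = mesh_integral (\<lambda>K x. 1 * grad_sq (grad_conf K x) + (-1) * ?B K x)"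
    by (simp add: div_curl_sq_eq)
  also have "\<dots> = 1 * mesh_integral (\<lambda>K x. grad_sq (grad_conf K x)) + (-1) * mesh_integral ?B"
    by (intro mesh_integral_linear cB continuous_sq continuous_grads)
  also have "mesh_integral ?B = 0" unfolding mesh_integral_def by (rule green_conf_field)
  finally show ?thesis by simp
qed

text \<open>Both energy seminorms are perturbed from \<open>v\<close> to the conforming field and
  back, and their values at the conforming field coincide. In the constant, 1 accounts for the
  gradient of the correction and \<open>sqrt (d + 2)\<close> for its divergence and curl.\<close>

lemma energies_difference:
  "\<bar>sqrt (mesh_integral (\<lambda>K x. grad_sq (grad_q K x))) - sqrt (mesh_integral (\<lambda>K x. div_curl_sq (grad_q K x)))\<bar>
    \<le> ((1 + sqrt (real CARD('n) + 2)) * sqrt (err_const \<Omega> k \<theta>)) * jump_seminorm \<Omega> \<T> v"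
proof -
  let ?N = "\<lambda>G. mesh_integral (\<lambda>K x. grad_sq (G K x))" and ?R = "\<lambda>G. mesh_integral (\<lambda>K x. div_curl_sq (G K x))"
  let ?V = "\<lambda>K x. grad_q K x" and ?W = "\<lambda>K x. grad_conf K x" and ?E = "\<lambda>K x. grad_corr K x"
  have neg: "grad_sq (\<lambda>i. - a i) = grad_sq a" "div_curl_sq (\<lambda>i. - a i) = div_curl_sq a" for a :: "'n \<Rightarrow> (real, 'n) vec"
    by (simp_all add: grad_sq_def div_curl_sq_def sum_negf power2_commute)
  have sub: "grad_sq (\<lambda>i. a i + - b i) \<le> (1 + t) * grad_sq a + (1 + 1 / t) * grad_sq b"
    "div_curl_sq (\<lambda>i. a i + - b i) \<le> (1 + t) * div_curl_sq a + (1 + 1 / t) * div_curl_sq b"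
    if "t > 0" for t and a b :: "'n \<Rightarrow> (real, 'n) vec"
    using grad_sq_add[OF that, of a "\<lambda>i. - b i"] div_curl_sq_add[OF that, of a "\<lambda>i. - b i"] by (simp_all only: neg)
  have W: "grad_conf K x = (\<lambda>i. grad_q K x i + - grad_corr K x i)" if "K \<in> \<T>" for K x
    using fun_cong[OF grad_q_eq[OF that, of x]] by simp
  note cont = continuous_sq continuous_grads
  have N: "sqrt (?N ?V) \<le> sqrt (?N ?W) + sqrt (?N ?E)" "sqrt (?N ?W) \<le> sqrt (?N ?V) + sqrt (?N ?E)"
    by (rule sqrt_mesh_integral_triangle; (intro cont; assumption)?; (rule grad_sq_nonneg)?; simp only: grad_q_eq grad_sq_add)
      (rule sqrt_mesh_integral_triangle; (intro cont; assumption)?; (rule grad_sq_nonneg)?; simp only: W sub)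
  have R: "sqrt (?R ?V) \<le> sqrt (?R ?W) + sqrt (?R ?E)" "sqrt (?R ?W) \<le> sqrt (?R ?V) + sqrt (?R ?E)"
    by (rule sqrt_mesh_integral_triangle; (intro cont; assumption)?; (rule div_curl_sq_nonneg)?; simp only: grad_q_eq div_curl_sq_add)
      (rule sqrt_mesh_integral_triangle; (intro cont; assumption)?; (rule div_curl_sq_nonneg)?; simp only: W sub)
  have "?R ?E \<le> mesh_integral (\<lambda>K x. (real CARD('n) + 2) * grad_sq (?E K x) + 0 * grad_sq (?E K x))"
    using div_curl_sq_le by (intro mesh_integral_mono cont continuous_intros) simp_all
  also have "\<dots> = (real CARD('n) + 2) * ?N ?E"     by (subst mesh_integral_linear; (intro cont; assumption)?; simp?)

  finally have RE: "sqrt (?R ?E) \<le> sqrt (real CARD('n) + 2) * sqrt (?N ?E)"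
    by (simp flip: real_sqrt_mult)
  have "?N ?E \<le> err_const \<Omega> k \<theta> * (\<Sum>F\<in>faces. face_energy F)"
    using grad_corr_total unfolding mesh_integral_def grad_sq_def .
  then have E: "sqrt (?N ?E) \<le> sqrt (err_const \<Omega> k \<theta>) * jump_seminorm \<Omega> \<T> v"
    unfolding jump_seminorm_eq by (simp flip: real_sqrt_mult)
  have "\<bar>sqrt (?N ?V) - sqrt (?R ?V)\<bar> \<le> sqrt (?N ?E) + sqrt (?R ?E)"
    using N R arg_cong[OF conf_field_energies, of sqrt] by linarith
  also have "\<dots> \<le> (1 + sqrt (real CARD('n) + 2)) * sqrt (?N ?E)" using RE by (simp add: algebra_simps)
  also have "\<dots> \<le> (1 + sqrt (real CARD('n) + 2)) * (sqrt (err_const \<Omega> k \<theta>) * jump_seminorm \<Omega> \<T> v)"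
    using E by (intro mult_left_mono) auto
  finally show ?thesis by (simp add: mult.assoc)
qed

text \<open>The values of \<open>f\<close> on the element boundaries are arbitrary, and these
  boundaries are null because the elements are convex. So \<open>f\<close> agrees almost everywhere
  on the domain with a Borel function, which gives measurability with respect to the completed
  measure.\<close>

lemma integral_domain_eq_mesh_integral:
  assumes g: "\<And>K. K \<in> \<T> \<Longrightarrow> continuous_on UNIV (g K)" and fg: "\<And>K x. K \<in> \<T> \<Longrightarrow> x \<in> interior K \<Longrightarrow> f x = g K x"
  shows "(LINT x:\<Omega>|lebesgue. f x) = mesh_integral g"
proof -
  define h where "h x = (\<Sum>K\<in>\<T>. indicator (interior K) x * g K x)" for x
  have gm: "g K \<in> borel_measurable borel" if "K \<in> \<T>" for K using g[OF that] by (rule borel_measurable_continuous_onI)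
  have hm: "h \<in> borel_measurable lborel" unfolding h_def[abs_def]
    by (intro borel_measurable_sum borel_measurable_times borel_measurable_indicator) (auto simp: gm)
  have in_h: "h x = g K x" if "K \<in> \<T>" "x \<in> interior K" for K x
  proof -
    have "x \<notin> interior K'" if "K' \<in> \<T>" "K' \<noteq> K" for K'
      using inter_interior[of K K'] \<open>K \<in> \<T>\<close> \<open>x \<in> interior K\<close> that interior_subset by blast
    then have "h x = (\<Sum>K'\<in>\<T>. if K' = K then g K x else 0)" unfolding h_def using that by (intro sum.cong) auto
    then show ?thesis using that by simp
  qed
  define N where "N = (\<Union>K\<in>\<T>. frontier K)"
  have "negligible N" unfolding N_def
    by (intro negligible_Union) (auto intro!: negligible_convex_frontier elem_compact(2))
  then have "N \<in> null_sets lebesgue" by (simp add: negligible_iff_null_sets)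
  then have "AE x in lebesgue. x \<notin> N" by (rule AE_not_in)
  moreover have "indicator \<Omega> x *\<^sub>R f x = h x" if "x \<notin> N" for x
  proof (cases "x \<in> \<Omega>")
    case True
    then have "x \<in> \<Union>\<T>" using closure_subset by (auto simp: Union_mesh)
    then obtain K where K: "K \<in> \<T>" "x \<in> K" by blast
    then have "x \<in> interior K" using that elem_compact(3)[OF K(1)] unfolding N_def frontier_def by auto
    then show ?thesis using True in_h fg K by simp
  next
    case False
    then have "x \<notin> interior K" if "K \<in> \<T>" for K using elem_interior(3)[OF that] by blast
    then have "h x = 0" unfolding h_def by (intro sum.neutral) simp
    then show ?thesis using False by simp
  qed
  ultimately have ae: "AE x in lebesgue. indicator \<Omega> x *\<^sub>R f x = h x" by auto
  have hl: "h \<in> borel_measurable lebesgue" using hm by (rule measurable_completion)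
  have fl: "(\<lambda>x. indicator \<Omega> x *\<^sub>R f x) \<in> borel_measurable lebesgue"
    using hl ae by (subst borel_measurable_AE) auto
  have "(LINT x:\<Omega>|lebesgue. f x) = integral\<^sup>L lebesgue h"
    unfolding set_lebesgue_integral_def by (rule integral_cong_AE[OF fl hl ae])
  also have "\<dots> = integral\<^sup>L lborel h" using hm by (rule integral_completion)
  also have "\<dots> = mesh_integral g"
    unfolding h_def[abs_def] mesh_integral_def set_lebesgue_integral_def
    using set_integrable_interior[OF _ g]
    by (subst Bochner_Integration.integral_sum) (auto simp: set_integrable_def)
  finally show ?thesis .
qed

lemma grad_elem: assumes K: "K \<in> \<T>" and x: "x \<in> interior K" shows "(\<lambda>i. grad v x $ i) = grad_q K x"
proof -
  let ?D = "\<lambda>h. \<chi> i. grad_q K x i \<bullet> h"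
  have "(q K has_derivative ?D) (at x)"
    unfolding has_derivative_componentwise_within[of "q K"]
  proof
    fix b :: "(real, 'n) vec" assume "b \<in> Basis"
    then obtain i where b: "b = axis i 1" by (auto simp: Basis_vec_def)
    have "((\<lambda>x. q K x $ i) has_derivative (\<lambda>h. grad_q K x i \<bullet> h)) (at x)"
      using poly_grad[OF poly[OF K]] unfolding C1_with_grad_def by blast
    then show "((\<lambda>x. q K x \<bullet> b) has_derivative (\<lambda>h. ?D h \<bullet> b)) (at x)" by (simp add: b inner_axis)
  qed
  then have "(v has_derivative ?D) (at x)"
    by (rule has_derivative_transform_within_open[OF _ open_interior x]) (use rep K in simp)
  then have "?D = frechet_derivative v (at x)" by (rule frechet_derivative_at)
  then have "grad v x = matrix ?D" by (simp add: grad_def jacobian_def)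
  then show ?thesis by (auto simp: fun_eq_iff vec_eq_iff matrix_def inner_axis)
qed

lemma broken_field_estimate:
  "\<bar>sqrt (LINT x:\<Omega>|lebesgue. (norm (grad v x))\<^sup>2) - sqrt (LINT x:\<Omega>|lebesgue. div_curl_sq (\<lambda>i. grad v x $ i))\<bar>
    \<le> ((1 + sqrt (real CARD('n) + 2)) * sqrt (err_const \<Omega> k \<theta>)) * jump_seminorm \<Omega> \<T> v"
proof -
  have n: "(norm A)\<^sup>2 = grad_sq (\<lambda>i. A $ i)" for A :: "((real, 'n) vec, 'n) vec"
    unfolding grad_sq_def by (simp add: norm_vec_def L2_set_def sum_nonneg)
  have "(LINT x:\<Omega>|lebesgue. (norm (grad v x))\<^sup>2) = mesh_integral (\<lambda>K x. grad_sq (grad_q K x))"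
    by (intro integral_domain_eq_mesh_integral continuous_sq continuous_grads;
      (assumption | (simp only: n, rule arg_cong[where f=grad_sq, OF grad_elem]; assumption)))

  moreover have "(LINT x:\<Omega>|lebesgue. div_curl_sq (\<lambda>i. grad v x $ i)) = mesh_integral (\<lambda>K x. div_curl_sq (grad_q K x))"
    by (intro integral_domain_eq_mesh_integral continuous_sq continuous_grads;
      (assumption | (rule arg_cong[where f=div_curl_sq, OF grad_elem]; assumption)))
  ultimately show ?thesis using energies_difference by simp
qed

end

section \<open>The estimate for broken polynomials in dimensions two and three\<close>

lemma broken_polynomials_estimate:
  fixes \<Omega> :: "(real^'n::{finite,wellorder}) set"
  assumes "2 \<le> CARD('n)" "1 \<le> k" "convex_polytopal_domain \<Omega>" "conforming_mesh \<Omega> \<T>" "v \<in> broken_polynomials \<T> k"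
  shows "\<bar>sqrt (LINT x:\<Omega>|lebesgue. (norm (grad v x))\<^sup>2) - sqrt (LINT x:\<Omega>|lebesgue. div_curl_sq (\<lambda>i. grad v x $ i))\<bar>
    \<le> ((1 + sqrt (real CARD('n) + 2)) * sqrt (err_const \<Omega> k (shape_regularity \<T>))) * jump_seminorm \<Omega> \<T> v"
proof -
  have "\<exists>q. \<forall>K\<in>\<T>. (\<forall>i. polynomial_of_degree_le k (\<lambda>x. q K x $ i)) \<and> (\<forall>x\<in>interior K. v x = q K x)"
    using assms(5) unfolding broken_polynomials_def by (intro bchoice) blast
  then obtain q where q: "\<And>K i. K \<in> \<T> \<Longrightarrow> polynomial_of_degree_le k (\<lambda>x. q K x $ i)" "\<And>K x. K \<in> \<T> \<Longrightarrow> x \<in> interior K \<Longrightarrow> v x = q K x"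
    by blast
  interpret broken_field \<Omega> \<T> k v q
  proof
    show "poly_deg k (\<lambda>x. q K x $ i)" if "K \<in> \<T>" for K i
      using polynomial_of_degree_le_imp_poly_deg[OF q(1)[OF that]] .
  qed (use assms q in auto)
  show ?thesis by (rule broken_field_estimate)
qed

lemma div_curl_sq_2: "div_curl_sq (\<lambda>i. grad v x $ i) = (dvg v x)\<^sup>2 + (curl2 v x)\<^sup>2"
  unfolding div_curl_sq_def dvg_def curl2_def by (simp add: sum_2 power2_eq_square field_simps)

lemma div_curl_sq_3: "div_curl_sq (\<lambda>i. grad v x $ i) = (dvg v x)\<^sup>2 + (norm (curl3 v x))\<^sup>2"
  unfolding div_curl_sq_def dvg_def curl3_def norm_sq_vec by (simp add: sum_3 power2_eq_square field_simps)

theorem theorem6p3: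
  fixes p :: nat
  assumes "p \<ge> 2"
  shows
    "(\<forall>\<Omega> :: (real^2) set. convex_polytopal_domain \<Omega> \<longrightarrow>
        (\<exists>C :: real \<Rightarrow> real. \<forall>\<T>. conforming_mesh \<Omega> \<T> \<longrightarrow>
          (\<forall>v \<in> broken_polynomials \<T> (p - 1).
            \<bar>sqrt (LINT x:\<Omega>|lebesgue. (norm (grad v x))\<^sup>2)
              - sqrt (LINT x:\<Omega>|lebesgue. (dvg v x)\<^sup>2 + (curl2 v x)\<^sup>2)\<bar>
            \<le> C (shape_regularity \<T>) * jump_seminorm \<Omega> \<T> v))) \<and>
     (\<forall>\<Omega> :: (real^3) set. convex_polytopal_domain \<Omega> \<longrightarrow>
        (\<exists>C :: real \<Rightarrow> real. \<forall>\<T>. conforming_mesh \<Omega> \<T> \<longrightarrow>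
          (\<forall>v \<in> broken_polynomials \<T> (p - 1).
            \<bar>sqrt (LINT x:\<Omega>|lebesgue. (norm (grad v x))\<^sup>2)
              - sqrt (LINT x:\<Omega>|lebesgue. (dvg v x)\<^sup>2 + (norm (curl3 v x))\<^sup>2)\<bar>
            \<le> C (shape_regularity \<T>) * jump_seminorm \<Omega> \<T> v)))"
proof -
  \<comment> \<open>A positive degree is what the lattice requires: \<open>node\<close> divides the
    indices by it.\<close>
  have k: "1 \<le> p - 1" using assms by simp
  show ?thesis
  proof (intro conjI allI impI)
    fix \<Omega> :: "(real^2) set" assume "convex_polytopal_domain \<Omega>"
    then show "\<exists>C :: real \<Rightarrow> real. \<forall>\<T>. conforming_mesh \<Omega> \<T> \<longrightarrow> (\<forall>v \<in> broken_polynomials \<T> (p - 1).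
      \<bar>sqrt (LINT x:\<Omega>|lebesgue. (norm (grad v x))\<^sup>2) - sqrt (LINT x:\<Omega>|lebesgue. (dvg v x)\<^sup>2 + (curl2 v x)\<^sup>2)\<bar>
        \<le> C (shape_regularity \<T>) * jump_seminorm \<Omega> \<T> v)"
      using broken_polynomials_estimate[OF _ k, of \<Omega>, unfolded div_curl_sq_2]
      by (intro exI[of _ "\<lambda>\<theta>. (1 + sqrt (real CARD(2) + 2)) * sqrt (err_const \<Omega> (p - 1) \<theta>)"]) simp
  next
    fix \<Omega> :: "(real^3) set" assume "convex_polytopal_domain \<Omega>"
    then show "\<exists>C :: real \<Rightarrow> real. \<forall>\<T>. conforming_mesh \<Omega> \<T> \<longrightarrow> (\<forall>v \<in> broken_polynomials \<T> (p - 1).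
      \<bar>sqrt (LINT x:\<Omega>|lebesgue. (norm (grad v x))\<^sup>2) - sqrt (LINT x:\<Omega>|lebesgue. (dvg v x)\<^sup>2 + (norm (curl3 v x))\<^sup>2)\<bar>
        \<le> C (shape_regularity \<T>) * jump_seminorm \<Omega> \<T> v)"
      using broken_polynomials_estimate[OF _ k, of \<Omega>, unfolded div_curl_sq_3]
      by (intro exI[of _ "\<lambda>\<theta>. (1 + sqrt (real CARD(3) + 2)) * sqrt (err_const \<Omega> (p - 1) \<theta>)"]) simp
  qed
qed

end
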